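(* Let $\Omega \subseteq \mathbb{R}^d$ be a (Lebesgue measurable) set of finite measure $|\Omega|$. For every $\varepsilon > 0$, there exists a countable set $\Lambda \subseteq \mathbb{R}^d$ satisfying $D^-(\Lambda) \ge (1-\varepsilon)|\Omega|$ and such that $\{ e^{2\pi i \lambda \cdot x}\, \mathbf{1}_\Omega(x) \}_{\lambda \in \Lambda}$ (as functions of $x$) is a Riesz sequence in $L^2(\Omega)$.
   Context: The lower Beurling density of $\Lambda \subseteq \mathbb{R}^d$ is $$D^-(\Lambda) = \liminf_{r\to\infty} \inf_{x \in \mathbb{R}^d} \frac{\#(\Lambda \cap B_r(x))}{|B_r(x)|},$$ where $B_r(x)$ is the open Euclidean ball and $|\cdot|$ is Lebesgue measure. $\mathbf{1}_\Omega$ is the indicator function of $\Omega$. A countable family $\{g_i\}_{i\in I}$ in a Hilbert space is a Riesz sequence if there are $A,B>0$ with $A\|c\|^2 \le \|\sum_{i\in I} c_i g_i\|^2 \le B\|c\|^2$ for all $c \in \ell^2(I)$. *)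

theory Defs
  imports "HOL-Analysis.Analysis"
begin

(* Points are counted with emeasure (count_space UNIV), because card is 0 on infinite sets;
   a ball containing infinitely many points of S thus contributes \<infinity>. *)
definition lower_Beurling_density :: "(real ^ 'n) set \<Rightarrow> ennreal" where
  "lower_Beurling_density S =
     Liminf at_top (\<lambda>r::real. INF x. emeasure (count_space UNIV) (S \<inter> ball x r) /
                                      emeasure lebesgue (ball x r))"

(* L^2(M) is represented by functions rather than by a.e.-classes, so L2_norm is a seminorm;
   elements at distance 0 are the same element of the Hilbert space. *)
definition L2_space :: "'a measure \<Rightarrow> ('a \<Rightarrow> complex) set" where
  "L2_space M = {f \<in> borel_measurable M. integrable M (\<lambda>x. (cmod (f x))\<^sup>2)}"

definition L2_norm :: "'a measure \<Rightarrow> ('a \<Rightarrow> complex) \<Rightarrow> real" where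
  "L2_norm M f = sqrt (\<integral>x. (cmod (f x))\<^sup>2 \<partial>M)"

(* The analogue of has_sum for convergence in L^2(M): unconditional (net) convergence of the
   finite partial sums.  The limit is unique up to a.e. equality. *)
definition has_L2_sum :: "'a measure \<Rightarrow> ('i \<Rightarrow> 'a \<Rightarrow> complex) \<Rightarrow> 'i set \<Rightarrow> ('a \<Rightarrow> complex) \<Rightarrow> bool" where
  "has_L2_sum M h I f \<longleftrightarrow> f \<in> L2_space M \<and>
     ((\<lambda>F. L2_norm M (\<lambda>x. (\<Sum>i\<in>F. h i x) - f x)) \<longlongrightarrow> 0) (finite_subsets_at_top I)"

(* The hypothesis on c says that c restricted to I lies in l^2(I).  Since f below is determined
   up to a.e. equality, the existential only asserts that the series converges. *)
definition Riesz_sequence_L2 :: "'a measure \<Rightarrow> ('i \<Rightarrow> 'a \<Rightarrow> complex) \<Rightarrow> 'i set \<Rightarrow> bool" where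
  "Riesz_sequence_L2 M g I \<longleftrightarrow>
     countable I \<and> (\<forall>i\<in>I. g i \<in> L2_space M) \<and>
     (\<exists>A>0. \<exists>B>0. \<forall>c::'i \<Rightarrow> complex.
        (\<lambda>i. (cmod (c i))\<^sup>2) summable_on I \<longrightarrow>
        (\<exists>f. has_L2_sum M (\<lambda>i x. c i * g i x) I f \<and>
             A * (\<Sum>\<^sub>\<infinity>i\<in>I. (cmod (c i))\<^sup>2) \<le> (L2_norm M f)\<^sup>2 \<and>
             (L2_norm M f)\<^sup>2 \<le> B * (\<Sum>\<^sub>\<infinity>i\<in>I. (cmod (c i))\<^sup>2)))"

end

theory Submission
  imports Defs "HOL-Computational_Algebra.Fundamental_Theorem_Algebra" "Jordan_Normal_Form.Determinant"
begin

text \<open>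
  It suffices to choose \<open>\<Lambda>\<close> block by block. Intersect \<open>\<Omega>\<close> with a cube \<open>Q\<close> of side \<open>R\<close> that
  carries most of its measure and split the lattice \<open>(1/R) \<int>\<^sup>d\<close>, whose exponentials are orthogonal
  on \<open>Q\<close>, into large congruent blocks. The normalised Gram matrix of the exponentials on \<open>\<Omega> \<inter> Q\<close> has
  constant diagonal \<open>\<tau> = |\<Omega> \<inter> Q| / |Q|\<close>, and a barrier argument in the style of Marcus, Spielman and
  Srivastava deletes from every block only slightly more than the fraction \<open>1 - \<tau>\<close> of its points
  so that the remaining Gram matrix is bounded below by a positive constant that does not
  depend on the number of blocks. Hence about \<open>\<tau> R\<^sup>d = |\<Omega> \<inter> Q|\<close> points per unit volume survive.

  The Bessel bound on all of \<open>\<Omega>\<close> is not automatic. Every surviving point may be moved inside a small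
  cell without destroying the lower bound, and a second barrier argument picks from each
  cell one point of a much finer lattice so that the upper bound is controlled by \<open>|\<Omega>|\<close> and the cell
  size only. All bounds are uniform in the number of blocks and in the fineness of the second
  lattice, so compactness of the product of the closed block cubes yields an infinite configuration.

  In both selection steps the determinant of \<open>diag y + M\<close> is a real stable multiaffine function of \<open>y\<close>;
  averaging its translates over one block keeps it stable, the barrier function controls how far the
  largest root moves, and some single translate is at least as good as the average.
\<close>

section \<open>Real-rooted polynomials\<close>

text \<open>A translate of \<open>diag_det\<close> in coordinate i changes the i-th diagonal entry.
  In the lower selection translates go up, and an index hit by one is discarded: the final form is
  only tested on vectors vanishing there, so m translates per block cost at most m indices. In
  exchange each averaging round lets the diagonal of the block descend by about
  \<open>1 / (L * r)\<close>, where L is the block size and r bounds every barrier value. Descending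
  from height t to below 0 takes about \<open>r * t * L\<close> rounds, so the discarded fraction is
  about \<open>r * t\<close>. In the upper selection translates go down, and an index is kept when
  it is hit. Uniformity in the number of blocks comes from one fact: after each round, at the new
  point, no barrier value exceeds its old one, so the last block starts with the same budget as the
  first. The second selection is forced because the barrier argument sees only the cube Q, where the
  lattice is orthogonal, while \<open>\<Omega>\<close> may be unbounded. The fine lattice is
  orthogonal on a cube as large as desired, and its norm bound there divided by the number of points
  per cell depends only on the cell size.\<close>

abbreviation cpoly :: "real poly \<Rightarrow> complex poly" where
  "cpoly \<equiv> map_poly complex_of_real"

definition real_rooted :: "real poly \<Rightarrow> bool" where
  "real_rooted g \<longleftrightarrow> (\<forall>z. poly (cpoly g) z = 0 \<longrightarrow> Im z = 0)"

lemma poly_cpoly_of_real: "poly (cpoly g) (complex_of_real x) = complex_of_real (poly g x)"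
  by (induction g) (auto simp: map_poly_pCons)

lemma cpoly_mult: "cpoly (p * q) = cpoly p * cpoly q"
  by (intro poly_eqI) (simp add: coeff_map_poly coeff_mult)

lemma cpoly_linear: "cpoly [:- z, 1:] = [:- complex_of_real z, 1:]"
  by (simp add: map_poly_pCons)

lemma real_rooted_dvd: "real_rooted (p * q) \<Longrightarrow> real_rooted q"
  by (auto simp: real_rooted_def cpoly_mult)

lemma real_rooted_factorization:
  assumes "real_rooted g" "g \<noteq> 0"
  shows "\<exists>zs. g = Polynomial.smult (lead_coeff g) (\<Prod>z\<leftarrow>zs. [:- z, 1:])"
  using assms
proof (induction "degree g" arbitrary: g rule: less_induct)
  case less
  show ?case
  proof (cases "degree g = 0")
    case True
    then obtain a where "g = [:a:]" by (meson degree_eq_zeroE)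
    then show ?thesis by (intro exI[of _ "[]"]) simp
  next
    case False
    have "\<not> constant (poly (cpoly g))"
      using False by (simp add: constant_degree degree_map_poly)
    then obtain z where z: "poly (cpoly g) z = 0"
      using fundamental_theorem_of_algebra by blast
    with less.prems have "Im z = 0" by (auto simp: real_rooted_def)
    then have "of_real (Re z) = z" by (simp add: complex_eq_iff)
    then have "poly g (Re z) = 0"
      using z poly_cpoly_of_real[of g "Re z"] by simp
    then obtain q where q: "g = [:- Re z, 1:] * q"
      by (auto simp: poly_eq_0_iff_dvd elim: dvdE)
    then have "q \<noteq> 0" using less.prems by auto
    then have "degree q < degree g" unfolding q by (subst degree_mult_eq) auto
    moreover have "real_rooted q" using less.prems q real_rooted_dvd by blast
    ultimately obtain zs where zs: "q = Polynomial.smult (lead_coeff q) (\<Prod>z\<leftarrow>zs. [:- z, 1:])"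
      using less.hyps \<open>q \<noteq> 0\<close> by blast
    have "lead_coeff g = lead_coeff q" by (simp only: q lead_coeff_mult) simp
    have "g = [:- Re z, 1:] * Polynomial.smult (lead_coeff q) (\<Prod>z\<leftarrow>zs. [:- z, 1:])"
      using q zs by (rule back_subst[of "\<lambda>x. g = [:- Re z, 1:] * x"])
    also have "\<dots> = Polynomial.smult (lead_coeff g) (\<Prod>z\<leftarrow>Re z # zs. [:- z, 1:])"
      by (simp only: mult_smult_right list.map prod_list.Cons \<open>lead_coeff g = lead_coeff q\<close>)
    finally show ?thesis by blast
  qed
qed

definition pos_coeffs :: "real poly \<Rightarrow> bool" where
  "pos_coeffs g \<longleftrightarrow> (\<forall>k\<le>degree g. coeff g k > 0)"

lemma pos_coeffs_prod_list:
  assumes "\<And>z. z \<in> set zs \<Longrightarrow> z < (0::real)"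
  shows "pos_coeffs (\<Prod>z\<leftarrow>zs. [:- z, 1:])"
  using assms
proof (induction zs)
  case Nil
  then show ?case by (simp add: pos_coeffs_def)
next
  case (Cons a zs)
  let ?p = "\<Prod>z\<leftarrow>zs. [:- z, 1:]"
  have IH: "pos_coeffs ?p" and a: "a < 0" using Cons by auto
  have nn: "coeff ?p k \<ge> 0" for k
    using IH unfolding pos_coeffs_def by (metis coeff_eq_0 less_eq_real_def linorder_le_less_linear)
  have ne: "?p \<noteq> 0" using IH unfolding pos_coeffs_def by force
  have deg: "degree ([:- a, 1:] * ?p) = Suc (degree ?p)"
    using ne by (subst degree_mult_eq) auto
  have "coeff ([:- a, 1:] * ?p) k > 0" if "k \<le> Suc (degree ?p)" for k
  proof (cases k)
    case 0
    then show ?thesis using IH a by (auto simp: pos_coeffs_def mult_neg_pos)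
  next
    case (Suc j)
    then have "coeff ?p j > 0" using IH that by (auto simp: pos_coeffs_def)
    moreover have "a * coeff ?p k \<le> 0" using nn[of k] a by (simp add: mult_nonpos_nonneg)
    ultimately show ?thesis using Suc by (simp add: coeff_pCons)
  qed
  then show ?case using deg by (simp add: pos_coeffs_def)
qed

lemma poly_prod_list_linear: "poly (\<Prod>z\<leftarrow>zs. [:- z, 1:]) x = (\<Prod>z\<leftarrow>zs. x - z)"
  for x :: real
  by (induction zs) (auto simp: algebra_simps)

text \<open>All roots are negative, so every linear factor has positive coefficients. Positive
  coefficients in turn exclude roots in [0, infinity). Coefficients thus serve as a continuous
  substitute for the position of the largest root.\<close>

lemma real_rooted_pos_coeffs:
  assumes "real_rooted g" "lead_coeff g > 0" "\<And>x. x \<ge> 0 \<Longrightarrow> poly g x \<noteq> 0"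
  shows "pos_coeffs g"
proof -
  have "g \<noteq> 0" using assms by auto
  then obtain zs where zs: "g = Polynomial.smult (lead_coeff g) (\<Prod>z\<leftarrow>zs. [:- z, 1:])"
    using real_rooted_factorization assms by blast
  have "z < 0" if "z \<in> set zs" for z
  proof (rule ccontr)
    assume "\<not> z < 0"
    have "poly (\<Prod>z\<leftarrow>zs. [:- z, 1:]) z = 0"
      using that unfolding poly_prod_list_linear by (induction zs) auto
    then have "poly g z = 0" by (subst zs) simp
    then show False using assms(3)[of z] \<open>\<not> z < 0\<close> by auto
  qed
  then have "pos_coeffs (\<Prod>z\<leftarrow>zs. [:- z, 1:])" by (rule pos_coeffs_prod_list)
  then show ?thesis
    using assms(2) by (subst zs) (auto simp: pos_coeffs_def)
qed

text \<open>If the smallest coefficient first vanished at some s, all coefficients would still be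
  nonnegative there and the constant term positive. Then there is no root in [0, infinity), and
  real-rootedness makes every coefficient strictly positive after all. So the minimum never reaches
  0, and no continuity of roots is involved.\<close>

lemma pos_coeffs_continuation:
  fixes e :: "nat \<Rightarrow> real \<Rightarrow> real"
  assumes cont: "\<And>k. k \<le> d \<Longrightarrow> continuous_on {0..1} (e k)"
    and rr: "\<And>s. s \<in> {0..1} \<Longrightarrow> real_rooted (\<Sum>k\<le>d. monom (e k s) k)"
    and top: "\<And>s. s \<in> {0..1} \<Longrightarrow> e d s > 0"
    and bot: "\<And>s. s \<in> {0..1} \<Longrightarrow> e 0 s > 0"
    and init: "\<And>k. k \<le> d \<Longrightarrow> e k 0 > 0"
    and k: "k \<le> d"
  shows "e k 1 > 0"
proof -
  define m where "m s = Min ((\<lambda>k. e k s) ` {..d})" for s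
  have cm: "continuous_on {0..1} m"
  proof -
    have "continuous_on {0..1} (\<lambda>s. Min ((\<lambda>k. e k s) ` {..n}))" if "n \<le> d" for n
      using that
    proof (induction n)
      case 0
      then show ?case using cont by simp
    next
      case (Suc n)
      have "(\<lambda>s. Min ((\<lambda>k. e k s) ` {..Suc n})) = (\<lambda>s. min (e (Suc n) s) (Min ((\<lambda>k. e k s) ` {..n})))"
        by (auto simp: atMost_Suc)
      then show ?case using Suc cont[of "Suc n"] by (simp only:) (intro continuous_on_min, auto)
    qed
    then show ?thesis unfolding m_def by blast
  qed
  have noz: "m s \<noteq> 0" if s: "s \<in> {0..1}" for s
  proof
    assume m0: "m s = 0"
    let ?g = "\<Sum>k\<le>d. monom (e k s) k"
    have nn: "e k s \<ge> 0" if "k \<le> d" for k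
      using m0 that unfolding m_def by (metis Min_le atMost_iff finite_atMost finite_imageI imageI)
    have cg: "coeff ?g k = (if k \<le> d then e k s else 0)" for k
      by (simp add: coeff_sum)
    have add_diag: "degree ?g = d"
      by (rule antisym, rule degree_le) (use top[OF s] in \<open>auto simp: cg intro!: le_degree\<close>)
    have "poly ?g x > 0" if "x \<ge> 0" for x
    proof -
      have "poly ?g x = (\<Sum>k\<le>d. e k s * x ^ k)" by (simp add: poly_sum poly_monom)
      also have "\<dots> \<ge> (\<Sum>k\<in>{0}. e k s * x ^ k)"
        using nn that by (intro sum_mono2) auto
      finally show ?thesis using bot[OF s] by simp
    qed
    then have "pos_coeffs ?g"
      using rr[OF s] top[OF s] by (intro real_rooted_pos_coeffs) (auto simp: add_diag cg less_imp_neq[THEN not_sym])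
    then have "e k s > 0" if "k \<le> d" for k
      using that unfolding pos_coeffs_def add_diag cg by auto
    moreover have "m s \<in> (\<lambda>k. e k s) ` {..d}" unfolding m_def by (intro Min_in) auto
    ultimately show False using m0 by force
  qed
  have "m 0 > 0" unfolding m_def using init by (subst Min_gr_iff) auto
  have "m 1 > 0"
  proof (rule ccontr)
    assume "\<not> m 1 > 0"
    then obtain s where "s \<ge> 0" "s \<le> 1" "m s = 0"
      using IVT2'[of m 1 0 0] cm \<open>m 0 > 0\<close> by auto
    then show False using noz[of s] by auto
  qed
  then show ?thesis unfolding m_def using k by (subst (asm) Min_gr_iff) auto
qed

section \<open>Partial fractions with nonnegative residues\<close>

text \<open>Near z the quotient behaves like c / (s - z)^k. For k at least 2 the image of the upper
  half plane under w^(-k) meets both half planes, so the imaginary part cannot keep one sign; for k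
  = 1 the sign of c is forced.\<close>

lemma Im_nonpos_simple_pole:
  fixes g1 h :: "real poly"
  assumes im: "\<And>s. Im s > 0 \<Longrightarrow> Im (poly (cpoly h) s / poly (cpoly ([:- z, 1:] ^ k * g1)) s) \<le> 0"
    and k: "k \<ge> 1" and g1: "poly g1 z \<noteq> 0" and h: "poly h z \<noteq> 0"
  shows "k = 1 \<and> poly h z / poly g1 z \<ge> 0"
proof -
  define c where "c = poly h z / poly g1 z"
  have c0: "c \<noteq> 0" using g1 h by (simp add: c_def)
  have cp: "cpoly ([:- z, 1:] ^ k * g1) = [:- of_real z, 1:] ^ k * cpoly g1" for k
    by (induction k) (simp_all add: cpoly_mult cpoly_linear mult.assoc del: mult_pCons_left)
  have key: "c * Im (inverse w ^ k) \<le> 0" if w: "Im w > 0" for w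
  proof -
    let ?f = "\<lambda>s. poly (cpoly h) s / poly (cpoly g1) s"
    let ?p = "\<lambda>\<epsilon>::real. of_real z + of_real \<epsilon> * w"
    have w0: "w \<noteq> 0" using w by auto
    \<comment> \<open>Approach z along the ray through w. The positive factor \<epsilon>^k does not
      change signs and leaves a quantity with limit c * w^(-k).\<close>
    have "((\<lambda>\<epsilon>. inverse w ^ k * ?f (?p \<epsilon>)) \<longlongrightarrow> inverse w ^ k * ?f (?p 0)) (at_right 0)"
      using g1 by (intro tendsto_intros) (auto simp: poly_cpoly_of_real)
    then have "((\<lambda>\<epsilon>. Im (inverse w ^ k * ?f (?p \<epsilon>))) \<longlongrightarrow> Im (inverse w ^ k * ?f (?p 0))) (at_right 0)"
      by (rule tendsto_Im)
    moreover have "eventually (\<lambda>\<epsilon>. Im (inverse w ^ k * ?f (?p \<epsilon>)) \<le> 0) (at_right 0)"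
    proof (rule eventually_at_rightI[of 0 1])
      fix \<epsilon> :: real assume e: "\<epsilon> \<in> {0<..<1}"
      let ?s = "?p \<epsilon>"
      have "Im (?f ?s / (of_real \<epsilon> * w) ^ k) \<le> 0"
        using im[of ?s] e w unfolding cp poly_mult poly_power by (simp add: mult.commute[of "poly (cpoly g1) _"])
      also have "?f ?s / (of_real \<epsilon> * w) ^ k = of_real (inverse (\<epsilon> ^ k)) * (inverse w ^ k * ?f ?s)"
        by (simp only: divide_inverse inverse_mult_distrib power_mult_distrib of_real_inverse of_real_power power_inverse mult_ac)
      also have "Im \<dots> = inverse (\<epsilon> ^ k) * Im (inverse w ^ k * ?f ?s)"
        by (simp only: times_complex.sel Im_complex_of_real Re_complex_of_real mult_zero_left add_0_right)
      finally have "inverse (\<epsilon> ^ k) * Im (inverse w ^ k * ?f ?s) \<le> 0" .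
      moreover have "inverse (\<epsilon> ^ k) > 0" using e by simp
      ultimately show "Im (inverse w ^ k * ?f ?s) \<le> 0"
        by (meson linorder_not_less mult_pos_pos)
    qed simp
    ultimately have "Im (inverse w ^ k * ?f (?p 0)) \<le> 0"
      by (intro tendsto_upperbound) auto
    moreover have "?f (?p 0) = of_real c" by (simp add: poly_cpoly_of_real c_def)
    ultimately show ?thesis
      by (simp only: times_complex.sel Im_complex_of_real Re_complex_of_real mult_zero_right add_0_left add_0_right)
        (simp only: mult.commute)
  qed
  have im_cis: "Im (inverse (cis \<theta>) ^ k) = - sin (k * \<theta>)" for \<theta> :: real
    by (simp only: cis_inverse Complex.DeMoivre cis.sel mult_minus_right sin_minus) 
  have th: "c * (- sin (k * \<theta>)) \<le> 0" if "0 < \<theta>" "\<theta> < pi" for \<theta> :: real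
    using key[of "cis \<theta>"] that by (simp add: im_cis sin_gt_zero del: cis_inverse)
  have "c \<ge> 0"
  proof -
    \<comment> \<open>With \<open>k * \<theta> = pi / 2\<close> the imaginary part of w^(-k) is -1,
      which forces c to be nonnegative.\<close>
    define \<theta> where "\<theta> = pi / (2 * real k)"
    have "\<theta> > 0" using k by (simp add: \<theta>_def)
    have kt: "real k * \<theta> = pi / 2" using k by (simp add: \<theta>_def)
    have "1 * \<theta> \<le> real k * \<theta>" using k \<open>\<theta> > 0\<close> by (intro mult_right_mono) auto
    then have "\<theta> < pi" using kt pi_gt_zero by linarith
    from th[OF \<open>\<theta> > 0\<close> this] show ?thesis unfolding kt by simp
  qed
  moreover have "k = 1"
  proof (rule ccontr)
    assume "k \<noteq> 1"
    then have "2 \<le> k" using k by auto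
    then have k2: "real k \<ge> 2" by (metis of_nat_le_iff of_nat_numeral)
    \<comment> \<open>Now w^(-k) has imaginary part +1. The angle lies below pi exactly because k is
      at least 2.\<close>
    define \<theta> where "\<theta> = 3 / 2 * pi / real k"
    have "\<theta> > 0" using k by (simp add: \<theta>_def)
    have kt: "real k * \<theta> = 3 / 2 * pi" using k by (simp add: \<theta>_def)
    have "2 * \<theta> \<le> real k * \<theta>" using k2 \<open>\<theta> > 0\<close> by (intro mult_right_mono) auto
    then have "\<theta> < pi" using kt pi_gt_zero by linarith
    from th[OF \<open>\<theta> > 0\<close> this] have "c \<le> 0" unfolding kt sin_3over2_pi by simp
    then show False using \<open>c \<ge> 0\<close> c0 by simp
  qed
  ultimately show ?thesis by (simp add: c_def)
qed

context
  notes mult_pCons_left [simp del] mult_pCons_right [simp del]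
begin

text \<open>Lagrange interpolation: g has as many distinct roots as its degree, and h agrees there
  with the combination of the cofactors \<open>q z\<close>, so the difference P has more zeros than
  its degree permits. The disjunct \<open>h = 0\<close> covers a constant g.\<close>

lemma partial_fractions_simple:
  fixes g h :: "real poly"
  assumes rr: "real_rooted g" and g0: "g \<noteq> 0" and dh: "degree h < degree g \<or> h = 0"
    and simple: "\<And>z. poly g z = 0 \<Longrightarrow> order z g = 1"
    and nonneg: "\<And>z g1. g = [:- z, 1:] * g1 \<Longrightarrow> poly h z / poly g1 z \<ge> 0"
  shows "\<exists>Z c. finite Z \<and> (\<forall>z\<in>Z. poly g z = 0 \<and> c z \<ge> 0) \<and>
           (\<forall>s. poly g s \<noteq> 0 \<longrightarrow> poly h s / poly g s = (\<Sum>z\<in>Z. c z / (s - z)))"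
proof -
  define Z where "Z = {z. poly g z = 0}"
  have fin: "finite Z" unfolding Z_def using g0 by (rule poly_roots_finite)
  define q where "q z = (SOME g1. g = [:- z, 1:] * g1)" for z
  have q: "g = [:- z, 1:] * q z" if "z \<in> Z" for z
  proof -
    have "[:- z, 1:] dvd g" using that unfolding Z_def poly_eq_0_iff_dvd by simp
    then have "\<exists>g1. g = [:- z, 1:] * g1" unfolding dvd_def .
    then show ?thesis unfolding q_def by (rule someI_ex)
  qed
  have q0: "q z \<noteq> 0" if "z \<in> Z" for z using q[OF that] g0 by auto
  have dq: "degree g = Suc (degree (q z))" if "z \<in> Z" for z
    by (subst q[OF that], subst degree_mult_eq) (use q0[OF that] in auto)
  have qz: "poly (q z) z \<noteq> 0" if "z \<in> Z" for z
  proof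
    assume "poly (q z) z = 0"
    then obtain r where "q z = [:- z, 1:] * r" by (auto simp: poly_eq_0_iff_dvd)
    then have "g = [:- z, 1:] * ([:- z, 1:] * r)" using q[OF that] by metis
    then have "[:- z, 1:] ^ 2 dvd g" unfolding power2_eq_square by (metis dvd_triv_left mult.assoc)
    then have "2 \<le> order z g" using g0 by (simp add: order_divides)
    then show False using simple[of z] that by (simp add: Z_def)
  qed
  have qz': "poly (q z) w = 0" if "z \<in> Z" "w \<in> Z" "w \<noteq> z" for z w
  proof -
    have "poly ([:- z, 1:] * q z) w = 0" using q[OF that(1)] that(2) by (simp add: Z_def)
    then show ?thesis using that by simp
  qed
  define c where "c z = poly h z / poly (q z) z" for z
  have cardZ: "card Z = degree g"
  proof -
    obtain zs where zs: "g = Polynomial.smult (lead_coeff g) (\<Prod>z\<leftarrow>zs. [:- z, 1:])"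
      using real_rooted_factorization[OF rr g0] by blast
    have len: "degree (\<Prod>z\<leftarrow>zs. [:- z, 1::real:]) = length zs \<and> (\<Prod>z\<leftarrow>zs. [:- z, 1::real:]) \<noteq> 0" for zs
    proof (induction zs)
      case (Cons a zs)
      then show ?case by (simp only: list.map prod_list.Cons, subst degree_mult_eq) auto
    qed simp
    have "degree g = length zs" by (subst zs) (use g0 len in simp)
    moreover have "Z = set zs"
    proof -
      have "poly g z = 0 \<longleftrightarrow> poly (\<Prod>z\<leftarrow>zs. [:- z, 1:]) z = 0" for z
        by (subst zs) (use g0 in simp)
      then show ?thesis unfolding Z_def poly_prod_list_linear by (auto simp: prod_list_zero_iff)
    qed
    moreover have "distinct zs"
    proof (rule ccontr)
      assume "\<not> distinct zs"
      then obtain xs ys ws y where "zs = xs @ [y] @ ys @ [y] @ ws"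
        using not_distinct_decomp by blast
      then have "g = [:- y, 1:] ^ 2 * Polynomial.smult (lead_coeff g) (\<Prod>z\<leftarrow>xs @ ys @ ws. [:- z, 1:])"
        by (subst zs) (simp add: power2_eq_square mult_ac)
      then have "[:- y, 1:] ^ 2 dvd g" by (metis dvd_triv_left)
      then have "2 \<le> order y g" using g0 by (simp add: order_divides)
      moreover have "poly g y = 0" using calculation g0 by (simp add: order_root)
      ultimately show False using simple[of y] by simp
    qed
    ultimately show ?thesis by (simp add: distinct_card)
  qed
  define P where "P = h - (\<Sum>z\<in>Z. Polynomial.smult (c z) (q z))"
  have Pz: "poly P w = 0" if "w \<in> Z" for w
  proof -
    have "(\<Sum>z\<in>Z. c z * poly (q z) w) = (\<Sum>z\<in>{w}. c z * poly (q z) w)"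
      using fin that qz' by (intro sum.mono_neutral_right) auto
    then show ?thesis using qz[OF that] by (simp add: P_def poly_sum c_def)
  qed
  have "P = 0"
  proof (rule ccontr)
    assume "P \<noteq> 0"
    have "card Z \<le> card {z. poly P z = 0}"
      using Pz poly_roots_finite[OF \<open>P \<noteq> 0\<close>] by (intro card_mono) auto
    also have "\<dots> \<le> degree P" using \<open>P \<noteq> 0\<close> by (rule card_poly_roots_bound)
    finally have le: "degree g \<le> degree P" using cardZ by simp
    show False
    proof (cases "Z = {}")
      case True
      then show False using cardZ dh \<open>P \<noteq> 0\<close> by (auto simp: P_def)
    next
      case False
      then have pos: "degree g > 0" using dq by fastforce
      have "degree (\<Sum>z\<in>Z. Polynomial.smult (c z) (q z)) < degree g"
      proof (rule le_less_trans)
        show "degree (\<Sum>z\<in>Z. Polynomial.smult (c z) (q z)) \<le> degree g - 1"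
          using dq by (intro degree_sum_le[OF fin]) (metis degree_smult_le diff_Suc_1)
        show "degree g - 1 < degree g" using pos by simp
      qed
      moreover have "degree h < degree g" using dh pos by auto
      ultimately have "degree P < degree g" unfolding P_def by (intro degree_diff_less)
      then show False using le by simp
    qed
  qed
  then have h: "h = (\<Sum>z\<in>Z. Polynomial.smult (c z) (q z))" by (simp add: P_def)
  have "poly h s / poly g s = (\<Sum>z\<in>Z. c z / (s - z))" if s: "poly g s \<noteq> 0" for s
  proof -
    have "c z * poly (q z) s / poly g s = c z / (s - z)" if "z \<in> Z" for z
    proof -
      have "poly g s = (s - z) * poly (q z) s" by (subst q[OF that]) (simp add: algebra_simps)
      then show ?thesis using s by simp
    qed
    then show ?thesis by (subst h) (simp add: poly_sum sum_divide_distrib)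
  qed
  moreover have "poly g z = 0 \<and> c z \<ge> 0" if "z \<in> Z" for z
    using that nonneg[OF q[OF that]] by (simp add: Z_def c_def)
  ultimately show ?thesis using fin by blast
qed

text \<open>Common roots of g and h are cancelled by induction on the degree, because the local
  analysis at a pole needs a nonzero numerator. Afterwards all poles are simple with nonnegative
  residue.\<close>

lemma partial_fractions_nonneg:
  fixes g h :: "real poly"
  assumes "real_rooted g" "g \<noteq> 0" "degree h < degree g \<or> h = 0"
    and im: "\<And>s. Im s > 0 \<Longrightarrow> Im (poly (cpoly h) s / poly (cpoly g) s) \<le> 0"
  shows "\<exists>Z c. finite Z \<and> (\<forall>z\<in>Z. poly g z = 0 \<and> c z \<ge> 0) \<and>
           (\<forall>s. poly g s \<noteq> 0 \<longrightarrow> poly h s / poly g s = (\<Sum>z\<in>Z. c z / (s - z)))"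
  using assms
proof (induction "degree g" arbitrary: g h rule: less_induct)
  case less
  show ?case
  proof (cases "\<exists>z. poly g z = 0 \<and> poly h z = 0")
    case True
    then obtain z g' h' where g': "g = [:- z, 1:] * g'" and h': "h = [:- z, 1:] * h'"
      by (auto simp: poly_eq_0_iff_dvd elim!: dvdE)
    have "g' \<noteq> 0" using less.prems(2) g' by auto
    have add_diag: "degree g = Suc (degree g')"
      by (subst g', subst degree_mult_eq) (use \<open>g' \<noteq> 0\<close> in auto)
    have dh: "degree h' < degree g' \<or> h' = 0"
    proof (cases "h' = 0")
      case False
      have "degree h = Suc (degree h')"
        by (subst h', subst degree_mult_eq) (use False in auto)
      moreover have "h \<noteq> 0" using False h' by auto
      ultimately show ?thesis using less.prems(3) add_diag by simp
    qed simp
    have "real_rooted g'" using less.prems(1) g' real_rooted_dvd by blast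
    moreover have "Im (poly (cpoly h') s / poly (cpoly g') s) \<le> 0" if "Im s > 0" for s
    proof -
      have "s \<noteq> of_real z" using that by auto
      then show ?thesis using less.prems(4)[OF that] unfolding g' h' cpoly_mult cpoly_linear
        by simp
    qed
    ultimately obtain Z c where Z: "finite Z" "\<forall>z\<in>Z. poly g' z = 0 \<and> c z \<ge> 0"
      "\<And>s. poly g' s \<noteq> 0 \<Longrightarrow> poly h' s / poly g' s = (\<Sum>z\<in>Z. c z / (s - z))"
      using less.hyps[of g' h'] add_diag dh \<open>g' \<noteq> 0\<close> by auto
    show ?thesis
    proof (intro exI conjI ballI allI impI)
      show "finite Z" by fact
      show "poly g z = 0" "c z \<ge> 0" if "z \<in> Z" for z
        using Z(2) that by (auto simp: g')
      show "poly h s / poly g s = (\<Sum>z\<in>Z. c z / (s - z))" if "poly g s \<noteq> 0" for s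
        using that Z(3)[of s] by (simp add: g' h')
    qed
  next
    case False
    have fact: "k = 1 \<and> poly h z / poly g1 z \<ge> 0"
      if "g = [:- z, 1:] ^ k * g1" "k \<ge> 1" "poly g1 z \<noteq> 0" for z g1 k
      using less.prems(4) that False unfolding that(1)
      by (intro Im_nonpos_simple_pole[of h z k g1]) (auto simp: zero_power)
    have simple: "order z g = 1" if "poly g z = 0" for z
    proof -
      obtain g1 where g1: "g = [:- z, 1:] ^ order z g * g1" "\<not> [:- z, 1:] dvd g1"
        using order_decomp[OF less.prems(2)] by blast
      moreover have "order z g \<ge> 1" using that less.prems(2) by (metis less_one not_le order_root)
      ultimately show ?thesis using fact by (simp add: poly_eq_0_iff_dvd)
    qed
    show ?thesis
    proof (rule partial_fractions_simple[OF less.prems(1-3) simple])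
      fix z g1 assume g1: "g = [:- z, 1:] * g1"
      show "0 \<le> poly h z / poly g1 z"
      \<comment> \<open>If g1 vanishes at z the quotient is 0 by the convention on division.\<close>
      proof (cases "poly g1 z = 0")
        case False
        then show ?thesis using fact[of z 1 g1] g1 by simp
      qed simp
    qed
  qed
qed

end

section \<open>Stable multiaffine functions\<close>

definition shift_at :: "'i \<Rightarrow> 'a::plus \<Rightarrow> ('i \<Rightarrow> 'a) \<Rightarrow> 'i \<Rightarrow> 'a" where
  "shift_at i v y = y(i := y i + v)"

text \<open>For a function that is affine in each coordinate the unit difference is the partial derivative.\<close>

definition pdiff :: "'i \<Rightarrow> (('i \<Rightarrow> 'a) \<Rightarrow> 'a) \<Rightarrow> ('i \<Rightarrow> 'a::comm_ring_1) \<Rightarrow> 'a" where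
  "pdiff i H y = H (shift_at i 1 y) - H y"

definition multiaffine :: "'i set \<Rightarrow> (('i \<Rightarrow> 'a::comm_ring_1) \<Rightarrow> 'a) \<Rightarrow> bool" where
  "multiaffine I H \<longleftrightarrow> (\<forall>i\<in>I. \<forall>y v. H (shift_at i v y) = H y + v * pdiff i H y)"

lemma shift_at_commute: "shift_at i v (shift_at j w y) = shift_at j w (shift_at i v y)" for v :: "'a::ab_semigroup_add"
  by (cases "i = j") (auto simp: shift_at_def fun_upd_twist add_ac)

lemma multiaffineD: "multiaffine I H \<Longrightarrow> i \<in> I \<Longrightarrow> H (shift_at i v y) = H y + v * pdiff i H y"
  by (simp add: multiaffine_def)

lemma pdiff_commute: "pdiff i (pdiff j H) y = pdiff j (pdiff i H) y"
  by (simp add: pdiff_def shift_at_commute)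

lemma multiaffine_pdiff:
  assumes "multiaffine I H" "j \<in> I" shows "multiaffine I (pdiff j H)"
  unfolding multiaffine_def
proof (intro ballI allI)
  fix i y v assume i: "i \<in> I"
  have "pdiff j H (shift_at i v y) = H (shift_at i v (shift_at j 1 y)) - H (shift_at i v y)"
    by (simp only: pdiff_def shift_at_commute[of j])
  also have "\<dots> = pdiff j H y + v * (pdiff i H (shift_at j 1 y) - pdiff i H y)"
    by (simp only: multiaffineD[OF assms(1) i]) (simp add: pdiff_def algebra_simps)
  also have "pdiff i H (shift_at j 1 y) - pdiff i H y = pdiff i (pdiff j H) y"
    by (simp only: pdiff_def shift_at_commute[of i] ) (simp add: algebra_simps)
  finally show "pdiff j H (shift_at i v y) = pdiff j H y + v * pdiff i (pdiff j H) y" .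
qed

lemma multiaffine_shift_at:
  assumes "multiaffine I H" shows "multiaffine I (\<lambda>y. H (shift_at k w y))"
  unfolding multiaffine_def
proof (intro ballI allI)
  fix i y v assume i: "i \<in> I"
  have e: "H (shift_at k w (shift_at i u y)) = H (shift_at i u (shift_at k w y))" for u
    by (subst shift_at_commute) (rule refl)
  show "H (shift_at k w (shift_at i v y)) = H (shift_at k w y) + v * pdiff i (\<lambda>y. H (shift_at k w y)) y"
    unfolding e pdiff_def by (rule multiaffineD[OF assms i, unfolded pdiff_def])
qed

lemma multiaffine_sum:
  assumes "\<And>k. k \<in> K \<Longrightarrow> multiaffine I (H k)"
  shows "multiaffine I (\<lambda>y. \<Sum>k\<in>K. w k * H k y)"
  unfolding multiaffine_def
proof (intro ballI allI)
  fix i y v assume i: "i \<in> I"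
  have "(\<Sum>k\<in>K. w k * H k (shift_at i v y)) = (\<Sum>k\<in>K. w k * H k y + v * (w k * pdiff i (H k) y))"
    by (intro sum.cong refl) (simp add: multiaffineD[OF assms i] algebra_simps)
  then show "(\<Sum>k\<in>K. w k * H k (shift_at i v y)) =
      (\<Sum>k\<in>K. w k * H k y) + v * pdiff i (\<lambda>y. \<Sum>k\<in>K. w k * H k y) y"
    by (simp add: pdiff_def sum.distrib sum_subtractf sum_distrib_left right_diff_distrib)
qed

text \<open>Coordinates are switched on one at a time; the affine identity for the new one reduces
  the claim to the product rule.\<close>

lemma multiaffine_directional_derivative:
  fixes H :: "('i \<Rightarrow> real) \<Rightarrow> real"
  assumes "finite J" "J \<subseteq> I" "multiaffine I H"
  shows "((\<lambda>s. H (\<lambda>i. if i \<in> J then y i + s * u i else y i)) has_real_derivative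
           (\<Sum>i\<in>J. u i * pdiff i H y)) (at 0)"
  using assms
proof (induction J arbitrary: H rule: finite_induct)
  case empty
  then show ?case by simp
next
  case (insert j J)
  let ?y = "\<lambda>s i. if i \<in> J then y i + s * u i else y i"
  have j: "j \<in> I" and J: "J \<subseteq> I" using insert by auto
  have eq: "(\<lambda>i. if i \<in> insert j J then y i + s * u i else y i) = shift_at j (s * u j) (?y s)" for s
    using insert.hyps by (auto simp: shift_at_def)
  have d1: "((\<lambda>s. H (?y s)) has_real_derivative (\<Sum>i\<in>J. u i * pdiff i H y)) (at 0)"
    by (rule insert.IH[OF J insert.prems(2)])
  have d2: "((\<lambda>s. pdiff j H (?y s)) has_real_derivative (\<Sum>i\<in>J. u i * pdiff i (pdiff j H) y)) (at 0)"
    by (rule insert.IH[OF J multiaffine_pdiff[OF insert.prems(2) j]])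
  have y0: "?y 0 = y" by auto
  have "((\<lambda>s. H (?y s) + s * u j * pdiff j H (?y s)) has_real_derivative
      (\<Sum>i\<in>J. u i * pdiff i H y) + u j * pdiff j H y) (at 0)"
    using y0 by (auto intro!: derivative_eq_intros d1 d2)
  then show ?case
    unfolding eq multiaffineD[OF insert.prems(2) j] using insert.hyps by (simp add: add.commute)
qed

text \<open>Multivariate polynomials are represented by functions. The last clause makes every restriction to a real
  line a real polynomial whose coefficient of degree \<open>card I\<close> is the product of the direction entries,
  that is, the coefficient of the full monomial is \<open>1\<close>.\<close>

definition stable :: "'i set \<Rightarrow> (('i \<Rightarrow> complex) \<Rightarrow> complex) \<Rightarrow> bool" where
  "stable I G \<longleftrightarrow> finite I \<and> multiaffine I G \<and>
     (\<forall>y y'. (\<forall>i\<in>I. y i = y' i) \<longrightarrow> G y = G y') \<and>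
     (\<forall>y. (\<forall>i\<in>I. Im (y i) > 0) \<longrightarrow> G y \<noteq> 0) \<and>
     (\<forall>y u. \<exists>p. degree p \<le> card I \<and> coeff p (card I) = (\<Prod>i\<in>I. u i) \<and>
        (\<forall>s. poly (cpoly p) s = G (\<lambda>i. of_real (y i) + s * of_real (u i))))"

definition re_val :: "(('i \<Rightarrow> complex) \<Rightarrow> complex) \<Rightarrow> ('i \<Rightarrow> real) \<Rightarrow> real" where
  "re_val G y = Re (G (\<lambda>i. of_real (y i)))"

lemma stableD:
  assumes "stable I G"
  shows stable_finite: "finite I" and stable_multiaffine: "multiaffine I G"
    and stable_cong: "(\<And>i. i \<in> I \<Longrightarrow> y i = y' i) \<Longrightarrow> G y = G y'"
    and stable_nonzero: "(\<And>i. i \<in> I \<Longrightarrow> Im (y i) > 0) \<Longrightarrow> G y \<noteq> 0"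
  using assms unfolding stable_def by (blast, blast, blast, blast)

lemma stable_line:
  assumes "stable I G"
  obtains p where "degree p \<le> card I" "coeff p (card I) = (\<Prod>i\<in>I. u i)"
    "\<And>s. poly (cpoly p) s = G (\<lambda>i. of_real (y i) + s * of_real (u i))"
  using assms unfolding stable_def by metis

lemma stable_real: assumes "stable I G" shows "G (\<lambda>i. of_real (y i)) = of_real (re_val G y)"
proof -
  obtain p where p: "\<And>s. poly (cpoly p) s = G (\<lambda>i. of_real (y i) + s * of_real (0::real))"
    by (rule stable_line[OF assms, of "\<lambda>_. 0" y]) auto
  have "G (\<lambda>i. of_real (y i)) = of_real (poly p 0)"
    using p[of 0] poly_cpoly_of_real[of p 0] by simp
  then show ?thesis by (simp add: re_val_def)
qed

lemma re_val_cong: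
  assumes "stable I G" "\<And>i. i \<in> I \<Longrightarrow> y i = y' i"
  shows "re_val G y = re_val G y'"
  unfolding re_val_def
  using stable_cong[OF assms(1), of "\<lambda>i. of_real (y i)" "\<lambda>i. of_real (y' i)"] assms(2) by simp

lemma of_real_shift_at: "(\<lambda>i. complex_of_real (shift_at j v y i)) = shift_at j (of_real v) (\<lambda>i. of_real (y i))"
  by (auto simp: shift_at_def)

lemma pdiff_re_val: "pdiff i (re_val G) y = re_val (pdiff i G) y"
  by (simp add: pdiff_def re_val_def of_real_shift_at)

lemma re_val_multiaffine: assumes "stable I G" shows "multiaffine I (re_val G)"
  unfolding multiaffine_def pdiff_re_val
  by (auto simp: re_val_def of_real_shift_at multiaffineD[OF stable_multiaffine[OF assms]])

text \<open>In coordinate i alone the function is affine in the increment v, with zero at v = -1/r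
  for r the quotient. Stability keeps this zero out of the upper half plane, so the imaginary part
  of 1/r is at least that of \<open>y i\<close>, hence positive.\<close>

lemma stable_pdiff_Im:
  assumes G: "stable I G" and i: "i \<in> I" and y: "\<And>k. k \<in> I \<Longrightarrow> Im (y k) > 0"
  shows "pdiff i G y / G y = 0 \<or> Im (pdiff i G y / G y) < 0"
proof (cases "pdiff i G y = 0")
  case False
  define r where "r = pdiff i G y / G y"
  have G0: "G y \<noteq> 0" using stable_nonzero[OF G] y by blast
  have r0: "r \<noteq> 0" using False G0 by (simp add: r_def)
  have "G (shift_at i (- 1 / r) y) = 0"
    using multiaffineD[OF stable_multiaffine[OF G] i, of "- 1 / r" y] False G0 by (simp add: r_def)
  then have "\<not> (\<forall>k\<in>I. Im (shift_at i (- 1 / r) y k) > 0)"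
    using stable_nonzero[OF G] by blast
  then have "Im (y i + - 1 / r) \<le> 0" using y by (auto simp: shift_at_def split: if_splits)
  then have "Im (1 / r) > 0" using y[OF i] by simp
  then have "Im r < 0"
    using sum_power2_ge_zero[of "Re r" "Im r"]
    by (auto simp: Im_divide divide_less_0_iff not_less)
  then show ?thesis by (simp add: r_def)
qed simp

section \<open>Averages of translates\<close>

definition avg :: "('i \<Rightarrow> real) \<Rightarrow> 'i set \<Rightarrow> real \<Rightarrow> (('i \<Rightarrow> complex) \<Rightarrow> complex) \<Rightarrow> ('i \<Rightarrow> complex) \<Rightarrow> complex" where
  "avg w b \<beta> G y = (\<Sum>i\<in>b. of_real (w i) * G (shift_at i (of_real \<beta>) y))"

lemma re_val_avg: "re_val (avg w b \<beta> G) y = (\<Sum>i\<in>b. w i * re_val G (shift_at i \<beta> y))"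
  by (simp add: re_val_def avg_def of_real_shift_at)

text \<open>Divided by G, the average is 1 + \<beta> times a convex combination of the quotients of
  \<open>stable_pdiff_Im\<close>. These lie in the open lower half plane or are 0, so a vanishing
  imaginary part makes every weighted quotient 0 and leaves the value 1. This works for either sign
  of \<beta>; weights of total mass 1 preserve the top coefficient.\<close>

lemma stable_avg:
  assumes G: "stable I G" and b: "b \<subseteq> I" and w: "\<And>i. i \<in> b \<Longrightarrow> w i \<ge> 0" "sum w b = 1"
  shows "stable I (avg w b \<beta> G)"
  unfolding stable_def
proof (intro conjI allI impI)
  show "finite I" by (rule stable_finite[OF G])
  show "multiaffine I (avg w b \<beta> G)"
    unfolding avg_def by (intro multiaffine_sum multiaffine_shift_at stable_multiaffine[OF G])
next
  fix y y' :: "'a \<Rightarrow> complex" assume e: "\<forall>i\<in>I. y i = y' i"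
  have "G (shift_at i (of_real \<beta>) y) = G (shift_at i (of_real \<beta>) y')" for i
    using e by (intro stable_cong[OF G, of "shift_at i (of_real \<beta>) y" "shift_at i (of_real \<beta>) y'"]) (auto simp: shift_at_def)
  then show "avg w b \<beta> G y = avg w b \<beta> G y'" unfolding avg_def by simp
next
  fix y :: "'a \<Rightarrow> complex" assume y: "\<forall>i\<in>I. Im (y i) > 0"
  have G0: "G y \<noteq> 0" using stable_nonzero[OF G] y by blast
  define r where "r i = pdiff i G y / G y" for i
  have r: "r i = 0 \<or> Im (r i) < 0" if "i \<in> b" for i
    unfolding r_def using stable_pdiff_Im[OF G, of i y] b y that by blast
  have eq: "avg w b \<beta> G y = G y * (1 + of_real \<beta> * (\<Sum>i\<in>b. of_real (w i) * r i))"
  proof -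
    have "avg w b \<beta> G y = (\<Sum>i\<in>b. of_real (w i) * (G y + of_real \<beta> * pdiff i G y))"
      unfolding avg_def using b by (intro sum.cong refl) (simp add: multiaffineD[OF stable_multiaffine[OF G]] subset_eq)
    also have "\<dots> = (\<Sum>i\<in>b. of_real (w i)) * G y + (\<Sum>i\<in>b. of_real (w i) * (of_real \<beta> * pdiff i G y))"
      by (simp add: sum.distrib sum_distrib_right distrib_left)
    also have "(\<Sum>i\<in>b. complex_of_real (w i)) = 1" using w(2) by (metis of_real_1 of_real_sum)
    also have "1 * G y + (\<Sum>i\<in>b. of_real (w i) * (of_real \<beta> * pdiff i G y)) =
        G y * (1 + of_real \<beta> * (\<Sum>i\<in>b. of_real (w i) * r i))"
      using G0 by (simp add: r_def sum_distrib_left distrib_left mult_ac)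
    finally show ?thesis .
  qed
  show "avg w b \<beta> G y \<noteq> 0"
  proof
    assume "avg w b \<beta> G y = 0"
    then have z: "1 + of_real \<beta> * (\<Sum>i\<in>b. of_real (w i) * r i) = 0" using eq G0 by simp
    have nz: "\<beta> \<noteq> 0" using z by auto
    have "Im (1 + of_real \<beta> * (\<Sum>i\<in>b. of_real (w i) * r i)) = \<beta> * (\<Sum>i\<in>b. w i * Im (r i))" by simp
    then have "(\<Sum>i\<in>b. w i * Im (r i)) = 0" using nz z by simp
    then have "(\<Sum>i\<in>b. w i * - Im (r i)) = 0" by (simp add: sum_negf)
    moreover have "w i * - Im (r i) \<ge> 0" if "i \<in> b" for i
      using r[OF that] w(1)[OF that] by (auto simp: mult_nonneg_nonpos)
    ultimately have "\<forall>i\<in>b. w i * - Im (r i) = 0"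
      using finite_subset[OF b stable_finite[OF G]] by (subst (asm) sum_nonneg_eq_0_iff) auto
    then have "of_real (w i) * r i = 0" if "i \<in> b" for i
      using r[OF that] that by force
    then have s0: "(\<Sum>i\<in>b. of_real (w i) * r i) = 0" by (intro sum.neutral ballI)
    show False using z unfolding s0 by simp
  qed
next
  fix y u :: "'a \<Rightarrow> real"
  have "\<exists>p. degree p \<le> card I \<and> coeff p (card I) = (\<Prod>k\<in>I. u k) \<and>
      (\<forall>s. poly (cpoly p) s = G (\<lambda>k. of_real (shift_at i \<beta> y k) + s * of_real (u k)))" for i
    using G unfolding stable_def by blast
  then obtain p where p: "\<And>i. degree (p i) \<le> card I" "\<And>i. coeff (p i) (card I) = (\<Prod>k\<in>I. u k)"
    "\<And>i s. poly (cpoly (p i)) s = G (\<lambda>k. of_real (shift_at i \<beta> y k) + s * of_real (u k))" by metis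
  let ?p = "\<Sum>i\<in>b. Polynomial.smult (w i) (p i)"
  have fb: "finite b" using finite_subset[OF b stable_finite[OF G]] .
  show "\<exists>p. degree p \<le> card I \<and> coeff p (card I) = (\<Prod>i\<in>I. u i) \<and>
      (\<forall>s. poly (cpoly p) s = avg w b \<beta> G (\<lambda>i. of_real (y i) + s * of_real (u i)))"
  proof (intro exI[of _ ?p] conjI allI)
    show "degree ?p \<le> card I"
      using p(1) by (intro degree_sum_le[OF fb]) (meson degree_smult_le order_trans)
    show "coeff ?p (card I) = (\<Prod>i\<in>I. u i)"
      using w(2) by (simp add: coeff_sum p(2) flip: sum_distrib_right)
    fix s :: complex
    have "cpoly ?p = (\<Sum>i\<in>b. Polynomial.smult (of_real (w i)) (cpoly (p i)))"
      by (intro poly_eqI) (simp add: coeff_sum coeff_map_poly)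
    moreover have "(\<lambda>k. of_real (shift_at i \<beta> y k) + s * of_real (u k)) =
        shift_at i (of_real \<beta>) (\<lambda>k. of_real (y k) + s * of_real (u k))" for i
      by (auto simp: shift_at_def)
    ultimately show "poly (cpoly ?p) s = avg w b \<beta> G (\<lambda>i. of_real (y i) + s * of_real (u i))"
      by (simp add: poly_sum p(3) avg_def)
  qed
qed

section \<open>Restriction to real lines\<close>

definition vadd :: "('i \<Rightarrow> real) \<Rightarrow> real \<Rightarrow> ('i \<Rightarrow> real) \<Rightarrow> 'i \<Rightarrow> real" where
  "vadd y s u = (\<lambda>i. y i + s * u i)"

lemma vadd_vadd: "vadd (vadd y s u) t u = vadd y (s + t) u"
  by (auto simp: vadd_def algebra_simps)

lemma vadd_0 [simp]: "vadd y 0 u = y"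
  by (simp add: vadd_def)

lemma vadd_shift_at: "vadd (shift_at j v y) s u = shift_at j v (vadd y s u)"
  by (auto simp: vadd_def shift_at_def)

text \<open>The properties of \<open>re_val G\<close> that survive \<open>pdiff\<close>. Stability
  itself does not survive, since a partial difference loses the full monomial.\<close>

definition regular :: "'i set \<Rightarrow> (('i \<Rightarrow> real) \<Rightarrow> real) \<Rightarrow> bool" where
  "regular I H \<longleftrightarrow> finite I \<and> multiaffine I H \<and> (\<forall>y y'. (\<forall>i\<in>I. y i = y' i) \<longrightarrow> H y = H y')"

lemma regular_cong: "regular I H \<Longrightarrow> \<forall>i\<in>I. y i = y' i \<Longrightarrow> H y = H y'"
  by (simp add: regular_def)

lemma regular_re_val: assumes "stable I G" shows "regular I (re_val G)"
  unfolding regular_def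
proof (intro conjI allI impI)
  show "finite I" "multiaffine I (re_val G)" using stable_finite[OF assms] re_val_multiaffine[OF assms] by auto
  fix y y' :: "'a \<Rightarrow> real" assume "\<forall>i\<in>I. y i = y' i"
  then show "re_val G y = re_val G y'" by (intro re_val_cong[OF assms]) auto
qed

lemma regular_pdiff:
  assumes H: "regular I H" and j: "j \<in> I" shows "regular I (pdiff j H)"
  unfolding regular_def
proof (intro conjI allI impI)
  show "finite I" "multiaffine I (pdiff j H)" using H j multiaffine_pdiff[of I H j] by (auto simp: regular_def)
  fix y y' :: "'a \<Rightarrow> real" assume e: "\<forall>i\<in>I. y i = y' i"
  have "H (shift_at j 1 y) = H (shift_at j 1 y')" "H y = H y'"
    using e by (auto intro!: regular_cong[OF H] simp: shift_at_def)
  then show "pdiff j H y = pdiff j H y'" by (simp add: pdiff_def)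
qed

lemma regular_deriv:
  assumes H: "regular I H"
  shows "((\<lambda>s. H (vadd y s u)) has_real_derivative (\<Sum>i\<in>I. u i * pdiff i H (vadd y s u))) (at s)"
proof -
  let ?y = "vadd y s u"
  have "((\<lambda>t. H (\<lambda>i. if i \<in> I then ?y i + t * u i else ?y i)) has_real_derivative
      (\<Sum>i\<in>I. u i * pdiff i H ?y)) (at 0)"
    using H by (intro multiaffine_directional_derivative[of I I]) (auto simp: regular_def)
  also have "(\<lambda>t. H (\<lambda>i. if i \<in> I then ?y i + t * u i else ?y i)) = (\<lambda>t. H (vadd y (t + s) u))"
    by (intro ext regular_cong[OF H]) (auto simp: vadd_def algebra_simps)
  finally have "((\<lambda>t. H (vadd y (t + s) u)) has_real_derivative (\<Sum>i\<in>I. u i * pdiff i H ?y)) (at 0)" .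
  then show ?thesis using DERIV_shift[of "\<lambda>t. H (vadd y t u)" _ 0 s] by simp
qed

lemma regular_tendsto:
  assumes "regular I H"
  shows "((\<lambda>s. H (vadd y s u)) \<longlongrightarrow> H y) (at_right 0)"
proof -
  have "isCont (\<lambda>s. H (vadd y s u)) 0"
    using regular_deriv[OF assms] by (rule DERIV_isCont)
  then have "((\<lambda>s. H (vadd y s u)) \<longlongrightarrow> H (vadd y 0 u)) (at 0)" by (simp only: isCont_def)
  then show ?thesis by (simp add: filterlim_at_split)
qed

text \<open>The point \<open>y\<close> lies in the component of the nonvanishing set that is closed under adding
  nonnegative vectors. Only \<open>\<ge> 0\<close> is demanded at the other points, which makes the condition easy to
  establish; strict positivity there follows from stability (see \<open>above_roots_mono\<close>).\<close>

definition above_roots :: "'i set \<Rightarrow> (('i \<Rightarrow> complex) \<Rightarrow> complex) \<Rightarrow> ('i \<Rightarrow> real) \<Rightarrow> bool" where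
  "above_roots I G y \<longleftrightarrow> re_val G y > 0 \<and> (\<forall>u. (\<forall>i\<in>I. u i \<ge> 0) \<longrightarrow> re_val G (vadd y 1 u) \<ge> 0)"

lemma above_roots_pos: "above_roots I G y \<Longrightarrow> re_val G y > 0"
  by (simp add: above_roots_def)

lemma above_roots_cong:
  assumes G: "stable I G" and e: "\<forall>i\<in>I. y i = y' i" and "above_roots I G y" shows "above_roots I G y'"
proof -
  have "re_val G y = re_val G y'" "re_val G (vadd y 1 u) = re_val G (vadd y' 1 u)" for u
    using e by (auto intro!: regular_cong[OF regular_re_val[OF G]] simp: vadd_def)
  then show ?thesis using assms(3) unfolding above_roots_def by metis
qed

lemma above_roots_pdiff_nonneg:
  assumes G: "stable I G" and y: "above_roots I G y" and j: "j \<in> I"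
  shows "pdiff j (re_val G) y \<ge> 0"
proof (rule ccontr)
  assume neg: "\<not> pdiff j (re_val G) y \<ge> 0"
  \<comment> \<open>This increment brings the affine function of coordinate j to exactly -1.\<close>
  define v where "v = - (re_val G y + 1) / pdiff j (re_val G) y"
  have v: "v \<ge> 0" using neg above_roots_pos[OF y] by (simp add: v_def divide_nonpos_neg)
  have "re_val G (vadd y 1 (\<lambda>i. if i = j then v else 0)) \<ge> 0"
    using y v unfolding above_roots_def by simp
  also have "vadd y 1 (\<lambda>i. if i = j then v else 0) = shift_at j v y"
    by (auto simp: vadd_def shift_at_def)
  also have "re_val G (shift_at j v y) = re_val G y + v * pdiff j (re_val G) y"
    by (rule multiaffineD[OF re_val_multiaffine[OF G] j])
  also have "\<dots> = -1" using neg by (simp add: v_def)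
  finally show False by simp
qed

lemma above_roots_shift_at:
  assumes G: "stable I G" and y: "above_roots I G y" and j: "j \<in> I" and v: "v \<ge> 0"
  shows "above_roots I G (shift_at j v y)"
  unfolding above_roots_def
proof (intro conjI allI impI)
  have "re_val G (shift_at j v y) = re_val G y + v * pdiff j (re_val G) y" by (rule multiaffineD[OF re_val_multiaffine[OF G] j])
  then show "re_val G (shift_at j v y) > 0"
    using above_roots_pos[OF y] above_roots_pdiff_nonneg[OF G y j] v by (simp add: add_pos_nonneg)
  fix u :: "'a \<Rightarrow> real" assume u: "\<forall>i\<in>I. 0 \<le> u i"
  have "vadd (shift_at j v y) 1 u = vadd y 1 (shift_at j v u)" by (auto simp: vadd_def shift_at_def)
  moreover have "\<forall>i\<in>I. 0 \<le> shift_at j v u i" using u v by (auto simp: shift_at_def)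
  ultimately show "0 \<le> re_val G (vadd (shift_at j v y) 1 u)" using y unfolding above_roots_def by metis
qed

lemma coordinatewise_induct:
  assumes "finite I" and cong: "\<And>y y'. \<forall>i\<in>I. y i = y' i \<Longrightarrow> P y \<Longrightarrow> P y'"
    and step: "\<And>y j v. P y \<Longrightarrow> j \<in> I \<Longrightarrow> v \<ge> (0::real) \<Longrightarrow> P (shift_at j v y)"
    and "P y" and u: "\<forall>i\<in>I. u i \<ge> 0"
  shows "P (vadd y 1 u)"
proof -
  have "P (\<lambda>i. if i \<in> J then y i + u i else y i)" if "finite J" "J \<subseteq> I" for J
    using that
  proof (induction J rule: finite_induct)
    case empty
    then show ?case using \<open>P y\<close> by simp
  next
    case (insert j J)
    have "(\<lambda>i. if i \<in> insert j J then y i + u i else y i) = shift_at j (u j) (\<lambda>i. if i \<in> J then y i + u i else y i)"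
      using insert.hyps by (auto simp: shift_at_def)
    then show ?case using step[of "\<lambda>i. if i \<in> J then y i + u i else y i" j "u j"] insert u by auto
  qed
  from this[OF assms(1) order_refl] show ?thesis
    by (rule cong[rotated]) (simp add: vadd_def)
qed

lemma above_roots_vadd:
  assumes G: "stable I G" and y: "above_roots I G y" and u: "\<forall>i\<in>I. u i \<ge> 0" and s: "s \<ge> 0"
  shows "above_roots I G (vadd y s u)"
proof -
  have "above_roots I G (vadd y 1 (\<lambda>i. s * u i))"
  proof (rule coordinatewise_induct[OF stable_finite[OF G], of "above_roots I G"])
    show "\<And>y y'. \<forall>i\<in>I. y i = y' i \<Longrightarrow> above_roots I G y \<Longrightarrow> above_roots I G y'" by (rule above_roots_cong[OF G])
    show "\<And>y j v. above_roots I G y \<Longrightarrow> j \<in> I \<Longrightarrow> 0 \<le> v \<Longrightarrow> above_roots I G (shift_at j v y)" by (rule above_roots_shift_at[OF G])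
  qed (use y u s in auto)
  then show ?thesis by (simp add: vadd_def)
qed

lemma above_roots_mono:
  assumes "stable I G" "above_roots I G y" "\<forall>i\<in>I. y i \<le> y' i" shows "above_roots I G y'"
proof -
  have "above_roots I G (vadd y 1 (\<lambda>i. y' i - y i))" using assms by (intro above_roots_vadd) auto
  then show ?thesis by (simp add: vadd_def)
qed

lemma vadd_complex: "(\<lambda>i. complex_of_real (vadd y s u i)) = (\<lambda>i. of_real (y i) + of_real s * of_real (u i))"
  by (simp add: vadd_def)

text \<open>A positive direction maps the upper half plane into the region where G does not vanish,
  and conjugation handles the lower half plane. The positive top coefficient fixes the
  degree.\<close>

lemma stable_line_real:
  assumes G: "stable I G" and u: "\<forall>i\<in>I. u i > 0"
  obtains g where "degree g = card I" "coeff g (card I) = (\<Prod>i\<in>I. u i)" "(\<Prod>i\<in>I. u i) > 0" "real_rooted g" "g \<noteq> 0"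
    "\<And>s. poly (cpoly g) s = G (\<lambda>i. of_real (y i) + s * of_real (u i))"
    "\<And>s. poly g s = re_val G (vadd y s u)"
proof -
  obtain g where g: "degree g \<le> card I" "coeff g (card I) = (\<Prod>i\<in>I. u i)"
    "\<And>s. poly (cpoly g) s = G (\<lambda>i. of_real (y i) + s * of_real (u i))"
    by (rule stable_line[OF G, of u y]) blast
  have pos: "(\<Prod>i\<in>I. u i) > 0" using u by (intro prod_pos) auto
  then have g0: "g \<noteq> 0" using g(2) by auto
  have deg: "degree g = card I" using g(1,2) pos by (metis le_antisym le_degree less_numeral_extra(3))
  have rvg: "poly g s = re_val G (vadd y s u)" for s
    using g(3)[of "of_real s"] unfolding poly_cpoly_of_real re_val_def vadd_complex by (metis Re_complex_of_real)
  have up: "poly (cpoly g) s \<noteq> 0" if "Im s > 0" for s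
    unfolding g(3) using that u by (intro stable_nonzero[OF G]) auto
  have "real_rooted g" unfolding real_rooted_def
  proof (intro allI impI)
    fix z assume z: "poly (cpoly g) z = 0"
    have "poly (cpoly g) (cnj z) = cnj (poly (cpoly g) z)"
      by (induction g) (auto simp: map_poly_pCons)
    then have "poly (cpoly g) (cnj z) = 0" using z by simp
    then show "Im z = 0" using up[of z] up[of "cnj z"] z by (cases "Im z" "0::real" rule: linorder_cases) auto
  qed
  then show thesis using that deg g pos g0 rvg by blast
qed

text \<open>The logarithmic derivative in coordinate j, along a line in a positive direction, is a
  quotient with nonpositive imaginary part on the upper half plane, so partial fractions apply. The
  poles are roots on the line, hence behind y. Monotonicity and convexity of the barrier are read
  off from this form.\<close>

lemma barrier_representation:
  assumes G: "stable I G" and y: "above_roots I G y" and u: "\<forall>i\<in>I. u i > 0" and j: "j \<in> I"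
  obtains Z c where "finite Z" "\<And>z. z \<in> Z \<Longrightarrow> z < 0 \<and> c z \<ge> 0 \<and> re_val G (vadd y z u) = 0"
    "\<And>s. re_val G (vadd y s u) \<noteq> 0 \<Longrightarrow>
       pdiff j (re_val G) (vadd y s u) / re_val G (vadd y s u) = (\<Sum>z\<in>Z. c z / (s - z))"
proof -
  obtain g where g: "degree g = card I" "coeff g (card I) = (\<Prod>i\<in>I. u i)" "real_rooted g" "g \<noteq> 0"
    "\<And>s. poly (cpoly g) s = G (\<lambda>i. of_real (y i) + s * of_real (u i))"
    "\<And>s. poly g s = re_val G (vadd y s u)"
    by (rule stable_line_real[OF G u, of y]) blast
  obtain g1 where g1: "degree g1 = card I" "coeff g1 (card I) = (\<Prod>i\<in>I. u i)"
    "\<And>s. poly (cpoly g1) s = G (\<lambda>i. of_real (shift_at j 1 y i) + s * of_real (u i))"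
    "\<And>s. poly g1 s = re_val G (vadd (shift_at j 1 y) s u)"
    by (rule stable_line_real[OF G u, of "shift_at j 1 y"]) blast
  \<comment> \<open>Both restrictions have the same top coefficient, so the degree drops as the
    partial fraction lemma requires.\<close>
  define h where "h = g1 - g"
  have "degree h \<le> card I" unfolding h_def using g(1) g1(1) by (intro degree_diff_le) auto
  moreover have "coeff h (card I) = 0" by (simp add: h_def g(2) g1(2))
  ultimately have dh: "degree h < degree g \<or> h = 0"
    unfolding g(1) using leading_coeff_0_iff[of h] by (metis le_neq_implies_less)
  have hr: "poly h s = pdiff j (re_val G) (vadd y s u)" for s
    by (simp add: h_def g(6) g1(4) pdiff_def vadd_shift_at)
  have hc: "poly (cpoly h) s = pdiff j G (\<lambda>i. of_real (y i) + s * of_real (u i))" for s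
  proof -
    have "cpoly h = cpoly g1 - cpoly g" by (intro poly_eqI) (simp add: h_def coeff_map_poly)
    moreover have "(\<lambda>i. of_real (shift_at j 1 y i) + s * of_real (u i)) =
        shift_at j 1 (\<lambda>i. of_real (y i) + s * of_real (u i))" by (auto simp: shift_at_def)
    ultimately show ?thesis by (simp add: g(5) g1(3) pdiff_def)
  qed
  have "Im (poly (cpoly h) s / poly (cpoly g) s) \<le> 0" if "Im s > 0" for s
    unfolding hc g(5) using stable_pdiff_Im[OF G j, of "\<lambda>i. of_real (y i) + s * of_real (u i)"] u that
    by (auto simp: less_imp_le)
  then obtain Z c where Z: "finite Z" "\<forall>z\<in>Z. poly g z = 0 \<and> c z \<ge> 0"
    "\<forall>s. poly g s \<noteq> 0 \<longrightarrow> poly h s / poly g s = (\<Sum>z\<in>Z. c z / (s - z))"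
    using partial_fractions_nonneg[OF g(3,4) dh] by blast
  have "z < 0" if "z \<in> Z" for z
  proof (rule ccontr)
    assume "\<not> z < 0"
    then have "above_roots I G (vadd y z u)" using u by (intro above_roots_vadd[OF G y]) (auto simp: less_imp_le)
    then show False using Z(2) that g(6)[of z] above_roots_pos by fastforce
  qed
  then show thesis using that[OF Z(1), of c] Z g(6) hr by auto
qed

text \<open>Positivity on a segment behind y does not by itself give positivity on the whole cone
  above its endpoint. The joint property \<open>?P\<close> is inherited when one coordinate grows:
  all poles of the barrier lie before the segment, so the partial derivative is nonnegative on
  it.\<close>

lemma above_roots_vadd_minus:
  assumes G: "stable I G" and y: "above_roots I G y" and u: "\<forall>i\<in>I. u i > 0"
    and pos: "\<And>s. 0 \<le> s \<Longrightarrow> s \<le> \<delta> \<Longrightarrow> re_val G (vadd y (- s) u) > 0" and \<delta>: "\<delta> \<ge> 0"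
  shows "above_roots I G (vadd y (- \<delta>) u)"
proof -
  let ?P = "\<lambda>y. above_roots I G y \<and> (\<forall>s. 0 \<le> s \<longrightarrow> s \<le> \<delta> \<longrightarrow> re_val G (vadd y (- s) u) > 0)"
  have step: "?P (shift_at j v y)" if P: "?P y" and j: "j \<in> I" and v: "v \<ge> 0" for y j v
  proof (intro conjI allI impI)
    show "above_roots I G (shift_at j v y)" using above_roots_shift_at[OF G _ j v] P by blast
    fix s assume s: "0 \<le> s" "s \<le> \<delta>"
    obtain Z c where Z: "finite Z" "\<And>z. z \<in> Z \<Longrightarrow> z < 0 \<and> c z \<ge> 0 \<and> re_val G (vadd y z u) = 0"
      "\<And>s. re_val G (vadd y s u) \<noteq> 0 \<Longrightarrow>
         pdiff j (re_val G) (vadd y s u) / re_val G (vadd y s u) = (\<Sum>z\<in>Z. c z / (s - z))"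
      using barrier_representation[OF G _ u j] P by blast
    have "- s - z > 0" if "z \<in> Z" for z
    proof (rule ccontr)
      assume "\<not> - s - z > 0"
      then have "0 \<le> - z" "- z \<le> \<delta>" using Z(2)[OF that] s by auto
      then have "re_val G (vadd y (- (- z)) u) > 0" using P by blast
      then show False using Z(2)[OF that] by simp
    qed
    then have "(\<Sum>z\<in>Z. c z / (- s - z)) \<ge> 0"
      using Z(2) by (intro sum_nonneg divide_nonneg_pos) auto
    moreover have p: "re_val G (vadd y (- s) u) > 0" using P s by blast
    ultimately have "pdiff j (re_val G) (vadd y (- s) u) / re_val G (vadd y (- s) u) \<ge> 0" using Z(3)[of "- s"] by simp
    then have "pdiff j (re_val G) (vadd y (- s) u) \<ge> 0" using p by (simp add: zero_le_divide_iff)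
    then show "re_val G (vadd (shift_at j v y) (- s) u) > 0"
      unfolding vadd_shift_at multiaffineD[OF re_val_multiaffine[OF G] j] using p v by (simp add: add_pos_nonneg)
  qed
  have cong: "?P y'" if e: "\<forall>i\<in>I. y i = y' i" and P: "?P y" for y y'
  proof -
    have "re_val G (vadd y s u) = re_val G (vadd y' s u)" for s
      using e by (intro regular_cong[OF regular_re_val[OF G]]) (auto simp: vadd_def)
    then show ?thesis using P above_roots_cong[OF G e] by simp
  qed
  have P: "?P (vadd y 1 w)" if "\<forall>i\<in>I. w i \<ge> 0" for w
    by (rule coordinatewise_induct[OF stable_finite[OF G], of ?P, OF cong step]) (use y pos that in auto)
  show ?thesis unfolding above_roots_def
  proof (intro conjI allI impI)
    show "re_val G (vadd y (- \<delta>) u) > 0" using pos[OF \<delta>] by simp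
    fix w :: "'a \<Rightarrow> real" assume w: "\<forall>i\<in>I. 0 \<le> w i"
    have "vadd (vadd y (- \<delta>) u) 1 w = vadd (vadd y 1 w) (- \<delta>) u" by (auto simp: vadd_def)
    then show "re_val G (vadd (vadd y (- \<delta>) u) 1 w) \<ge> 0"
      using P[OF w] \<delta> by (auto intro: less_imp_le)
  qed
qed

section \<open>The barrier function\<close>

text \<open>The logarithmic partial derivative. For \<open>diag_det N M\<close> it is the j-th
  diagonal entry of the inverse of diag y + M.\<close>

definition barrier :: "(('i \<Rightarrow> complex) \<Rightarrow> complex) \<Rightarrow> 'i \<Rightarrow> ('i \<Rightarrow> real) \<Rightarrow> real" where
  "barrier G j y = pdiff j (re_val G) y / re_val G y"

text \<open>The quotient rule for \<open>barrier\<close> in direction u, written out so that limits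
  in u and y can be taken term by term.\<close>

definition barrier_deriv :: "'i set \<Rightarrow> (('i \<Rightarrow> complex) \<Rightarrow> complex) \<Rightarrow> ('i \<Rightarrow> real) \<Rightarrow> 'i \<Rightarrow> ('i \<Rightarrow> real) \<Rightarrow> real" where
  "barrier_deriv I G u j y = (\<Sum>i\<in>I. u i * pdiff i (pdiff j (re_val G)) y) / re_val G y
     - pdiff j (re_val G) y * (\<Sum>i\<in>I. u i * pdiff i (re_val G) y) / (re_val G y)\<^sup>2"

lemma barrier_nonneg: "stable I G \<Longrightarrow> above_roots I G y \<Longrightarrow> j \<in> I \<Longrightarrow> barrier G j y \<ge> 0"
  unfolding barrier_def using above_roots_pdiff_nonneg above_roots_pos by (metis divide_nonneg_pos)

lemma barrier_has_derivative:
  assumes G: "stable I G" and j: "j \<in> I" and p: "re_val G (vadd y s u) \<noteq> 0"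
  shows "((\<lambda>s. barrier G j (vadd y s u)) has_real_derivative barrier_deriv I G u j (vadd y s u)) (at s)"
  unfolding barrier_def barrier_deriv_def
  by (rule derivative_eq_intros regular_deriv[OF regular_pdiff[OF regular_re_val[OF G] j]]
      regular_deriv[OF regular_re_val[OF G]] p refl)+
     (use p in \<open>simp add: field_simps power2_eq_square\<close>)

text \<open>Along a positive direction the barrier is a sum of terms c / (s - z) with c nonnegative
  and z negative. Each is convex and decreasing for nonnegative s, so it lies above its
  tangents.\<close>

lemma barrier_tangent_strict:
  assumes G: "stable I G" and y: "above_roots I G y" and u: "\<forall>i\<in>I. u i > 0" and j: "j \<in> I"
    and s: "s0 \<ge> 0" "s1 \<ge> 0"
  shows "barrier G j (vadd y s1 u) \<ge> barrier G j (vadd y s0 u) + (s1 - s0) * barrier_deriv I G u j (vadd y s0 u)"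
    and "barrier_deriv I G u j (vadd y s0 u) \<le> 0"
proof -
  obtain Z c where Z: "finite Z" "\<And>z. z \<in> Z \<Longrightarrow> z < 0 \<and> c z \<ge> 0 \<and> re_val G (vadd y z u) = 0"
    "\<And>s. re_val G (vadd y s u) \<noteq> 0 \<Longrightarrow> barrier G j (vadd y s u) = (\<Sum>z\<in>Z. c z / (s - z))"
    unfolding barrier_def by (rule barrier_representation[OF G y u j]) blast
  have ne: "re_val G (vadd y s u) \<noteq> 0" if "s \<ge> 0" for s
    using above_roots_pos[OF above_roots_vadd[OF G y, of u s]] u that by (force simp: less_imp_le)
  have d1: "((\<lambda>s. barrier G j (vadd y s u)) has_real_derivative barrier_deriv I G u j (vadd y s0 u)) (at s0)"
    using s ne by (intro barrier_has_derivative[OF G j]) auto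
  have d2: "((\<lambda>s. \<Sum>z\<in>Z. c z / (s - z)) has_real_derivative (\<Sum>z\<in>Z. - c z / (s0 - z)\<^sup>2)) (at s0)"
  proof (intro DERIV_sum)
    fix z assume "z \<in> Z"
    then have "s0 - z \<noteq> 0" using Z(2)[of z] s by auto
    then show "((\<lambda>s. c z / (s - z)) has_real_derivative (- c z / (s0 - z)\<^sup>2)) (at s0)"
      by (auto intro!: derivative_eq_intros simp: power2_eq_square)
  qed
  have "isCont (\<lambda>s. re_val G (vadd y s u)) s0"
    using regular_deriv[OF regular_re_val[OF G]] by (rule DERIV_isCont)
  then have "eventually (\<lambda>s. re_val G (vadd y s u) \<noteq> 0) (nhds s0)"
    using ne[OF s(1)] tendsto_imp_eventually_ne[of _ _ "at s0"]
    by (auto simp: isCont_def eventually_nhds_conv_at)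
  then have ev: "eventually (\<lambda>s. barrier G j (vadd y s u) = (\<Sum>z\<in>Z. c z / (s - z))) (nhds s0)"
    by eventually_elim (rule Z(3))
  have D: "barrier_deriv I G u j (vadd y s0 u) = (\<Sum>z\<in>Z. - c z / (s0 - z)\<^sup>2)"
    by (rule DERIV_unique[OF d1 DERIV_cong_ev[OF refl ev refl, THEN iffD2, OF d2]])
  show "barrier_deriv I G u j (vadd y s0 u) \<le> 0"
    unfolding D using Z(2) by (intro sum_nonpos) (auto simp: divide_nonpos_nonneg)
  have "(\<Sum>z\<in>Z. c z / (s0 - z) + (s1 - s0) * (- c z / (s0 - z)\<^sup>2)) \<le> (\<Sum>z\<in>Z. c z / (s1 - z))"
  proof (rule sum_mono)
    fix z assume z: "z \<in> Z"
    define a where "a = s0 - z"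
    define b where "b = s1 - z"
    have a: "a > 0" and b: "b > 0" and c: "c z \<ge> 0" using Z(2)[OF z] s by (auto simp: a_def b_def)
    have "1 / b - (1 / a - (b - a) / a\<^sup>2) = (b - a)\<^sup>2 / (a\<^sup>2 * b)"
      using a b by (simp add: field_simps power2_eq_square)
    also have "\<dots> \<ge> 0" using a b by simp
    finally have "c z * (1 / a - (b - a) / a\<^sup>2) \<le> c z * (1 / b)" using c by (intro mult_left_mono) auto
    then show "c z / (s0 - z) + (s1 - s0) * (- c z / (s0 - z)\<^sup>2) \<le> c z / (s1 - z)"
      by (simp add: a_def b_def algebra_simps)
  qed
  then show "barrier G j (vadd y s1 u) \<ge> barrier G j (vadd y s0 u) + (s1 - s0) * barrier_deriv I G u j (vadd y s0 u)"
    unfolding D Z(3)[OF ne[OF s(1)]] Z(3)[OF ne[OF s(2)]] by (simp only: sum.distrib sum_distrib_left)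
qed

lemma barrier_tendsto:
  assumes G: "stable I G" and y: "above_roots I G y" and j: "j \<in> I"
  shows "((\<lambda>\<epsilon>. barrier G j (vadd y \<epsilon> w)) \<longlongrightarrow> barrier G j y) (at_right 0)"
  unfolding barrier_def using above_roots_pos[OF y]
  by (intro tendsto_divide regular_tendsto[OF regular_pdiff[OF regular_re_val[OF G] j]]
      regular_tendsto[OF regular_re_val[OF G]]) auto

lemma barrier_deriv_tendsto:
  assumes G: "stable I G" and y: "above_roots I G y" and j: "j \<in> I"
  shows "((\<lambda>\<epsilon>. barrier_deriv I G (\<lambda>i. u i + \<epsilon>) j (vadd y \<epsilon> w)) \<longlongrightarrow> barrier_deriv I G u j y) (at_right 0)"
proof -
  note r = regular_re_val[OF G]
  have "((\<lambda>\<epsilon>. barrier_deriv I G (\<lambda>i. u i + \<epsilon>) j (vadd y \<epsilon> w)) \<longlongrightarrow>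
      (\<Sum>i\<in>I. (u i + 0) * pdiff i (pdiff j (re_val G)) y) / re_val G y
      - pdiff j (re_val G) y * (\<Sum>i\<in>I. (u i + 0) * pdiff i (re_val G) y) / (re_val G y)\<^sup>2) (at_right 0)"
    unfolding barrier_deriv_def using above_roots_pos[OF y]
    by (intro tendsto_intros regular_tendsto[OF r] regular_tendsto[OF regular_pdiff[OF r]]
        regular_tendsto[OF regular_pdiff[OF regular_pdiff[OF r]]] j) auto
  then show ?thesis by (simp add: barrier_deriv_def)
qed

text \<open>Indicators of blocks have zero entries, where the line polynomial would lose its full
  degree. The direction is perturbed to u + \<epsilon> and the inequalities pass to the
  limit.\<close>

lemma barrier_tangent:
  assumes G: "stable I G" and y: "above_roots I G y" and u: "\<forall>i\<in>I. u i \<ge> 0" and j: "j \<in> I"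
    and s: "s0 \<ge> 0" "s1 \<ge> 0"
  shows "barrier G j (vadd y s1 u) \<ge> barrier G j (vadd y s0 u) + (s1 - s0) * barrier_deriv I G u j (vadd y s0 u)"
    and "barrier_deriv I G u j (vadd y s0 u) \<le> 0"
proof -
  let ?u = "\<lambda>\<epsilon> i. u i + \<epsilon>"
  \<comment> \<open>At time s the perturbation is a displacement by \<epsilon> in the constant
    direction s, the form used in the limit lemmas.\<close>
  have v: "vadd y s (?u \<epsilon>) = vadd (vadd y s u) \<epsilon> (\<lambda>_. s)" for s \<epsilon>
    by (auto simp: vadd_def algebra_simps)
  have a: "above_roots I G (vadd y s u)" if "s \<ge> 0" for s using above_roots_vadd[OF G y u that] .
  have ev: "eventually (\<lambda>\<epsilon>. \<epsilon> > (0::real)) (at_right 0)" by (rule eventually_at_right_less)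
  have t1: "((\<lambda>\<epsilon>. barrier_deriv I G (?u \<epsilon>) j (vadd y s0 (?u \<epsilon>))) \<longlongrightarrow> barrier_deriv I G u j (vadd y s0 u)) (at_right 0)"
    unfolding v by (rule barrier_deriv_tendsto[OF G a[OF s(1)] j])
  have t2: "((\<lambda>\<epsilon>. barrier G j (vadd y s (?u \<epsilon>))) \<longlongrightarrow> barrier G j (vadd y s u)) (at_right 0)" if "s \<ge> 0" for s
    unfolding v by (rule barrier_tendsto[OF G a[OF that] j])
  show "barrier_deriv I G u j (vadd y s0 u) \<le> 0"
  proof (rule tendsto_upperbound[OF t1])
    show "eventually (\<lambda>\<epsilon>. barrier_deriv I G (?u \<epsilon>) j (vadd y s0 (?u \<epsilon>)) \<le> 0) (at_right 0)"
      using ev by eventually_elim (use u in \<open>auto intro!: barrier_tangent_strict(2)[OF G y _ j s] add_nonneg_pos\<close>)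
  qed simp
  show "barrier G j (vadd y s1 u) \<ge> barrier G j (vadd y s0 u) + (s1 - s0) * barrier_deriv I G u j (vadd y s0 u)"
  proof (rule tendsto_le[OF _ t2[OF s(2)] tendsto_add[OF t2[OF s(1)] tendsto_mult[OF tendsto_const t1]]])
    show "eventually (\<lambda>\<epsilon>. barrier G j (vadd y s0 (?u \<epsilon>)) + (s1 - s0) * barrier_deriv I G (?u \<epsilon>) j (vadd y s0 (?u \<epsilon>))
       \<le> barrier G j (vadd y s1 (?u \<epsilon>))) (at_right 0)"
      using ev by eventually_elim (use u in \<open>auto intro!: barrier_tangent_strict(1)[OF G y _ j s] add_nonneg_pos\<close>)
  qed simp
qed

lemma barrier_antimono:
  assumes G: "stable I G" and y: "above_roots I G y" and le: "\<forall>i\<in>I. y i \<le> y' i" and j: "j \<in> I"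
  shows "barrier G j y' \<le> barrier G j y"
proof -
  let ?u = "\<lambda>i. y' i - y i"
  have v: "vadd y 1 ?u = y'" by (simp add: vadd_def)
  have "barrier G j (vadd y 0 ?u) \<ge> barrier G j (vadd y 1 ?u) + (0 - 1) * barrier_deriv I G ?u j (vadd y 1 ?u)"
    using le by (intro barrier_tangent(1)[OF G y _ j]) auto
  moreover have "barrier_deriv I G ?u j (vadd y 1 ?u) \<le> 0"
    using le by (intro barrier_tangent(2)[OF G y _ j, of _ 1 1]) auto
  ultimately show ?thesis unfolding v by simp
qed

text \<open>Moving the weights continuously from the average to a single translate that is positive at \<open>y\<close>, the
  coefficients of the line restrictions cannot lose positivity, because real-rootedness is preserved.\<close>

lemma above_roots_avg_imp:
  assumes G: "stable I G" and b: "b \<subseteq> I" "b \<noteq> {}" and w: "\<And>i. i \<in> b \<Longrightarrow> w i \<ge> 0" "sum w b = 1"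
    and y: "above_roots I (avg w b \<beta> G) y"
  shows "\<exists>i\<in>b. above_roots I G (shift_at i \<beta> y)"
proof -
  have fb: "finite b" using b(1) stable_finite[OF G] finite_subset by blast
  have Ga: "stable I (avg w b \<beta> G)" by (rule stable_avg[OF G b(1) w])
  have "(\<Sum>i\<in>b. w i * re_val G (shift_at i \<beta> y)) > 0" using above_roots_pos[OF y] by (simp add: re_val_avg)
  then obtain i where i: "i \<in> b" "w i * re_val G (shift_at i \<beta> y) > 0"
    by (metis (no_types, lifting) linorder_not_less sum_nonpos)
  then have Gi: "re_val G (shift_at i \<beta> y) > 0" using w(1)[OF i(1)] by (simp add: zero_less_mult_iff)
  define ws where "ws s k = (1 - s) * w k + s * (if k = i then 1 else 0)" for s :: real and k
  have ws: "stable I (avg (ws s) b \<beta> G)" if "s \<in> {0..1}" for s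
  proof (rule stable_avg[OF G b(1)])
    show "ws s k \<ge> 0" if "k \<in> b" for k using that w(1) \<open>s \<in> {0..1}\<close> by (simp add: ws_def)
    have "(\<Sum>k\<in>b. if k = i then 1 else 0::real) = 1" using fb i(1) by simp
    then show "sum (ws s) b = 1"
      by (simp add: ws_def[abs_def] sum.distrib w(2) flip: sum_distrib_left)
  qed
  have rws: "re_val (avg (ws s) b \<beta> G) z = (1 - s) * re_val (avg w b \<beta> G) z + s * re_val G (shift_at i \<beta> z)" for s z
  proof -
    have "(\<Sum>k\<in>b. ws s k * re_val G (shift_at k \<beta> z)) =
        (\<Sum>k\<in>b. (1 - s) * (w k * re_val G (shift_at k \<beta> z)) + s * (if k = i then re_val G (shift_at i \<beta> z) else 0))"
      by (intro sum.cong) (auto simp: ws_def algebra_simps)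
    also have "\<dots> = (1 - s) * (\<Sum>k\<in>b. w k * re_val G (shift_at k \<beta> z)) + s * (\<Sum>k\<in>b. if k = i then re_val G (shift_at i \<beta> z) else 0)"
      by (simp only: sum.distrib sum_distrib_left)
    also have "(\<Sum>k\<in>b. if k = i then re_val G (shift_at i \<beta> z) else 0) = re_val G (shift_at i \<beta> z)"
      using fb i(1) by simp
    finally show ?thesis by (simp add: re_val_avg)
  qed
  \<comment> \<open>Strictly positive directions come first, since only they give line polynomials
    of full degree; the boundary of the cone follows by a limit.\<close>
  have pos: "re_val G (vadd (shift_at i \<beta> y) 1 u) \<ge> 0" if u: "\<forall>k\<in>I. u k > 0" for u
  proof -
    define d where "d = card I"
    obtain g0 where g0: "degree g0 = d" "coeff g0 d = (\<Prod>i\<in>I. u i)" "(\<Prod>i\<in>I. u i) > 0"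
      "real_rooted g0" "g0 \<noteq> 0"
      "\<And>s. poly (cpoly g0) s = avg w b \<beta> G (\<lambda>i. of_real (y i) + s * of_real (u i))"
      "\<And>s. poly g0 s = re_val (avg w b \<beta> G) (vadd y s u)"
      unfolding d_def by (rule stable_line_real[OF Ga u, of y]) blast
    obtain g1 where g1: "degree g1 = d" "coeff g1 d = (\<Prod>i\<in>I. u i)"
      "\<And>s. poly g1 s = re_val G (vadd (shift_at i \<beta> y) s u)"
      unfolding d_def by (rule stable_line_real[OF G u, of "shift_at i \<beta> y"]) blast
    define e where "e k s = (1 - s) * coeff g0 k + s * coeff g1 k" for k and s :: real
    \<comment> \<open>The linear interpolation of coefficients is itself the line restriction of an
      average, with weights \<open>ws s\<close>, and so stays real-rooted.\<close>
    have gs: "(\<Sum>k\<le>d. monom (e k s) k) = Polynomial.smult (1 - s) g0 + Polynomial.smult s g1" for s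
      by (intro poly_eqI) (auto simp: e_def coeff_sum g0(1) g1(1) coeff_eq_0)
    have init: "pos_coeffs g0"
    proof (rule real_rooted_pos_coeffs[OF g0(4)])
      show "lead_coeff g0 > 0" using g0 by simp
      fix x :: real assume "x \<ge> 0"
      then have "above_roots I (avg w b \<beta> G) (vadd y x u)"
        using u by (intro above_roots_vadd[OF stable_avg[OF G b(1) w] y]) (auto simp: less_imp_le)
      then show "poly g0 x \<noteq> 0" using above_roots_pos g0(7)[of x] by fastforce
    qed
    have pos: "e k 1 > 0" if "k \<le> d" for k
    proof (rule pos_coeffs_continuation[of d e k])
      show "continuous_on {0..1} (e k)" for k unfolding e_def by (intro continuous_intros)
      fix s :: real assume s: "s \<in> {0..1}"
      obtain gs' where gs': "degree gs' = d" "real_rooted gs'"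
        "\<And>x. poly gs' x = re_val (avg (ws s) b \<beta> G) (vadd y x u)"
        unfolding d_def by (rule stable_line_real[OF ws[OF s] u, of y]) blast
      have "poly gs' x = poly (Polynomial.smult (1 - s) g0 + Polynomial.smult s g1) x" for x
        by (simp add: gs'(3) rws g0(7) g1(3) vadd_shift_at)
      then have "poly gs' = poly (Polynomial.smult (1 - s) g0 + Polynomial.smult s g1)" by (rule ext)
      then have "gs' = Polynomial.smult (1 - s) g0 + Polynomial.smult s g1" by (rule poly_eq_poly_eq_iff[THEN iffD1])
      then show "real_rooted (\<Sum>k\<le>d. monom (e k s) k)" using gs' gs by simp
      show "e d s > 0" using g0 g1 by (simp add: e_def algebra_simps)
      have "coeff g0 0 > 0" using init by (simp add: pos_coeffs_def)
      moreover have "coeff g1 0 > 0" using Gi g1(3)[of 0] by (simp add: poly_0_coeff_0)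
      ultimately show "e 0 s > 0" using s unfolding e_def
        by (cases "s = 0") (auto intro!: add_nonneg_pos)
    next
      fix k assume "k \<le> d"
      then show "e k 0 > 0" using init g0(1) by (simp add: e_def pos_coeffs_def)
    qed (use that in auto)
    have "poly g1 1 = (\<Sum>k\<le>d. coeff g1 k * 1 ^ k)" using g1(1) by (simp add: poly_altdef)
    also have "\<dots> \<ge> 0" using pos by (intro sum_nonneg) (auto simp: e_def less_imp_le)
    finally show ?thesis using g1(3)[of 1] by simp
  qed
  have "above_roots I G (shift_at i \<beta> y)" unfolding above_roots_def
  proof (intro conjI allI impI)
    show "re_val G (shift_at i \<beta> y) > 0" by (rule Gi)
    fix u :: "'a \<Rightarrow> real" assume u: "\<forall>k\<in>I. 0 \<le> u k"
    have "((\<lambda>\<epsilon>. re_val G (vadd (vadd (shift_at i \<beta> y) 1 u) \<epsilon> (\<lambda>_. 1))) \<longlongrightarrow> re_val G (vadd (shift_at i \<beta> y) 1 u)) (at_right 0)"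
      by (rule regular_tendsto[OF regular_re_val[OF G]])
    moreover have "eventually (\<lambda>\<epsilon>. re_val G (vadd (vadd (shift_at i \<beta> y) 1 u) \<epsilon> (\<lambda>_. 1)) \<ge> 0) (at_right 0)"
      using eventually_at_right_less[of "0::real"]
    proof eventually_elim
      case (elim \<epsilon>)
      have "vadd (vadd (shift_at i \<beta> y) 1 u) \<epsilon> (\<lambda>_. 1) = vadd (shift_at i \<beta> y) 1 (\<lambda>k. u k + \<epsilon>)"
        by (auto simp: vadd_def)
      then show ?case using pos[of "\<lambda>k. u k + \<epsilon>"] u elim by (auto intro: add_nonneg_pos)
    qed
    ultimately show "re_val G (vadd (shift_at i \<beta> y) 1 u) \<ge> 0" by (rule tendsto_lowerbound) simp
  qed
  then show ?thesis using i(1) by blast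
qed

section \<open>Block averages and their effect on the barrier\<close>

definition ind :: "'i set \<Rightarrow> 'i \<Rightarrow> real" where
  "ind b i = (if i \<in> b then 1 else 0)"

definition block_barrier :: "(('i \<Rightarrow> complex) \<Rightarrow> complex) \<Rightarrow> 'i set \<Rightarrow> ('i \<Rightarrow> real) \<Rightarrow> real" where
  "block_barrier G b y = (\<Sum>j\<in>b. barrier G j y)"

definition block_avg :: "'i set \<Rightarrow> real \<Rightarrow> (('i \<Rightarrow> complex) \<Rightarrow> complex) \<Rightarrow> ('i \<Rightarrow> complex) \<Rightarrow> complex" where
  "block_avg b \<beta> G = avg (\<lambda>_. 1 / card b) b \<beta> G"

lemma sum_ind: "finite I \<Longrightarrow> b \<subseteq> I \<Longrightarrow> (\<Sum>i\<in>I. ind b i * f i) = (\<Sum>i\<in>b. f i)"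
  unfolding ind_def by (subst sum.mono_neutral_left[of I b, symmetric]) (auto intro: sum.cong)

lemma block_barrier_nonneg:
  "stable I G \<Longrightarrow> above_roots I G y \<Longrightarrow> b \<subseteq> I \<Longrightarrow> block_barrier G b y \<ge> 0"
  unfolding block_barrier_def by (intro sum_nonneg barrier_nonneg[of I]) auto

lemma block_barrier_antimono:
  assumes "stable I G" "above_roots I G y" "\<forall>i\<in>I. y i \<le> y' i" "b \<subseteq> I"
  shows "block_barrier G b y' \<le> block_barrier G b y"
  unfolding block_barrier_def using assms by (intro sum_mono barrier_antimono[of I]) auto

context
  fixes I b :: "'i set" and G and \<beta> \<gamma> :: real
  assumes G: "stable I G" and b: "b \<subseteq> I" "b \<noteq> {}" and \<gamma>: "\<gamma> = \<beta> / card b"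
begin

lemma card_b: "card b > 0"
  using b stable_finite[OF G] finite_subset card_gt_0_iff by blast

lemma stable_block_avg: "stable I (block_avg b \<beta> G)"
  unfolding block_avg_def using card_b by (intro stable_avg[OF G b(1)]) auto

lemma above_roots_block_avg_imp: "above_roots I (block_avg b \<beta> G) y \<Longrightarrow> \<exists>i\<in>b. above_roots I G (shift_at i \<beta> y)"
  unfolding block_avg_def using card_b by (intro above_roots_avg_imp[OF G b]) auto

text \<open>Since G is affine in each coordinate, averaging the translates over the block is the
  differential operator 1 + \<gamma> times the sum of the partial derivatives in the block. The
  barrier method is about such operators.\<close>

lemma re_val_block_avg_pdiff: "re_val (block_avg b \<beta> G) y = re_val G y + \<gamma> * (\<Sum>i\<in>b. pdiff i (re_val G) y)"
proof -
  have "re_val (block_avg b \<beta> G) y = (\<Sum>i\<in>b. 1 / card b * (re_val G y + \<beta> * pdiff i (re_val G) y))"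
    unfolding block_avg_def re_val_avg using b(1)
    by (intro sum.cong refl arg_cong2[of _ _ _ _ times] multiaffineD[OF re_val_multiaffine[OF G]]) auto
  also have "\<dots> = 1 / card b * (card b * re_val G y + \<beta> * (\<Sum>i\<in>b. pdiff i (re_val G) y))"
    by (simp only: sum_distrib_left[symmetric] sum.distrib) (simp add: sum_distrib_left)
  also have "\<dots> = re_val G y + \<gamma> * (\<Sum>i\<in>b. pdiff i (re_val G) y)"
    using card_b by (simp add: \<gamma> field_simps)
  finally show ?thesis .
qed

lemma re_val_block_avg:
  assumes "re_val G y \<noteq> 0" shows "re_val (block_avg b \<beta> G) y = re_val G y * (1 + \<gamma> * block_barrier G b y)"
  unfolding re_val_block_avg_pdiff block_barrier_def barrier_def sum_divide_distrib[symmetric]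
  using assms by (simp add: field_simps)

text \<open>Averaging multiplies G by 1 + \<gamma> times the block barrier, so the logarithmic
  derivative in j gains the one of this factor. By symmetry of second derivatives the j-derivative
  of the block barrier is the derivative of barrier j in the direction of the block.\<close>

lemma barrier_block_avg:
  assumes y: "re_val G y \<noteq> 0" "1 + \<gamma> * block_barrier G b y \<noteq> 0" and j: "j \<in> I"
  shows "barrier (block_avg b \<beta> G) j y = barrier G j y + \<gamma> / (1 + \<gamma> * block_barrier G b y) * barrier_deriv I G (ind b) j y"
proof -
  define g where "g = re_val G y"
  define h where "h = pdiff j (re_val G) y"
  define A where "A = (\<Sum>i\<in>b. pdiff i (re_val G) y)"
  define B where "B = (\<Sum>i\<in>b. pdiff i (pdiff j (re_val G)) y)"
  have P: "block_barrier G b y = A / g"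
    by (simp add: block_barrier_def barrier_def A_def g_def sum_divide_distrib)
  have "pdiff j (re_val (block_avg b \<beta> G)) y = re_val (block_avg b \<beta> G) (shift_at j 1 y) - re_val (block_avg b \<beta> G) y" by (simp add: pdiff_def)
  also have "\<dots> = h + \<gamma> * (\<Sum>i\<in>b. pdiff i (re_val G) (shift_at j 1 y) - pdiff i (re_val G) y)"
    unfolding re_val_block_avg_pdiff by (simp add: h_def pdiff_def[of j] sum_subtractf algebra_simps)
  also have "(\<Sum>i\<in>b. pdiff i (re_val G) (shift_at j 1 y) - pdiff i (re_val G) y) = B"
    unfolding B_def by (intro sum.cong refl) (subst pdiff_commute, simp only: pdiff_def[of j])
  finally have h': "pdiff j (re_val (block_avg b \<beta> G)) y = h + \<gamma> * B" .
  have d: "barrier_deriv I G (ind b) j y = B / g - h * A / g\<^sup>2"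
    unfolding barrier_deriv_def sum_ind[OF stable_finite[OF G] b(1)] by (simp add: A_def B_def g_def h_def)
  have n: "g \<noteq> 0" "1 + \<gamma> * (A / g) \<noteq> 0" using y P by (auto simp: g_def)
  have "barrier (block_avg b \<beta> G) j y = (h + \<gamma> * B) / (g * (1 + \<gamma> * (A / g)))"
    unfolding barrier_def h' re_val_block_avg[OF y(1)] P by (simp add: g_def)
  also have "\<dots> = h / g + \<gamma> / (1 + \<gamma> * (A / g)) * (B / g - h * A / g\<^sup>2)"
  proof -
    define X where "X = A / g"
    define D where "D = 1 + \<gamma> * X"
    have nD: "D \<noteq> 0" using n by (simp add: D_def X_def)
    have "B / g - h * A / g\<^sup>2 = (B - h * X) / g"
      using n(1) by (simp add: X_def field_simps power2_eq_square)
    moreover have "h / g + \<gamma> / D * ((B - h * X) / g) = (h * D + \<gamma> * (B - h * X)) / (g * D)"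
      using n(1) nD by (simp add: field_simps)
    moreover have "h * D + \<gamma> * (B - h * X) = h + \<gamma> * B" by (simp add: D_def algebra_simps)
    ultimately show ?thesis unfolding X_def[symmetric] D_def[symmetric] by simp
  qed
  finally show ?thesis unfolding d P by (simp add: barrier_def h_def g_def)
qed

text \<open>Averaging adds \<kappa> D to barrier j at the lowered point, with D nonpositive the
  derivative in the block direction. By convexity, moving down by \<delta> raises the barrier by at
  most - \<delta> D. The hypothesis on \<delta> says that \<delta> is at most \<kappa>, so averaging
  pays for the descent.\<close>

lemma barrier_down:
  assumes p: "above_roots I G (vadd y (- \<delta>) (ind b))" and \<delta>: "\<delta> \<ge> 0" "\<gamma> \<ge> 0"
    and le: "\<delta> * (1 + \<gamma> * block_barrier G b (vadd y (- \<delta>) (ind b))) \<le> \<gamma>"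
  shows "above_roots I (block_avg b \<beta> G) (vadd y (- \<delta>) (ind b))"
    and "j \<in> I \<Longrightarrow> barrier (block_avg b \<beta> G) j (vadd y (- \<delta>) (ind b)) \<le> barrier G j y"
proof -
  let ?p = "vadd y (- \<delta>) (ind b)"
  have pos: "1 + \<gamma> * block_barrier G b z > 0" if "above_roots I G z" for z
    using block_barrier_nonneg[OF G that b(1)] \<delta> by (simp add: add_pos_nonneg)
  show "above_roots I (block_avg b \<beta> G) ?p"
    unfolding above_roots_def
  proof (intro conjI allI impI)
    show "re_val (block_avg b \<beta> G) ?p > 0" using pos[OF p] above_roots_pos[OF p] by (simp add: re_val_block_avg)
    fix u :: "'i \<Rightarrow> real" assume "\<forall>i\<in>I. 0 \<le> u i"
    then have a: "above_roots I G (vadd ?p 1 u)" by (intro above_roots_vadd[OF G p]) auto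
    show "re_val (block_avg b \<beta> G) (vadd ?p 1 u) \<ge> 0"
      using pos[OF a] above_roots_pos[OF a] by (simp add: re_val_block_avg)
  qed
  assume j: "j \<in> I"
  have y: "vadd ?p \<delta> (ind b) = y" by (auto simp: vadd_def)
  have u: "\<forall>i\<in>I. ind b i \<ge> 0" by (simp add: ind_def)
  define \<kappa> where "\<kappa> = \<gamma> / (1 + \<gamma> * block_barrier G b ?p)"
  have "\<kappa> \<ge> \<delta>" unfolding \<kappa>_def using le pos[OF p] by (simp add: pos_le_divide_eq)
  moreover have d: "barrier_deriv I G (ind b) j ?p \<le> 0"
    using barrier_tangent(2)[OF G p u j, of 0 0] by simp
  ultimately have "\<kappa> * barrier_deriv I G (ind b) j ?p \<le> \<delta> * barrier_deriv I G (ind b) j ?p"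
    by (rule mult_right_mono_neg)
  moreover have "barrier G j y \<ge> barrier G j ?p + \<delta> * barrier_deriv I G (ind b) j ?p"
    using barrier_tangent(1)[OF G p u j, of 0 \<delta>] \<delta> unfolding y by simp
  moreover have "barrier (block_avg b \<beta> G) j ?p = barrier G j ?p + \<kappa> * barrier_deriv I G (ind b) j ?p"
    unfolding \<kappa>_def using pos[OF p] above_roots_pos[OF p] by (intro barrier_block_avg j) auto
  ultimately show "barrier (block_avg b \<beta> G) j ?p \<le> barrier G j y" by linarith
qed

text \<open>The mirror image for negative \<beta>: averaging now raises the barriers and the upward
  shift pays for it. The factor 1 + \<gamma> times the block barrier could vanish, so its positivity
  is demanded at the raised point; further up it persists because the block barrier
  decreases.\<close>

lemma barrier_up:
  assumes y: "above_roots I G y" and \<delta>: "\<delta> \<ge> 0" "\<gamma> \<le> 0"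
    and pos: "1 + \<gamma> * block_barrier G b (vadd y \<delta> (ind b)) > 0"
    and le: "- \<gamma> \<le> \<delta> * (1 + \<gamma> * block_barrier G b (vadd y \<delta> (ind b)))"
  shows "above_roots I (block_avg b \<beta> G) (vadd y \<delta> (ind b))"
    and "j \<in> I \<Longrightarrow> barrier (block_avg b \<beta> G) j (vadd y \<delta> (ind b)) \<le> barrier G j y"
proof -
  let ?p = "vadd y \<delta> (ind b)"
  have u: "\<forall>i\<in>I. ind b i \<ge> 0" by (simp add: ind_def)
  have p: "above_roots I G ?p" using \<delta> by (intro above_roots_vadd[OF G y u])
  show "above_roots I (block_avg b \<beta> G) ?p"
    unfolding above_roots_def
  proof (intro conjI allI impI)
    show "re_val (block_avg b \<beta> G) ?p > 0" using pos above_roots_pos[OF p] by (simp add: re_val_block_avg)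
    fix w :: "'i \<Rightarrow> real" assume w: "\<forall>i\<in>I. 0 \<le> w i"
    then have a: "above_roots I G (vadd ?p 1 w)" by (intro above_roots_vadd[OF G p]) auto
    have "block_barrier G b (vadd ?p 1 w) \<le> block_barrier G b ?p"
      using w by (intro block_barrier_antimono[OF G p _ b(1)]) (auto simp: vadd_def[of ?p])
    then have "\<gamma> * block_barrier G b ?p \<le> \<gamma> * block_barrier G b (vadd ?p 1 w)" using \<delta>(2) by (rule mult_left_mono_neg)
    then show "re_val (block_avg b \<beta> G) (vadd ?p 1 w) \<ge> 0"
      using pos above_roots_pos[OF a] by (simp add: re_val_block_avg)
  qed
  assume j: "j \<in> I"
  define \<kappa> where "\<kappa> = \<gamma> / (1 + \<gamma> * block_barrier G b ?p)"
  have "\<kappa> \<ge> - \<delta>" unfolding \<kappa>_def using le pos by (simp add: pos_le_divide_eq)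
  moreover have d: "barrier_deriv I G (ind b) j ?p \<le> 0"
    using barrier_tangent(2)[OF G y u j, of \<delta> 0] \<delta> by simp
  ultimately have "\<kappa> * barrier_deriv I G (ind b) j ?p \<le> - \<delta> * barrier_deriv I G (ind b) j ?p"
    by (rule mult_right_mono_neg)
  moreover have "barrier G j y \<ge> barrier G j ?p - \<delta> * barrier_deriv I G (ind b) j ?p"
    using barrier_tangent(1)[OF G y u j, of \<delta> 0] \<delta> by simp
  moreover have "barrier (block_avg b \<beta> G) j ?p = barrier G j ?p + \<kappa> * barrier_deriv I G (ind b) j ?p"
    unfolding \<kappa>_def using pos above_roots_pos[OF p] by (intro barrier_block_avg j) auto
  ultimately show "barrier (block_avg b \<beta> G) j ?p \<le> barrier G j y" by linarith
qed

end

lemma prod_list_deriv: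
  fixes zs :: "real list"
  assumes "\<And>z. z \<in> set zs \<Longrightarrow> s \<noteq> z"
  shows "((\<lambda>s. \<Prod>z\<leftarrow>zs. s - z) has_real_derivative (\<Prod>z\<leftarrow>zs. s - z) * (\<Sum>z\<leftarrow>zs. 1 / (s - z))) (at s)"
  using assms
proof (induction zs)
  case (Cons a zs)
  then have "((\<lambda>s. \<Prod>z\<leftarrow>zs. s - z) has_real_derivative (\<Prod>z\<leftarrow>zs. s - z) * (\<Sum>z\<leftarrow>zs. 1 / (s - z))) (at s)" by simp
  moreover have "s - a \<noteq> 0" using Cons.prems by auto
  ultimately show ?case by (auto intro!: derivative_eq_intros simp: field_simps)
qed simp

lemma sum_list_deriv:
  fixes zs :: "real list"
  assumes "\<And>z. z \<in> set zs \<Longrightarrow> s \<noteq> z"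
  shows "((\<lambda>s. \<Sum>z\<leftarrow>zs. 1 / (s - z)) has_real_derivative - (\<Sum>z\<leftarrow>zs. 1 / (s - z)\<^sup>2)) (at s)"
  using assms
proof (induction zs)
  case (Cons a zs)
  then have "((\<lambda>s. \<Sum>z\<leftarrow>zs. 1 / (s - z)) has_real_derivative - (\<Sum>z\<leftarrow>zs. 1 / (s - z)\<^sup>2)) (at s)" by simp
  moreover have "s - a \<noteq> 0" using Cons.prems by auto
  ultimately show ?case by (auto intro!: derivative_eq_intros simp: power2_eq_square)
qed simp

text \<open>The barriers weighted by the direction itself sum to the logarithmic derivative of the
  line polynomial. All residues are therefore 1, one per root with multiplicity, and a small
  derivative at y keeps every single root far away.\<close>

lemma weighted_block_barrier_representation:
  assumes G: "stable I G" and y: "above_roots I G y" and u: "\<forall>i\<in>I. u i > 0"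
  obtains zs where "\<And>z. z \<in> set zs \<Longrightarrow> z < 0"
    "\<And>s. (\<And>z. z \<in> set zs \<Longrightarrow> z < s) \<Longrightarrow> re_val G (vadd y s u) > 0"
    "\<And>s. (\<And>z. z \<in> set zs \<Longrightarrow> z < s) \<Longrightarrow> (\<Sum>j\<in>I. u j * barrier G j (vadd y s u)) = (\<Sum>z\<leftarrow>zs. 1 / (s - z))"
    "(\<Sum>j\<in>I. u j * barrier_deriv I G u j y) = - (\<Sum>z\<leftarrow>zs. 1 / z\<^sup>2)"
proof -
  obtain g where g: "degree g = card I" "coeff g (card I) = (\<Prod>i\<in>I. u i)" "(\<Prod>i\<in>I. u i) > 0"
    "real_rooted g" "g \<noteq> 0" "\<And>s. poly g s = re_val G (vadd y s u)"
    by (rule stable_line_real[OF G u, of y]) blast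
  define c where "c = (\<Prod>i\<in>I. u i)"
  obtain zs where "g = Polynomial.smult (lead_coeff g) (\<Prod>z\<leftarrow>zs. [:- z, 1:])"
    using real_rooted_factorization[OF g(4,5)] by blast
  then have "poly g s = c * (\<Prod>z\<leftarrow>zs. s - z)" for s
    by (metis c_def g(1,2) poly_prod_list_linear poly_smult)
  then have prodform: "re_val G (vadd y s u) = c * (\<Prod>z\<leftarrow>zs. s - z)" for s using g(6) by simp
  have c: "c > 0" using g(3) by (simp add: c_def)
  have neg: "z < 0" if "z \<in> set zs" for z
  proof (rule ccontr)
    assume "\<not> z < 0"
    then have "above_roots I G (vadd y z u)" using u by (intro above_roots_vadd[OF G y]) (auto simp: less_imp_le)
    then have "re_val G (vadd y z u) > 0" by (rule above_roots_pos)
    moreover have "(\<Prod>z'\<leftarrow>zs. z - z') = 0" using that by (induction zs) auto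
    ultimately show False using prodform by simp
  qed
  have pos: "re_val G (vadd y s u) > 0" if "\<And>z. z \<in> set zs \<Longrightarrow> z < s" for s
  proof -
    have "(\<Prod>z\<leftarrow>zs. s - z) > 0" using that by (induction zs) auto
    then show ?thesis using c prodform by simp
  qed
  have rep: "(\<Sum>j\<in>I. u j * barrier G j (vadd y s u)) = (\<Sum>z\<leftarrow>zs. 1 / (s - z))"
    if s: "\<And>z. z \<in> set zs \<Longrightarrow> z < s" for s
  proof -
    have "((\<lambda>s. c * (\<Prod>z\<leftarrow>zs. s - z)) has_real_derivative
        c * ((\<Prod>z\<leftarrow>zs. s - z) * (\<Sum>z\<leftarrow>zs. 1 / (s - z)))) (at s)"
      using s by (intro DERIV_cmult prod_list_deriv) fastforce
    moreover have "((\<lambda>s. c * (\<Prod>z\<leftarrow>zs. s - z)) has_real_derivative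
        (\<Sum>i\<in>I. u i * pdiff i (re_val G) (vadd y s u))) (at s)"
      using regular_deriv[OF regular_re_val[OF G], of y u s] unfolding prodform .
    ultimately have "(\<Sum>i\<in>I. u i * pdiff i (re_val G) (vadd y s u)) =
        re_val G (vadd y s u) * (\<Sum>z\<leftarrow>zs. 1 / (s - z))"
      unfolding prodform using DERIV_unique by (metis mult.assoc)
    then show ?thesis using pos[OF s] by (simp add: barrier_def sum_divide_distrib[symmetric])
  qed
  have "(\<Sum>j\<in>I. u j * barrier_deriv I G u j y) = - (\<Sum>z\<leftarrow>zs. 1 / (0 - z)\<^sup>2)"
  proof (rule DERIV_unique)
    have "((\<lambda>s. barrier G j (vadd y s u)) has_real_derivative barrier_deriv I G u j (vadd y 0 u)) (at 0)" if "j \<in> I" for j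
      using above_roots_pos[OF y] by (intro barrier_has_derivative[OF G that]) auto
    then show "((\<lambda>s. \<Sum>j\<in>I. u j * barrier G j (vadd y s u)) has_real_derivative (\<Sum>j\<in>I. u j * barrier_deriv I G u j y)) (at 0)"
      by (intro DERIV_sum DERIV_cmult) auto
    have "eventually (\<lambda>s. \<forall>z\<in>set zs. z < s) (nhds (0::real))"
      using neg by (intro eventually_ball_finite) (auto intro: order_tendstoD(1)[OF tendsto_ident_at] eventually_nhds_in_open[of "{z<..}" for z, simplified])
    then have ev: "eventually (\<lambda>s. (\<Sum>j\<in>I. u j * barrier G j (vadd y s u)) = (\<Sum>z\<leftarrow>zs. 1 / (s - z))) (nhds 0)"
      by eventually_elim (use rep in blast)
    have "((\<lambda>s. \<Sum>z\<leftarrow>zs. 1 / (s - z)) has_real_derivative - (\<Sum>z\<leftarrow>zs. 1 / (0 - z)\<^sup>2)) (at 0)"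
      using neg by (intro sum_list_deriv) fastforce
    then show "((\<lambda>s. \<Sum>j\<in>I. u j * barrier G j (vadd y s u)) has_real_derivative - (\<Sum>z\<leftarrow>zs. 1 / (0 - z)\<^sup>2)) (at 0)"
      by (rule DERIV_cong_ev[OF refl ev refl, THEN iffD2])
  qed
  then show thesis using that[of zs] neg pos rep by simp
qed

section \<open>Processing blocks\<close>

lemma elem_le_sum_list_nonneg:
  fixes f :: "'b \<Rightarrow> real"
  assumes "\<And>x. f x \<ge> 0" "z \<in> set zs" shows "f z \<le> (\<Sum>x\<leftarrow>zs. f x)"
  using assms(2)
proof (induction zs)
  case (Cons a zs)
  have "(\<Sum>x\<leftarrow>zs. f x) \<ge> 0" using assms(1) by (intro sum_list_nonneg) auto
  then show ?case using Cons assms(1)[of a] by force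
qed simp

text \<open>If the barrier derivative is small, no root lies near the current point along the block direction, so there
  is room to move by \<open>\<delta>\<close>. Otherwise averaging alone lowers the barrier by a definite amount, which can
  happen only boundedly often.\<close>

lemma room_for_shift:
  assumes G: "stable I G" and y: "above_roots I G y" and b: "b \<subseteq> I" and \<phi>: "\<phi> > 0" "block_barrier G b y \<le> \<phi>"
    and K: "K > 1" and \<delta>: "\<delta> = (1 - 1 / K)\<^sup>2 / \<phi>"
    and S: "- (\<Sum>j\<in>b. barrier_deriv I G (ind b) j y) < \<phi>\<^sup>2 / K\<^sup>2"
  shows "above_roots I G (vadd y (- \<delta>) (ind b)) \<and> block_barrier G b (vadd y (- \<delta>) (ind b)) \<le> \<phi> / (1 - 1 / K)"
proof -
  \<comment> \<open>The indicator of the block is made strictly positive; \<epsilon> tends to 0 at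
    the end.\<close>
  define u where "u \<epsilon> i = ind b i + \<epsilon>" for \<epsilon> :: real and i
  define X where "X \<epsilon> = (\<Sum>j\<in>I. u \<epsilon> j * barrier G j y)" for \<epsilon>
  define D where "D \<epsilon> = (\<Sum>j\<in>I. u \<epsilon> j * barrier_deriv I G (u \<epsilon>) j y)" for \<epsilon>
  note fI = stable_finite[OF G]
  have \<delta>0: "\<delta> \<ge> 0" using \<delta> \<phi> by simp
  have \<delta>1: "\<delta> \<le> 1 / \<phi>"
  proof -
    have "(1 - 1 / K)\<^sup>2 \<le> 1" using K by (intro power_le_one) auto
    then show ?thesis unfolding \<delta> using \<phi> by (intro divide_right_mono) auto
  qed
  have tX: "(X \<longlongrightarrow> block_barrier G b y) (at_right 0)"
  proof -
    have "((\<lambda>\<epsilon>. \<Sum>j\<in>I. u \<epsilon> j * barrier G j y) \<longlongrightarrow> (\<Sum>j\<in>I. (ind b j + 0) * barrier G j y)) (at_right 0)"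
      unfolding u_def by (intro tendsto_intros)
    then show ?thesis by (simp add: X_def[abs_def] sum_ind[OF fI b] block_barrier_def)
  qed
  have tD: "(D \<longlongrightarrow> (\<Sum>j\<in>b. barrier_deriv I G (ind b) j y)) (at_right 0)"
  proof -
    have "((\<lambda>\<epsilon>. barrier_deriv I G (u \<epsilon>) j y) \<longlongrightarrow> barrier_deriv I G (ind b) j y) (at_right 0)" if "j \<in> I" for j
      using barrier_deriv_tendsto[OF G y that, of "ind b" "\<lambda>_. 0"] by (simp add: u_def[abs_def] vadd_def)
    then have "((\<lambda>\<epsilon>. \<Sum>j\<in>I. u \<epsilon> j * barrier_deriv I G (u \<epsilon>) j y) \<longlongrightarrow> (\<Sum>j\<in>I. (ind b j + 0) * barrier_deriv I G (ind b) j y)) (at_right 0)"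
      unfolding u_def[of _ "_::'a"] by (intro tendsto_intros) (auto simp: u_def[abs_def])
    then show ?thesis by (simp add: D_def[abs_def] sum_ind[OF fI b])
  qed
  have claim: "above_roots I G (vadd y (- \<delta>) (ind b)) \<and> block_barrier G b (vadd y (- \<delta>) (ind b)) \<le> X \<epsilon> / (1 - 1 / K)"
    if \<epsilon>: "\<epsilon> > 0" and De: "- D \<epsilon> < \<phi>\<^sup>2 / K\<^sup>2" for \<epsilon>
  proof -
    have u: "\<forall>i\<in>I. u \<epsilon> i > 0" using \<epsilon> by (simp add: u_def ind_def)
    obtain zs where zs: "\<And>z. z \<in> set zs \<Longrightarrow> z < 0"
      "\<And>s. (\<And>z. z \<in> set zs \<Longrightarrow> z < s) \<Longrightarrow> re_val G (vadd y s (u \<epsilon>)) > 0"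
      "\<And>s. (\<And>z. z \<in> set zs \<Longrightarrow> z < s) \<Longrightarrow>
          (\<Sum>j\<in>I. u \<epsilon> j * barrier G j (vadd y s (u \<epsilon>))) = (\<Sum>z\<leftarrow>zs. 1 / (s - z))"
      "D \<epsilon> = - (\<Sum>z\<leftarrow>zs. 1 / z\<^sup>2)"
      unfolding D_def by (rule weighted_block_barrier_representation[OF G y u]) blast
    \<comment> \<open>One term of a sum of nonnegative terms below
      \<open>\<phi>\<^sup>2 / K\<^sup>2\<close> already bounds the distance of its root, which
      exceeds \<delta> by the factor K at least.\<close>
    have far: "- z > K / \<phi>" if z: "z \<in> set zs" for z
    proof -
      have "1 / z\<^sup>2 \<le> (\<Sum>z\<leftarrow>zs. 1 / z\<^sup>2)" using z by (intro elem_le_sum_list_nonneg) auto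
      also have "\<dots> < \<phi>\<^sup>2 / K\<^sup>2" using De zs(4) by simp
      finally have "(K / \<phi>)\<^sup>2 < (- z)\<^sup>2"
        using zs(1)[OF z] K \<phi> by (simp add: field_simps power_divide)
      then show ?thesis by (rule power2_less_imp_less) (use zs(1)[OF z] in simp)
    qed
    have K\<phi>: "K / \<phi> \<ge> 1 / \<phi>" using K \<phi> by (intro divide_right_mono) auto
    have "above_roots I G (vadd y (- \<delta>) (u \<epsilon>))"
    proof (rule above_roots_vadd_minus[OF G y u _ \<delta>0])
      fix s assume "0 \<le> s" "s \<le> \<delta>"
      then show "re_val G (vadd y (- s) (u \<epsilon>)) > 0"
        using far \<delta>1 K\<phi> by (intro zs(2)) force
    qed
    moreover have le: "\<forall>i\<in>I. vadd y (- \<delta>) (u \<epsilon>) i \<le> vadd y (- \<delta>) (ind b) i"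
      using \<delta>0 \<epsilon> by (simp add: vadd_def u_def algebra_simps)
    ultimately have a: "above_roots I G (vadd y (- \<delta>) (u \<epsilon>))" "above_roots I G (vadd y (- \<delta>) (ind b))"
      using above_roots_mono[OF G] by blast+
    have "block_barrier G b (vadd y (- \<delta>) (ind b)) \<le> block_barrier G b (vadd y (- \<delta>) (u \<epsilon>))"
      by (rule block_barrier_antimono[OF G a(1) le b])
    also have "\<dots> = (\<Sum>j\<in>I. ind b j * barrier G j (vadd y (- \<delta>) (u \<epsilon>)))"
      unfolding sum_ind[OF fI b] block_barrier_def ..
    also have "\<dots> \<le> (\<Sum>j\<in>I. u \<epsilon> j * barrier G j (vadd y (- \<delta>) (u \<epsilon>)))"
      using \<epsilon> barrier_nonneg[OF G a(1)] by (intro sum_mono mult_right_mono) (auto simp: u_def)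
    also have "\<dots> = (\<Sum>z\<leftarrow>zs. 1 / (- \<delta> - z))"
      using far \<delta>1 K\<phi> by (intro zs(3)) force
    also have "\<dots> \<le> (\<Sum>z\<leftarrow>zs. 1 / (1 - 1 / K) * (1 / (0 - z)))"
    proof (rule sum_list_mono)
      fix z assume z: "z \<in> set zs"
      \<comment> \<open>Moving by \<delta> eats at most the fraction 1/K of the distance to a root,
        so each summand grows at most by the factor 1 / (1 - 1/K).\<close>
      have "1 / \<phi> < - z / K" using far[OF z] K \<phi> by (simp add: field_simps)
      then have "(1 - 1 / K) * (0 - z) \<le> - \<delta> - z" using \<delta>1 by (simp add: algebra_simps)
      moreover have "(1 - 1 / K) * (0 - z) > 0" using K zs(1)[OF z] by (intro mult_pos_pos) auto
      ultimately have "1 / (- \<delta> - z) \<le> 1 / ((1 - 1 / K) * (0 - z))" by (rule frac_le[OF zero_le_one order_refl, rotated])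
      then show "1 / (- \<delta> - z) \<le> 1 / (1 - 1 / K) * (1 / (0 - z))" by simp
    qed
    also have "\<dots> = 1 / (1 - 1 / K) * (\<Sum>z\<leftarrow>zs. 1 / (0 - z))" by (rule sum_list_const_mult)
    also have "(\<Sum>z\<leftarrow>zs. 1 / (0 - z)) = X \<epsilon>"
      using zs(3)[of 0] zs(1) by (simp add: X_def)
    finally show ?thesis using a(2) by simp
  qed
  have "eventually (\<lambda>\<epsilon>. - D \<epsilon> < \<phi>\<^sup>2 / K\<^sup>2) (at_right 0)"
    using order_tendstoD(2)[OF tendsto_minus[OF tD] S] .
  then have ev: "eventually (\<lambda>\<epsilon>. above_roots I G (vadd y (- \<delta>) (ind b)) \<and>
      block_barrier G b (vadd y (- \<delta>) (ind b)) \<le> X \<epsilon> / (1 - 1 / K)) (at_right 0)"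
    using eventually_at_right_less[of "0::real"] by eventually_elim (rule claim)
  then have "above_roots I G (vadd y (- \<delta>) (ind b))"
    using eventually_happens'[of "at_right (0::real)"] by (auto simp: eventually_conj_iff)
  moreover have "block_barrier G b (vadd y (- \<delta>) (ind b)) \<le> block_barrier G b y / (1 - 1 / K)"
  proof (rule tendsto_lowerbound)
    show "((\<lambda>\<epsilon>. X \<epsilon> / (1 - 1 / K)) \<longlongrightarrow> block_barrier G b y / (1 - 1 / K)) (at_right 0)"
      using K by (intro tendsto_divide tX tendsto_const) auto
  qed (use ev in \<open>auto elim: eventually_mono\<close>)
  moreover have "\<dots> \<le> \<phi> / (1 - 1 / K)" using \<phi> K by (intro divide_right_mono) auto
  ultimately show ?thesis by linarith
qed

text \<open>The bound on \<sigma> is a potential. A round either permits a descent by \<delta>, or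
  it lowers the block barrier by at least \<open>\<phi> / (2 * K\<^sup>2)\<close>, which increases
  the subtracted term by at least 1 and so cancels the increase of m. As the block barrier stays
  between 0 and \<phi>, at most \<open>2 * K\<^sup>2\<close> rounds are lost.\<close>

lemma block_down:
  assumes G: "stable I G" and y: "above_roots I G y" and b: "b \<subseteq> I" "b \<noteq> {}" and \<phi>: "\<phi> > 0" "block_barrier G b y \<le> \<phi>"
    and K: "K > 1" and \<delta>: "\<delta> = (1 - 1 / K)\<^sup>2 / \<phi>" and \<beta>: "\<beta> = K / \<phi> * card b"
  shows "\<exists>\<sigma>\<ge>0. let H = (block_avg b \<beta> ^^ m) G; p = vadd y (- \<sigma>) (ind b) in
     \<sigma> \<ge> \<delta> * (m - 2 * K\<^sup>2 * (\<phi> - block_barrier H b p) / \<phi>) \<and> stable I H \<and> above_roots I H p \<and> (\<forall>j\<in>I. barrier H j p \<le> barrier G j y)"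
proof (induction m)
  case 0
  have "0 \<ge> \<delta> * (0 - 2 * K\<^sup>2 * (\<phi> - block_barrier G b y) / \<phi>)"
    using \<phi> \<delta> by (intro mult_nonneg_nonpos) auto
  then show ?case using G y by (intro exI[of _ 0]) (auto simp: Let_def)
next
  case (Suc m)
  define H where "H = (block_avg b \<beta> ^^ m) G"
  obtain \<sigma> where \<sigma>: "\<sigma> \<ge> 0" "\<sigma> \<ge> \<delta> * (m - 2 * K\<^sup>2 * (\<phi> - block_barrier H b (vadd y (- \<sigma>) (ind b))) / \<phi>)"
    and H: "stable I H" and p: "above_roots I H (vadd y (- \<sigma>) (ind b))"
    and le: "\<And>j. j \<in> I \<Longrightarrow> barrier H j (vadd y (- \<sigma>) (ind b)) \<le> barrier G j y"
    using Suc by (auto simp: Let_def H_def)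
  define y' where "y' = vadd y (- \<sigma>) (ind b)"
  define \<gamma> where "\<gamma> = K / \<phi>"
  have cb: "card b > 0" using b stable_finite[OF G] by (meson card_gt_0_iff finite_subset)
  have \<gamma>: "\<gamma> = \<beta> / card b" using cb by (simp add: \<gamma>_def \<beta>)
  have \<gamma>0: "\<gamma> > 0" using K \<phi> by (simp add: \<gamma>_def)
  have \<delta>0: "\<delta> \<ge> 0" using \<delta> \<phi> by simp
  have Hs: "(block_avg b \<beta> ^^ Suc m) G = block_avg b \<beta> H" by (simp add: H_def)
  have gH: "stable I (block_avg b \<beta> H)" by (rule stable_block_avg[OF H b \<gamma>])
  have y': "above_roots I H y'" using p by (simp add: y'_def)
  have P': "block_barrier H b y' \<le> \<phi>"
  proof -
    have "block_barrier H b y' \<le> block_barrier G b y" unfolding block_barrier_def y'_def using b le by (intro sum_mono) auto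
    then show ?thesis using \<phi> by simp
  qed
  show ?case
  proof (cases "- (\<Sum>j\<in>b. barrier_deriv I H (ind b) j y') < \<phi>\<^sup>2 / K\<^sup>2")
    case True
    let ?p = "vadd y' (- \<delta>) (ind b)"
    have p: "above_roots I H ?p" "block_barrier H b ?p \<le> \<phi> / (1 - 1 / K)"
      using room_for_shift[OF H y' b(1) \<phi>(1) P' K \<delta> True] by auto
    \<comment> \<open>The constants are tuned for this estimate: the left side is at most 1/\<phi> +
      (1 - 1/K) * (K/\<phi>) = K/\<phi> = \<gamma>.\<close>
    have "\<delta> * (1 + \<gamma> * block_barrier H b ?p) \<le> \<delta> * (1 + \<gamma> * (\<phi> / (1 - 1 / K)))"
      using p(2) \<gamma>0 \<delta>0 by (intro mult_left_mono add_left_mono) auto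
    also have "\<dots> = (1 - 1 / K)\<^sup>2 / \<phi> + (1 - 1 / K) * \<gamma>"
    proof -
      have n: "1 - 1 / K \<noteq> 0" "\<phi> \<noteq> 0" using K \<phi> by auto
      have "(1 - 1 / K)\<^sup>2 / \<phi> * (\<gamma> * (\<phi> / (1 - 1 / K))) = (1 - 1 / K) * \<gamma>"
        using n by (simp add: power2_eq_square)
      then show ?thesis unfolding \<delta> by (simp only: distrib_left mult_1_right)
    qed
    also have "\<dots> \<le> 1 / \<phi> + (1 - 1 / K) * \<gamma>"
    proof -
      have "(1 - 1 / K)\<^sup>2 \<le> 1" using K by (intro power_le_one) auto
      then have "(1 - 1 / K)\<^sup>2 / \<phi> \<le> 1 / \<phi>" using \<phi> by (intro divide_right_mono) auto
      then show ?thesis by simp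
    qed
    also have "\<dots> = \<gamma>" using K \<phi> by (simp add: \<gamma>_def field_simps)
    finally have c: "\<delta> * (1 + \<gamma> * block_barrier H b ?p) \<le> \<gamma>" .
    note bd = barrier_down[OF H b \<gamma> p(1) \<delta>0 less_imp_le[OF \<gamma>0] c]
    have pe: "?p = vadd y (- (\<sigma> + \<delta>)) (ind b)" by (simp add: y'_def vadd_vadd)
    have mono: "barrier (block_avg b \<beta> H) j ?p \<le> barrier H j y'" if "j \<in> I" for j by (rule bd(2)[OF that])
    have "block_barrier (block_avg b \<beta> H) b ?p \<le> block_barrier H b y'" unfolding block_barrier_def using b mono by (intro sum_mono) auto
    then have "\<delta> * (m + 1 - 2 * K\<^sup>2 * (\<phi> - block_barrier (block_avg b \<beta> H) b ?p) / \<phi>)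
        \<le> \<delta> * (m + 1 - 2 * K\<^sup>2 * (\<phi> - block_barrier H b y') / \<phi>)"
      using \<delta>0 \<phi> by (intro mult_left_mono diff_left_mono divide_right_mono) auto
    also have "\<dots> = \<delta> * (m - 2 * K\<^sup>2 * (\<phi> - block_barrier H b y') / \<phi>) + \<delta>" by (simp add: algebra_simps)
    also have "\<dots> \<le> \<sigma> + \<delta>" using \<sigma>(2) by (simp add: y'_def)
    finally have sg: "\<delta> * (m + 1 - 2 * K\<^sup>2 * (\<phi> - block_barrier (block_avg b \<beta> H) b ?p) / \<phi>) \<le> \<sigma> + \<delta>" .
    have "barrier (block_avg b \<beta> H) j ?p \<le> barrier G j y" if "j \<in> I" for j
      using mono[OF that] le[OF that] by (simp add: y'_def)
    then show ?thesis
      using sg gH bd(1) \<sigma>(1) \<delta>0 unfolding Hs pe by (intro exI[of _ "\<sigma> + \<delta>"]) (simp add: Let_def add.commute)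
  next
    case False
    \<comment> \<open>Without room the point stays put, which is the case \<delta> = 0 of the
      descent lemma.\<close>
    have v0: "vadd y' (- 0) (ind b) = y'" by simp
    note bd = barrier_down[OF H b \<gamma>, where \<delta> = 0 and y = y', unfolded v0, OF y' order_refl less_imp_le[OF \<gamma>0]]
    have a: "above_roots I (block_avg b \<beta> H) y'" using bd(1) \<gamma>0 by simp
    have mono: "barrier (block_avg b \<beta> H) j y' \<le> barrier H j y'" if "j \<in> I" for j using bd(2)[of j] that \<gamma>0 by simp
    have nn: "block_barrier H b y' \<ge> 0" by (rule block_barrier_nonneg[OF H y' b(1)])
    have pos: "1 + \<gamma> * block_barrier H b y' > 0" using nn \<gamma>0 by (simp add: add_pos_nonneg)
    \<comment> \<open>Since \<gamma> \<phi> = K exceeds 1, \<kappa> is at least 1/(2 \<phi>);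
      multiplied by the large derivative this is the guaranteed drop of the block barrier.\<close>
    define \<kappa> where "\<kappa> = \<gamma> / (1 + \<gamma> * block_barrier H b y')"
    have "\<kappa> \<ge> \<gamma> / (1 + \<gamma> * \<phi>)" unfolding \<kappa>_def
      using pos P' \<gamma>0 by (intro frac_le) auto
    moreover have "\<gamma> / (1 + \<gamma> * \<phi>) \<ge> 1 / (2 * \<phi>)"
    proof -
      have "\<gamma> * \<phi> = K" using \<phi> by (simp add: \<gamma>_def)
      moreover have "1 / 2 \<le> K / (1 + K)" using K by (simp add: field_simps)
      then have "1 / 2 / \<phi> \<le> K / (1 + K) / \<phi>" using \<phi> by (intro divide_right_mono) auto
      then have "1 / (2 * \<phi>) \<le> \<gamma> / (1 + K)" by (simp add: \<gamma>_def mult.commute)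
      ultimately show ?thesis by simp
    qed
    ultimately have \<kappa>: "\<kappa> \<ge> 1 / (2 * \<phi>)" by linarith
    have "block_barrier (block_avg b \<beta> H) b y' = (\<Sum>j\<in>b. barrier H j y' + \<kappa> * barrier_deriv I H (ind b) j y')"
      unfolding block_barrier_def[of "block_avg b \<beta> H"] \<kappa>_def
      using b pos above_roots_pos[OF y'] by (intro sum.cong refl barrier_block_avg[OF H b \<gamma>]) auto
    also have "\<dots> = block_barrier H b y' - \<kappa> * - (\<Sum>j\<in>b. barrier_deriv I H (ind b) j y')"
      by (simp add: sum.distrib sum_distrib_left block_barrier_def)
    also have "\<dots> \<le> block_barrier H b y' - 1 / (2 * \<phi>) * (\<phi>\<^sup>2 / K\<^sup>2)"
      using False \<kappa> \<phi> by (intro diff_left_mono mult_mono) (auto intro: order_trans[of 0 "1 / (2 * \<phi>)"])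
    also have "1 / (2 * \<phi>) * (\<phi>\<^sup>2 / K\<^sup>2) = \<phi> / (2 * K\<^sup>2)" using \<phi> by (simp add: power2_eq_square)
    finally have drop: "block_barrier (block_avg b \<beta> H) b y' \<le> block_barrier H b y' - \<phi> / (2 * K\<^sup>2)" .
    have "2 * K\<^sup>2 * (\<phi> - block_barrier (block_avg b \<beta> H) b y') / \<phi> \<ge> 2 * K\<^sup>2 * (\<phi> - block_barrier H b y' + \<phi> / (2 * K\<^sup>2)) / \<phi>"
      using drop \<phi> by (intro divide_right_mono mult_left_mono) auto
    also have "2 * K\<^sup>2 * (\<phi> - block_barrier H b y' + \<phi> / (2 * K\<^sup>2)) / \<phi> = 2 * K\<^sup>2 * (\<phi> - block_barrier H b y') / \<phi> + 1"
      using \<phi> K by (simp add: field_simps)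
    finally have "\<delta> * (m + 1 - 2 * K\<^sup>2 * (\<phi> - block_barrier (block_avg b \<beta> H) b y') / \<phi>)
        \<le> \<delta> * (m - 2 * K\<^sup>2 * (\<phi> - block_barrier H b y') / \<phi>)"
      using \<delta>0 by (intro mult_left_mono) auto
    also have "\<dots> \<le> \<sigma>" using \<sigma>(2) by (simp add: y'_def)
    finally have sg: "\<delta> * (m + 1 - 2 * K\<^sup>2 * (\<phi> - block_barrier (block_avg b \<beta> H) b y') / \<phi>) \<le> \<sigma>" .
    have "barrier (block_avg b \<beta> H) j y' \<le> barrier G j y" if "j \<in> I" for j
      using mono[OF that] le[OF that] by (simp add: y'_def)
    then show ?thesis
      using sg gH a \<sigma>(1) unfolding Hs y'_def by (intro exI[of _ \<sigma>]) (simp add: Let_def add.commute)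
  qed
qed

lemma stable_block_avg_pow:
  assumes "stable I G" "b \<subseteq> I" "b \<noteq> {}" shows "stable I ((block_avg b \<beta> ^^ m) G)"
  by (induction m) (use assms in \<open>auto intro: stable_block_avg\<close>)

definition blocks_avg :: "nat \<Rightarrow> real \<Rightarrow> 'i set list \<Rightarrow> (('i \<Rightarrow> complex) \<Rightarrow> complex) \<Rightarrow> ('i \<Rightarrow> complex) \<Rightarrow> complex" where
  "blocks_avg m \<beta> bs G = foldr (\<lambda>b H. (block_avg b \<beta> ^^ m) H) bs G"

lemma blocks_avg_simps [simp]:
  "blocks_avg m \<beta> [] G = G" "blocks_avg m \<beta> (b # bs) G = (block_avg b \<beta> ^^ m) (blocks_avg m \<beta> bs G)"
  by (simp_all add: blocks_avg_def)

lemma stable_blocks_avg: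
  assumes "stable I G" "\<And>b. b \<in> set bs \<Longrightarrow> b \<subseteq> I \<and> b \<noteq> {}" shows "stable I (blocks_avg m \<beta> bs G)"
  using assms(2) by (induction bs) (use assms(1) in \<open>auto intro!: stable_block_avg_pow\<close>)

text \<open>No barrier value ends above its initial one, so the bound \<phi> is still valid for
  blocks not yet treated. Nonnegativity of the final block barrier turns the potential of
  \<open>block_down\<close> into the loss of \<open>2 * K\<^sup>2\<close> rounds.\<close>

lemma blocks_down:
  fixes \<phi> K \<delta> \<beta> :: real and L m :: nat
  assumes G: "stable I G" and y: "above_roots I G y" and \<phi>: "\<phi> > 0" and K: "K > 1"
    and bs: "\<And>b. b \<in> set bs \<Longrightarrow> b \<subseteq> I \<and> card b = L \<and> block_barrier G b y \<le> \<phi>" and L: "L > 0"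
    and \<delta>: "\<delta> = (1 - 1 / K)\<^sup>2 / \<phi>" and \<beta>: "\<beta> = K / \<phi> * L"
  shows "\<exists>p. above_roots I (blocks_avg m \<beta> bs G) p \<and> (\<forall>j\<in>I. barrier (blocks_avg m \<beta> bs G) j p \<le> barrier G j y)
      \<and> (\<forall>i. p i \<le> y i) \<and> (\<forall>b\<in>set bs. \<forall>i\<in>b. p i \<le> y i - \<delta> * (m - 2 * K\<^sup>2))"
  using bs
proof (induction bs)
  case Nil
  then show ?case using y by (intro exI[of _ y]) simp
next
  case (Cons b bs)
  define H where "H = blocks_avg m \<beta> bs G"
  obtain p where p: "above_roots I H p" "\<And>j. j \<in> I \<Longrightarrow> barrier H j p \<le> barrier G j y" "\<And>i. p i \<le> y i"
    "\<And>b i. b \<in> set bs \<Longrightarrow> i \<in> b \<Longrightarrow> p i \<le> y i - \<delta> * (m - 2 * K\<^sup>2)"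
    using Cons.IH[OF Cons.prems[OF list.set_intros(2)]] unfolding H_def by blast
  have b: "b \<subseteq> I" "card b = L" "block_barrier G b y \<le> \<phi>" using Cons.prems[of b] by auto
  then have b0: "b \<noteq> {}" using L by auto
  have H: "stable I H" unfolding H_def using Cons.prems L by (intro stable_blocks_avg[OF G]) fastforce
  have "block_barrier H b p \<le> block_barrier G b y" unfolding block_barrier_def using b(1) p(2) by (intro sum_mono) auto
  then have PH: "block_barrier H b p \<le> \<phi>" using b by simp
  define H' where "H' = (block_avg b \<beta> ^^ m) H"
  obtain \<sigma> where \<sigma>: "\<sigma> \<ge> 0" "\<sigma> \<ge> \<delta> * (m - 2 * K\<^sup>2 * (\<phi> - block_barrier H' b (vadd p (- \<sigma>) (ind b))) / \<phi>)"
    "stable I H'" "above_roots I H' (vadd p (- \<sigma>) (ind b))" "\<And>j. j \<in> I \<Longrightarrow> barrier H' j (vadd p (- \<sigma>) (ind b)) \<le> barrier H j p"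
    using block_down[OF H p(1) b(1) b0 \<phi> PH K \<delta>, of \<beta> m] \<beta> b(2) by (auto simp: Let_def H'_def)
  let ?p = "vadd p (- \<sigma>) (ind b)"
  have \<delta>0: "\<delta> \<ge> 0" using \<delta> \<phi> by simp
  have "2 * K\<^sup>2 * (\<phi> - block_barrier H' b ?p) / \<phi> \<le> 2 * K\<^sup>2 * (\<phi> - 0) / \<phi>"
    using \<phi> block_barrier_nonneg[OF \<sigma>(3,4) b(1)] by (intro divide_right_mono mult_left_mono) auto
  then have "\<delta> * (m - 2 * K\<^sup>2) \<le> \<delta> * (m - 2 * K\<^sup>2 * (\<phi> - block_barrier H' b ?p) / \<phi>)"
    using \<delta>0 \<phi> by (intro mult_left_mono) auto
  then have \<sigma>m: "\<sigma> \<ge> \<delta> * (m - 2 * K\<^sup>2)" using \<sigma>(2) by linarith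
  have le: "?p i \<le> p i" for i using \<sigma>(1) by (simp add: vadd_def ind_def)
  show ?case
  proof (intro exI[of _ ?p] conjI ballI allI)
    show "above_roots I (blocks_avg m \<beta> (b # bs) G) ?p" using \<sigma>(4) by (simp add: H'_def H_def)
    show "barrier (blocks_avg m \<beta> (b # bs) G) j ?p \<le> barrier G j y" if "j \<in> I" for j
      using \<sigma>(5)[OF that] p(2)[OF that] by (simp add: H'_def H_def)
    show "?p i \<le> y i" for i using le[of i] p(3)[of i] by simp
    fix b' i assume "b' \<in> set (b # bs)" and i: "i \<in> b'"
    then consider "b' = b" | "b' \<in> set bs" by auto
    then show "?p i \<le> y i - \<delta> * (m - 2 * K\<^sup>2)"
    proof cases
      case 1
      then have "?p i = p i - \<sigma>" using i by (simp add: vadd_def ind_def)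
      then show ?thesis using \<sigma>m p(3)[of i] by linarith
    next
      case 2
      then show ?thesis using p(4)[OF 2 i] le[of i] by linarith
    qed
  qed
qed

lemma blocks_up:
  fixes L :: nat
  assumes G: "stable I G" and y: "above_roots I G y"
    and bs: "\<And>b. b \<in> set bs \<Longrightarrow> b \<subseteq> I \<and> card b = L \<and> block_barrier G b y \<le> 1 / 2" and L: "L > 0"
    and disj: "distinct bs" "disjoint (set bs)"
  shows "\<exists>p. above_roots I (blocks_avg 1 (- real L) bs G) p \<and> (\<forall>j\<in>I. barrier (blocks_avg 1 (- real L) bs G) j p \<le> barrier G j y)
      \<and> (\<forall>i. p i = y i + (if i \<in> \<Union>(set bs) then 2 else 0))"
  using bs disj
proof (induction bs)
  case Nil
  then show ?case using y by (intro exI[of _ y]) simp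
next
  case (Cons b bs)
  define H where "H = blocks_avg 1 (- real L) bs G"
  have "disjoint (set bs)" "distinct bs" using Cons.prems(2,3) by (auto simp: pairwise_insert disjoint_def)
  then obtain p where p: "above_roots I H p" "\<And>j. j \<in> I \<Longrightarrow> barrier H j p \<le> barrier G j y"
    "\<And>i. p i = y i + (if i \<in> \<Union>(set bs) then 2 else 0)"
    using Cons.IH[OF Cons.prems(1)[OF list.set_intros(2)]] unfolding H_def by blast
  have b: "b \<subseteq> I" "card b = L" "block_barrier G b y \<le> 1 / 2" using Cons.prems(1)[of b] by auto
  then have b0: "b \<noteq> {}" using L by auto
  have H: "stable I H" unfolding H_def using Cons.prems L by (intro stable_blocks_avg[OF G]) fastforce
  have "block_barrier H b p \<le> block_barrier G b y" unfolding block_barrier_def using b(1) p(2) by (intro sum_mono) auto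
  then have PH: "block_barrier H b p \<le> 1 / 2" using b by simp
  let ?p = "vadd p 2 (ind b)"
  have "block_barrier H b ?p \<le> block_barrier H b p" by (rule block_barrier_antimono[OF H p(1) _ b(1)]) (simp add: vadd_def ind_def)
  then have P2: "block_barrier H b ?p \<le> 1 / 2" using PH by simp
  have \<gamma>: "- 1 = - real L / card b" using b L by simp
  \<comment> \<open>With \<gamma> = -1 and block barrier at most 1/2 the factor is at least 1/2, so
    a shift by 2 suffices.\<close>
  note bu = barrier_up[OF H b(1) b0 \<gamma> p(1), of 2]
  show ?case
  proof (intro exI[of _ ?p] conjI ballI allI)
    show "above_roots I (blocks_avg 1 (- real L) (b # bs) G) ?p" using bu(1) P2 by (simp add: H_def)
    show "barrier (blocks_avg 1 (- real L) (b # bs) G) j ?p \<le> barrier G j y" if "j \<in> I" for j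
      using bu(2)[OF _ _ _ _ that] P2 p(2)[OF that] by (simp add: H_def)
    have "i \<notin> \<Union>(set bs)" if "i \<in> b" for i
      using Cons.prems(2,3) that by (auto simp: disjoint_def)
    then show "?p i = y i + (if i \<in> \<Union>(set (b # bs)) then 2 else 0)" for i
      using p(3)[of i] by (auto simp: vadd_def ind_def)
  qed
qed

section \<open>From averages back to single translates\<close>

text \<open>The averages are undone one at a time; n counts how often each coordinate was
  chosen.\<close>

lemma above_roots_block_avg_pow_imp:
  assumes G: "stable I G" and b: "b \<subseteq> I" "b \<noteq> {}" and y: "above_roots I ((block_avg b \<beta> ^^ m) G) y"
  shows "\<exists>n::'i \<Rightarrow> nat. (\<forall>i. i \<notin> b \<longrightarrow> n i = 0) \<and> sum n b = m \<and> above_roots I G (\<lambda>i. y i + \<beta> * n i)"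
  using y
proof (induction m arbitrary: y)
  case 0
  then show ?case by (intro exI[of _ "\<lambda>_. 0"]) simp
next
  case (Suc m)
  have fb: "finite b" using b(1) stable_finite[OF G] finite_subset by blast
  obtain i where i: "i \<in> b" "above_roots I ((block_avg b \<beta> ^^ m) G) (shift_at i \<beta> y)"
    using above_roots_block_avg_imp[OF stable_block_avg_pow[OF G b] b refl, where \<beta> = \<beta> and y = y] Suc.prems by auto
  obtain n :: "'i \<Rightarrow> nat" where n: "\<forall>i. i \<notin> b \<longrightarrow> n i = 0" "sum n b = m" "above_roots I G (\<lambda>k. shift_at i \<beta> y k + \<beta> * n k)"
    using Suc.IH[OF i(2)] by blast
  have "(\<lambda>k. shift_at i \<beta> y k + \<beta> * n k) = (\<lambda>k. y k + \<beta> * (n(i := Suc (n i))) k)"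
    by (auto simp: shift_at_def algebra_simps)
  moreover have "sum (n(i := Suc (n i))) b = Suc m"
  proof -
    have "sum (n(i := Suc (n i))) b = Suc (n i) + sum (n(i := Suc (n i))) (b - {i})"
      using fb i(1) by (subst sum.remove) auto
    also have "sum (n(i := Suc (n i))) (b - {i}) = sum n (b - {i})" by (intro sum.cong) auto
    also have "Suc (n i) + \<dots> = Suc (sum n b)" using sum.remove[OF fb i(1), of n] by simp
    finally show ?thesis using n(2) by simp
  qed
  ultimately show ?case using n i by (intro exI[of _ "n(i := Suc (n i))"]) auto
qed

lemma above_roots_blocks_avg_imp:
  assumes G: "stable I G" and bs: "\<And>b. b \<in> set bs \<Longrightarrow> b \<subseteq> I \<and> b \<noteq> {}"
    and disj: "distinct bs" "disjoint (set bs)" and y: "above_roots I (blocks_avg m \<beta> bs G) y"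
  shows "\<exists>n::'i \<Rightarrow> nat. (\<forall>i. i \<notin> \<Union>(set bs) \<longrightarrow> n i = 0) \<and> (\<forall>b\<in>set bs. sum n b = m) \<and>
     above_roots I G (\<lambda>i. y i + \<beta> * n i)"
  using bs disj y
proof (induction bs arbitrary: y)
  case Nil
  then show ?case by (intro exI[of _ "\<lambda>_. 0"]) simp
next
  case (Cons b bs)
  have b: "b \<subseteq> I" "b \<noteq> {}" using Cons.prems by auto
  have gH: "stable I (blocks_avg m \<beta> bs G)" using Cons.prems by (intro stable_blocks_avg[OF G]) auto
  obtain n0 :: "'i \<Rightarrow> nat" where n0: "\<forall>i. i \<notin> b \<longrightarrow> n0 i = 0" "sum n0 b = m"
    "above_roots I (blocks_avg m \<beta> bs G) (\<lambda>i. y i + \<beta> * n0 i)"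
    using above_roots_block_avg_pow_imp[OF gH b] Cons.prems(4) unfolding blocks_avg_simps by blast
  have "disjoint (set bs)" "distinct bs" using Cons.prems(2,3) by (auto simp: disjoint_def)
  then obtain n1 :: "'i \<Rightarrow> nat" where n1: "\<forall>i. i \<notin> \<Union>(set bs) \<longrightarrow> n1 i = 0" "\<forall>b\<in>set bs. sum n1 b = m"
    "above_roots I G (\<lambda>i. y i + \<beta> * n0 i + \<beta> * n1 i)"
    using Cons.IH[OF _ _ _ n0(3)] Cons.prems(1) by auto
  have dj: "b \<inter> b' = {}" if "b' \<in> set bs" for b'
    using Cons.prems(2,3) that by (auto simp: disjoint_def)
  have "sum (\<lambda>i. n0 i + n1 i) b' = m" if b': "b' \<in> set (b # bs)" for b'
  proof (cases "b' = b")
    case True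
    have "sum n1 b = 0" using n1(1) dj by (intro sum.neutral) blast
    then show ?thesis using True n0(2) by (simp add: sum.distrib)
  next
    case False
    then have "b' \<in> set bs" using b' by simp
    moreover have "sum n0 b' = 0" using n0(1) dj[OF calculation] by (intro sum.neutral) blast
    ultimately show ?thesis using n1(2) by (simp add: sum.distrib)
  qed
  then show ?case using n0 n1 by (intro exI[of _ "\<lambda>i. n0 i + n1 i"]) (auto simp: algebra_simps)
qed

section \<open>Determinants of Hermitian matrices\<close>

definition mat_vec :: "nat \<Rightarrow> (nat \<Rightarrow> nat \<Rightarrow> complex) \<Rightarrow> (nat \<Rightarrow> complex) \<Rightarrow> nat \<Rightarrow> complex" where
  "mat_vec N A x i = (\<Sum>j<N. A i j * x j)"

definition fun_det :: "nat \<Rightarrow> (nat \<Rightarrow> nat \<Rightarrow> complex) \<Rightarrow> complex" where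
  "fun_det N A = Determinant.det (mat N N (\<lambda>(i, j). A i j))"

lemma fun_det_expand:
  "fun_det N A = (\<Sum>p\<in>{p. p permutes {..<N}}. of_int (sign p) * (\<Prod>i<N. A i (p i)))"
proof -
  have "fun_det N A = (\<Sum>p\<in>{p. p permutes {0..<N}}.
      of_int (sign p) * (\<Prod>i = 0..<N. (mat N N (\<lambda>(i, j). A i j)) $$ (i, p i)))"
    unfolding fun_det_def by (rule det_def') simp
  also have "\<dots> = (\<Sum>p\<in>{p. p permutes {0..<N}}. of_int (sign p) * (\<Prod>i = 0..<N. A i (p i)))"
  proof (intro sum.cong refl arg_cong2[of _ _ _ _ times] prod.cong)
    fix p i assume p: "p \<in> {p. p permutes {0..<N}}" and i: "i \<in> {0..<N}"
    then have "p i \<in> {0..<N}" by (simp only: mem_Collect_eq permutes_in_image)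
    then show "mat N N (\<lambda>(i, j). A i j) $$ (i, p i) = A i (p i)" using i by simp
  qed
  finally show ?thesis by (simp add: lessThan_atLeast0)
qed

lemma fun_det_transpose: "fun_det N (\<lambda>i j. A j i) = fun_det N A"
proof -
  have "mat N N (\<lambda>(i, j). A j i) = transpose_mat (mat N N (\<lambda>(i, j). A i j))" by auto
  then show ?thesis unfolding fun_det_def by (simp add: det_transpose[of _ N])
qed

lemma mult_mat_vec_mat_vec:
  "mat N N (\<lambda>(i, j). A i j) *\<^sub>v Matrix.vec N x = Matrix.vec N (mat_vec N A x)"
  by (intro eq_vecI) (auto simp: mat_vec_def scalar_prod_def lessThan_atLeast0 intro!: sum.cong)

lemma fun_det_zero_iff:
  "fun_det N A = 0 \<longleftrightarrow> (\<exists>x. (\<exists>i<N. x i \<noteq> 0) \<and> (\<forall>i<N. mat_vec N A x i = 0))"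
proof -
  have "fun_det N A = 0 \<longleftrightarrow> (\<exists>v. v \<in> carrier_vec N \<and> v \<noteq> 0\<^sub>v N \<and> mat N N (\<lambda>(i, j). A i j) *\<^sub>v v = 0\<^sub>v N)"
    unfolding fun_det_def by (rule det_0_iff_vec_prod_zero) simp
  also have "\<dots> \<longleftrightarrow> (\<exists>x. (\<exists>i<N. x i \<noteq> 0) \<and> (\<forall>i<N. mat_vec N A x i = 0))"
  proof safe
    fix v :: "complex Matrix.vec" assume v: "v \<in> carrier_vec N" "v \<noteq> 0\<^sub>v N"
      and z: "mat N N (\<lambda>(i, j). A i j) *\<^sub>v v = 0\<^sub>v N"
    let ?x = "\<lambda>i. vec_index v i"
    have vx: "v = Matrix.vec N ?x" using v(1) by auto
    have "\<exists>i<N. ?x i \<noteq> 0" using v by (metis carrier_vecD eq_vecI index_zero_vec)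
    moreover have "mat_vec N A ?x i = 0" if "i < N" for i
    proof -
      have "Matrix.vec N (mat_vec N A ?x) = 0\<^sub>v N" using z vx mult_mat_vec_mat_vec[of N A ?x] by metis
      then have "vec_index (Matrix.vec N (mat_vec N A ?x)) i = vec_index (0\<^sub>v N) i" by simp
      then show ?thesis using that by simp
    qed
    ultimately show "\<exists>x. (\<exists>i<N. x i \<noteq> 0) \<and> (\<forall>i<N. mat_vec N A x i = 0)" by blast
  next
    fix x i assume i: "i < N" "x i \<noteq> 0" and z: "\<forall>i<N. mat_vec N A x i = 0"
    have "Matrix.vec N x \<noteq> 0\<^sub>v N"
    proof
      assume "Matrix.vec N x = 0\<^sub>v N"
      then have "vec_index (Matrix.vec N x) i = vec_index (0\<^sub>v N) i" by simp
      then show False using i by simp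
    qed
    moreover have "Matrix.vec N (mat_vec N A x) = 0\<^sub>v N" using z by auto
    ultimately show "\<exists>v. v \<in> carrier_vec N \<and> v \<noteq> 0\<^sub>v N \<and> mat N N (\<lambda>(i, j). A i j) *\<^sub>v v = 0\<^sub>v N"
      by (intro exI[of _ "Matrix.vec N x"]) (simp add: mult_mat_vec_mat_vec)
  qed
  finally show ?thesis .
qed

lemma fun_det_inverse:
  assumes "fun_det N A \<noteq> 0"
  obtains V where "\<And>i j. i < N \<Longrightarrow> j < N \<Longrightarrow> (\<Sum>k<N. A i k * V k j) = (if i = j then 1 else 0)"
    "\<And>i j. i < N \<Longrightarrow> j < N \<Longrightarrow> (\<Sum>k<N. V i k * A k j) = (if i = j then 1 else 0)"
proof -
  let ?A = "mat N N (\<lambda>(i, j). A i j)"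
  have "?A \<in> Units (ring_mat TYPE(complex) N ())"
    using assms unfolding fun_det_def by (intro det_non_zero_imp_unit) auto
  then obtain B where B: "B \<in> carrier_mat N N" "B * ?A = 1\<^sub>m N" "?A * B = 1\<^sub>m N"
    unfolding Units_def ring_mat_def by auto
  have *: "(\<Sum>k<N. (X $$ (i, k)) * (Y $$ (k, j))) = (if i = j then 1 else 0)"
    if "X \<in> carrier_mat N N" "Y \<in> carrier_mat N N" "X * Y = 1\<^sub>m N" "i < N" "j < N"
    for X Y :: "complex mat" and i j
  proof -
    have "(\<Sum>k<N. (X $$ (i, k)) * (Y $$ (k, j))) = (X * Y) $$ (i, j)"
      using that(1,2,4,5) by (simp add: scalar_prod_def lessThan_atLeast0)
    also have "\<dots> = 1\<^sub>m N $$ (i, j)" by (simp only: that(3))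
    also have "\<dots> = (if i = j then 1 else 0)" using that(4,5) by simp
    finally show ?thesis .
  qed
  show thesis
  proof (rule that[of "\<lambda>i j. B $$ (i, j)"])
    fix i j assume ij: "i < N" "j < N"
    show "(\<Sum>k<N. A i k * B $$ (k, j)) = (if i = j then 1 else 0)"
      using *[OF _ B(1) B(3) ij] ij by simp
    show "(\<Sum>k<N. B $$ (i, k) * A k j) = (if i = j then 1 else 0)"
      using *[OF B(1) _ B(2) ij] ij by simp
  qed
qed

definition herm :: "nat \<Rightarrow> (nat \<Rightarrow> nat \<Rightarrow> complex) \<Rightarrow> bool" where
  "herm N A \<longleftrightarrow> (\<forall>i<N. \<forall>j<N. A j i = cnj (A i j))"

lemma hermD: "herm N A \<Longrightarrow> i < N \<Longrightarrow> j < N \<Longrightarrow> cnj (A i j) = A j i"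
  unfolding herm_def by metis

definition sform :: "nat \<Rightarrow> (nat \<Rightarrow> nat \<Rightarrow> complex) \<Rightarrow> (nat \<Rightarrow> complex) \<Rightarrow> (nat \<Rightarrow> complex) \<Rightarrow> complex" where
  "sform N A u v = (\<Sum>i<N. cnj (u i) * mat_vec N A v i)"

definition qf :: "nat \<Rightarrow> (nat \<Rightarrow> nat \<Rightarrow> complex) \<Rightarrow> (nat \<Rightarrow> complex) \<Rightarrow> real" where
  "qf N A x = Re (sform N A x x)"

definition nsq :: "nat \<Rightarrow> (nat \<Rightarrow> complex) \<Rightarrow> real" where
  "nsq N x = (\<Sum>i<N. (cmod (x i))\<^sup>2)"

definition add_diag :: "(nat \<Rightarrow> complex) \<Rightarrow> (nat \<Rightarrow> nat \<Rightarrow> complex) \<Rightarrow> nat \<Rightarrow> nat \<Rightarrow> complex" where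
  "add_diag y M i j = (if i = j then y i else 0) + M i j"

definition diag_det :: "nat \<Rightarrow> (nat \<Rightarrow> nat \<Rightarrow> complex) \<Rightarrow> (nat \<Rightarrow> complex) \<Rightarrow> complex" where
  "diag_det N M y = fun_det N (add_diag y M)"

lemma mat_vec_add_diag: "i < N \<Longrightarrow> mat_vec N (add_diag y M) x i = y i * x i + mat_vec N M x i"
  by (simp add: mat_vec_def add_diag_def distrib_right sum.distrib if_distrib[of "\<lambda>c. c * _"] cong: if_cong)

lemma sform_cnj: assumes "herm N A" shows "sform N A v u = cnj (sform N A u v)"
proof -
  have "cnj (sform N A u v) = (\<Sum>i<N. \<Sum>j<N. u i * (cnj (A i j) * cnj (v j)))"
    by (simp add: sform_def mat_vec_def sum_distrib_left)
  also have "\<dots> = (\<Sum>i<N. \<Sum>j<N. u i * (A j i * cnj (v j)))"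
    using assms by (intro sum.cong refl) (simp add: hermD)
  also have "\<dots> = (\<Sum>j<N. \<Sum>i<N. u i * (A j i * cnj (v j)))" by (rule sum.swap)
  also have "\<dots> = sform N A v u" by (simp add: sform_def mat_vec_def sum_distrib_left mult_ac)
  finally show ?thesis by simp
qed

lemma sform_real: "herm N A \<Longrightarrow> sform N A x x = of_real (qf N A x)"
  using sform_cnj[of N A x x] by (simp add: qf_def complex_eq_iff)

lemma nsq_nonneg: "nsq N x \<ge> 0"
  by (simp add: nsq_def sum_nonneg)

lemma cnj_mult_self: "cnj z * z = (complex_of_real (cmod z))\<^sup>2" "cnj z * (a * z) = a * (complex_of_real (cmod z))\<^sup>2"
  using complex_norm_square[of z] by (simp_all add: mult_ac)

lemma nsq_complex: "(\<Sum>i<N. cnj (x i) * x i) = of_real (nsq N x)"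
  by (simp add: nsq_def cnj_mult_self)

lemma nsq_pos: "i < N \<Longrightarrow> x i \<noteq> 0 \<Longrightarrow> nsq N x > 0"
  unfolding nsq_def by (intro sum_pos2[of _ i]) auto

lemma sform_add: "sform N A (\<lambda>i. u i + c * v i) w = sform N A u w + cnj c * sform N A v w"
  by (simp add: sform_def distrib_right sum.distrib sum_distrib_left mult.assoc)

lemma mat_vec_add: "mat_vec N A (\<lambda>i. u i + c * v i) k = mat_vec N A u k + c * mat_vec N A v k"
  by (simp add: mat_vec_def distrib_left sum.distrib sum_distrib_left mult.left_commute)

lemma sform_add_right: "sform N A w (\<lambda>i. u i + c * v i) = sform N A w u + c * sform N A w v"
  by (simp add: sform_def mat_vec_add distrib_left sum.distrib sum_distrib_left mult.left_commute)

lemma multiaffine_prod_linear: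
  fixes \<alpha> \<beta> :: "'i \<Rightarrow> 'a::comm_ring_1"
  assumes "finite J" shows "multiaffine I (\<lambda>y. \<Prod>i\<in>J. \<alpha> i * y i + \<beta> i)"
  unfolding multiaffine_def pdiff_def
proof (intro ballI allI)
  fix k :: 'i and y :: "'i \<Rightarrow> 'a" and v
  show "(\<Prod>i\<in>J. \<alpha> i * shift_at k v y i + \<beta> i) = (\<Prod>i\<in>J. \<alpha> i * y i + \<beta> i) +
      v * ((\<Prod>i\<in>J. \<alpha> i * shift_at k 1 y i + \<beta> i) - (\<Prod>i\<in>J. \<alpha> i * y i + \<beta> i))"
  proof (cases "k \<in> J")
    case True
    have r: "(\<Prod>i\<in>J. \<alpha> i * shift_at k w y i + \<beta> i) = (\<alpha> k * (y k + w) + \<beta> k) * (\<Prod>i\<in>J-{k}. \<alpha> i * y i + \<beta> i)" for w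
    proof -
      have "(\<Prod>i\<in>J - {k}. \<alpha> i * shift_at k w y i + \<beta> i) = (\<Prod>i\<in>J - {k}. \<alpha> i * y i + \<beta> i)"
        by (intro prod.cong) (auto simp: shift_at_def)
      then show ?thesis using prod.remove[OF assms True, of "\<lambda>i. \<alpha> i * shift_at k w y i + \<beta> i"] by (simp add: shift_at_def)
    qed
    have r0: "(\<Prod>i\<in>J. \<alpha> i * y i + \<beta> i) = (\<alpha> k * y k + \<beta> k) * (\<Prod>i\<in>J-{k}. \<alpha> i * y i + \<beta> i)"
      by (rule prod.remove[OF assms True])
    show ?thesis unfolding r r0 by (simp add: algebra_simps)
  next
    case False
    then have "(\<Prod>i\<in>J. \<alpha> i * shift_at k w y i + \<beta> i) = (\<Prod>i\<in>J. \<alpha> i * y i + \<beta> i)" for w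
      by (intro prod.cong) (auto simp: shift_at_def)
    then show ?thesis by simp
  qed
qed

lemma prod_linear_poly:
  fixes a b :: "'i \<Rightarrow> 'a::comm_ring_1"
  assumes "finite J"
  shows "degree (\<Prod>i\<in>J. [:a i, b i:]) \<le> card J \<and> coeff (\<Prod>i\<in>J. [:a i, b i:]) (card J) = (\<Prod>i\<in>J. b i)"
  using assms
proof (induction J rule: finite_induct)
  case (insert j J)
  let ?q = "\<Prod>i\<in>J. [:a i, b i:]"
  have "degree ([:a j, b j:] * ?q) \<le> degree [:a j, b j:] + degree ?q" by (rule degree_mult_le)
  also have "\<dots> \<le> 1 + card J" using insert.IH by (intro add_mono) auto
  finally have d: "degree ([:a j, b j:] * ?q) \<le> Suc (card J)" by simp
  have "coeff ?q (Suc (card J)) = 0" using insert.IH by (intro coeff_eq_0) auto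
  then have "coeff ([:a j, b j:] * ?q) (Suc (card J)) = b j * coeff ?q (card J)" by simp
  then show ?case using d insert by simp
qed simp

text \<open>The difference to the coefficientwise conjugate vanishes on the whole real line, hence
  identically.\<close>

lemma real_poly_of_real_values:
  assumes "\<And>s. poly P (complex_of_real s) \<in> \<real>"
  shows "cpoly (map_poly Re P) = P"
proof -
  let ?Q = "map_poly cnj P"
  have Q: "poly ?Q (cnj z) = cnj (poly P z)" for z
    by (induction P) (auto simp: map_poly_pCons)
  have "P - ?Q = 0"
  proof (rule ccontr)
    assume "P - ?Q \<noteq> 0"
    then have "finite {z. poly (P - ?Q) z = 0}" by (rule poly_roots_finite)
    moreover have "poly (P - ?Q) (of_real s) = 0" for s
      using Q[of "of_real s"] assms[of s] by (simp add: Reals_cnj_iff)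
    then have "range complex_of_real \<subseteq> {z. poly (P - ?Q) z = 0}" by auto
    ultimately have "finite (range complex_of_real)" by (rule rev_finite_subset)
    then have "finite (UNIV :: real set)" by (rule finite_imageD) (simp add: inj_on_def)
    then show False by (simp add: infinite_UNIV_char_0)
  qed
  then have "coeff P k = cnj (coeff P k)" for k by (metis coeff_map_poly complex_cnj_zero eq_iff_diff_eq_0)
  then have "coeff P k = of_real (Re (coeff P k))" for k by (metis Reals_cnj_iff complex_is_Real_iff of_real_Re)
  then show ?thesis by (intro poly_eqI) (simp add: coeff_map_poly)
qed

lemma diag_det_expand:
  "diag_det N M y = (\<Sum>p\<in>{p. p permutes {..<N}}. of_int (sign p) *
     (\<Prod>i<N. (if i = p i then 1 else 0) * y i + M i (p i)))"
  unfolding diag_det_def fun_det_expand add_diag_def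
  by (intro sum.cong refl arg_cong2[of _ _ _ _ times] prod.cong) auto

lemma diag_det_zero_iff: "diag_det N M y = 0 \<longleftrightarrow> (\<exists>x. (\<exists>i<N. x i \<noteq> 0) \<and> (\<forall>i<N. y i * x i + mat_vec N M x i = 0))"
  unfolding diag_det_def fun_det_zero_iff by (simp add: mat_vec_add_diag)

lemma diag_det_real:
  assumes M: "herm N M" and y: "\<And>i. y i \<in> \<real>" shows "diag_det N M y \<in> \<real>"
proof -
  have "cnj (diag_det N M y) = fun_det N (\<lambda>i j. cnj (add_diag y M i j))"
    unfolding diag_det_def fun_det_expand by simp
  also have "\<dots> = fun_det N (\<lambda>i j. add_diag y M j i)"
  proof -
    have "cnj (add_diag y M i j) = add_diag y M j i" if "i < N" "j < N" for i j
      using hermD[OF M that] y[of i] unfolding add_diag_def by (auto simp: Reals_cnj_iff)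
    then show ?thesis unfolding fun_det_expand
      by (intro sum.cong refl arg_cong2[of _ _ _ _ times] prod.cong) (auto simp: permutes_in_image[of _ "{..<N}", simplified])
  qed
  also have "\<dots> = diag_det N M y" unfolding diag_det_def by (rule fun_det_transpose)
  finally show ?thesis by (simp add: Reals_cnj_iff)
qed

text \<open>A kernel vector x would give 0 as the value of x* (diag y + M) x, whose imaginary part
  is the sum of Im(y i) |x i|^2, because the form of M is real. This sum is positive in the
  forbidden region.\<close>

lemma stable_diag_det:
  assumes M: "herm N M" shows "stable {..<N} (diag_det N M)"
  unfolding stable_def
proof (intro conjI allI impI)
  show "finite {..<N}" by simp
  show "multiaffine {..<N} (diag_det N M)"
    unfolding diag_det_expand[abs_def] by (intro multiaffine_sum multiaffine_prod_linear) auto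
next
  fix y y' :: "nat \<Rightarrow> complex" assume "\<forall>i\<in>{..<N}. y i = y' i"
  then show "diag_det N M y = diag_det N M y'"
    unfolding diag_det_expand by (intro sum.cong refl arg_cong2[of _ _ _ _ times] prod.cong) auto
next
  fix y :: "nat \<Rightarrow> complex" assume y: "\<forall>i\<in>{..<N}. Im (y i) > 0"
  show "diag_det N M y \<noteq> 0"
  proof
    assume "diag_det N M y = 0"
    then obtain x i where x: "i < N" "x i \<noteq> 0" "\<And>i. i < N \<Longrightarrow> y i * x i + mat_vec N M x i = 0"
      unfolding diag_det_zero_iff by blast
    have "0 = (\<Sum>i<N. cnj (x i) * (y i * x i + mat_vec N M x i))" using x(3) by simp
    also have "\<dots> = (\<Sum>i<N. y i * of_real ((cmod (x i))\<^sup>2)) + of_real (qf N M x)"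
      unfolding sform_real[OF M, symmetric] sform_def
      by (simp add: distrib_left sum.distrib cnj_mult_self)
    finally have "Im ((\<Sum>i<N. y i * of_real ((cmod (x i))\<^sup>2)) + of_real (qf N M x)) = 0" by simp
    then have "(\<Sum>i<N. Im (y i) * (cmod (x i))\<^sup>2) = 0" by simp
    moreover have "(\<Sum>i<N. Im (y i) * (cmod (x i))\<^sup>2) > 0"
      using y x by (intro sum_pos2[of _ i]) (auto simp: less_imp_le)
    ultimately show False by simp
  qed
next
  fix y u :: "nat \<Rightarrow> real"
  define \<alpha> where "\<alpha> p i = (if i = p i then 1 else 0 :: complex)" for p :: "nat \<Rightarrow> nat" and i
  define Q where "Q p = (\<Prod>i<N. [:\<alpha> p i * of_real (y i) + M i (p i), \<alpha> p i * of_real (u i):])" for p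
  define P where "P = (\<Sum>p\<in>{p. p permutes {..<N}}. Polynomial.smult (of_int (sign p)) (Q p))"
  have fin: "finite {p. p permutes {..<N}}" by (simp add: finite_permutations)
  have Q: "degree (Q p) \<le> N" "coeff (Q p) N = (\<Prod>i<N. \<alpha> p i * of_real (u i))" for p
    using prod_linear_poly[of "{..<N}" "\<lambda>i. \<alpha> p i * of_real (y i) + M i (p i)" "\<lambda>i. \<alpha> p i * of_real (u i)"]
    by (auto simp: Q_def)
  have Ps: "poly P s = diag_det N M (\<lambda>i. of_real (y i) + s * of_real (u i))" for s
    unfolding P_def Q_def diag_det_expand poly_sum
    by (intro sum.cong refl) (simp add: poly_prod \<alpha>_def algebra_simps cong: if_cong)
  have dP: "degree P \<le> N"
    unfolding P_def using Q(1) by (intro degree_sum_le[OF fin]) (meson degree_smult_le order_trans)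
  have cP: "coeff P N = of_real (\<Prod>i<N. u i)"
  proof -
    have "coeff P N = (\<Sum>p\<in>{p. p permutes {..<N}}. of_int (sign p) * (\<Prod>i<N. \<alpha> p i * of_real (u i)))"
      by (simp add: P_def coeff_sum Q)
    \<comment> \<open>Any other permutation moves some i, whose factor is then free of the line
      variable.\<close>
    also have "\<dots> = (\<Sum>p\<in>{id}. of_int (sign p) * (\<Prod>i<N. \<alpha> p i * of_real (u i)))"
    proof (rule sum.mono_neutral_right[OF fin])
      show "{id} \<subseteq> {p. p permutes {..<N}}" by (auto simp: permutes_id)
      show "\<forall>p\<in>{p. p permutes {..<N}} - {id}. of_int (sign p) * (\<Prod>i<N. \<alpha> p i * of_real (u i)) = 0"
      proof
        fix p assume p: "p \<in> {p. p permutes {..<N}} - {id}"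
        then obtain i where "p i \<noteq> i" by (auto simp: fun_eq_iff)
        moreover have "i < N" using p \<open>p i \<noteq> i\<close> permutes_not_in[of p "{..<N}" i] by auto
        ultimately have "(\<Prod>i<N. \<alpha> p i * of_real (u i)) = 0"
          by (intro prod_zero) (auto simp: \<alpha>_def intro!: bexI[of _ i])
        then show "of_int (sign p) * (\<Prod>i<N. \<alpha> p i * of_real (u i)) = 0" by simp
      qed
    qed
    also have "\<dots> = of_real (\<Prod>i<N. u i)" by (simp add: \<alpha>_def sign_id)
    finally show ?thesis .
  qed
  have "poly P (of_real s) \<in> \<real>" for s
    unfolding Ps by (intro diag_det_real[OF M]) auto
  then have cp: "cpoly (map_poly Re P) = P" by (rule real_poly_of_real_values)
  show "\<exists>p. degree p \<le> card {..<N} \<and> coeff p (card {..<N}) = (\<Prod>i\<in>{..<N}. u i) \<and>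
      (\<forall>s. poly (cpoly p) s = diag_det N M (\<lambda>i. of_real (y i) + s * of_real (u i)))"
  proof (intro exI[of _ "map_poly Re P"] conjI allI)
    have "coeff (map_poly Re P) k = 0" if "N < k" for k
      using dP that by (simp add: coeff_map_poly coeff_eq_0)
    then have "degree (map_poly Re P) \<le> N" by (intro degree_le) blast
    then show "degree (map_poly Re P) \<le> card {..<N}" by simp
    show "coeff (map_poly Re P) (card {..<N}) = (\<Prod>i\<in>{..<N}. u i)" by (simp add: coeff_map_poly cP del: of_real_prod)
    show "poly (cpoly (map_poly Re P)) s = diag_det N M (\<lambda>i. of_real (y i) + s * of_real (u i))" for s
      unfolding cp by (rule Ps)
  qed
qed

section \<open>Positive definite diagonal shifts\<close>

definition diag_form :: "nat \<Rightarrow> (nat \<Rightarrow> nat \<Rightarrow> complex) \<Rightarrow> (nat \<Rightarrow> real) \<Rightarrow> (nat \<Rightarrow> complex) \<Rightarrow> real" where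
  "diag_form N M y x = (\<Sum>i<N. y i * (cmod (x i))\<^sup>2) + qf N M x"

lemma diag_form_kernel:
  assumes M: "herm N M" and z: "\<And>i. i < N \<Longrightarrow> of_real (y i) * x i + mat_vec N M x i = 0"
  shows "diag_form N M y x = 0"
proof -
  have "0 = (\<Sum>i<N. cnj (x i) * (of_real (y i) * x i + mat_vec N M x i))" using z by simp
  also have "\<dots> = (\<Sum>i<N. of_real (y i * (cmod (x i))\<^sup>2)) + of_real (qf N M x)"
    unfolding sform_real[OF M, symmetric] sform_def
    by (simp add: distrib_left sum.distrib cnj_mult_self)
  also have "\<dots> = of_real (diag_form N M y x)" by (simp add: diag_form_def)
  finally show ?thesis by simp
qed

definition posdef :: "nat \<Rightarrow> (nat \<Rightarrow> nat \<Rightarrow> complex) \<Rightarrow> (nat \<Rightarrow> real) \<Rightarrow> bool" where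
  "posdef N M y \<longleftrightarrow> (\<forall>x. (\<exists>i<N. x i \<noteq> 0) \<longrightarrow> diag_form N M y x > 0)"

lemma posdef_mono: "posdef N M y \<Longrightarrow> (\<And>i. i < N \<Longrightarrow> y i \<le> y' i) \<Longrightarrow> posdef N M y'"
  unfolding posdef_def
proof (intro allI impI)
  fix x assume pdef: "\<forall>x. (\<exists>i<N. x i \<noteq> 0) \<longrightarrow> 0 < diag_form N M y x" and le: "\<And>i. i < N \<Longrightarrow> y i \<le> y' i"
    and x: "\<exists>i<N. x i \<noteq> (0::complex)"
  have "diag_form N M y x \<le> diag_form N M y' x"
    unfolding diag_form_def using le by (intro add_right_mono sum_mono mult_right_mono) auto
  then show "0 < diag_form N M y' x" using pdef x by (meson less_le_trans)
qed

text \<open>Along the all-ones direction the polynomial is monic, and a root s at least 0 would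
  produce a kernel vector of a positive definite form. Its coefficients are therefore positive,
  among them the constant one.\<close>

lemma posdef_re_val_pos:
  assumes M: "herm N M" and pdef: "posdef N M y" shows "re_val (diag_det N M) y > 0"
proof -
  obtain g where g: "degree g = card {..<N}" "coeff g (card {..<N}) = (\<Prod>i\<in>{..<N}. 1)" "real_rooted g"
    "\<And>s. poly g s = re_val (diag_det N M) (vadd y s (\<lambda>_. 1))"
    by (rule stable_line_real[OF stable_diag_det[OF M], of "\<lambda>_. 1" y]) auto
  have "pos_coeffs g"
  proof (rule real_rooted_pos_coeffs[OF g(3)])
    show "lead_coeff g > 0" using g(1,2) by simp
    fix s :: real assume s: "s \<ge> 0"
    have pd': "posdef N M (vadd y s (\<lambda>_. 1))" using pdef s by (rule_tac posdef_mono) (auto simp: vadd_def)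
    show "poly g s \<noteq> 0"
    proof
      assume "poly g s = 0"
      then have "diag_det N M (\<lambda>i. of_real (vadd y s (\<lambda>_. 1) i)) = 0"
        using g(4) stable_real[OF stable_diag_det[OF M]] by simp
      then obtain x where "\<exists>i<N. x i \<noteq> 0"
        "\<And>i. i < N \<Longrightarrow> of_real (vadd y s (\<lambda>_. 1) i) * x i + mat_vec N M x i = 0"
        unfolding diag_det_zero_iff by blast
      then show False using diag_form_kernel[OF M] pd' unfolding posdef_def by (metis less_irrefl)
    qed
  qed
  then have "coeff g 0 > 0" by (simp add: pos_coeffs_def)
  then show ?thesis using g(4)[of 0] by (simp add: poly_0_coeff_0)
qed

lemma posdef_above_roots:
  assumes M: "herm N M" and pdef: "posdef N M y" shows "above_roots {..<N} (diag_det N M) y"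
  unfolding above_roots_def
proof (intro conjI allI impI)
  show "re_val (diag_det N M) y > 0" by (rule posdef_re_val_pos[OF M pdef])
  fix u :: "nat \<Rightarrow> real" assume "\<forall>i\<in>{..<N}. 0 \<le> u i"
  then have "posdef N M (vadd y 1 u)" using pdef by (rule_tac posdef_mono) (auto simp: vadd_def)
  then show "re_val (diag_det N M) (vadd y 1 u) \<ge> 0" using posdef_re_val_pos[OF M] by (simp add: less_imp_le)
qed

text \<open>The hypothesis says that the form stays nonnegative when \<open>y j\<close> is lowered
  by 1/r. The determinant is then still nonnegative, and being affine in \<open>y j\<close> it
  equals the old value minus 1/r times the partial derivative. Strict definiteness is restored by
  adding \<epsilon> to the diagonal.\<close>

lemma barrier_diag_det_le:
  assumes M: "herm N M" and pdef: "posdef N M y" and j: "j < N" and r: "r > 0"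
    and le: "\<And>x. (cmod (x j))\<^sup>2 \<le> r * diag_form N M y x"
  shows "barrier (diag_det N M) j y \<le> r"
proof -
  note G = stable_diag_det[OF M]
  let ?z = "shift_at j (- 1 / r) y"
  have "re_val (diag_det N M) ?z \<ge> 0"
  proof (rule tendsto_lowerbound[OF regular_tendsto[OF regular_re_val[OF G], of ?z "\<lambda>_. 1"]])
    show "eventually (\<lambda>\<epsilon>. re_val (diag_det N M) (vadd ?z \<epsilon> (\<lambda>_. 1)) \<ge> 0) (at_right 0)"
      using eventually_at_right_less[of "0::real"]
    proof eventually_elim
      case (elim \<epsilon>)
      have "posdef N M (vadd ?z \<epsilon> (\<lambda>_. 1))" unfolding posdef_def
      proof (intro allI impI)
        fix x :: "nat \<Rightarrow> complex" assume "\<exists>i<N. x i \<noteq> 0"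
        then have "nsq N x > 0" using nsq_pos by blast
        have "diag_form N M (vadd ?z \<epsilon> (\<lambda>_. 1)) x =
            (\<Sum>i<N. y i * (cmod (x i))\<^sup>2 + (if i = j then - 1 / r * (cmod (x j))\<^sup>2 else 0) + \<epsilon> * (cmod (x i))\<^sup>2) + qf N M x"
          unfolding diag_form_def vadd_def shift_at_def
          by (intro arg_cong2[of _ _ _ _ "(+)"] sum.cong refl) (auto simp: algebra_simps)
        also have "\<dots> = diag_form N M y x - 1 / r * (cmod (x j))\<^sup>2 + \<epsilon> * nsq N x"
          using j by (simp add: sum.distrib diag_form_def nsq_def sum_distrib_left)
        also have "\<dots> > 0"
        proof -
          have "1 / r * (cmod (x j))\<^sup>2 \<le> diag_form N M y x" using le[of x] r by (simp add: field_simps)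
          moreover have "\<epsilon> * nsq N x > 0" using elim \<open>nsq N x > 0\<close> by simp
          ultimately show ?thesis by linarith
        qed
        finally show "diag_form N M (vadd ?z \<epsilon> (\<lambda>_. 1)) x > 0" .
      qed
      then show ?case using posdef_re_val_pos[OF M] by (simp add: less_imp_le)
    qed
  qed simp
  also have "re_val (diag_det N M) ?z = re_val (diag_det N M) y + (- 1 / r) * pdiff j (re_val (diag_det N M)) y"
    using j by (intro multiaffineD[OF re_val_multiaffine[OF G]]) auto
  finally have "pdiff j (re_val (diag_det N M)) y \<le> r * re_val (diag_det N M) y" using r by (simp add: field_simps)
  then show ?thesis unfolding barrier_def using posdef_re_val_pos[OF M pdef] by (simp add: divide_le_eq)
qed

section \<open>Selecting principal submatrices\<close>

lemma compact_Pi_UNIV: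
  fixes S :: "'a \<Rightarrow> 'b::topological_space set"
  assumes "\<And>i. compact (S i)" shows "compact {x. \<forall>i. x i \<in> S i}"
proof -
  have "compactin (product_topology (\<lambda>i::'a. euclidean :: 'b topology) UNIV) (PiE UNIV S)"
    unfolding compactin_PiE using assms by simp
  moreover have "PiE UNIV S = {x. \<forall>i. x i \<in> S i}" by (auto simp: PiE_def Pi_def)
  ultimately show ?thesis by (simp add: euclidean_product_topology)
qed

lemma continuous_on_coord [continuous_intros]:
  "continuous_on S (\<lambda>x::'a \<Rightarrow> 'b::topological_space. x i)"
  by (rule continuous_on_subset[OF continuous_on_product_coordinates]) auto

text \<open>With u = A x the form at x + t u is 2 t |u|^2 plus a quadratic term, which is negative
  for small negative t unless u = 0.\<close>

lemma psd_kernel: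
  assumes A: "herm N A" and psd: "\<And>x. qf N A x \<ge> 0" and z: "qf N A x = 0" and i: "i < N"
  shows "mat_vec N A x i = 0"
proof -
  define u where "u = mat_vec N A x"
  have uu: "sform N A u x = of_real (nsq N u)"
    unfolding sform_def u_def nsq_complex[symmetric] by simp
  have ux: "sform N A x u = of_real (nsq N u)" using sform_cnj[OF A, of x u] uu by simp
  have le: "2 * t * nsq N u + t\<^sup>2 * qf N A u \<ge> 0" for t :: real
  proof -
    have "sform N A (\<lambda>i. x i + of_real t * u i) (\<lambda>i. x i + of_real t * u i) =
       sform N A x x + of_real t * sform N A x u + of_real t * sform N A u x + of_real (t\<^sup>2) * sform N A u u"
      by (simp add: sform_add sform_add_right algebra_simps power2_eq_square)
    then have "complex_of_real (qf N A (\<lambda>i. x i + of_real t * u i)) =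
        of_real (qf N A x + t * nsq N u + t * nsq N u + t\<^sup>2 * qf N A u)"
      by (simp only: uu ux sform_real[OF A] of_real_add of_real_mult)
    then have "qf N A (\<lambda>i. x i + of_real t * u i) = qf N A x + t * nsq N u + t * nsq N u + t\<^sup>2 * qf N A u"
      by (simp only: of_real_eq_iff)
    then show ?thesis using psd[of "\<lambda>i. x i + of_real t * u i"] z by simp
  qed
  have "nsq N u = 0"
  proof (rule ccontr)
    assume "nsq N u \<noteq> 0"
    then have pos: "nsq N u > 0" using nsq_nonneg[of N u] by simp
    \<comment> \<open>Small enough that t * qf(u) exceeds -|u|^2; the added 1 guards against a
      vanishing form at u.\<close>
    define t where "t = - nsq N u / (qf N A u + 1)"
    have q: "qf N A u \<ge> 0" by (rule psd)
    have t: "t < 0" using pos q by (simp add: t_def divide_neg_pos)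
    have "2 * nsq N u + t * qf N A u > 0"
    proof -
      have "t * qf N A u \<ge> - nsq N u"
        using q pos by (simp add: t_def field_simps)
      then show ?thesis using pos by linarith
    qed
    with t have "t * (2 * nsq N u + t * qf N A u) < 0" by (rule mult_neg_pos)
    then show False using le[of t] by (simp add: algebra_simps power2_eq_square)
  qed
  then show ?thesis using nsq_pos[OF i, of u] unfolding u_def by fastforce
qed

lemma sum_diag_form: "Re (\<Sum>i<N. cnj (x i) * (of_real (y i) * x i)) = (\<Sum>i<N. y i * (cmod (x i))\<^sup>2)"
  by (simp add: cnj_mult_self flip: of_real_power)

lemma herm_add_diag: "herm N M \<Longrightarrow> herm N (add_diag (\<lambda>i. of_real (y i)) M)"
  unfolding herm_def[of N "add_diag _ _"] by (simp add: add_diag_def hermD)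

lemma qf_add_diag: "qf N (add_diag (\<lambda>i. of_real (y i)) M) x = diag_form N M y x"
proof -
  have "sform N (add_diag (\<lambda>i. of_real (y i)) M) x x = (\<Sum>i<N. cnj (x i) * (of_real (y i) * x i)) + sform N M x x"
    unfolding sform_def by (simp add: mat_vec_add_diag distrib_left sum.distrib)
  then show ?thesis by (simp only: qf_def diag_form_def sum_diag_form plus_complex.sel)
qed

lemma diag_form_scale: "diag_form N M y (\<lambda>i. of_real c * x i) = c\<^sup>2 * diag_form N M y x"
proof -
  have "sform N M (\<lambda>i. of_real c * x i) (\<lambda>i. of_real c * x i) = of_real (c\<^sup>2) * sform N M x x"
    by (simp add: sform_def mat_vec_def sum_distrib_left power2_eq_square mult_ac)
  then have "qf N M (\<lambda>i. of_real c * x i) = c\<^sup>2 * qf N M x" by (simp add: qf_def)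
  then show ?thesis
    by (simp add: diag_form_def norm_mult power_mult_distrib sum_distrib_left distrib_left mult_ac)
qed

text \<open>The converse of \<open>posdef_above_roots\<close>, up to strictness. A negative minimum
  of the form on the unit sphere could be lifted to 0 by raising the diagonal, making the
  determinant vanish at a point above y.\<close>

lemma above_roots_imp_diag_form_nonneg:
  assumes M: "herm N M" and a: "above_roots {..<N} (diag_det N M) y" shows "diag_form N M y x \<ge> 0"
proof (cases "\<exists>i<N. x i \<noteq> 0")
  case False
  then show ?thesis by (simp add: diag_form_def qf_def sform_def)
next
  case True
  \<comment> \<open>Pinning the coordinates from N on to 0 makes the unit sphere compact in the
    product topology.\<close>
  define B where "B = {v::nat \<Rightarrow> complex. \<forall>i. v i \<in> (if i < N then cball 0 1 else {0})}"
  define S where "S = {v \<in> B. nsq N v = 1}"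
  have cB: "compact B" unfolding B_def by (intro compact_Pi_UNIV) auto
  have cn: "continuous_on B (nsq N)" unfolding nsq_def by (intro continuous_intros)
  have S: "S = B \<inter> nsq N -` {1}" by (auto simp: S_def)
  have "closed B" by (rule compact_imp_closed[OF cB])
  then have "closed (B \<inter> nsq N -` {1})" by (rule continuous_closed_preimage[OF cn]) simp
  then have "compact S" unfolding S using cB compact_Int_closed[of B "B \<inter> nsq N -` {1}"] by simp
  have cQ: "continuous_on S (diag_form N M y)"
    unfolding diag_form_def qf_def sform_def mat_vec_def by (intro continuous_intros)
  define nrm where "nrm v = (\<lambda>i. if i < N then of_real (1 / sqrt (nsq N v)) * v i else 0)" for v
  have inS: "nrm v \<in> S" if v: "nsq N v > 0" for v
  proof -
    have n1: "nsq N (nrm v) = 1"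
      using v by (simp add: nsq_def nrm_def norm_mult norm_divide power_mult_distrib power_divide sum_nonneg
          flip: sum_distrib_left sum_divide_distrib)
    have "cmod (nrm v i) \<le> 1" if "i < N" for i
    proof -
      have "(cmod (nrm v i))\<^sup>2 \<le> nsq N (nrm v)"
        unfolding nsq_def using that by (intro member_le_sum) auto
      then show ?thesis using n1 by (simp add: power_le_one_iff abs_square_le_1)
    qed
    then show ?thesis using n1 unfolding S_def B_def by (auto simp: nrm_def)
  qed
  have Qnrm: "diag_form N M y v = nsq N v * diag_form N M y (nrm v)" if v: "nsq N v > 0" for v
  proof -
    have "diag_form N M y (nrm v) = diag_form N M y (\<lambda>i. of_real (1 / sqrt (nsq N v)) * v i)"
      unfolding diag_form_def qf_def sform_def mat_vec_def by (simp add: nrm_def)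
    also have "\<dots> = (1 / sqrt (nsq N v))\<^sup>2 * diag_form N M y v" by (rule diag_form_scale)
    finally show ?thesis using v by (simp add: power_divide)
  qed
  have xpos: "nsq N x > 0" using True nsq_pos by blast
  then have "S \<noteq> {}" using inS by blast
  then obtain v where v: "v \<in> S" "\<And>w. w \<in> S \<Longrightarrow> diag_form N M y v \<le> diag_form N M y w"
    using continuous_attains_inf[OF \<open>compact S\<close> _ cQ] by blast
  define m where "m = diag_form N M y v"
  have "m \<ge> 0"
  proof (rule ccontr)
    assume "\<not> m \<ge> 0"
    \<comment> \<open>As m is negative this point lies above y, while the minimiser v becomes a
      kernel vector there.\<close>
    let ?y = "vadd y (- m) (\<lambda>_. 1)"
    have Q': "diag_form N M ?y w = diag_form N M y w - m * nsq N w" for w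
      by (simp add: diag_form_def vadd_def nsq_def algebra_simps sum.distrib sum_subtractf sum_distrib_left)
    have psd: "diag_form N M ?y w \<ge> 0" for w
    proof (cases "nsq N w > 0")
      case True
      have "diag_form N M y w \<ge> nsq N w * m"
        unfolding Qnrm[OF True] m_def using True v(2)[OF inS[OF True]] by (intro mult_left_mono) auto
      then show ?thesis by (simp add: Q' mult.commute)
    next
      case False
      then have "\<forall>i<N. w i = 0" using nsq_pos by blast
      then show ?thesis by (simp add: diag_form_def qf_def sform_def)
    qed
    have "nsq N v = 1" using v(1) by (simp add: S_def)
    then have "diag_form N M ?y v = 0" unfolding Q' by (simp add: m_def)
    then have "mat_vec N (add_diag (\<lambda>i. of_real (?y i)) M) v i = 0" if "i < N" for i
      using psd_kernel[OF herm_add_diag[OF M] _ _ that, of ?y v] psd by (simp add: qf_add_diag)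
    then have "of_real (?y i) * v i + mat_vec N M v i = 0" if "i < N" for i using that by (simp add: mat_vec_add_diag)
    moreover have "\<exists>i<N. v i \<noteq> 0"
    proof (rule ccontr)
      assume "\<not> ?thesis"
      then have "nsq N v = 0" by (simp add: nsq_def)
      then show False using \<open>nsq N v = 1\<close> by simp
    qed
    ultimately have "diag_det N M (\<lambda>i. of_real (?y i)) = 0" unfolding diag_det_zero_iff by blast
    then have "re_val (diag_det N M) ?y = 0" by (simp add: re_val_def)
    moreover have "above_roots {..<N} (diag_det N M) ?y"
      using \<open>\<not> m \<ge> 0\<close> by (intro above_roots_vadd[OF stable_diag_det[OF M] a]) auto
    ultimately show False using above_roots_pos by fastforce
  qed
  then have "diag_form N M y (nrm x) \<ge> 0" using v(2)[OF inS[OF xpos]] by (simp add: m_def)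
  then show ?thesis unfolding Qnrm[OF xpos] using xpos by simp
qed

text \<open>Start at the constant height t, where all barriers are at most r and a block of size L
  has block barrier at most L r. The condition \<open>shift\<close> says that m rounds carry every
  block down to -a. Coordinates never translated keep this height, so on vectors supported there the
  form of M dominates a times the squared norm.\<close>

lemma selection_lower:
  fixes N L m :: nat and t r K a :: real
  assumes M: "herm N M" and r: "r > 0" and K: "K > 1" and L: "L > 0"
    and le: "\<And>x j. j < N \<Longrightarrow> (cmod (x j))\<^sup>2 \<le> r * (t * nsq N x + qf N M x)"
    and bs: "\<And>b. b \<in> set bs \<Longrightarrow> b \<subseteq> {..<N} \<and> card b = L" and disj: "distinct bs" "disjoint (set bs)"
    and shift: "(1 - 1 / K)\<^sup>2 / (L * r) * (m - 2 * K\<^sup>2) \<ge> t + a"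
  shows "\<exists>A\<subseteq>\<Union>(set bs). (\<forall>b\<in>set bs. card (b \<inter> A) \<ge> L - m) \<and>
     (\<forall>x. (\<forall>i. i \<notin> A \<longrightarrow> x i = 0) \<longrightarrow> qf N M x \<ge> a * nsq N x)"
proof -
  let ?F = "diag_det N M" and ?I = "{..<N}"
  define y where "y = (\<lambda>i::nat. t)"
  note G = stable_diag_det[OF M]
  have Qyt: "diag_form N M y x = t * nsq N x + qf N M x" for x
    by (simp add: diag_form_def y_def nsq_def sum_distrib_left)
  have pdef: "posdef N M y" unfolding posdef_def
  proof (intro allI impI)
    fix x assume "\<exists>i<N. x i \<noteq> (0::complex)"
    then obtain i where i: "i < N" "x i \<noteq> 0" by blast
    then have "0 < (cmod (x i))\<^sup>2" by simp
    also have "\<dots> \<le> r * diag_form N M y x" using le[OF i(1)] Qyt by simp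
    finally show "diag_form N M y x > 0" using r by (simp add: zero_less_mult_iff)
  qed
  have a0: "above_roots ?I ?F y" by (rule posdef_above_roots[OF M pdef])
  have ph: "barrier ?F j y \<le> r" if "j < N" for j
    using le[OF that] Qyt by (intro barrier_diag_det_le[OF M pdef that r]) simp
  define \<phi> where "\<phi> = L * r"
  have \<phi>: "\<phi> > 0" using L r by (simp add: \<phi>_def)
  have Phb: "block_barrier ?F b y \<le> \<phi>" if b: "b \<in> set bs" for b
  proof -
    have "block_barrier ?F b y \<le> (\<Sum>j\<in>b. r)" unfolding block_barrier_def using bs[OF b] ph by (intro sum_mono) auto
    then show ?thesis using bs[OF b] by (simp add: \<phi>_def)
  qed
  define \<beta> where "\<beta> = K / \<phi> * L"
  define \<delta> where "\<delta> = (1 - 1 / K)\<^sup>2 / \<phi>"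
  obtain p where p: "above_roots ?I (blocks_avg m \<beta> bs ?F) p" "\<forall>b\<in>set bs. \<forall>i\<in>b. p i \<le> y i - \<delta> * (m - 2 * K\<^sup>2)"
    using blocks_down[OF G a0 \<phi> K _ L \<delta>_def \<beta>_def, of bs m] bs Phb by blast
  have ne: "b \<subseteq> ?I \<and> b \<noteq> {}" if "b \<in> set bs" for b using bs[OF that] L by auto
  obtain n :: "nat \<Rightarrow> nat" where n: "\<forall>b\<in>set bs. sum n b = m" "above_roots ?I ?F (\<lambda>i. p i + \<beta> * n i)"
    using above_roots_blocks_avg_imp[OF G ne disj p(1)] by blast
  \<comment> \<open>A block undergoes m translates in total, so at most m of its indices have a
    positive count.\<close>
  define A where "A = {i \<in> \<Union>(set bs). n i = 0}"
  show ?thesis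
  proof (intro exI[of _ A] conjI ballI allI impI)
    show "A \<subseteq> \<Union>(set bs)" by (auto simp: A_def)
    fix b assume b: "b \<in> set bs"
    have fb: "finite b" using bs[OF b] finite_subset by blast
    have "card (b - A) = (\<Sum>i\<in>b - A. 1)" by simp
    also have "\<dots> \<le> (\<Sum>i\<in>b - A. n i)" using b by (intro sum_mono) (auto simp: A_def Suc_le_eq)
    also have "\<dots> \<le> sum n b" using fb by (intro sum_mono2) auto
    finally have "card (b - A) \<le> m" using n(1) b by simp
    moreover have "card b = card (b \<inter> A) + card (b - A)"
      using fb by (metis card_Diff_subset_Int card_mono finite_Int inf_le1 le_add_diff_inverse)
    ultimately show "card (b \<inter> A) \<ge> L - m" using bs[OF b] by simp
  next
    fix x :: "nat \<Rightarrow> complex" assume x: "\<forall>i. i \<notin> A \<longrightarrow> x i = 0"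
    have "0 \<le> diag_form N M (\<lambda>i. p i + \<beta> * n i) x" by (rule above_roots_imp_diag_form_nonneg[OF M n(2)])
    \<comment> \<open>Translated coordinates carry a large diagonal entry, but x vanishes
      there.\<close>
    also have "\<dots> \<le> (\<Sum>i<N. - a * (cmod (x i))\<^sup>2) + qf N M x"
      unfolding diag_form_def
    proof (intro add_right_mono sum_mono)
      fix i
      show "(p i + \<beta> * n i) * (cmod (x i))\<^sup>2 \<le> - a * (cmod (x i))\<^sup>2"
      proof (cases "i \<in> A")
        case True
        then obtain b where "b \<in> set bs" "i \<in> b" "n i = 0" by (auto simp: A_def)
        then have "p i + \<beta> * n i \<le> - a"
          using p(2) shift by (force simp: y_def \<delta>_def \<phi>_def)
        then show ?thesis by (intro mult_right_mono) auto
      qed (use x in simp)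
    qed
    also have "(\<Sum>i<N. - a * (cmod (x i))\<^sup>2) = - a * nsq N x" by (simp add: nsq_def sum_distrib_left sum_negf)
    finally show "qf N M x \<ge> a * nsq N x" by simp
  qed
qed

text \<open>The discriminant argument with z - t w u. If the form vanishes at u, a large t forces
  the pairing w to be 0.\<close>

lemma psd_cauchy_schwarz:
  assumes A: "herm N A" and psd: "\<And>x. qf N A x \<ge> 0"
  shows "(cmod (sform N A u z))\<^sup>2 \<le> qf N A u * qf N A z"
proof -
  define w where "w = sform N A u z"
  have zu: "sform N A z u = cnj w" using sform_cnj[OF A, of z u] by (simp add: w_def)
  have le: "qf N A z - 2 * t * (cmod w)\<^sup>2 + t\<^sup>2 * (cmod w)\<^sup>2 * qf N A u \<ge> 0" for t :: real
  proof -
    define c where "c = - of_real t * w"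
    have "sform N A (\<lambda>i. z i + c * u i) (\<lambda>i. z i + c * u i) =
       sform N A z z + c * sform N A z u + cnj c * sform N A u z + c * cnj c * sform N A u u"
      by (simp add: sform_add sform_add_right algebra_simps)
    moreover have "c * sform N A z u = of_real (- t * (cmod w)\<^sup>2)"
      using cnj_mult_self(1)[of w] by (simp add: c_def zu mult.commute)
    moreover have "cnj c * sform N A u z = of_real (- t * (cmod w)\<^sup>2)"
      using cnj_mult_self(1)[of w] by (simp add: c_def flip: w_def)
    moreover have "c * cnj c = of_real (t\<^sup>2 * (cmod w)\<^sup>2)"
      using cnj_mult_self(1)[of w] by (simp add: c_def power2_eq_square mult_ac)
    ultimately have "sform N A (\<lambda>i. z i + c * u i) (\<lambda>i. z i + c * u i) =
       of_real (qf N A z - 2 * t * (cmod w)\<^sup>2 + t\<^sup>2 * (cmod w)\<^sup>2 * qf N A u)"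
      unfolding sform_real[OF A, of z] sform_real[OF A, of u] by simp
    then have "qf N A (\<lambda>i. z i + c * u i) = qf N A z - 2 * t * (cmod w)\<^sup>2 + t\<^sup>2 * (cmod w)\<^sup>2 * qf N A u"
      unfolding qf_def[of N A "\<lambda>i. z i + c * u i"] by simp
    then show ?thesis using psd[of "\<lambda>i. z i + c * u i"] by simp
  qed
  show ?thesis
  proof (cases "qf N A u = 0")
    case True
    have "(cmod w)\<^sup>2 = 0"
    proof (rule ccontr)
      assume n: "(cmod w)\<^sup>2 \<noteq> 0"
      have "qf N A z - 2 * ((qf N A z + 1) / (2 * (cmod w)\<^sup>2)) * (cmod w)\<^sup>2 \<ge> 0"
        using le[of "(qf N A z + 1) / (2 * (cmod w)\<^sup>2)"] True by simp
      then show False using n by simp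
    qed
    then show ?thesis using True by (simp add: w_def)
  next
    case False
    then have p: "qf N A u > 0" using psd[of u] by simp
    have "qf N A z - 2 * (1 / qf N A u) * (cmod w)\<^sup>2 + (1 / qf N A u)\<^sup>2 * (cmod w)\<^sup>2 * qf N A u
        = qf N A z - (cmod w)\<^sup>2 / qf N A u"
      using p by (simp add: field_simps power2_eq_square)
    then have "(cmod w)\<^sup>2 / qf N A u \<le> qf N A z" using le[of "1 / qf N A u"] by simp
    then show ?thesis using p by (simp add: w_def divide_le_eq mult.commute)
  qed
qed

text \<open>The conjugate transpose of V is a left inverse of the Hermitian W; associativity
  identifies it with the right inverse V.\<close>

lemma herm_inverse:
  assumes W: "herm N W" and r: "\<And>i j. i < N \<Longrightarrow> j < N \<Longrightarrow> (\<Sum>k<N. W i k * V k j) = (if i = j then 1 else 0)"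
    and l: "\<And>i j. i < N \<Longrightarrow> j < N \<Longrightarrow> (\<Sum>k<N. V i k * W k j) = (if i = j then 1 else 0)"
  shows "herm N V"
  unfolding herm_def
proof (intro allI impI)
  fix i j assume ij: "i < N" "j < N"
  have cr: "(\<Sum>k<N. cnj (V k i) * W k l) = (if l = i then 1 else 0)" if "l < N" for l
  proof -
    have "cnj (\<Sum>k<N. W l k * V k i) = (\<Sum>k<N. cnj (V k i) * W k l)"
      using that hermD[OF W] by (simp add: mult.commute)
    then show ?thesis using r[OF that ij(1)] by (metis complex_cnj_one complex_cnj_zero)
  qed
  have "(\<Sum>l<N. (\<Sum>k<N. cnj (V k i) * W k l) * V l j) = (\<Sum>l<N. (if l = i then 1 else 0) * V l j)"
    by (intro sum.cong refl) (simp add: cr)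
  also have "\<dots> = V i j" using ij by (simp add: if_distrib[of "\<lambda>c. c * _"] cong: if_cong)
  finally have 1: "(\<Sum>l<N. (\<Sum>k<N. cnj (V k i) * W k l) * V l j) = V i j" .
  have "(\<Sum>l<N. (\<Sum>k<N. cnj (V k i) * W k l) * V l j) = (\<Sum>k<N. cnj (V k i) * (\<Sum>l<N. W k l * V l j))"
    by (simp add: sum_distrib_left sum_distrib_right mult.assoc) (rule sum.swap)
  also have "\<dots> = (\<Sum>k<N. cnj (V k i) * (if k = j then 1 else 0))"
    using ij by (intro sum.cong refl) (simp add: r)
  also have "\<dots> = cnj (V j i)" using ij by (simp add: if_distrib[of "\<lambda>c. _ * c"] cong: if_cong)
  finally show "V j i = cnj (V i j)" using 1 by simp
qed

lemma mat_vec_inverse: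
  assumes "\<And>i j. i < N \<Longrightarrow> j < N \<Longrightarrow> (\<Sum>k<N. W i k * V k j) = (if i = j then 1 else 0)" "i < N"
  shows "mat_vec N W (mat_vec N V x) i = x i"
proof -
  have "mat_vec N W (mat_vec N V x) i = (\<Sum>k<N. \<Sum>j<N. W i k * V k j * x j)"
    by (simp add: mat_vec_def sum_distrib_left mult.assoc)
  also have "\<dots> = (\<Sum>j<N. (\<Sum>k<N. W i k * V k j) * x j)"
    by (subst sum.swap) (simp add: sum_distrib_right)
  also have "\<dots> = (\<Sum>j<N. (if i = j then 1 else 0) * x j)"
    using assms by (intro sum.cong refl) simp
  also have "\<dots> = x i" using assms(2) by (simp add: if_distrib[of "\<lambda>c. c * _"] cong: if_cong)
  finally show ?thesis .
qed

text \<open>Works with the inverse of \<open>W\<close>, turning an upper bound for the selected submatrix into positivity of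
  a diagonal shift.\<close>

lemma selection_upper:
  fixes N L :: nat and C \<omega> :: real
  assumes W: "herm N W" and pdef: "\<And>x. (\<exists>i<N. x i \<noteq> 0) \<Longrightarrow> qf N W x > 0"
    and C: "C > 0" "\<And>x. qf N W x \<le> C * nsq N x" and \<omega>: "\<omega> > 0" "\<And>j. j < N \<Longrightarrow> Re (W j j) \<le> \<omega>"
    and bs: "\<And>b. b \<in> set bs \<Longrightarrow> b \<subseteq> {..<N} \<and> card b = L" and L: "L > 0"
    and disj: "distinct bs" "disjoint (set bs)"
  shows "\<exists>S\<subseteq>\<Union>(set bs). (\<forall>b\<in>set bs. card (b \<inter> S) = 1) \<and>
     (\<forall>x. (\<forall>i. i \<notin> S \<longrightarrow> x i = 0) \<longrightarrow> qf N W x \<le> (2 * \<omega> + 2 * (C / L)) * nsq N x)"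
proof -
  define \<kappa> where "\<kappa> = C / L"
  \<comment> \<open>Chosen so that \<open>L * r = 1 / 2\<close> below, the initial block barrier
    that \<open>blocks_up\<close> admits.\<close>
  define t where "t = 2 * \<omega> / \<kappa>"
  define B where "B = t + 2"
  have \<kappa>: "\<kappa> > 0" using C L by (simp add: \<kappa>_def)
  have t: "t > 0" using \<kappa> \<omega> by (simp add: t_def)
  have B: "B > 0" using t by (simp add: B_def)
  have psd: "qf N W x \<ge> 0" for x
    using pdef[of x] by (cases "\<exists>i<N. x i \<noteq> 0") (auto simp: qf_def sform_def less_imp_le)
  have "fun_det N W \<noteq> 0"
  proof
    assume "fun_det N W = 0"
    then obtain x where x: "\<exists>i<N. x i \<noteq> 0" "\<forall>i<N. mat_vec N W x i = 0" unfolding fun_det_zero_iff by blast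
    then have "qf N W x = 0" by (simp add: qf_def sform_def)
    then show False using pdef[OF x(1)] by simp
  qed
  then obtain V where V: "\<And>i j. i < N \<Longrightarrow> j < N \<Longrightarrow> (\<Sum>k<N. W i k * V k j) = (if i = j then 1 else 0)"
    "\<And>i j. i < N \<Longrightarrow> j < N \<Longrightarrow> (\<Sum>k<N. V i k * W k j) = (if i = j then 1 else 0)"
    by (rule fun_det_inverse) blast
  have hV: "herm N V" by (rule herm_inverse[OF W V])
  have qV: "qf N V x = qf N W (mat_vec N V x)" for x
  proof -
    have "sform N W (mat_vec N V x) (mat_vec N V x) = (\<Sum>i<N. cnj (mat_vec N V x i) * x i)"
      unfolding sform_def by (intro sum.cong refl) (simp add: mat_vec_inverse[OF V(1)])
    also have "\<dots> = cnj (sform N V x x)" by (simp add: sform_def mult.commute)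
    finally show ?thesis by (simp add: qf_def)
  qed
  \<comment> \<open>Here B = t + 2 bounds the diagonal after the shift by 2, and subtracting it from
    C B V cancels that height. What remains in the end is nonnegativity of C B V minus L on the
    selected coordinates.\<close>
  define M where "M i j = of_real (C * B) * V i j - (if i = j then of_real B else 0)" for i j
  have M: "herm N M" unfolding herm_def M_def by (simp add: hermD[OF hV])
  have qM: "qf N M x = C * B * qf N V x - B * nsq N x" for x
  proof -
    have "mat_vec N M x i = of_real (C * B) * mat_vec N V x i - of_real B * x i" if "i < N" for i
      using that by (simp add: mat_vec_def M_def left_diff_distrib sum_subtractf sum_distrib_left mult.assoc
          if_distrib[of "\<lambda>c. c * _"] cong: if_cong)
    then have "sform N M x x = of_real (C * B) * sform N V x x - of_real B * (\<Sum>i<N. cnj (x i) * x i)"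
      by (simp add: sform_def right_diff_distrib sum_subtractf sum_distrib_left mult_ac)
    then show ?thesis unfolding qf_def nsq_complex by simp
  qed
  \<comment> \<open>The entry x j is the pairing of the j-th unit vector with V x in the form of W;
    apply Cauchy-Schwarz and the bound \<omega> on the diagonal.\<close>
  have entry: "(cmod (x j))\<^sup>2 \<le> \<omega> * qf N V x" if j: "j < N" for x j
  proof -
    define e where "e i = (if i = j then 1 else 0 :: complex)" for i
    have "sform N W e z = mat_vec N W z j" for z
      using j by (simp add: sform_def e_def if_distrib[of cnj] if_distrib[of "\<lambda>c. c * _"] cong: if_cong)
    moreover have "mat_vec N W e j = W j j"
      using j by (simp add: mat_vec_def e_def if_distrib[of "\<lambda>c. _ * c"] cong: if_cong)
    ultimately have "(cmod (mat_vec N W (mat_vec N V x) j))\<^sup>2 \<le> Re (W j j) * qf N W (mat_vec N V x)"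
      using psd_cauchy_schwarz[OF W psd, of e "mat_vec N V x"] by (simp add: qf_def)
    also have "\<dots> \<le> \<omega> * qf N W (mat_vec N V x)" using \<omega>(2)[OF j] psd by (intro mult_right_mono) auto
    finally show ?thesis using mat_vec_inverse[OF V(1) j] qV by simp
  qed
  have nV: "nsq N x \<le> C * qf N V x" for x
  proof (cases "nsq N x = 0")
    case True
    then show ?thesis using C psd qV by simp
  next
    case False
    then have p: "nsq N x > 0" using nsq_nonneg[of N x] by simp
    have "sform N W x (mat_vec N V x) = of_real (nsq N x)"
      unfolding nsq_complex[symmetric] sform_def by (intro sum.cong refl) (simp add: mat_vec_inverse[OF V(1)])
    then have "(nsq N x)\<^sup>2 \<le> qf N W x * qf N W (mat_vec N V x)"
      using psd_cauchy_schwarz[OF W psd, of x "mat_vec N V x"] by simp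
    also have "\<dots> \<le> C * nsq N x * qf N W (mat_vec N V x)" using C(2) psd by (intro mult_right_mono) auto
    finally have "nsq N x * nsq N x \<le> nsq N x * (C * qf N V x)" by (simp add: qV power2_eq_square mult_ac)
    then show ?thesis using p by simp
  qed
  \<comment> \<open>By the choice of B the left side is C (t + 2) times the form of V minus 2 |x|^2,
    and \<open>nV\<close> absorbs the last term.\<close>
  have lower: "t * nsq N x + qf N M x \<ge> t * C * qf N V x" for x
  proof -
    have "2 * nsq N x \<le> 2 * (C * qf N V x)" using nV by simp
    then show ?thesis unfolding qM B_def by (simp add: algebra_simps)
  qed
  define y where "y = (\<lambda>i::nat. t)"
  have Qyt: "diag_form N M y x = t * nsq N x + qf N M x" for x
    by (simp add: diag_form_def y_def nsq_def sum_distrib_left)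
  define r where "r = \<omega> / (t * C)"
  have r: "r > 0" using \<omega> t C by (simp add: r_def)
  have le: "(cmod (x j))\<^sup>2 \<le> r * diag_form N M y x" if "j < N" for x j
  proof -
    have "(cmod (x j))\<^sup>2 \<le> r * (t * C * qf N V x)" using entry[OF that] t C by (simp add: r_def)
    also have "\<dots> \<le> r * diag_form N M y x" unfolding Qyt using r lower by (intro mult_left_mono) auto
    finally show ?thesis .
  qed
  have pdM: "posdef N M y" unfolding posdef_def
  proof (intro allI impI)
    fix x assume "\<exists>i<N. x i \<noteq> (0::complex)"
    then obtain i where i: "i < N" "x i \<noteq> 0" by blast
    then have "0 < (cmod (x i))\<^sup>2" by simp
    also have "\<dots> \<le> r * diag_form N M y x" by (rule le[OF i(1)])
    finally show "diag_form N M y x > 0" using r by (simp add: zero_less_mult_iff)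
  qed
  let ?F = "diag_det N M" and ?I = "{..<N}"
  note G = stable_diag_det[OF M]
  have a0: "above_roots ?I ?F y" by (rule posdef_above_roots[OF M pdM])
  have ph: "barrier ?F j y \<le> r" if "j < N" for j using le[OF that] by (rule barrier_diag_det_le[OF M pdM that r])
  have Lr: "L * r = 1 / 2" using \<kappa> \<omega> C L by (simp add: r_def t_def \<kappa>_def field_simps)
  have Phb: "block_barrier ?F b y \<le> 1 / 2" if b: "b \<in> set bs" for b
  proof -
    have "block_barrier ?F b y \<le> (\<Sum>j\<in>b. r)" unfolding block_barrier_def using bs[OF b] ph by (intro sum_mono) auto
    then show ?thesis using bs[OF b] Lr by simp
  qed
  obtain p where p: "above_roots ?I (blocks_avg 1 (- real L) bs ?F) p" "\<forall>i. p i = y i + (if i \<in> \<Union>(set bs) then 2 else 0)"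
    using blocks_up[OF G a0 _ L disj] bs Phb by blast
  have ne: "b \<subseteq> ?I \<and> b \<noteq> {}" if "b \<in> set bs" for b using bs[OF that] L by auto
  obtain n :: "nat \<Rightarrow> nat" where n: "\<forall>i. i \<notin> \<Union>(set bs) \<longrightarrow> n i = 0" "\<forall>b\<in>set bs. sum n b = 1"
    "above_roots ?I ?F (\<lambda>i. p i + - real L * n i)"
    using above_roots_blocks_avg_imp[OF G ne disj p(1)] by blast
  define S where "S = {i \<in> \<Union>(set bs). n i = 1}"
  have one: "card (b \<inter> S) = 1" if b: "b \<in> set bs" for b
  proof -
    have fb: "finite b" using bs[OF b] finite_subset by blast
    obtain i where "i \<in> b" "n i = 1" "\<forall>j\<in>b. i \<noteq> j \<longrightarrow> n j = 0"
      using n(2) b sum_eq_1_iff[OF fb, of n] by auto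
    then have "b \<inter> S = {i}" using b by (auto simp: S_def)
    then show ?thesis by simp
  qed
  have bound: "qf N W x \<le> \<kappa> * B * nsq N x" if x: "\<forall>i. i \<notin> S \<longrightarrow> x i = 0" for x
  proof -
    \<comment> \<open>Testing at v = W x undoes the inversion: the form of V at v is the form of W
      at x. This bounds v on S, while Cauchy-Schwarz bounds the form of W at x by |x| times the norm
      of v on S. In the combined inequality one factor \<open>qf N W x\<close> cancels.\<close>
    define v where "v = mat_vec N W x"
    have vx: "mat_vec N V v i = x i" if "i < N" for i unfolding v_def by (rule mat_vec_inverse[OF V(2) that])
    have qVv: "qf N V v = qf N W x"
    proof -
      have "sform N V v v = (\<Sum>i<N. cnj (v i) * x i)"
        unfolding sform_def by (intro sum.cong refl) (simp add: vx)
      also have "\<dots> = cnj (sform N W x x)" by (simp add: sform_def v_def mult.commute)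
      finally show ?thesis by (simp add: qf_def)
    qed
    define s where "s = (\<Sum>i\<in>S. (cmod (v i))\<^sup>2)"
    have SN: "S \<subseteq> ?I" using bs by (auto simp: S_def)
    have fS: "finite S" using SN finite_subset by blast
    have "0 \<le> diag_form N M (\<lambda>i. p i + - real L * n i) v" by (rule above_roots_imp_diag_form_nonneg[OF M n(3)])
    also have "\<dots> \<le> (\<Sum>i<N. B * (cmod (v i))\<^sup>2 - (if i \<in> S then L * (cmod (v i))\<^sup>2 else 0)) + qf N M v"
      unfolding diag_form_def
    proof (intro add_right_mono sum_mono)
      fix i
      have pi: "p i \<le> B" using p(2) by (auto simp: y_def B_def)
      have "real L * n i \<ge> (if i \<in> S then L else 0)" by (auto simp: S_def)
      then have "p i + - real L * n i \<le> B - (if i \<in> S then L else 0)" using pi by linarith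
      then have "(p i + - real L * n i) * (cmod (v i))\<^sup>2 \<le> (B - (if i \<in> S then L else 0)) * (cmod (v i))\<^sup>2"
        by (intro mult_right_mono) auto
      then show "(p i + - real L * n i) * (cmod (v i))\<^sup>2 \<le> B * (cmod (v i))\<^sup>2 - (if i \<in> S then L * (cmod (v i))\<^sup>2 else 0)"
        by (auto simp: algebra_simps)
    qed
    also have "(\<Sum>i<N. B * (cmod (v i))\<^sup>2 - (if i \<in> S then L * (cmod (v i))\<^sup>2 else 0)) = B * nsq N v - L * s"
    proof -
      have "(\<Sum>i<N. if i \<in> S then L * (cmod (v i))\<^sup>2 else 0) = (\<Sum>i\<in>S. L * (cmod (v i))\<^sup>2)"
        using SN by (subst sum.inter_restrict[symmetric]) (auto intro: sum.cong)
      then show ?thesis by (simp add: sum_subtractf nsq_def s_def sum_distrib_left)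
    qed
    finally have Ls: "L * s \<le> C * B * qf N W x" by (simp add: qM qVv)
    have "qf N W x \<le> sqrt (nsq N x) * sqrt s"
    proof -
      have "sform N W x x = (\<Sum>i\<in>S. cnj (x i) * v i)"
        unfolding sform_def v_def using SN x by (intro sum.mono_neutral_right) auto
      then have "qf N W x \<le> cmod (\<Sum>i\<in>S. cnj (x i) * v i)" unfolding qf_def by (metis complex_Re_le_cmod)
      also have "\<dots> \<le> (\<Sum>i\<in>S. \<bar>cmod (x i)\<bar> * \<bar>cmod (v i)\<bar>)"
        by (rule order_trans[OF norm_sum]) (simp add: norm_mult)
      also have "\<dots> \<le> L2_set (\<lambda>i. cmod (x i)) S * L2_set (\<lambda>i. cmod (v i)) S" by (rule L2_set_mult_ineq)
      also have "(\<Sum>i\<in>S. (cmod (x i))\<^sup>2) = nsq N x"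
        unfolding nsq_def using SN x by (intro sum.mono_neutral_left) auto
      then have "L2_set (\<lambda>i. cmod (x i)) S * L2_set (\<lambda>i. cmod (v i)) S = sqrt (nsq N x) * sqrt s"
        by (simp add: L2_set_def s_def)
      finally show ?thesis .
    qed
    then have "(qf N W x)\<^sup>2 \<le> (sqrt (nsq N x) * sqrt s)\<^sup>2" using psd by (intro power_mono)
    also have "\<dots> = nsq N x * s" using nsq_nonneg[of N x] by (simp add: power_mult_distrib s_def sum_nonneg)
    also have "\<dots> \<le> nsq N x * (C * B * qf N W x / L)"
      using Ls L nsq_nonneg[of N x] by (intro mult_left_mono) (auto simp: pos_le_divide_eq mult.commute)
    finally have sq: "qf N W x * qf N W x \<le> qf N W x * (\<kappa> * B * nsq N x)"
      by (simp add: power2_eq_square \<kappa>_def mult_ac)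
    show ?thesis
    proof (cases "qf N W x = 0")
      case True
      then show ?thesis using \<kappa> B nsq_nonneg[of N x] by simp
    next
      case False
      then have "qf N W x > 0" using psd[of x] by simp
      then show ?thesis using sq by simp
    qed
  qed
  have "\<kappa> * B = 2 * \<omega> + 2 * (C / L)" using \<kappa> by (simp add: B_def t_def distrib_left flip: \<kappa>_def)
  moreover have "S \<subseteq> \<Union>(set bs)" by (auto simp: S_def)
  ultimately show ?thesis using one bound by (intro exI[of _ S]) auto
qed

section \<open>Selection over arbitrary finite index sets\<close>

text \<open>Determinants are indexed by numbers below N, frequencies by integer vectors. These forms
  carry the selection results over along an enumeration.\<close>

definition qfI :: "'k set \<Rightarrow> ('k \<Rightarrow> 'k \<Rightarrow> complex) \<Rightarrow> ('k \<Rightarrow> complex) \<Rightarrow> real" where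
  "qfI I W x = Re (\<Sum>i\<in>I. cnj (x i) * (\<Sum>j\<in>I. W i j * x j))"

definition nsqI :: "'k set \<Rightarrow> ('k \<Rightarrow> complex) \<Rightarrow> real" where
  "nsqI I x = (\<Sum>i\<in>I. (cmod (x i))\<^sup>2)"

lemma qfI_reindex:
  assumes "bij_betw g {..<N} I" shows "qfI I W x = qf N (\<lambda>i j. W (g i) (g j)) (\<lambda>i. x (g i))"
  unfolding qfI_def qf_def sform_def mat_vec_def
  by (simp flip: sum.reindex_bij_betw[OF assms])

lemma nsqI_reindex:
  assumes "bij_betw g {..<N} I" shows "nsqI I x = nsq N (\<lambda>i. x (g i))"
  unfolding nsqI_def nsq_def by (simp flip: sum.reindex_bij_betw[OF assms])

lemma reindex_blocks:
  assumes g: "bij_betw g {..<N} I" and Bs: "finite Bs" "\<And>b. b \<in> Bs \<Longrightarrow> b \<subseteq> I \<and> card b = L" "disjoint Bs" and L: "L > 0"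
  obtains bs where "distinct bs" "disjoint (set bs)" "\<And>b. b \<in> set bs \<Longrightarrow> b \<subseteq> {..<N} \<and> card b = L"
    "set bs = (\<lambda>b. {i\<in>{..<N}. g i \<in> b}) ` Bs"
proof -
  let ?h = "\<lambda>b. {i\<in>{..<N}. g i \<in> b}"
  have inj: "inj_on g {..<N}" and im: "g ` {..<N} = I" using g by (auto simp: bij_betw_def)
  have gh: "g ` ?h b = b" if "b \<in> Bs" for b using Bs(2)[OF that] im by auto
  obtain bs where bs: "set bs = ?h ` Bs" "distinct bs" using finite_distinct_list[of "?h ` Bs"] Bs(1) by auto
  show thesis
  proof (rule that[OF bs(2) _ _ bs(1)])
    show "disjoint (set bs)" unfolding bs(1) disjoint_def
    proof (intro ballI impI)
      fix a b assume "a \<in> ?h ` Bs" "b \<in> ?h ` Bs" "a \<noteq> b"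
      then obtain a' b' where above_roots: "a' \<in> Bs" "b' \<in> Bs" "a = ?h a'" "b = ?h b'" "a' \<noteq> b'" by auto
      then have "a' \<inter> b' = {}" using Bs(3) by (auto simp: disjoint_def)
      then show "a \<inter> b = {}" using above_roots by auto
    qed
    fix b assume "b \<in> set bs"
    then obtain b' where b': "b' \<in> Bs" "b = ?h b'" using bs by auto
    have "card (g ` b) = card b" using inj b' by (intro card_image) (auto intro: inj_on_subset)
    then show "b \<subseteq> {..<N} \<and> card b = L" using b' gh Bs(2) by auto
  qed
qed

lemma selection_lowerI:
  fixes L m :: nat and t r K a :: real
  assumes I: "finite I" and W: "\<And>i j. i \<in> I \<Longrightarrow> j \<in> I \<Longrightarrow> W j i = cnj (W i j)"
    and r: "r > 0" and K: "K > 1" and L: "L > 0"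
    and le: "\<And>x j. j \<in> I \<Longrightarrow> (cmod (x j))\<^sup>2 \<le> r * (t * nsqI I x + qfI I W x)"
    and Bs: "finite Bs" "\<And>b. b \<in> Bs \<Longrightarrow> b \<subseteq> I \<and> card b = L" "disjoint Bs"
    and shift: "(1 - 1 / K)\<^sup>2 / (L * r) * (m - 2 * K\<^sup>2) \<ge> t + a"
  shows "\<exists>A\<subseteq>\<Union>Bs. (\<forall>b\<in>Bs. card (b \<inter> A) \<ge> L - m) \<and>
     (\<forall>x. (\<forall>i\<in>I - A. x i = 0) \<longrightarrow> qfI I W x \<ge> a * nsqI I x)"
proof -
  define N where "N = card I"
  obtain g where "bij_betw g {0..<N} I" using ex_bij_betw_nat_finite[OF I] by (auto simp: N_def)
  then have g: "bij_betw g {..<N} I" by (simp add: lessThan_atLeast0)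
  have inj: "inj_on g {..<N}" and im: "g ` {..<N} = I" using g by (auto simp: bij_betw_def)
  let ?W = "\<lambda>i j. W (g i) (g j)"
  have gI: "g i \<in> I" if "i < N" for i using im that by auto
  have hW: "herm N ?W" unfolding herm_def using W gI by blast
  obtain bs where bs: "distinct bs" "disjoint (set bs)" "\<And>b. b \<in> set bs \<Longrightarrow> b \<subseteq> {..<N} \<and> card b = L"
    "set bs = (\<lambda>b. {i\<in>{..<N}. g i \<in> b}) ` Bs"
  proof (rule reindex_blocks[OF g Bs L])
    fix bs :: "nat set list"
    assume "distinct bs" "disjoint (set bs)" "\<And>b. b \<in> set bs \<Longrightarrow> b \<subseteq> {..<N} \<and> card b = L"
      "set bs = (\<lambda>b. {i \<in> {..<N}. g i \<in> b}) ` Bs"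
    then show thesis by (rule that)
  qed
  have le': "(cmod (x j))\<^sup>2 \<le> r * (t * nsq N x + qf N ?W x)" if j: "j < N" for x j
  proof -
    define y where "y k = x (the_inv_into {..<N} g k)" for k
    have y: "y (g i) = x i" if "i < N" for i using the_inv_into_f_f[OF inj] that by (simp add: y_def)
    have "nsq N (\<lambda>i. y (g i)) = nsq N x" unfolding nsq_def using y by (intro sum.cong) auto
    moreover have "qf N ?W (\<lambda>i. y (g i)) = qf N ?W x"
      unfolding qf_def sform_def mat_vec_def using y by (intro arg_cong[where f = Re] sum.cong) auto
    ultimately show ?thesis using le[OF gI[OF j], of y] y[OF j]
      unfolding nsqI_reindex[OF g] qfI_reindex[OF g] by simp
  qed
  obtain A where A: "A \<subseteq> \<Union>(set bs)" "\<forall>b\<in>set bs. card (b \<inter> A) \<ge> L - m"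
    "\<And>x. (\<forall>i. i \<notin> A \<longrightarrow> x i = 0) \<Longrightarrow> qf N ?W x \<ge> a * nsq N x"
    using selection_lower[OF hW r K L le' bs(3,1,2) shift] by blast
  have AN: "A \<subseteq> {..<N}" using A(1) bs(3) by blast
  show ?thesis
  proof (intro exI[of _ "g ` A"] conjI ballI allI impI)
    show "g ` A \<subseteq> \<Union>Bs" using A(1) bs(4) by auto
    fix b assume b: "b \<in> Bs"
    let ?b = "{i\<in>{..<N}. g i \<in> b}"
    have "?b \<in> set bs" using bs(4) b by blast
    then have "L - m \<le> card (?b \<inter> A)" using A(2) by blast
    also have "\<dots> = card (g ` (?b \<inter> A))"
      using inj by (intro card_image[symmetric]) (auto intro: inj_on_subset)
    also have "\<dots> \<le> card (b \<inter> g ` A)"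
      using Bs(2)[OF b] I by (intro card_mono) (auto intro: finite_subset)
    finally show "L - m \<le> card (b \<inter> g ` A)" .
  next
    fix x :: "'a \<Rightarrow> complex" assume x: "\<forall>i\<in>I - g ` A. x i = 0"
    define y where "y i = (if i < N then x (g i) else 0)" for i
    have "\<forall>i. i \<notin> A \<longrightarrow> y i = 0"
    proof (intro allI impI)
      fix i assume "i \<notin> A"
      then have "g i \<notin> g ` A" if "i < N" using that inj AN by (auto simp: inj_on_def)
      then show "y i = 0" using x gI by (auto simp: y_def)
    qed
    then have "qf N ?W y \<ge> a * nsq N y" by (rule A(3))
    moreover have "nsq N y = nsqI I x" unfolding nsqI_reindex[OF g] nsq_def y_def by (intro sum.cong) auto
    moreover have "qf N ?W y = qfI I W x"
      unfolding qfI_reindex[OF g] qf_def sform_def mat_vec_def y_def by (intro arg_cong[where f = Re] sum.cong) auto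
    ultimately show "qfI I W x \<ge> a * nsqI I x" by simp
  qed
qed

lemma selection_upperI:
  fixes L :: nat and C \<omega> :: real
  assumes I: "finite I" and W: "\<And>i j. i \<in> I \<Longrightarrow> j \<in> I \<Longrightarrow> W j i = cnj (W i j)"
    and pdef: "\<And>x. (\<exists>i\<in>I. x i \<noteq> 0) \<Longrightarrow> qfI I W x > 0"
    and C: "C > 0" "\<And>x. qfI I W x \<le> C * nsqI I x" and \<omega>: "\<omega> > 0" "\<And>j. j \<in> I \<Longrightarrow> Re (W j j) \<le> \<omega>"
    and Bs: "finite Bs" "\<And>b. b \<in> Bs \<Longrightarrow> b \<subseteq> I \<and> card b = L" "disjoint Bs" and L: "L > 0"
  shows "\<exists>S\<subseteq>\<Union>Bs. (\<forall>b\<in>Bs. card (b \<inter> S) = 1) \<and>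
     (\<forall>x. (\<forall>i\<in>I - S. x i = 0) \<longrightarrow> qfI I W x \<le> (2 * \<omega> + 2 * (C / L)) * nsqI I x)"
proof -
  define N where "N = card I"
  obtain g where "bij_betw g {0..<N} I" using ex_bij_betw_nat_finite[OF I] by (auto simp: N_def)
  then have g: "bij_betw g {..<N} I" by (simp add: lessThan_atLeast0)
  have inj: "inj_on g {..<N}" and im: "g ` {..<N} = I" using g by (auto simp: bij_betw_def)
  let ?W = "\<lambda>i j. W (g i) (g j)"
  have gI: "g i \<in> I" if "i < N" for i using im that by auto
  have hW: "herm N ?W" unfolding herm_def using W gI by blast
  obtain bs where bs: "distinct bs" "disjoint (set bs)" "\<And>b. b \<in> set bs \<Longrightarrow> b \<subseteq> {..<N} \<and> card b = L"
    "set bs = (\<lambda>b. {i\<in>{..<N}. g i \<in> b}) ` Bs"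
  proof (rule reindex_blocks[OF g Bs L])
    fix bs :: "nat set list"
    assume "distinct bs" "disjoint (set bs)" "\<And>b. b \<in> set bs \<Longrightarrow> b \<subseteq> {..<N} \<and> card b = L"
      "set bs = (\<lambda>b. {i \<in> {..<N}. g i \<in> b}) ` Bs"
    then show thesis by (rule that)
  qed
  have ex: "\<exists>y. nsq N x = nsqI I y \<and> qf N ?W x = qfI I W y \<and> (\<forall>i<N. y (g i) = x i)" for x
  proof -
    define y where "y k = x (the_inv_into {..<N} g k)" for k
    have y: "y (g i) = x i" if "i < N" for i using the_inv_into_f_f[OF inj] that by (simp add: y_def)
    have "nsq N (\<lambda>i. y (g i)) = nsq N x" unfolding nsq_def using y by (intro sum.cong) auto
    moreover have "qf N ?W (\<lambda>i. y (g i)) = qf N ?W x"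
      unfolding qf_def sform_def mat_vec_def using y by (intro arg_cong[where f = Re] sum.cong) auto
    ultimately show ?thesis using y
      unfolding nsqI_reindex[OF g] qfI_reindex[OF g] by (intro exI[of _ y]) simp
  qed
  have pd': "qf N ?W x > 0" if "\<exists>i<N. x i \<noteq> 0" for x
  proof -
    obtain y where y: "qf N ?W x = qfI I W y" "\<forall>i<N. y (g i) = x i" using ex[of x] by blast
    then have "\<exists>i\<in>I. y i \<noteq> 0" using that gI by metis
    then show ?thesis using pdef[of y] y by simp
  qed
  have C': "qf N ?W x \<le> C * nsq N x" for x
  proof -
    obtain y where "nsq N x = nsqI I y" "qf N ?W x = qfI I W y" using ex[of x] by blast
    then show ?thesis using C(2)[of y] by simp
  qed
  have \<omega>': "Re (?W j j) \<le> \<omega>" if "j < N" for j using \<omega>(2)[OF gI[OF that]] .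
  obtain S where S: "S \<subseteq> \<Union>(set bs)" "\<forall>b\<in>set bs. card (b \<inter> S) = 1"
    "\<And>x. (\<forall>i. i \<notin> S \<longrightarrow> x i = 0) \<Longrightarrow> qf N ?W x \<le> (2 * \<omega> + 2 * (C / L)) * nsq N x"
    using selection_upper[OF hW pd' C(1) C' \<omega>(1) \<omega>' bs(3) L bs(1,2)] by blast
  have SN: "S \<subseteq> {..<N}" using S(1) bs(3) by blast
  show ?thesis
  proof (intro exI[of _ "g ` S"] conjI ballI allI impI)
    show "g ` S \<subseteq> \<Union>Bs" using S(1) bs(4) by auto
    fix b assume b: "b \<in> Bs"
    let ?b = "{i\<in>{..<N}. g i \<in> b}"
    have "?b \<in> set bs" using bs(4) b by blast
    then have "card (?b \<inter> S) = 1" using S(2) by blast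
    moreover have "card (g ` (?b \<inter> S)) = card (?b \<inter> S)"
      using inj by (intro card_image) (auto intro: inj_on_subset)
    moreover have "g ` (?b \<inter> S) = b \<inter> g ` S" using SN by auto
    ultimately show "card (b \<inter> g ` S) = 1" by simp
  next
    fix x :: "'a \<Rightarrow> complex" assume x: "\<forall>i\<in>I - g ` S. x i = 0"
    define y where "y i = (if i < N then x (g i) else 0)" for i
    have "\<forall>i. i \<notin> S \<longrightarrow> y i = 0"
    proof (intro allI impI)
      fix i assume "i \<notin> S"
      then have "g i \<notin> g ` S" if "i < N" using that inj SN by (auto simp: inj_on_def)
      then show "y i = 0" using x gI by (auto simp: y_def)
    qed
    then have "qf N ?W y \<le> (2 * \<omega> + 2 * (C / L)) * nsq N y" by (rule S(3))
    moreover have "nsq N y = nsqI I x" unfolding nsqI_reindex[OF g] nsq_def y_def by (intro sum.cong) auto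
    moreover have "qf N ?W y = qfI I W x"
      unfolding qfI_reindex[OF g] qf_def sform_def mat_vec_def y_def by (intro arg_cong[where f = Re] sum.cong) auto
    ultimately show "qfI I W x \<le> (2 * \<omega> + 2 * (C / L)) * nsqI I x" by simp
  qed
qed

no_notation Matrix.vec_index (infixl \<open>$\<close> 100)
no_notation Matrix.scalar_prod (infix \<open>\<bullet>\<close> 70)

section \<open>Exponential sums\<close>

definition expo :: "real ^ 'n \<Rightarrow> real ^ 'n \<Rightarrow> complex" where
  "expo l x = cis (2 * pi * (l \<bullet> x))"

text \<open>The Fourier transform of the indicator of S at -l in the convention with kernel e^(-2 pi
  i l x). Its values at differences of frequencies are the Gram matrix of the exponentials on
  S.\<close>

definition ft :: "(real ^ 'n) set \<Rightarrow> real ^ 'n \<Rightarrow> complex" where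
  "ft S l = (LINT x|lebesgue_on S. expo l x)"

definition trig :: "'k set \<Rightarrow> ('k \<Rightarrow> real ^ 'n) \<Rightarrow> ('k \<Rightarrow> complex) \<Rightarrow> real ^ 'n \<Rightarrow> complex" where
  "trig F l c x = (\<Sum>i\<in>F. c i * expo (l i) x)"

definition energy :: "(real ^ 'n) set \<Rightarrow> 'k set \<Rightarrow> ('k \<Rightarrow> real ^ 'n) \<Rightarrow> ('k \<Rightarrow> complex) \<Rightarrow> real" where
  "energy S F l c = (LINT x|lebesgue_on S. (cmod (trig F l c x))\<^sup>2)"

lemma norm_expo [simp]: "cmod (expo l x) = 1"
  by (simp add: expo_def)

lemma cnj_expo: "cnj (expo l x) = expo (- l) x"
  by (simp add: expo_def cis_cnj)

lemma expo_add: "expo (l + m) x = expo l x * expo m x"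
  by (simp add: expo_def inner_add_left distrib_left cis_mult)

lemma expo_mult_cnj: "expo l x * cnj (expo m x) = expo (l - m) x"
  unfolding cnj_expo expo_add[symmetric] by simp

lemma continuous_on_expo [continuous_intros]: "continuous_on S (expo l)"
  unfolding expo_def by (intro continuous_intros)

lemma continuous_on_trig [continuous_intros]: "continuous_on S (trig F l c)"
  unfolding trig_def by (intro continuous_intros)

lemma integrable_lebesgue_on_bounded:
  fixes f :: "real ^ 'n \<Rightarrow> 'b::{banach, second_countable_topology}"
  assumes S: "S \<in> lmeasurable" and f: "continuous_on S f" and B: "\<And>x. x \<in> S \<Longrightarrow> norm (f x) \<le> B"
  shows "integrable (lebesgue_on S) f"
proof -
  interpret finite_measure "lebesgue_on S" by (rule finite_measure_lebesgue_on[OF S])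
  show ?thesis
    using S B by (intro integrable_const_bound[of _ B] continuous_imp_measurable_on_sets_lebesgue[OF f])
      (auto intro!: AE_I2)
qed

lemma integrable_expo: "S \<in> lmeasurable \<Longrightarrow> integrable (lebesgue_on S) (expo l)"
  by (rule integrable_lebesgue_on_bounded[of _ _ 1]) (auto intro: continuous_intros)

lemma norm_trig_le: "cmod (trig F l c x) \<le> (\<Sum>i\<in>F. cmod (c i))"
  unfolding trig_def by (rule order_trans[OF norm_sum]) (simp add: norm_mult)

lemma integrable_trig_square:
  assumes "S \<in> lmeasurable" shows "integrable (lebesgue_on S) (\<lambda>x. (cmod (trig F l c x))\<^sup>2)"
proof (rule integrable_lebesgue_on_bounded[OF assms, of _ "(\<Sum>i\<in>F. cmod (c i))\<^sup>2"])
  show "norm ((cmod (trig F l c x))\<^sup>2) \<le> (\<Sum>i\<in>F. cmod (c i))\<^sup>2" for x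
    using norm_trig_le[of F l c x] by (simp add: power_mono)
qed (intro continuous_intros)

lemma ft_0: "S \<in> lmeasurable \<Longrightarrow> ft S 0 = of_real (measure lebesgue S)"
  by (simp add: ft_def expo_def measure_restrict_space fmeasurable_def scaleR_conv_of_real)

lemma ft_minus: "S \<in> lmeasurable \<Longrightarrow> ft S (- l) = cnj (ft S l)"
  unfolding ft_def cnj_expo[symmetric]
  by (rule integral_bounded_linear[OF bounded_linear_cnj integrable_expo])

lemma energy_gram:
  assumes S: "S \<in> lmeasurable"
  shows "of_real (energy S F l c) = (\<Sum>i\<in>F. cnj (c i) * (\<Sum>j\<in>F. ft S (l j - l i) * c j))"
proof -
  have "complex_of_real ((cmod (trig F l c x))\<^sup>2) = (\<Sum>i\<in>F. \<Sum>j\<in>F. cnj (c i) * c j * expo (l j - l i) x)" for x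
  proof -
    have "complex_of_real ((cmod (trig F l c x))\<^sup>2) = cnj (trig F l c x) * trig F l c x"
      by (simp add: complex_norm_square mult.commute del: of_real_power)
    also have "\<dots> = (\<Sum>i\<in>F. \<Sum>j\<in>F. cnj (c i * expo (l i) x) * (c j * expo (l j) x))"
      unfolding trig_def by (simp add: sum_product)
    also have "\<dots> = (\<Sum>i\<in>F. \<Sum>j\<in>F. cnj (c i) * c j * expo (l j - l i) x)"
      by (intro sum.cong refl) (simp add: expo_mult_cnj[symmetric] mult_ac)
    finally show ?thesis .
  qed
  then have "of_real (energy S F l c) = (LINT x|lebesgue_on S. (\<Sum>i\<in>F. \<Sum>j\<in>F. cnj (c i) * c j * expo (l j - l i) x))"
    unfolding energy_def integral_complex_of_real[symmetric] by simp
  also have "\<dots> = (\<Sum>i\<in>F. \<Sum>j\<in>F. cnj (c i) * c j * ft S (l j - l i))"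
    unfolding ft_def by (simp add: integrable_expo[OF S] integrable_mult_right)
  finally show ?thesis by (simp add: sum_distrib_left mult_ac)
qed

section \<open>Orthogonality on cubes\<close>

definition cube :: "real \<Rightarrow> (real ^ 'n) set" where
  "cube R = {x. \<forall>i. - (R / 2) \<le> x $ i \<and> x $ i \<le> R / 2}"

lemma cube_cbox: "cube R = cbox (Finite_Cartesian_Product.vec (- (R / 2))) (Finite_Cartesian_Product.vec (R / 2))"
  by (auto simp: cube_def mem_box_cart)

lemma lmeasurable_cube [simp]: "cube R \<in> lmeasurable"
  by (simp add: cube_cbox)

lemma measure_cube: "R \<ge> 0 \<Longrightarrow> measure lebesgue (cube R :: (real ^ 'n) set) = R ^ CARD('n)"
  unfolding cube_cbox by (subst measure_completion, simp, subst content_cbox_cart) (auto simp: interval_ne_empty_cart)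

lemma integral_cis_interval:
  assumes R: "R > 0" and m: "m \<in> \<int>" "m \<noteq> 0"
  shows "has_bochner_integral lborel (\<lambda>t. indicator {- (R / 2)..R / 2} t *\<^sub>R cis (2 * pi * (m / R * t))) 0"
proof -
  define \<alpha> where "\<alpha> = 2 * pi * m / R"
  have \<alpha>: "\<alpha> \<noteq> 0" using R m by (simp add: \<alpha>_def)
  define F where "F t = complex_of_real (sin (\<alpha> * t) / \<alpha>) - \<i> * of_real (cos (\<alpha> * t) / \<alpha>)" for t
  have d: "(F has_vector_derivative cis (\<alpha> * t)) (at t within {- (R / 2)..R / 2})" for t
  proof -
    have "((\<lambda>t. sin (\<alpha> * t) / \<alpha>) has_real_derivative cos (\<alpha> * t)) (at t within {- (R / 2)..R / 2})"
      using \<alpha> by (auto intro!: derivative_eq_intros)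
    moreover have "((\<lambda>t. cos (\<alpha> * t) / \<alpha>) has_real_derivative - sin (\<alpha> * t)) (at t within {- (R / 2)..R / 2})"
      using \<alpha> by (auto intro!: derivative_eq_intros)
    ultimately have "(F has_vector_derivative (of_real (cos (\<alpha> * t)) - \<i> * of_real (- sin (\<alpha> * t)))) (at t within {- (R / 2)..R / 2})"
      unfolding F_def by (intro has_vector_derivative_diff has_vector_derivative_mult_right has_vector_derivative_of_real)
        (auto simp: has_real_derivative_iff_has_vector_derivative)
    then show ?thesis by (simp add: cis.ctr Complex_eq)
  qed
  have "has_bochner_integral lborel (\<lambda>t. indicator {- (R / 2)..R / 2} t *\<^sub>R cis (\<alpha> * t)) (F (R / 2) - F (- (R / 2)))"
    using R d by (intro has_bochner_integral_FTC_Icc) (auto intro!: continuous_intros)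
  moreover have "F (R / 2) - F (- (R / 2)) = 0"
  proof -
    have "\<alpha> * (R / 2) = pi * m" using R by (simp add: \<alpha>_def)
    moreover have "sin (pi * m) = 0" using m(1) by (auto elim!: Ints_cases)
    ultimately show ?thesis by (simp add: F_def)
  qed
  moreover have "\<alpha> * t = 2 * pi * (m / R * t)" for t by (simp add: \<alpha>_def)
  ultimately show ?thesis by simp
qed

text \<open>The integral factors over coordinates, and in a coordinate with l i nonzero the
  exponential runs through a whole number of periods.\<close>

lemma ft_cube_eq_0:
  fixes l :: "real ^ 'n"
  assumes R: "R > 0" and l: "\<And>i. l $ i * R \<in> \<int>" "l \<noteq> 0"
  shows "ft (cube R) l = 0"
proof -
  define h where "h b t = indicator {- (R / 2)..R / 2} t *\<^sub>R cis (2 * pi * ((l \<bullet> b) * t))" for b :: "real ^ 'n" and t :: real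
  have inth: "integrable lborel (h b)" for b
    unfolding h_def by (intro borel_integrable_compact) (auto intro!: continuous_intros)
  have prodh: "indicator (cube R) x *\<^sub>R expo l x = (\<Prod>b\<in>Basis. h b (x \<bullet> b))" for x :: "real ^ 'n"
  proof -
    have "(indicator (cube R) x :: real) = (\<Prod>b\<in>Basis. indicator {- (R / 2)..R / 2} (x \<bullet> b))"
    proof (cases "x \<in> cube R")
      case True
      then have "x \<bullet> b \<in> {- (R / 2)..R / 2}" if "b \<in> Basis" for b
        using that by (auto simp: cube_def Basis_vec_def inner_axis)
      then show ?thesis using True by (simp add: indicator_def)
    next
      case False
      then obtain i where "\<not> (- (R / 2) \<le> x $ i \<and> x $ i \<le> R / 2)" by (auto simp: cube_def)
      then have "\<exists>b\<in>Basis. indicator {- (R / 2)..R / 2} (x \<bullet> b) = (0::real)"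
        by (intro bexI[of _ "axis i 1"]) (auto simp: inner_axis Basis_vec_def)
      then show ?thesis using False by (subst prod_zero) auto
    qed
    moreover have "expo l x = (\<Prod>b\<in>Basis. cis (2 * pi * ((l \<bullet> b) * (x \<bullet> b))))"
    proof -
      have "l \<bullet> x = (\<Sum>b\<in>Basis. (l \<bullet> b) * (x \<bullet> b))" by (rule euclidean_inner)
      then have "expo l x = cis (\<Sum>b\<in>Basis. 2 * pi * ((l \<bullet> b) * (x \<bullet> b)))"
        by (simp add: expo_def sum_distrib_left)
      also have "\<dots> = (\<Prod>b\<in>Basis. cis (2 * pi * ((l \<bullet> b) * (x \<bullet> b))))"
        unfolding cis_conv_exp by (simp add: exp_sum sum_distrib_left)
      finally show ?thesis .
    qed
    ultimately show ?thesis by (simp add: h_def prod.distrib scaleR_conv_of_real)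
  qed
  have zero: "integral\<^sup>L lborel (h (axis i 1)) = 0" if "l $ i \<noteq> 0" for i
  proof -
    have "has_bochner_integral lborel (h (axis i 1)) 0"
      using integral_cis_interval[OF R l(1), of i] that R by (simp add: h_def[abs_def] inner_axis)
    then show ?thesis by (rule has_bochner_integral_integral_eq)
  qed
  obtain i where i: "l $ i \<noteq> 0" using l(2) by (auto simp: Finite_Cartesian_Product.vec_eq_iff)
  have meas: "(\<lambda>x. indicator (cube R) x *\<^sub>R expo l x) \<in> borel_measurable borel"
    by (intro borel_measurable_scaleR borel_measurable_indicator borel_measurable_continuous_onI continuous_intros)
       (simp add: cube_cbox)
  interpret product_sigma_finite "\<lambda>_::real ^ 'n. lborel :: real measure" ..
  have "ft (cube R) l = (LINT x|lebesgue. indicator (cube R) x *\<^sub>R expo l x)"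
    unfolding ft_def using lmeasurable_cube by (intro integral_restrict_space) (auto simp: fmeasurable_def)
  also have "\<dots> = (LINT x|lborel. indicator (cube R) x *\<^sub>R expo l x)"
    using meas by (intro integral_completion) simp
  also have "\<dots> = (LINT f|(\<Pi>\<^sub>M b\<in>(Basis::(real^'n) set). lborel). (\<Prod>b\<in>Basis. h b (f b)))"
  proof -
    have "(LINT x|lborel. indicator (cube R) x *\<^sub>R expo l x) =
        (LINT f|(\<Pi>\<^sub>M b\<in>(Basis::(real^'n) set). lborel). indicator (cube R) (\<Sum>b\<in>Basis. f b *\<^sub>R b) *\<^sub>R expo l (\<Sum>b\<in>Basis. f b *\<^sub>R b))"
      by (subst lborel_eq, rule integral_distr) (use meas in auto)
    also have "\<dots> = (LINT f|(\<Pi>\<^sub>M b\<in>(Basis::(real^'n) set). lborel). (\<Prod>b\<in>Basis. h b (f b)))"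
      unfolding prodh by (intro Bochner_Integration.integral_cong refl prod.cong) (simp add: inner_sum_left_Basis)
    finally show ?thesis .
  qed
  also have "\<dots> = (\<Prod>b\<in>Basis. integral\<^sup>L lborel (h b))"
    by (rule product_integral_prod) (auto intro: inth)
  also have "\<dots> = 0"
    by (rule prod_zero) (use zero[OF i] in \<open>auto simp: Basis_vec_def intro!: bexI[of _ "axis i 1"]\<close>)
  finally show ?thesis .
qed

lemma energy_cube:
  fixes l :: "'k \<Rightarrow> real ^ 'n"
  assumes R: "R > 0" and F: "finite F" "inj_on l F" and l: "\<And>i a. i \<in> F \<Longrightarrow> l i $ a * R \<in> \<int>"
  shows "energy (cube R) F l c = R ^ CARD('n) * (\<Sum>i\<in>F. (cmod (c i))\<^sup>2)"
proof -
  have z: "ft (cube R) (l j - l i) = (if i = j then of_real (R ^ CARD('n)) else 0)" if "i \<in> F" "j \<in> F" for i j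
  proof (cases "i = j")
    case True
    then show ?thesis using R measure_cube[of R, where 'n = 'n] by (simp add: ft_0)
  next
    case False
    then have "l j - l i \<noteq> 0" using F(2) that by (auto simp: inj_on_def)
    moreover have "(l j - l i) $ a * R \<in> \<int>" for a using l[OF that(1)] l[OF that(2)] by (simp add: left_diff_distrib)
    ultimately show ?thesis using ft_cube_eq_0[OF R, of "l j - l i"] False by simp
  qed
  have "complex_of_real (energy (cube R) F l c) = (\<Sum>i\<in>F. cnj (c i) * (\<Sum>j\<in>F. ft (cube R) (l j - l i) * c j))"
    by (rule energy_gram) simp
  also have "\<dots> = (\<Sum>i\<in>F. cnj (c i) * (of_real (R ^ CARD('n)) * c i))"
  proof (intro sum.cong refl arg_cong2[of _ _ _ _ times])
    fix i assume i: "i \<in> F"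
    have "(\<Sum>j\<in>F. ft (cube R) (l j - l i) * c j) = (\<Sum>j\<in>F. if j = i then of_real (R ^ CARD('n)) * c i else 0)"
      using i by (intro sum.cong) (auto simp: z)
    then show "(\<Sum>j\<in>F. ft (cube R) (l j - l i) * c j) = of_real (R ^ CARD('n)) * c i" using F i by simp
  qed
  also have "\<dots> = of_real (R ^ CARD('n) * (\<Sum>i\<in>F. (cmod (c i))\<^sup>2))"
  proof -
    have "cnj (c i) * (of_real (R ^ CARD('n)) * c i) = of_real (R ^ CARD('n) * (cmod (c i))\<^sup>2)" for i
      using complex_norm_square[of "c i"] by (simp add: mult_ac)
    then show ?thesis by (simp only: of_real_sum[symmetric] sum_distrib_left)
  qed
  finally show ?thesis by (simp only: of_real_eq_iff)
qed

lemma LINT_split: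
  fixes f :: "real ^ 'n \<Rightarrow> 'b::{banach, second_countable_topology}"
  assumes S: "S \<in> lmeasurable" "Q \<in> lmeasurable" "S \<subseteq> Q" and f: "integrable (lebesgue_on Q) f"
  shows "(LINT x|lebesgue_on Q. f x) = (LINT x|lebesgue_on S. f x) + (LINT x|lebesgue_on (Q - S). f x)"
proof -
  have sets: "S \<in> sets lebesgue" "Q \<in> sets lebesgue" using S by (auto simp: fmeasurable_def)
  have iQ: "set_integrable lebesgue Q f"
    using f sets unfolding set_integrable_def by (subst (asm) integrable_restrict_space) auto
  have i: "set_integrable lebesgue S f" "set_integrable lebesgue (Q - S) f"
    using set_integrable_subset[OF iQ] sets S by auto
  have "(LINT x:Q|lebesgue. f x) = (LINT x:S \<union> (Q - S)|lebesgue. f x)"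
    using S(3) by (simp add: Un_absorb1)
  also have "\<dots> = (LINT x:S|lebesgue. f x) + (LINT x:Q - S|lebesgue. f x)"
    by (rule set_integral_Un[OF _ i]) auto
  finally show ?thesis
    using sets by (simp add: integral_restrict_space set_lebesgue_integral_def)
qed

lemma energy_split:
  assumes "S \<in> lmeasurable" "Q \<in> lmeasurable" "S \<subseteq> Q"
  shows "energy Q F l c = energy S F l c + energy (Q - S) F l c"
  unfolding energy_def by (rule LINT_split[OF assms integrable_trig_square[OF assms(2)]])

lemma energy_nonneg: "energy S F l c \<ge> 0"
  by (simp add: energy_def)

lemma energy_mono:
  assumes "S \<in> lmeasurable" "Q \<in> lmeasurable" "S \<subseteq> Q"
  shows "energy S F l c \<le> energy Q F l c"
  using energy_split[OF assms, of F l c] energy_nonneg[of "Q - S" F l c] by simp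

text \<open>Pointwise this is 2ab \<le> w a^2 + b^2/w with a the modulus of the exponential sum and
  b that of \<alpha>, integrated over T. The free weight w is what \<open>coefficient_bound\<close>
  exploits.\<close>

lemma weighted_pairing_bound:
  assumes T: "T \<in> lmeasurable" and F: "finite F" and w: "w > 0"
  shows "2 * Re (cnj \<alpha> * (\<Sum>i\<in>F. c i * ft T (l i - m))) \<le> w * energy T F l c + (cmod \<alpha>)\<^sup>2 / w * measure lebesgue T"
proof -
  let ?f = "trig F l c"
  interpret finite_measure "lebesgue_on T" by (rule finite_measure_lebesgue_on[OF T])
  have int: "integrable (lebesgue_on T) (\<lambda>x. ?f x * cnj (expo m x))"
    by (rule integrable_lebesgue_on_bounded[OF T, of _ "\<Sum>i\<in>F. cmod (c i)"])
       (auto intro!: continuous_intros simp: norm_mult norm_trig_le)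
  have "(LINT x|lebesgue_on T. ?f x * cnj (expo m x)) = (LINT x|lebesgue_on T. (\<Sum>i\<in>F. c i * expo (l i - m) x))"
    by (simp add: trig_def sum_distrib_right expo_mult_cnj mult.assoc)
  also have "\<dots> = (\<Sum>i\<in>F. c i * ft T (l i - m))"
    unfolding ft_def by (simp add: integrable_expo[OF T])
  finally have eq: "(\<Sum>i\<in>F. c i * ft T (l i - m)) = (LINT x|lebesgue_on T. ?f x * cnj (expo m x))" by simp
  have "2 * Re (cnj \<alpha> * (\<Sum>i\<in>F. c i * ft T (l i - m))) = (LINT x|lebesgue_on T. 2 * Re (cnj \<alpha> * (?f x * cnj (expo m x))))"
  proof -
    have "(LINT x|lebesgue_on T. Re (cnj \<alpha> * (?f x * cnj (expo m x)))) = Re (LINT x|lebesgue_on T. cnj \<alpha> * (?f x * cnj (expo m x)))"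
      by (rule integral_Re[OF integrable_mult_right[OF int]])
    also have "\<dots> = Re (cnj \<alpha> * (LINT x|lebesgue_on T. ?f x * cnj (expo m x)))"
      by (simp only: integral_mult_right_zero)
    finally show ?thesis unfolding eq by (simp only: integral_mult_right_zero)
  qed
  also have "\<dots> \<le> (LINT x|lebesgue_on T. w * (cmod (?f x))\<^sup>2 + (cmod \<alpha>)\<^sup>2 / w)"
  proof (rule integral_mono)
    show "integrable (lebesgue_on T) (\<lambda>x. 2 * Re (cnj \<alpha> * (?f x * cnj (expo m x))))"
      using int by (intro integrable_mult_right integrable_Re)
    show "integrable (lebesgue_on T) (\<lambda>x. w * (cmod (?f x))\<^sup>2 + (cmod \<alpha>)\<^sup>2 / w)"
      by (intro Bochner_Integration.integrable_add integrable_mult_right integrable_trig_square[OF T] integrable_const)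
    fix x
    have "Re (cnj \<alpha> * (?f x * cnj (expo m x))) \<le> cmod (cnj \<alpha> * (?f x * cnj (expo m x)))" by (rule complex_Re_le_cmod)
    also have "\<dots> = cmod \<alpha> * cmod (?f x)" by (simp add: norm_mult)
    finally have "2 * Re (cnj \<alpha> * (?f x * cnj (expo m x))) \<le> 2 * (cmod \<alpha> * cmod (?f x))" by simp
    also have "\<dots> \<le> w * (cmod (?f x))\<^sup>2 + (cmod \<alpha>)\<^sup>2 / w"
    proof -
      have "0 \<le> (w * cmod (?f x) - cmod \<alpha>)\<^sup>2 / w" using w by simp
      also have "\<dots> = w * (cmod (?f x))\<^sup>2 + (cmod \<alpha>)\<^sup>2 / w - 2 * (cmod \<alpha> * cmod (?f x))"
        using w by (simp add: field_simps power2_eq_square)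
      finally show ?thesis by simp
    qed
    finally show "2 * Re (cnj \<alpha> * (?f x * cnj (expo m x))) \<le> w * (cmod (?f x))\<^sup>2 + (cmod \<alpha>)\<^sup>2 / w" .
  qed
  also have "\<dots> = w * energy T F l c + (cmod \<alpha>)\<^sup>2 / w * measure lebesgue T"
  proof -
    have "(LINT x|lebesgue_on T. w * (cmod (?f x))\<^sup>2 + (cmod \<alpha>)\<^sup>2 / w) =
        (LINT x|lebesgue_on T. w * (cmod (?f x))\<^sup>2) + (LINT x|lebesgue_on T. (cmod \<alpha>)\<^sup>2 / w)"
      by (intro Bochner_Integration.integral_add integrable_mult_right integrable_trig_square[OF T] integrable_const)
    then show ?thesis using T by (simp add: energy_def measure_restrict_space fmeasurable_def)
  qed
  finally show ?thesis .
qed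

text \<open>The estimate that feeds the barrier: with \<open>t\<close> small, \<open>r * t\<close> is close to \<open>1 - \<tau>\<close>, the fraction of points that
  has to be discarded.\<close>

lemma coefficient_bound:
  fixes l :: "'k \<Rightarrow> real ^ 'n"
  assumes R: "R > 0" and F: "finite F" "inj_on l F" and l: "\<And>i a. i \<in> F \<Longrightarrow> l i $ a * R \<in> \<int>"
    and S: "S \<in> lmeasurable" "S \<subseteq> cube R" and t: "t > 0" and j: "j \<in> F"
    and \<tau>: "\<tau> = measure lebesgue S / R ^ CARD('n)" and r: "r = \<tau> / (1 + t) + (1 - \<tau>) / t" "r > 0"
  shows "(cmod (c j))\<^sup>2 \<le> r * (t * (\<Sum>i\<in>F. (cmod (c i))\<^sup>2) + energy S F l c / R ^ CARD('n))"
proof -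
  define D where "D = R ^ CARD('n)"
  \<comment> \<open>The maximiser of twice the pairing term minus the cost |\<alpha>|^2 D r; the
    gain is then X.\<close>
  define \<alpha> where "\<alpha> = c j / of_real r"
  have D: "D > 0" using R by (simp add: D_def)
  let ?Q = "cube R :: (real ^ 'n) set"
  have QS: "?Q - S \<in> lmeasurable" by (rule fmeasurable_Diff[OF lmeasurable_cube fmeasurableD[OF S(1)]])
  have mQ: "measure lebesgue ?Q = D" using R measure_cube[of R, where 'n = 'n] by (simp add: D_def)
  have mQS: "measure lebesgue (?Q - S) = D - measure lebesgue S"
    using measurable_measure_Diff[OF lmeasurable_cube fmeasurableD[OF S(1)] S(2)] mQ by simp
  let ?J = "\<lambda>T. \<Sum>i\<in>F. c i * ft T (l i - l j)"
  have JQ: "?J ?Q = of_real D * c j"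
  proof -
    have "?J ?Q = (\<Sum>i\<in>F. if i = j then of_real D * c j else 0)"
    proof (intro sum.cong refl)
      fix i assume i: "i \<in> F"
      have "ft ?Q (l i - l j) = 0" if "i \<noteq> j"
      proof (rule ft_cube_eq_0[OF R])
        show "(l i - l j) $ a * R \<in> \<int>" for a using l[OF i] l[OF j] by (simp add: left_diff_distrib)
        show "l i - l j \<noteq> 0" using F(2) i j that by (auto simp: inj_on_def)
      qed
      then show "c i * ft ?Q (l i - l j) = (if i = j then of_real D * c j else 0)" by (auto simp: ft_0 mQ)
    qed
    then show ?thesis using F(1) j by simp
  qed
  have Jsplit: "?J ?Q = ?J S + ?J (?Q - S)"
    unfolding ft_def
    by (subst LINT_split[OF S(1) lmeasurable_cube S(2) integrable_expo[OF lmeasurable_cube]])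
       (simp add: distrib_left sum.distrib)
  define E E' E'' where "E = energy S F l c" and "E' = energy (?Q - S) F l c" and "E'' = energy ?Q F l c"
  define X where "X = D * (cmod (c j))\<^sup>2 / r"
  \<comment> \<open>Weight 1 + t on S and t on the rest of the cube: the energies then combine to t
    times the energy of the whole cube plus that of S, and the cube energy is known exactly by
    orthogonality.\<close>
  have 1: "2 * Re (cnj \<alpha> * ?J S) \<le> (1 + t) * E + (cmod \<alpha>)\<^sup>2 / (1 + t) * measure lebesgue S"
    unfolding E_def using t by (intro weighted_pairing_bound[OF S(1) F(1)]) auto
  have 2: "2 * Re (cnj \<alpha> * ?J (?Q - S)) \<le> t * E' + (cmod \<alpha>)\<^sup>2 / t * measure lebesgue (?Q - S)"
    unfolding E'_def by (rule weighted_pairing_bound[OF QS F(1) t])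
  have 3: "Re (cnj \<alpha> * ?J ?Q) = Re (cnj \<alpha> * ?J S) + Re (cnj \<alpha> * ?J (?Q - S))"
    unfolding Jsplit by (simp only: distrib_left plus_complex.sel)
  have 4: "Re (cnj \<alpha> * ?J ?Q) = X"
  proof -
    have "cnj \<alpha> * (of_real D * c j) = of_real (D / r) * of_real ((cmod (c j))\<^sup>2)"
      using r(2) complex_norm_square[of "c j"] by (simp add: \<alpha>_def field_simps)
    also have "\<dots> = of_real X" by (simp add: X_def)
    finally show ?thesis unfolding JQ by (simp only: Re_complex_of_real)
  qed
  have 5: "(1 + t) * E + t * E' = t * E'' + E"
    using energy_split[OF S(1) lmeasurable_cube S(2), of F l c]
    by (simp add: E_def E'_def E''_def algebra_simps)
  have 6: "E'' = D * (\<Sum>i\<in>F. (cmod (c i))\<^sup>2)"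
    unfolding D_def E''_def by (rule energy_cube[OF R F l])
  have 7: "(cmod \<alpha>)\<^sup>2 / (1 + t) * measure lebesgue S + (cmod \<alpha>)\<^sup>2 / t * measure lebesgue (?Q - S) = X"
  proof -
    have mS: "measure lebesgue S = \<tau> * D" using D by (simp add: \<tau> D_def[symmetric])
    have "(cmod \<alpha>)\<^sup>2 / (1 + t) * measure lebesgue S + (cmod \<alpha>)\<^sup>2 / t * measure lebesgue (?Q - S) = (cmod \<alpha>)\<^sup>2 * D * r"
      unfolding mQS mS r(1) using t by (simp add: field_simps)
    then show ?thesis using r(2) by (simp add: X_def \<alpha>_def norm_divide power_divide power2_eq_square)
  qed
  have "X \<le> t * E'' + E" using 1 2 3 4 5 7 by linarith
  also have "\<dots> = D * (t * (\<Sum>i\<in>F. (cmod (c i))\<^sup>2) + E / D)"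
    using D by (simp add: 6 field_simps)
  finally have "D * ((cmod (c j))\<^sup>2 / r) \<le> D * (t * (\<Sum>i\<in>F. (cmod (c i))\<^sup>2) + energy S F l c / D)"
    by (simp add: X_def E_def)
  then have "(cmod (c j))\<^sup>2 / r \<le> t * (\<Sum>i\<in>F. (cmod (c i))\<^sup>2) + energy S F l c / D"
    using D by (simp only: mult_le_cancel_left_pos)
  then show ?thesis using r(2) by (simp add: D_def pos_divide_le_eq mult.commute)
qed

lemma isCont_ft:
  assumes S: "S \<in> lmeasurable" shows "continuous_on UNIV (ft S)"
  unfolding continuous_on_eq_continuous_within
proof (intro ballI, unfold continuous_within_sequentially, intro allI impI)
  fix l :: "real ^ 'a" and X :: "nat \<Rightarrow> real ^ 'a" assume X: "(\<forall>n. X n \<in> UNIV) \<and> X \<longlonglongrightarrow> l"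
  interpret finite_measure "lebesgue_on S" by (rule finite_measure_lebesgue_on[OF S])
  have "(\<lambda>n. LINT x|lebesgue_on S. expo (X n) x) \<longlonglongrightarrow> (LINT x|lebesgue_on S. expo l x)"
  proof (rule integral_dominated_convergence[where w = "\<lambda>_. 1"])
    show "AE x in lebesgue_on S. (\<lambda>n. expo (X n) x) \<longlonglongrightarrow> expo l x"
    proof (intro AE_I2)
      fix x :: "real ^ 'a"
      show "(\<lambda>n. expo (X n) x) \<longlonglongrightarrow> expo l x"
        unfolding expo_def cis_conv_exp using X by (intro tendsto_intros) auto
    qed
  qed (use integrable_expo[OF S] in auto)
  then show "(ft S \<circ> X) \<longlonglongrightarrow> ft S l" by (simp add: ft_def o_def)
qed

section \<open>Moving the frequencies\<close>

text \<open>One factor \<xi> i \<bullet> x is split over the coordinates: x $ a is at most R/2 on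
  the cube, and \<xi> i $ a, at most \<rho>, joins the coefficients, which keeps the sum a lattice
  sum. Cauchy-Schwarz over the CARD('n) summands costs that factor, so the bound does not see the
  size of F.\<close>

lemma inner_power_energy:
  fixes l \<xi> :: "'k \<Rightarrow> real ^ 'n" and R \<rho> :: real
  assumes R: "R > 0" and F: "finite F" "inj_on l F" and l: "\<And>i a. i \<in> F \<Longrightarrow> l i $ a * R \<in> \<int>"
    and \<rho>: "\<rho> \<ge> 0" "\<And>i a. i \<in> F \<Longrightarrow> \<bar>\<xi> i $ a\<bar> \<le> \<rho>"
  shows "(LINT x|lebesgue_on (cube R). (cmod (\<Sum>i\<in>F. c i * of_real ((\<xi> i \<bullet> x) ^ k) * expo (l i) x))\<^sup>2)
      \<le> (CARD('n) * \<rho> * (R / 2)) ^ (2 * k) * (R ^ CARD('n) * (\<Sum>i\<in>F. (cmod (c i))\<^sup>2))"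
proof (induction k arbitrary: c)
  case 0
  show ?case using energy_cube[OF R F l, of c] by (simp add: energy_def trig_def)
next
  case (Suc k)
  let ?Q = "cube R :: (real ^ 'n) set"
  interpret finite_measure "lebesgue_on ?Q" by (rule finite_measure_lebesgue_on) simp
  define g where "g a x = (\<Sum>i\<in>F. (c i * of_real (\<xi> i $ a)) * of_real ((\<xi> i \<bullet> x) ^ k) * expo (l i) x)" for a x
  have cg: "continuous_on S (g a)" for a S unfolding g_def by (intro continuous_intros)
  have cQ: "compact ?Q" by (simp add: cube_cbox)
  have ig: "integrable (lebesgue_on ?Q) h" if "continuous_on ?Q h" for h :: "real ^ 'n \<Rightarrow> real"
  proof -
    have "bounded (h ` ?Q)" using that cQ compact_continuous_image compact_imp_bounded by blast
    then obtain B where "\<And>x. x \<in> ?Q \<Longrightarrow> norm (h x) \<le> B" by (auto simp: bounded_iff)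
    then show ?thesis
      using that by (intro integrable_const_bound[of _ B] continuous_imp_measurable_on_sets_lebesgue)
        (auto simp: fmeasurableD intro!: AE_I2)
  qed
  have split: "(\<Sum>i\<in>F. c i * of_real ((\<xi> i \<bullet> x) ^ Suc k) * expo (l i) x) = (\<Sum>a\<in>UNIV. of_real (x $ a) * g a x)" for x
  proof -
    have "of_real ((\<xi> i \<bullet> x) ^ Suc k) = (\<Sum>a\<in>UNIV. complex_of_real (x $ a) * (of_real (\<xi> i $ a) * of_real ((\<xi> i \<bullet> x) ^ k)))" for i
      by (simp add: inner_vec_def[of "\<xi> i" x] sum_distrib_right mult_ac)
    then have "(\<Sum>i\<in>F. c i * of_real ((\<xi> i \<bullet> x) ^ Suc k) * expo (l i) x) =
        (\<Sum>i\<in>F. \<Sum>a\<in>UNIV. of_real (x $ a) * ((c i * of_real (\<xi> i $ a)) * of_real ((\<xi> i \<bullet> x) ^ k) * expo (l i) x))"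
      by (simp only: sum_distrib_left sum_distrib_right) (simp add: mult_ac)
    also have "\<dots> = (\<Sum>a\<in>UNIV. of_real (x $ a) * g a x)"
      unfolding g_def sum_distrib_left by (rule sum.swap)
    finally show ?thesis .
  qed
  have pt: "(cmod (\<Sum>i\<in>F. c i * of_real ((\<xi> i \<bullet> x) ^ Suc k) * expo (l i) x))\<^sup>2
      \<le> CARD('n) * (R / 2)\<^sup>2 * (\<Sum>a\<in>UNIV. (cmod (g a x))\<^sup>2)" if x: "x \<in> ?Q" for x
  proof -
    have xa: "\<bar>x $ a\<bar> \<le> R / 2" for a using x[unfolded cube_def, simplified, rule_format, of a] by linarith
    have "cmod (\<Sum>a\<in>UNIV. of_real (x $ a) * g a x) \<le> (\<Sum>a\<in>UNIV. \<bar>x $ a\<bar> * cmod (g a x))"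
      by (rule order_trans[OF norm_sum]) (simp add: norm_mult)
    then have "(cmod (\<Sum>a\<in>UNIV. of_real (x $ a) * g a x))\<^sup>2 \<le> (\<Sum>a\<in>UNIV. \<bar>x $ a\<bar> * cmod (g a x))\<^sup>2"
      by (intro power_mono) auto
    also have "\<dots> \<le> (\<Sum>a\<in>UNIV. (\<bar>x $ a\<bar> * cmod (g a x))\<^sup>2) * CARD('n)" by (rule sum_squared_le_sum_of_squares)
    also have "(\<Sum>a\<in>UNIV. (\<bar>x $ a\<bar> * cmod (g a x))\<^sup>2) \<le> (\<Sum>a\<in>UNIV. (R / 2 * cmod (g a x))\<^sup>2)"
      using xa by (intro sum_mono power_mono mult_right_mono) auto
    also have "\<dots> = (R / 2)\<^sup>2 * (\<Sum>a\<in>UNIV. (cmod (g a x))\<^sup>2)" by (simp add: power_mult_distrib sum_distrib_left power_divide)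
    finally show ?thesis unfolding split by (simp add: mult_ac)
  qed
  let ?B = "(CARD('n) * \<rho> * (R / 2)) ^ (2 * k) * R ^ CARD('n)"
  have B: "?B \<ge> 0" using R \<rho> by simp
  have ga: "(LINT x|lebesgue_on ?Q. (cmod (g a x))\<^sup>2) \<le> ?B * (\<rho>\<^sup>2 * (\<Sum>i\<in>F. (cmod (c i))\<^sup>2))" for a
  proof -
    have "(LINT x|lebesgue_on ?Q. (cmod (g a x))\<^sup>2) \<le> ?B * (\<Sum>i\<in>F. (cmod (c i * of_real (\<xi> i $ a)))\<^sup>2)"
      using Suc.IH[of "\<lambda>i. c i * of_real (\<xi> i $ a)"] unfolding g_def by (simp add: mult.assoc)
    also have "(\<Sum>i\<in>F. (cmod (c i * of_real (\<xi> i $ a)))\<^sup>2) \<le> (\<Sum>i\<in>F. \<rho>\<^sup>2 * (cmod (c i))\<^sup>2)"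
    proof (rule sum_mono)
      fix i assume "i \<in> F"
      then have "(\<bar>\<xi> i $ a\<bar>)\<^sup>2 \<le> \<rho>\<^sup>2" using \<rho> by (intro power_mono) auto
      then have "(cmod (c i))\<^sup>2 * (\<bar>\<xi> i $ a\<bar>)\<^sup>2 \<le> (cmod (c i))\<^sup>2 * \<rho>\<^sup>2" by (rule mult_left_mono) simp
      then show "(cmod (c i * of_real (\<xi> i $ a)))\<^sup>2 \<le> \<rho>\<^sup>2 * (cmod (c i))\<^sup>2"
        by (simp add: norm_mult power_mult_distrib mult.commute)
    qed
    finally show ?thesis using B by (simp add: sum_distrib_left mult_left_mono)
  qed
  have "(LINT x|lebesgue_on ?Q. (cmod (\<Sum>i\<in>F. c i * of_real ((\<xi> i \<bullet> x) ^ Suc k) * expo (l i) x))\<^sup>2)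
      \<le> (LINT x|lebesgue_on ?Q. CARD('n) * (R / 2)\<^sup>2 * (\<Sum>a\<in>UNIV. (cmod (g a x))\<^sup>2))"
  proof (rule integral_mono)
    show "integrable (lebesgue_on ?Q) (\<lambda>x. (cmod (\<Sum>i\<in>F. c i * of_real ((\<xi> i \<bullet> x) ^ Suc k) * expo (l i) x))\<^sup>2)"
      by (intro ig continuous_intros)
    show "integrable (lebesgue_on ?Q) (\<lambda>x. CARD('n) * (R / 2)\<^sup>2 * (\<Sum>a\<in>UNIV. (cmod (g a x))\<^sup>2))"
      by (intro ig continuous_intros cg)
  qed (use pt in auto)
  also have "\<dots> = CARD('n) * (R / 2)\<^sup>2 * (\<Sum>a\<in>UNIV. LINT x|lebesgue_on ?Q. (cmod (g a x))\<^sup>2)"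
    by (subst integral_mult_right_zero, subst Bochner_Integration.integral_sum) (auto intro!: ig continuous_intros cg)
  also have "\<dots> \<le> CARD('n) * (R / 2)\<^sup>2 * (\<Sum>a\<in>(UNIV :: 'n set). ?B * (\<rho>\<^sup>2 * (\<Sum>i\<in>F. (cmod (c i))\<^sup>2)))"
    by (intro mult_left_mono sum_mono ga) auto
  also have "\<dots> = (CARD('n) * \<rho> * (R / 2)) ^ (2 * Suc k) * (R ^ CARD('n) * (\<Sum>i\<in>F. (cmod (c i))\<^sup>2))"
  proof -
    have "(CARD('n) * \<rho> * (R / 2)) ^ (2 * Suc k) = (CARD('n) * \<rho> * (R / 2)) ^ (2 * k) * (CARD('n) * \<rho> * (R / 2))\<^sup>2"
      by (simp add: power_add power2_eq_square)
    then show ?thesis by (simp add: power2_eq_square mult_ac)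
  qed
  finally show ?case .
qed

text \<open>Expand the exponential of the displacement in its power series. The k-th term has L^2
  norm at most \<theta>^k / k! times the norm of the lattice sum, with \<theta> the product of 2 pi
  and the factor CARD('n) \<rho> R/2 above. Summing from k = 1 gives exp \<theta> - 1.\<close>

lemma perturbation_bound:
  fixes l \<xi> :: "'k \<Rightarrow> real ^ 'n"
  assumes R: "R > 0" and F: "finite F" "inj_on l F" and l: "\<And>i a. i \<in> F \<Longrightarrow> l i $ a * R \<in> \<int>"
    and \<rho>: "\<rho> > 0" "\<And>i a. i \<in> F \<Longrightarrow> \<bar>\<xi> i $ a\<bar> \<le> \<rho>" and \<theta>: "\<theta> = pi * CARD('n) * \<rho> * R"
  shows "(LINT x|lebesgue_on (cube R). (cmod (trig F (\<lambda>i. l i + \<xi> i) c x - trig F l c x))\<^sup>2)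
      \<le> (exp \<theta> - 1)\<^sup>2 * (R ^ CARD('n) * (\<Sum>i\<in>F. (cmod (c i))\<^sup>2))"
proof -
  let ?Q = "cube R :: (real ^ 'n) set"
  define C where "C = R ^ CARD('n) * (\<Sum>i\<in>F. (cmod (c i))\<^sup>2)"
  have C: "C \<ge> 0" using R by (simp add: C_def sum_nonneg)
  interpret finite_measure "lebesgue_on ?Q" by (rule finite_measure_lebesgue_on) simp
  have \<theta>0: "\<theta> > 0" unfolding \<theta> using \<rho> R by (intro mult_pos_pos) auto
  define w where "w k = \<theta> ^ k / fact k" for k :: nat
  have w: "w k > 0" for k using \<theta>0 by (simp add: w_def)
  define u where "u k x = (\<Sum>i\<in>F. c i * of_real ((\<xi> i \<bullet> x) ^ k) * expo (l i) x) * ((2 * of_real pi * \<i>) ^ k / fact k)" for k x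
  define D where "D n x = (\<Sum>k\<in>{1..n}. u k x)" for n x
  have cu: "continuous_on S (u k)" for k S unfolding u_def by (intro continuous_intros) auto
  have cD: "continuous_on S (D n)" for n S unfolding D_def by (intro continuous_intros cu)
  have cQ: "compact ?Q" by (simp add: cube_cbox)
  have ig: "integrable (lebesgue_on ?Q) h" if "continuous_on ?Q h" for h :: "real ^ 'n \<Rightarrow> real"
  proof -
    have "bounded (h ` ?Q)" using that cQ compact_continuous_image compact_imp_bounded by blast
    then obtain B where "\<And>x. x \<in> ?Q \<Longrightarrow> norm (h x) \<le> B" by (auto simp: bounded_iff)
    then show ?thesis
      using that by (intro integrable_const_bound[of _ B] continuous_imp_measurable_on_sets_lebesgue)
        (auto simp: fmeasurableD intro!: AE_I2)
  qed
  have iu: "(LINT x|lebesgue_on ?Q. (cmod (u k x))\<^sup>2) \<le> (w k)\<^sup>2 * C" for k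
  proof -
    define q where "q = ((2 * pi) ^ k / fact k)\<^sup>2"
    have "(cmod (u k x))\<^sup>2 = (cmod (\<Sum>i\<in>F. c i * of_real ((\<xi> i \<bullet> x) ^ k) * expo (l i) x))\<^sup>2 * q" for x
      by (simp add: u_def q_def norm_mult norm_divide norm_power power_mult_distrib power_divide)
    then have "(LINT x|lebesgue_on ?Q. (cmod (u k x))\<^sup>2) =
        (LINT x|lebesgue_on ?Q. (cmod (\<Sum>i\<in>F. c i * of_real ((\<xi> i \<bullet> x) ^ k) * expo (l i) x))\<^sup>2) * q"
      by simp
    also have "\<dots> \<le> (CARD('n) * \<rho> * (R / 2)) ^ (2 * k) * C * q"
      unfolding C_def
      by (rule mult_right_mono[OF inner_power_energy[OF R F l]]) (use \<rho> in \<open>auto simp: q_def\<close>)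
    also have "(CARD('n) * \<rho> * (R / 2)) ^ (2 * k) * C * q = (w k)\<^sup>2 * C"
    proof -
      have "(CARD('n) * \<rho> * (R / 2)) ^ (2 * k) * q = ((CARD('n) * \<rho> * (R / 2)) ^ k * ((2 * pi) ^ k / fact k))\<^sup>2"
        by (simp add: q_def power_mult_distrib power_mult[symmetric] mult.commute[of k 2] power_divide)
      also have "(CARD('n) * \<rho> * (R / 2)) ^ k * ((2 * pi) ^ k / fact k) = w k"
      proof -
        have "(CARD('n) * \<rho> * (R / 2)) * (2 * pi) = \<theta>" by (simp add: \<theta>)
        then show ?thesis unfolding w_def by (metis power_mult_distrib times_divide_eq_right)
      qed
      finally show ?thesis by (simp add: mult_ac)
    qed
    finally show ?thesis .
  qed
  have iD: "(LINT x|lebesgue_on ?Q. (cmod (D n x))\<^sup>2) \<le> (exp \<theta> - 1)\<^sup>2 * C" for n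
  proof -
    have wn: "(\<Sum>k\<in>{1..n}. w k) \<le> exp \<theta> - 1"
    proof -
      have sm: "summable w" and sw: "suminf w = exp \<theta>"
        using exp_converges[of \<theta>] by (auto simp: w_def[abs_def] sums_iff divide_inverse mult.commute)
      have "(\<Sum>k\<in>{0..n}. w k) \<le> suminf w"
        using w by (intro sum_le_suminf sm) (auto intro: less_imp_le)
      moreover have "(\<Sum>k\<in>{0..n}. w k) = 1 + (\<Sum>k\<in>{1..n}. w k)"
        by (subst sum.atLeast_Suc_atMost) (auto simp: w_def)
      ultimately show ?thesis using sw by simp
    qed
    have wn0: "(\<Sum>k\<in>{1..n}. w k) \<ge> 0" using w by (intro sum_nonneg) (auto intro: less_imp_le)
    \<comment> \<open>Cauchy-Schwarz with weights \<open>w k\<close> replaces the triangle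
      inequality in L^2: after integration it yields the square of the sum of the norm
      bounds.\<close>
    have pt: "(cmod (D n x))\<^sup>2 \<le> (\<Sum>k\<in>{1..n}. w k) * (\<Sum>k\<in>{1..n}. (cmod (u k x))\<^sup>2 / w k)" for x
    proof -
      have "cmod (D n x) \<le> (\<Sum>k\<in>{1..n}. cmod (u k x))" unfolding D_def by (rule norm_sum)
      then have "(cmod (D n x))\<^sup>2 \<le> (\<Sum>k\<in>{1..n}. sqrt (w k) * (cmod (u k x) / sqrt (w k)))\<^sup>2"
        using w by (intro power_mono) (auto simp: less_imp_neq[THEN not_sym])
      also have "\<dots> \<le> (\<Sum>k\<in>{1..n}. (sqrt (w k))\<^sup>2) * (\<Sum>k\<in>{1..n}. (cmod (u k x) / sqrt (w k))\<^sup>2)"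
        by (rule Cauchy_Schwarz_ineq_sum)
      finally show ?thesis using w by (simp add: power_divide less_imp_le)
    qed
    have "(LINT x|lebesgue_on ?Q. (cmod (D n x))\<^sup>2) \<le>
        (LINT x|lebesgue_on ?Q. (\<Sum>k\<in>{1..n}. w k) * (\<Sum>k\<in>{1..n}. (cmod (u k x))\<^sup>2 / w k))"
      by (intro integral_mono pt ig continuous_intros cD cu) (use w in \<open>auto simp: less_imp_neq[THEN not_sym]\<close>)
    also have "\<dots> = (\<Sum>k\<in>{1..n}. w k) * (\<Sum>k\<in>{1..n}. (LINT x|lebesgue_on ?Q. (cmod (u k x))\<^sup>2) / w k)"
      by (subst integral_mult_right_zero, subst Bochner_Integration.integral_sum)
         (use w in \<open>auto intro!: ig continuous_intros cu simp: less_imp_neq[THEN not_sym]\<close>)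
    also have "\<dots> \<le> (\<Sum>k\<in>{1..n}. w k) * (\<Sum>k\<in>{1..n}. w k * C)"
    proof (intro mult_left_mono sum_mono wn0)
      fix k
      have "(LINT x|lebesgue_on ?Q. (cmod (u k x))\<^sup>2) / w k \<le> (w k)\<^sup>2 * C / w k"
        using iu[of k] w[of k] by (intro divide_right_mono) auto
      then show "(LINT x|lebesgue_on ?Q. (cmod (u k x))\<^sup>2) / w k \<le> w k * C"
        using w[of k] by (simp add: power2_eq_square)
    qed
    also have "\<dots> = (\<Sum>k\<in>{1..n}. w k)\<^sup>2 * C" by (simp add: power2_eq_square flip: sum_distrib_right)
    also have "\<dots> \<le> (exp \<theta> - 1)\<^sup>2 * C" using wn wn0 C by (intro mult_right_mono power_mono)
    finally show ?thesis .
  qed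
  have lim: "(\<lambda>n. D n x) \<longlonglongrightarrow> trig F (\<lambda>i. l i + \<xi> i) c x - trig F l c x" for x
  proof -
    have e: "(\<lambda>k. (2 * of_real pi * \<i> * of_real (\<xi> i \<bullet> x)) ^ k / fact k) sums expo (\<xi> i) x" for i
      using exp_converges[of "2 * of_real pi * \<i> * complex_of_real (\<xi> i \<bullet> x)"]
      by (simp add: expo_def cis_conv_exp scaleR_conv_of_real divide_inverse mult_ac)
    have "(\<lambda>k. \<Sum>i\<in>F. c i * expo (l i) x * ((2 * of_real pi * \<i> * of_real (\<xi> i \<bullet> x)) ^ k / fact k)) sums
        (\<Sum>i\<in>F. c i * expo (l i) x * expo (\<xi> i) x)"
      by (intro sums_sum sums_mult e)
    also have "(\<lambda>k. \<Sum>i\<in>F. c i * expo (l i) x * ((2 * of_real pi * \<i> * of_real (\<xi> i \<bullet> x)) ^ k / fact k)) = (\<lambda>k. u k x)"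
      unfolding u_def sum_distrib_right by (intro ext sum.cong refl) (simp add: power_mult_distrib mult_ac)
    also have "(\<Sum>i\<in>F. c i * expo (l i) x * expo (\<xi> i) x) = trig F (\<lambda>i. l i + \<xi> i) c x"
      by (simp add: trig_def expo_add mult.assoc)
    finally have "(\<lambda>k. u k x) sums trig F (\<lambda>i. l i + \<xi> i) c x" .
    then have "(\<lambda>n. \<Sum>k\<le>n. u k x) \<longlonglongrightarrow> trig F (\<lambda>i. l i + \<xi> i) c x" by (simp only: sums_def_le)
    then have "(\<lambda>n. (\<Sum>k\<le>n. u k x) - u 0 x) \<longlonglongrightarrow> trig F (\<lambda>i. l i + \<xi> i) c x - u 0 x"
      by (intro tendsto_intros)
    moreover have "(\<Sum>k\<le>n. u k x) - u 0 x = D n x" for n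
      unfolding D_def atMost_atLeast0 by (subst sum.atLeast_Suc_atMost) auto
    moreover have "u 0 x = trig F l c x" by (simp add: u_def trig_def)
    ultimately show ?thesis by simp
  qed
  have bound: "cmod (D n x) \<le> (\<Sum>i\<in>F. cmod (c i)) * exp \<theta>" if x: "x \<in> ?Q" for n x
  proof -
    have ip: "2 * pi * \<bar>\<xi> i \<bullet> x\<bar> \<le> \<theta>" if "i \<in> F" for i
    proof -
      have "\<bar>\<xi> i \<bullet> x\<bar> \<le> (\<Sum>a\<in>UNIV. \<bar>\<xi> i $ a\<bar> * \<bar>x $ a\<bar>)"
        unfolding inner_vec_def by (rule order_trans[OF sum_abs]) (simp add: abs_mult)
      also have "\<dots> \<le> (\<Sum>a\<in>(UNIV :: 'n set). \<rho> * (R / 2))"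
      proof (intro sum_mono mult_mono)
        show "\<bar>x $ a\<bar> \<le> R / 2" for a using x[unfolded cube_def, simplified, rule_format, of a] by linarith
      qed (use \<rho> that in auto)
      finally show ?thesis unfolding \<theta> by (simp add: field_simps)
    qed
    have uk: "cmod (u k x) \<le> (\<Sum>i\<in>F. cmod (c i)) * w k" for k
    proof -
      have "cmod (u k x) \<le> (\<Sum>i\<in>F. cmod (c i) * \<bar>\<xi> i \<bullet> x\<bar> ^ k) * ((2 * pi) ^ k / fact k)"
        unfolding u_def norm_mult
        by (intro mult_mono order_trans[OF norm_sum]) (auto simp: norm_mult norm_power norm_divide power_abs intro!: sum_nonneg)
      also have "\<dots> = (\<Sum>i\<in>F. cmod (c i) * ((2 * pi * \<bar>\<xi> i \<bullet> x\<bar>) ^ k / fact k))"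
        unfolding sum_distrib_right by (intro sum.cong refl) (simp add: power_mult_distrib mult_ac)
      also have "\<dots> \<le> (\<Sum>i\<in>F. cmod (c i) * w k)"
        unfolding w_def using ip by (intro sum_mono mult_left_mono divide_right_mono power_mono) auto
      finally show ?thesis by (simp add: sum_distrib_right)
    qed
    have "cmod (D n x) \<le> (\<Sum>k\<in>{1..n}. (\<Sum>i\<in>F. cmod (c i)) * w k)"
      unfolding D_def by (rule order_trans[OF norm_sum]) (intro sum_mono uk)
    also have "\<dots> = (\<Sum>i\<in>F. cmod (c i)) * (\<Sum>k\<in>{1..n}. w k)" by (simp add: sum_distrib_left)
    also have "(\<Sum>k\<in>{1..n}. w k) \<le> exp \<theta>"
    proof -
      have sm: "summable w" and sw: "suminf w = exp \<theta>"
        using exp_converges[of \<theta>] by (auto simp: w_def[abs_def] sums_iff divide_inverse mult.commute)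
      show ?thesis unfolding sw[symmetric] using w by (intro sum_le_suminf sm) (auto intro: less_imp_le)
    qed
    finally show ?thesis by (simp add: sum_nonneg mult_left_mono)
  qed
  have "(\<lambda>n. LINT x|lebesgue_on ?Q. (cmod (D n x))\<^sup>2) \<longlonglongrightarrow>
      (LINT x|lebesgue_on ?Q. (cmod (trig F (\<lambda>i. l i + \<xi> i) c x - trig F l c x))\<^sup>2)"
  proof (rule integral_dominated_convergence[where w = "\<lambda>_. ((\<Sum>i\<in>F. cmod (c i)) * exp \<theta>)\<^sup>2"])
    show "AE x in lebesgue_on ?Q. norm ((cmod (D n x))\<^sup>2) \<le> ((\<Sum>i\<in>F. cmod (c i)) * exp \<theta>)\<^sup>2" for n
      by (intro AE_I2) (simp add: bound power_mono)
    show "(\<lambda>x. (cmod (trig F (\<lambda>i. l i + \<xi> i) c x - trig F l c x))\<^sup>2) \<in> borel_measurable (lebesgue_on ?Q)"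
      by (intro continuous_imp_measurable_on_sets_lebesgue continuous_intros) (simp add: fmeasurableD)
    show "(\<lambda>x. (cmod (D n x))\<^sup>2) \<in> borel_measurable (lebesgue_on ?Q)" for n
      by (intro continuous_imp_measurable_on_sets_lebesgue continuous_intros cD) (simp add: fmeasurableD)
    show "AE x in lebesgue_on ?Q. (\<lambda>n. (cmod (D n x))\<^sup>2) \<longlonglongrightarrow>
        (cmod (trig F (\<lambda>i. l i + \<xi> i) c x - trig F l c x))\<^sup>2"
      by (intro AE_I2 tendsto_intros lim)
  qed auto
  then show ?thesis
    unfolding C_def[symmetric] by (rule LIMSEQ_le_const2) (use iD in auto)
qed

section \<open>Riesz sequences\<close>

definition sqint :: "'a measure \<Rightarrow> ('a \<Rightarrow> complex) \<Rightarrow> real" where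
  "sqint M f = (\<integral>x. (cmod (f x))\<^sup>2 \<partial>M)"

lemma sqint_nonneg [simp]: "sqint M f \<ge> 0"
  by (simp add: sqint_def)

lemma L2_norm_sqint: "(L2_norm M f)\<^sup>2 = sqint M f"
  by (simp add: L2_norm_def sqint_def)

lemma cmod_add_square_le: "(cmod (a + b))\<^sup>2 \<le> 2 * (cmod a)\<^sup>2 + 2 * (cmod b)\<^sup>2"
proof -
  have "(cmod (a + b))\<^sup>2 \<le> (cmod a + cmod b)\<^sup>2" by (intro power_mono norm_triangle_ineq) auto
  also have "\<dots> \<le> 2 * (cmod a)\<^sup>2 + 2 * (cmod b)\<^sup>2"
    using sum_squares_bound[of "cmod a" "cmod b"] by (simp add: power2_sum)
  finally show ?thesis .
qed

lemma L2_spaceD: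
  assumes "f \<in> L2_space M"
  shows L2_measurable: "f \<in> borel_measurable M" and L2_integrable: "integrable M (\<lambda>x. (cmod (f x))\<^sup>2)"
  using assms by (auto simp: L2_space_def)

lemma L2_add:
  assumes "f \<in> L2_space M" "g \<in> L2_space M"
  shows "(\<lambda>x. f x + g x) \<in> L2_space M" "sqint M (\<lambda>x. f x + g x) \<le> 2 * sqint M f + 2 * sqint M g"
proof -
  note [measurable] = L2_measurable[OF assms(1)] L2_measurable[OF assms(2)]
  note i = L2_integrable[OF assms(1)] L2_integrable[OF assms(2)]
  have ib: "integrable M (\<lambda>x. 2 * (cmod (f x))\<^sup>2 + 2 * (cmod (g x))\<^sup>2)" using i by simp
  have iS: "integrable M (\<lambda>x. (cmod (f x + g x))\<^sup>2)"
    by (rule Bochner_Integration.integrable_bound[OF ib]) (auto intro!: AE_I2 cmod_add_square_le)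
  then show "(\<lambda>x. f x + g x) \<in> L2_space M" by (simp add: L2_space_def)
  have "sqint M (\<lambda>x. f x + g x) \<le> (\<integral>x. 2 * (cmod (f x))\<^sup>2 + 2 * (cmod (g x))\<^sup>2 \<partial>M)"
    unfolding sqint_def by (rule integral_mono[OF iS ib cmod_add_square_le])
  then show "sqint M (\<lambda>x. f x + g x) \<le> 2 * sqint M f + 2 * sqint M g" using i by (simp add: sqint_def)
qed

lemma L2_minus: "f \<in> L2_space M \<Longrightarrow> (\<lambda>x. - f x) \<in> L2_space M"
  by (auto simp: L2_space_def)

lemma L2_diff:
  assumes "f \<in> L2_space M" "g \<in> L2_space M"
  shows "(\<lambda>x. f x - g x) \<in> L2_space M" "sqint M (\<lambda>x. f x - g x) \<le> 2 * sqint M f + 2 * sqint M g"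
  using L2_add[OF assms(1) L2_minus[OF assms(2)]] by (simp_all add: sqint_def)

lemma sqint_commute: "sqint M (\<lambda>x. f x - g x) = sqint M (\<lambda>x. g x - f x)"
  by (simp add: sqint_def norm_minus_commute)

lemma nn_sqint: "f \<in> L2_space M \<Longrightarrow> (\<integral>\<^sup>+x. ennreal ((cmod (f x))\<^sup>2) \<partial>M) = ennreal (sqint M f)"
  unfolding sqint_def by (rule nn_integral_eq_integral) (auto dest: L2_integrable)

text \<open>The weights 2^k turn a square-summability condition into a geometric bound on the
  increments.\<close>

lemma rapid_convergent:
  fixes s :: "nat \<Rightarrow> complex"
  assumes "(\<Sum>k. ennreal (2 ^ k * (cmod (s (Suc k) - s k))\<^sup>2)) < \<infinity>" shows "convergent s"
proof -
  let ?a = "\<lambda>k. 2 ^ k * (cmod (s (Suc k) - s k))\<^sup>2"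
  have "summable ?a" using assms by (intro summable_suminf_not_top) auto
  then have "Bseq ?a" by (rule convergent_imp_Bseq[OF summable_imp_convergent])
  then obtain C where C: "C > 0" "\<And>k. norm (?a k) \<le> C" by (auto simp: Bseq_def)
  have nb: "norm (s (Suc k) - s k) \<le> sqrt C * (1 / sqrt 2) ^ k" for k
  proof (rule power2_le_imp_le)
    have "1 / sqrt 2 * (1 / sqrt 2) = (1 / 2 :: real)" by simp
    then have "(1 / sqrt 2) ^ k * (1 / sqrt 2) ^ k = (1 / 2 :: real) ^ k"
      by (simp only: power_mult_distrib[symmetric])
    then have e: "(sqrt C * (1 / sqrt 2) ^ k)\<^sup>2 = C * (1 / 2) ^ k"
      using C by (simp add: power_mult_distrib power2_eq_square[of "(1 / sqrt 2) ^ k"])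
    have "(norm (s (Suc k) - s k))\<^sup>2 \<le> C / 2 ^ k"
      using C(2)[of k] by (simp add: pos_le_divide_eq mult.commute)
    then show "(norm (s (Suc k) - s k))\<^sup>2 \<le> (sqrt C * (1 / sqrt 2) ^ k)\<^sup>2"
      unfolding e by (simp add: power_divide)
  qed (use C in auto)
  have "(sqrt 2 :: real) > 1" by simp
  then have "norm (1 / sqrt 2 :: real) < 1" by (simp only: norm_divide norm_one) simp
  then have "summable (\<lambda>k. sqrt C * (1 / sqrt 2) ^ k)" by (intro summable_mult summable_geometric)
  then have "summable (\<lambda>k. s (Suc k) - s k)" by (rule summable_comparison_test') (rule nb)
  then have "(\<lambda>n. \<Sum>k<n. s (Suc k) - s k) \<longlonglongrightarrow> (\<Sum>k. s (Suc k) - s k)" by (rule summable_LIMSEQ)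
  then have "(\<lambda>n. s n - s 0) \<longlonglongrightarrow> (\<Sum>k. s (Suc k) - s k)" by (simp add: sum_lessThan_telescope)
  then have "(\<lambda>n. (s n - s 0) + s 0) \<longlonglongrightarrow> (\<Sum>k. s (Suc k) - s k) + s 0" by (intro tendsto_intros)
  then show ?thesis by (auto simp: convergent_def)
qed

text \<open>The Riesz-Fischer argument: a rapidly Cauchy subsequence converges almost everywhere,
  and Fatou's lemma converts this into convergence in norm.\<close>

lemma L2_complete:
  assumes S: "\<And>n. S n \<in> L2_space M"
    and Cauchy: "\<And>e. e > 0 \<Longrightarrow> \<exists>N. \<forall>m\<ge>N. \<forall>n\<ge>N. sqint M (\<lambda>x. S m x - S n x) < e"
  obtains f where "f \<in> L2_space M" "(\<lambda>n. sqint M (\<lambda>x. S n x - f x)) \<longlonglongrightarrow> 0"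
proof -
  note [measurable] = L2_measurable[OF S]
  have "\<forall>k. \<exists>N. \<forall>m\<ge>N. \<forall>n\<ge>N. sqint M (\<lambda>x. S m x - S n x) < (1 / 8) ^ k" by (intro allI Cauchy) simp
  then obtain N where N: "\<And>k m n. m \<ge> N k \<Longrightarrow> n \<ge> N k \<Longrightarrow> sqint M (\<lambda>x. S m x - S n x) < (1 / 8) ^ k" by metis
  \<comment> \<open>Strictly increasing and above both N k and k. The precision 8^(-k) leaves 4^(-k)
    after weighting with 2^k.\<close>
  define r where "r k = (\<Sum>j\<le>k. N j) + k" for k
  have rN: "r k \<ge> N k" for k unfolding r_def using member_le_sum[of k "{..k}" N] by auto
  have rS: "r (Suc k) > r k" for k by (simp add: r_def)
  have rk: "r k \<ge> k" for k by (simp add: r_def)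
  define H where "H x = (\<Sum>k. ennreal (2 ^ k * (cmod (S (r (Suc k)) x - S (r k) x))\<^sup>2))" for x
  have "(\<integral>\<^sup>+x. H x \<partial>M) = (\<Sum>k. \<integral>\<^sup>+x. ennreal (2 ^ k * (cmod (S (r (Suc k)) x - S (r k) x))\<^sup>2) \<partial>M)"
    unfolding H_def by (rule nn_integral_suminf) measurable
  also have "\<dots> \<le> (\<Sum>k. ennreal ((1 / 4) ^ k))"
  proof (intro suminf_le)
    fix k
    have d: "(\<lambda>x. S (r (Suc k)) x - S (r k) x) \<in> L2_space M" by (rule L2_diff(1)[OF S S])
    have "(\<integral>\<^sup>+x. ennreal (2 ^ k * (cmod (S (r (Suc k)) x - S (r k) x))\<^sup>2) \<partial>M)
        = 2 ^ k * (\<integral>\<^sup>+x. ennreal ((cmod (S (r (Suc k)) x - S (r k) x))\<^sup>2) \<partial>M)"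
      by (subst nn_integral_cmult[symmetric]) (auto simp: ennreal_mult'' ennreal_power[symmetric])
    also have "\<dots> = ennreal (2 ^ k * sqint M (\<lambda>x. S (r (Suc k)) x - S (r k) x))"
      unfolding nn_sqint[OF d] by (simp add: ennreal_mult'' ennreal_power[symmetric])
    also have "\<dots> \<le> ennreal ((1 / 4) ^ k)"
    proof (rule ennreal_leI)
      have "sqint M (\<lambda>x. S (r (Suc k)) x - S (r k) x) < (1 / 8) ^ k"
        using rN[of k] rS[of k] by (intro N) auto
      then have "2 ^ k * sqint M (\<lambda>x. S (r (Suc k)) x - S (r k) x) \<le> 2 ^ k * (1 / 8) ^ k" by simp
      also have "\<dots> = (1 / 4 :: real) ^ k" by (simp flip: power_mult_distrib)
      finally show "2 ^ k * sqint M (\<lambda>x. S (r (Suc k)) x - S (r k) x) \<le> (1 / 4) ^ k" .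
    qed
    finally show "(\<integral>\<^sup>+x. ennreal (2 ^ k * (cmod (S (r (Suc k)) x - S (r k) x))\<^sup>2) \<partial>M) \<le> ennreal ((1 / 4) ^ k)" .
  qed auto
  also have "\<dots> < \<infinity>"
    by (subst suminf_ennreal2) (auto intro!: summable_geometric)
  finally have "(\<integral>\<^sup>+x. H x \<partial>M) \<noteq> \<infinity>" by simp
  moreover have "H \<in> borel_measurable M" unfolding H_def by measurable
  ultimately have AEH: "AE x in M. H x \<noteq> \<infinity>" by (intro nn_integral_noteq_infinite)
  define f where "f x = lim (\<lambda>k. S (r k) x)" for x
  have f[measurable]: "f \<in> borel_measurable M" unfolding f_def by measurable
  have lim: "AE x in M. (\<lambda>k. S (r k) x) \<longlonglongrightarrow> f x"
    using AEH
  proof eventually_elim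
    case (elim x)
    then have "convergent (\<lambda>k. S (r k) x)"
      by (intro rapid_convergent) (auto simp: H_def less_top)
    then show ?case by (simp add: f_def convergent_LIMSEQ_iff)
  qed
  \<comment> \<open>Fatou along the subsequence lets the second index of the Cauchy estimate tend to
    infinity.\<close>
  have bound: "(\<integral>\<^sup>+x. ennreal ((cmod (S n x - f x))\<^sup>2) \<partial>M) \<le> ennreal e"
    if e: "e > 0" and N0: "\<And>m n. m \<ge> N0 \<Longrightarrow> n \<ge> N0 \<Longrightarrow> sqint M (\<lambda>x. S m x - S n x) < e" and n: "n \<ge> N0" for e N0 n
  proof -
    have "(\<integral>\<^sup>+x. ennreal ((cmod (S n x - f x))\<^sup>2) \<partial>M)
        = (\<integral>\<^sup>+x. liminf (\<lambda>k. ennreal ((cmod (S n x - S (r k) x))\<^sup>2)) \<partial>M)"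
    proof (rule nn_integral_cong_AE)
      show "AE x in M. ennreal ((cmod (S n x - f x))\<^sup>2) = liminf (\<lambda>k. ennreal ((cmod (S n x - S (r k) x))\<^sup>2))"
        using lim
      proof eventually_elim
        case (elim x)
        have "(\<lambda>k. ennreal ((cmod (S n x - S (r k) x))\<^sup>2)) \<longlonglongrightarrow> ennreal ((cmod (S n x - f x))\<^sup>2)"
          by (intro tendsto_intros elim)
        then show ?case by (intro lim_imp_Liminf[symmetric]) auto
      qed
    qed
    also have "\<dots> \<le> liminf (\<lambda>k. \<integral>\<^sup>+x. ennreal ((cmod (S n x - S (r k) x))\<^sup>2) \<partial>M)"
      by (rule nn_integral_liminf) measurable
    also have "\<dots> = liminf (\<lambda>k. ennreal (sqint M (\<lambda>x. S n x - S (r k) x)))"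
      by (simp add: nn_sqint[OF L2_diff(1)[OF S S]])
    also have "\<dots> \<le> ennreal e"
    proof (rule Liminf_le)
      show "eventually (\<lambda>k. ennreal (sqint M (\<lambda>x. S n x - S (r k) x)) \<le> ennreal e) sequentially"
        using eventually_ge_at_top[of N0]
      proof eventually_elim
        case (elim k)
        then have "r k \<ge> N0" using rk[of k] by simp
        then show ?case using N0[OF n] by (intro ennreal_leI) (simp add: less_imp_le)
      qed
    qed simp
    finally show ?thesis .
  qed
  have diff: "(\<lambda>x. S n x - f x) \<in> L2_space M" if "n \<ge> N 0" for n
  proof -
    have "(\<integral>\<^sup>+x. ennreal ((cmod (S n x - f x))\<^sup>2) \<partial>M) \<le> ennreal ((1 / 8) ^ 0)"
      by (rule bound[of _ "N 0"]) (use N[of 0] that in auto)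
    then have "(\<integral>\<^sup>+x. ennreal ((cmod (S n x - f x))\<^sup>2) \<partial>M) < \<infinity>" by (auto intro: le_less_trans)
    then have "integrable M (\<lambda>x. (cmod (S n x - f x))\<^sup>2)" by (intro integrableI_bounded) auto
    then show ?thesis by (simp add: L2_space_def)
  qed
  have "f \<in> L2_space M"
    using L2_diff(1)[OF S diff[OF order_refl], of "N 0"] by simp
  moreover have "(\<lambda>n. sqint M (\<lambda>x. S n x - f x)) \<longlonglongrightarrow> 0"
  proof (rule LIMSEQ_I)
    fix e :: real assume e: "e > 0"
    then obtain N0 where N0: "\<And>m n. m \<ge> N0 \<Longrightarrow> n \<ge> N0 \<Longrightarrow> sqint M (\<lambda>x. S m x - S n x) < e / 2"
      using Cauchy[of "e / 2"] by auto
    show "\<exists>no. \<forall>n\<ge>no. norm (sqint M (\<lambda>x. S n x - f x) - 0) < e"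
    proof (intro exI[of _ "max N0 (N 0)"] allI impI)
      fix n assume n: "n \<ge> max N0 (N 0)"
      have "ennreal (sqint M (\<lambda>x. S n x - f x)) \<le> ennreal (e / 2)"
        using nn_sqint[OF diff, of n] bound[of "e / 2" N0 n] N0 e n by auto
      then show "norm (sqint M (\<lambda>x. S n x - f x) - 0) < e" using e by (simp add: ennreal_le_iff)
    qed
  qed
  ultimately show thesis by (rule that)
qed

text \<open>The factors \<open>2\<close> lost by using \<open>|a + b|\<^sup>2 \<le> 2 |a|\<^sup>2 + 2 |b|\<^sup>2\<close> instead of the triangle inequality for the norm
  are harmless here.\<close>

lemma Riesz_sequence_from_finite:
  fixes \<Lambda> :: "(real ^ 'n) set" and \<Omega> :: "(real ^ 'n) set"
  assumes \<Omega>: "\<Omega> \<in> lmeasurable" and cnt: "countable \<Lambda>" and A: "A > 0" and B: "B > 0"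
    and lower: "\<And>F c. finite F \<Longrightarrow> F \<subseteq> \<Lambda> \<Longrightarrow> A * (\<Sum>l\<in>F. (cmod (c l))\<^sup>2) \<le> energy \<Omega> F (\<lambda>l. l) c"
    and upper: "\<And>F c. finite F \<Longrightarrow> F \<subseteq> \<Lambda> \<Longrightarrow> energy \<Omega> F (\<lambda>l. l) c \<le> B * (\<Sum>l\<in>F. (cmod (c l))\<^sup>2)"
  shows "Riesz_sequence_L2 (lebesgue_on \<Omega>)
           (\<lambda>l x. exp (2 * of_real pi * \<i> * of_real (l \<bullet> x)) * indicator \<Omega> x) \<Lambda>"
  unfolding Riesz_sequence_L2_def
proof (intro conjI ballI)
  let ?M = "lebesgue_on \<Omega>"
  define g where "g l x = exp (2 * of_real pi * \<i> * of_real (l \<bullet> x)) * (indicator \<Omega> x :: complex)" for l x :: "real ^ 'n"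
  have g: "g l x = expo l x" if "x \<in> \<Omega>" for l x
    using that by (simp add: g_def expo_def cis_conv_exp mult_ac)
  have \<Omega>s: "\<Omega> \<in> sets lebesgue" using \<Omega> by (rule fmeasurableD)
  have sums: "(\<Sum>i\<in>F. c i * g i x) = trig F (\<lambda>l. l) c x" if "x \<in> \<Omega>" for F c x
    using that by (simp add: trig_def g)
  have L2trig: "(\<lambda>x. \<Sum>i\<in>F. c i * g i x) \<in> L2_space ?M" for F c
  proof -
    have "trig F (\<lambda>l. l) c \<in> borel_measurable ?M"
      by (rule continuous_imp_measurable_on_sets_lebesgue[OF _ \<Omega>s]) (intro continuous_intros)
    then have m: "(\<lambda>x. \<Sum>i\<in>F. c i * g i x) \<in> borel_measurable ?M"
      by (rule measurable_cong[THEN iffD2, rotated]) (auto simp: sums)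
    have "integrable ?M (\<lambda>x. (cmod (\<Sum>i\<in>F. c i * g i x))\<^sup>2) = integrable ?M (\<lambda>x. (cmod (trig F (\<lambda>l. l) c x))\<^sup>2)"
      by (intro Bochner_Integration.integrable_cong) (auto simp: sums)
    then show ?thesis using m integrable_trig_square[OF \<Omega>] by (simp add: L2_space_def)
  qed
  have sqtrig: "sqint ?M (\<lambda>x. \<Sum>i\<in>F. c i * g i x) = energy \<Omega> F (\<lambda>l. l) c" for F c
    unfolding sqint_def energy_def by (intro Bochner_Integration.integral_cong) (auto simp: sums)
  show "countable \<Lambda>" by (rule cnt)
  show "(\<lambda>x. exp (2 * of_real pi * \<i> * of_real (l \<bullet> x)) * indicator \<Omega> x) \<in> L2_space ?M" for l
  proof -
    have "(\<lambda>x. \<Sum>i\<in>{l}. 1 * g i x) = g l" by (intro ext) simp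
    then show ?thesis using L2trig[of "\<lambda>_. 1" "{l}"] by (simp only: g_def[abs_def])
  qed
  have "\<exists>f. has_L2_sum ?M (\<lambda>i x. c i * g i x) \<Lambda> f \<and>
      A / 2 * (\<Sum>\<^sub>\<infinity>i\<in>\<Lambda>. (cmod (c i))\<^sup>2) \<le> (L2_norm ?M f)\<^sup>2 \<and>
      (L2_norm ?M f)\<^sup>2 \<le> 2 * B * (\<Sum>\<^sub>\<infinity>i\<in>\<Lambda>. (cmod (c i))\<^sup>2)"
    if sc: "(\<lambda>i. (cmod (c i))\<^sup>2) summable_on \<Lambda>" for c :: "real ^ 'n \<Rightarrow> complex"
  proof -
    define T where "T = (\<Sum>\<^sub>\<infinity>i\<in>\<Lambda>. (cmod (c i))\<^sup>2)"
    define s where "s F = (\<Sum>i\<in>F. (cmod (c i))\<^sup>2)" for F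
    define P where "P F x = (\<Sum>i\<in>F. c i * g i x)" for F x
    have sT: "(s \<longlongrightarrow> T) (finite_subsets_at_top \<Lambda>)"
      using has_sum_infsum[OF sc] by (simp add: has_sum_def s_def[abs_def] T_def)
    have PL2: "P F \<in> L2_space ?M" for F unfolding P_def[abs_def] by (rule L2trig)
    have close: "\<exists>F0. finite F0 \<and> F0 \<subseteq> \<Lambda> \<and> (\<forall>F G. finite F \<and> F0 \<subseteq> F \<and> F \<subseteq> \<Lambda> \<and> finite G \<and> F0 \<subseteq> G \<and> G \<subseteq> \<Lambda>
        \<longrightarrow> sqint ?M (\<lambda>x. P F x - P G x) \<le> e)" if e: "e > 0" for e
    proof -
      have "eventually (\<lambda>F. dist (s F) T < e / (2 * B)) (finite_subsets_at_top \<Lambda>)"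
        using sT e B by (intro tendstoD) auto
      then obtain F0 where F0': "finite F0 \<and> F0 \<subseteq> \<Lambda> \<and>
          (\<forall>F. finite F \<and> F0 \<subseteq> F \<and> F \<subseteq> \<Lambda> \<longrightarrow> dist (s F) T < e / (2 * B))"
        unfolding eventually_finite_subsets_at_top ..
      then have F0: "finite F0" "F0 \<subseteq> \<Lambda>"
          "\<And>F. finite F \<Longrightarrow> F0 \<subseteq> F \<Longrightarrow> F \<subseteq> \<Lambda> \<Longrightarrow> dist (s F) T < e / (2 * B)"
        by simp_all
      have "sqint ?M (\<lambda>x. P F x - P G x) \<le> e"
        if F: "finite F" "F0 \<subseteq> F" "F \<subseteq> \<Lambda>" and G: "finite G" "F0 \<subseteq> G" "G \<subseteq> \<Lambda>" for F G
      proof -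
        \<comment> \<open>The sums agree on F \<inter> G, so their difference lives on D. As D
          avoids F0, its square sum is a small tail.\<close>
        define D where "D = (F - G) \<union> (G - F)"
        define d where "d i = (if i \<in> F then c i else - c i)" for i
        have D: "finite D" "D \<subseteq> \<Lambda>" "D \<inter> F0 = {}" using F G by (auto simp: D_def)
        have eq: "P F x - P G x = (\<Sum>i\<in>D. d i * g i x)" for x
        proof -
          have "P F x = (\<Sum>i\<in>F - G. c i * g i x) + (\<Sum>i\<in>F \<inter> G. c i * g i x)"
            unfolding P_def using F by (subst sum.union_disjoint[symmetric]) (auto intro: sum.cong)
          moreover have "P G x = (\<Sum>i\<in>G - F. c i * g i x) + (\<Sum>i\<in>F \<inter> G. c i * g i x)"
            unfolding P_def using G by (subst sum.union_disjoint[symmetric]) (auto intro: sum.cong)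
          moreover have "(\<Sum>i\<in>D. d i * g i x) = (\<Sum>i\<in>F - G. d i * g i x) + (\<Sum>i\<in>G - F. d i * g i x)"
            unfolding D_def using F G by (intro sum.union_disjoint) auto
          moreover have "(\<Sum>i\<in>F - G. d i * g i x) = (\<Sum>i\<in>F - G. c i * g i x)"
            by (intro sum.cong) (auto simp: d_def)
          moreover have "(\<Sum>i\<in>G - F. d i * g i x) = - (\<Sum>i\<in>G - F. c i * g i x)"
            unfolding sum_negf[symmetric] by (intro sum.cong) (auto simp: d_def)
          ultimately show ?thesis by simp
        qed
        have "sqint ?M (\<lambda>x. P F x - P G x) = energy \<Omega> D (\<lambda>l. l) d" unfolding eq by (rule sqtrig)
        also have "\<dots> \<le> B * (\<Sum>l\<in>D. (cmod (d l))\<^sup>2)" by (rule upper[OF D(1,2)])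
        also have "(\<Sum>l\<in>D. (cmod (d l))\<^sup>2) = s D" unfolding s_def by (intro sum.cong) (auto simp: d_def)
        also have "s D = s (F0 \<union> D) - s F0"
          unfolding s_def using D F0(1) by (subst sum.union_disjoint) auto
        also have "\<dots> \<le> e / (2 * B) + e / (2 * B)"
          using F0(3)[of "F0 \<union> D"] F0(3)[of F0] F0(1,2) D by (auto simp: dist_real_def abs_less_iff)
        finally show ?thesis using B by (simp add: mult_left_mono)
      qed
      then show ?thesis using F0(1,2) by (intro exI[of _ F0]) auto
    qed
    \<comment> \<open>Completeness speaks of sequences, so the limit f is found along an exhaustion
      of \<Lambda>; \<open>close\<close> then extends the convergence to all finite subsets.\<close>
    define Fn where "Fn n = {l \<in> \<Lambda>. to_nat_on \<Lambda> l \<le> n}" for n :: nat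
    have Fn: "finite (Fn n)" "Fn n \<subseteq> \<Lambda>" for n
    proof -
      have "inj_on (to_nat_on \<Lambda>) (Fn n)" using inj_on_to_nat_on[OF cnt] by (auto simp: Fn_def inj_on_def)
      moreover have "to_nat_on \<Lambda> ` Fn n \<subseteq> {..n}" by (auto simp: Fn_def)
      ultimately show "finite (Fn n)" by (meson finite_atMost finite_imageD finite_subset)
    qed (auto simp: Fn_def)
    have exh: "\<exists>N. \<forall>n\<ge>N. F0 \<subseteq> Fn n" if "finite F0" "F0 \<subseteq> \<Lambda>" for F0
    proof (intro exI[of _ "\<Sum>l\<in>F0. to_nat_on \<Lambda> l"] allI impI subsetI)
      fix n l assume "n \<ge> (\<Sum>l\<in>F0. to_nat_on \<Lambda> l)" and l: "l \<in> F0"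
      moreover have "to_nat_on \<Lambda> l \<le> (\<Sum>l\<in>F0. to_nat_on \<Lambda> l)" using that l by (intro member_le_sum) auto
      ultimately show "l \<in> Fn n" using that by (auto simp: Fn_def)
    qed
    have cau: "\<exists>N. \<forall>m\<ge>N. \<forall>n\<ge>N. sqint ?M (\<lambda>x. P (Fn m) x - P (Fn n) x) < e" if e: "e > 0" for e
    proof -
      obtain F0 where F0: "finite F0" "F0 \<subseteq> \<Lambda>" "\<And>F G. finite F \<and> F0 \<subseteq> F \<and> F \<subseteq> \<Lambda> \<and> finite G \<and> F0 \<subseteq> G \<and> G \<subseteq> \<Lambda>
        \<Longrightarrow> sqint ?M (\<lambda>x. P F x - P G x) \<le> e / 2" using close[of "e / 2"] e by auto
      obtain N where N: "\<And>n. n \<ge> N \<Longrightarrow> F0 \<subseteq> Fn n" using exh[OF F0(1,2)] by blast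
      have "sqint ?M (\<lambda>x. P (Fn m) x - P (Fn n) x) < e" if "m \<ge> N" "n \<ge> N" for m n
        using F0(3)[of "Fn m" "Fn n"] Fn N that e by fastforce
      then show ?thesis by blast
    qed
    obtain f where f: "f \<in> L2_space ?M" "(\<lambda>n. sqint ?M (\<lambda>x. P (Fn n) x - f x)) \<longlonglongrightarrow> 0"
      by (rule L2_complete[of "\<lambda>n. P (Fn n)" ?M]) (use PL2 cau in auto)
    have lim: "((\<lambda>F. sqint ?M (\<lambda>x. P F x - f x)) \<longlongrightarrow> 0) (finite_subsets_at_top \<Lambda>)"
    proof (rule tendstoI)
      fix e :: real assume e: "e > 0"
      obtain F0 where F0: "finite F0" "F0 \<subseteq> \<Lambda>" "\<And>F G. finite F \<and> F0 \<subseteq> F \<and> F \<subseteq> \<Lambda> \<and> finite G \<and> F0 \<subseteq> G \<and> G \<subseteq> \<Lambda>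
        \<Longrightarrow> sqint ?M (\<lambda>x. P F x - P G x) \<le> e / 8" using close[of "e / 8"] e by auto
      obtain N where N: "\<And>n. n \<ge> N \<Longrightarrow> F0 \<subseteq> Fn n" using exh[OF F0(1,2)] by blast
      have "eventually (\<lambda>n. sqint ?M (\<lambda>x. P (Fn n) x - f x) < e / 8) sequentially"
        using order_tendstoD(2)[OF f(2), of "e / 8"] e by simp
      then have "eventually (\<lambda>n. sqint ?M (\<lambda>x. P (Fn n) x - f x) < e / 8 \<and> n \<ge> N) sequentially"
        using eventually_ge_at_top[of N] by eventually_elim simp
      then obtain n where n: "sqint ?M (\<lambda>x. P (Fn n) x - f x) < e / 8" "n \<ge> N"
        using eventually_happens[of _ sequentially] by auto
      have "dist (sqint ?M (\<lambda>x. P F x - f x)) 0 < e" if F: "finite F" "F0 \<subseteq> F" "F \<subseteq> \<Lambda>" for F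
      proof -
        have "sqint ?M (\<lambda>x. (P F x - P (Fn n) x) + (P (Fn n) x - f x)) \<le>
            2 * sqint ?M (\<lambda>x. P F x - P (Fn n) x) + 2 * sqint ?M (\<lambda>x. P (Fn n) x - f x)"
          by (intro L2_add L2_diff PL2 f(1))
        moreover have "sqint ?M (\<lambda>x. P F x - P (Fn n) x) \<le> e / 8"
          using F0(3)[of F "Fn n"] F Fn N[OF n(2)] by auto
        ultimately show ?thesis using n(1) e by simp
      qed
      then show "eventually (\<lambda>F. dist (sqint ?M (\<lambda>x. P F x - f x)) 0 < e) (finite_subsets_at_top \<Lambda>)"
        unfolding eventually_finite_subsets_at_top using F0(1,2) by (intro exI[of _ F0]) auto
    qed
    have nb: "finite_subsets_at_top \<Lambda> \<noteq> bot" by simp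
    have evF: "eventually (\<lambda>F. finite F \<and> F \<subseteq> \<Lambda>) (finite_subsets_at_top \<Lambda>)"
      by (rule eventually_finite_subsets_at_top_weakI) auto
    have low: "A / 2 * T \<le> sqint ?M f"
    proof -
      have "A * T \<le> 2 * 0 + 2 * sqint ?M f"
      proof (rule tendsto_le[OF nb])
        show "((\<lambda>F. 2 * sqint ?M (\<lambda>x. P F x - f x) + 2 * sqint ?M f) \<longlongrightarrow> 2 * 0 + 2 * sqint ?M f) (finite_subsets_at_top \<Lambda>)"
          by (intro tendsto_intros lim)
        show "((\<lambda>F. A * s F) \<longlongrightarrow> A * T) (finite_subsets_at_top \<Lambda>)" by (intro tendsto_intros sT)
        show "eventually (\<lambda>F. A * s F \<le> 2 * sqint ?M (\<lambda>x. P F x - f x) + 2 * sqint ?M f) (finite_subsets_at_top \<Lambda>)"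
          using evF
        proof eventually_elim
          case (elim F)
          have "A * s F \<le> sqint ?M (P F)"
            unfolding s_def P_def[abs_def] sqtrig using elim by (intro lower) auto
          also have "\<dots> = sqint ?M (\<lambda>x. (P F x - f x) + f x)" by simp
          also have "\<dots> \<le> 2 * sqint ?M (\<lambda>x. P F x - f x) + 2 * sqint ?M f"
            by (intro L2_add L2_diff PL2 f(1))
          finally show ?case .
        qed
      qed
      then show ?thesis by simp
    qed
    have up: "sqint ?M f \<le> 2 * B * T"
    proof -
      have "sqint ?M f \<le> 2 * 0 + 2 * (B * T)"
      proof (rule tendsto_le[OF nb])
        show "((\<lambda>F. 2 * sqint ?M (\<lambda>x. P F x - f x) + 2 * (B * s F)) \<longlongrightarrow> 2 * 0 + 2 * (B * T)) (finite_subsets_at_top \<Lambda>)"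
          by (intro tendsto_intros lim sT)
        show "((\<lambda>F. sqint ?M f) \<longlongrightarrow> sqint ?M f) (finite_subsets_at_top \<Lambda>)" by simp
        show "eventually (\<lambda>F. sqint ?M f \<le> 2 * sqint ?M (\<lambda>x. P F x - f x) + 2 * (B * s F)) (finite_subsets_at_top \<Lambda>)"
          using evF
        proof eventually_elim
          case (elim F)
          have "sqint ?M f = sqint ?M (\<lambda>x. (f x - P F x) + P F x)" by simp
          then have "sqint ?M f \<le> 2 * sqint ?M (\<lambda>x. f x - P F x) + 2 * sqint ?M (P F)"
            using L2_add(2)[OF L2_diff(1)[OF f(1) PL2] PL2, of F F] by (simp only:)
          moreover have "sqint ?M (P F) \<le> B * s F"
            unfolding s_def P_def[abs_def] sqtrig by (rule upper) (use elim in blast)+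
          moreover have "sqint ?M (\<lambda>x. f x - P F x) = sqint ?M (\<lambda>x. P F x - f x)"
            by (rule sqint_commute)
          ultimately show ?case by linarith
        qed
      qed
      then show ?thesis by simp
    qed
    have "((\<lambda>F. L2_norm ?M (\<lambda>x. P F x - f x)) \<longlongrightarrow> sqrt 0) (finite_subsets_at_top \<Lambda>)"
      unfolding L2_norm_def sqint_def[symmetric] by (intro tendsto_real_sqrt lim)
    then have hs: "has_L2_sum ?M (\<lambda>i x. c i * g i x) \<Lambda> f"
      unfolding has_L2_sum_def using f(1) by (simp add: P_def)
    show ?thesis using hs low up unfolding T_def L2_norm_sqint by blast
  qed
  then show "\<exists>A>0. \<exists>B>0. \<forall>c. (\<lambda>i. (cmod (c i))\<^sup>2) summable_on \<Lambda> \<longrightarrow>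
      (\<exists>f. has_L2_sum ?M (\<lambda>i x. c i * (exp (2 * of_real pi * \<i> * of_real (i \<bullet> x)) * indicator \<Omega> x)) \<Lambda> f \<and>
        A * (\<Sum>\<^sub>\<infinity>i\<in>\<Lambda>. (cmod (c i))\<^sup>2) \<le> (L2_norm ?M f)\<^sup>2 \<and>
        (L2_norm ?M f)\<^sup>2 \<le> B * (\<Sum>\<^sub>\<infinity>i\<in>\<Lambda>. (cmod (c i))\<^sup>2))"
    unfolding g_def using A B by (intro exI[of _ "A / 2"] conjI exI[of _ "2 * B"] allI impI) auto
qed

section \<open>Beurling density\<close>

lemma norm_le_CARD_mult:
  fixes v :: "real ^ 'n" and b :: real
  assumes "\<And>i. \<bar>v $ i\<bar> \<le> b"
  shows "norm v \<le> CARD('n) * b"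
proof -
  have "norm v \<le> (\<Sum>i\<in>UNIV. \<bar>v $ i\<bar>)" by (rule norm_le_l1_cart)
  also have "\<dots> \<le> (\<Sum>i\<in>(UNIV::'n set). b)" using assms by (rule sum_mono)
  finally show ?thesis by simp
qed

text \<open>Each cell of side b carries N labelled points. Cells contained in a ball of radius r
  cover the concentric ball of radius r - D, so volume comparison counts them, and the loss
  disappears as r grows. Closed cells share faces, so points are told apart by injectivity on
  labels.\<close>

lemma lower_Beurling_density_ge:
  fixes p :: "(int ^ 'n) \<times> nat \<Rightarrow> real ^ 'n" and b :: real
  assumes b: "b > 0" and inj: "inj_on p (UNIV \<times> {..<N})"
    and cell: "\<And>z s i. s < N \<Longrightarrow> b * z $ i \<le> p (z, s) $ i \<and> p (z, s) $ i \<le> b * (z $ i + 1)"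
  shows "ennreal (N / b ^ CARD('n)) \<le> lower_Beurling_density (p ` (UNIV \<times> {..<N}))"
proof -
  define d where "d = CARD('n)"
  \<comment> \<open>A bound on the diameter of a cell, by comparing the Euclidean norm with the sum
    of the coordinates.\<close>
  define D where "D = d * b"
  define V where "V = unit_ball_vol (real d)"
  define S where "S = p ` (UNIV \<times> {..<N})"
  define g where "g r = ennreal (N / b ^ d * ((r - D) / r) ^ d)" for r :: real
  have V: "V > 0" by (simp add: V_def)
  have D: "D > 0" using b by (simp add: D_def d_def)
  have ball: "emeasure lebesgue (ball x r) = ennreal (V * r ^ d)" if "r \<ge> 0" for x :: "real ^ 'n" and r
    using emeasure_ball[OF that, of x] by (simp add: V_def d_def)
  have bound: "g r \<le> emeasure (count_space UNIV) (S \<inter> ball x r) / emeasure lebesgue (ball x r)"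
    if r: "r > D" for r and x :: "real ^ 'n"
  proof -
    define C where "C z = cbox (\<chi> i. b * z $ i) (\<chi> i. b * (z $ i + 1))" for z :: "int ^ 'n"
    define Z where "Z = {z. C z \<subseteq> ball x r}"
    have mem: "y \<in> C z \<longleftrightarrow> (\<forall>i. b * z $ i \<le> y $ i \<and> y $ i \<le> b * (z $ i + 1))" for y z
      by (simp add: C_def mem_box_cart)
    have ballr: "emeasure lebesgue (ball x r) = ennreal (V * r ^ d)"
      using r D by (intro ball) simp
    have sub: "p ` (Z \<times> {..<N}) \<subseteq> S \<inter> ball x r"
      using cell by (auto simp: S_def Z_def mem)
    have injZ: "inj_on p (Z \<times> {..<N})" using inj by (rule inj_on_subset) auto
    show ?thesis
    \<comment> \<open>With infinitely many cells and N positive the count is infinite and the bound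
      trivial.\<close>
    proof (cases "finite Z \<or> N = 0")
      case False
      then have "infinite (Z \<times> {..<N})" by (auto simp: finite_cartesian_product_iff)
      then have "infinite (p ` (Z \<times> {..<N}))" using injZ finite_imageD by blast
      then have "infinite (S \<inter> ball x r)" using sub finite_subset by blast
      then have "emeasure (count_space UNIV) (S \<inter> ball x r) = \<infinity>" by simp
      then show ?thesis unfolding ballr by (simp add: ennreal_top_divide)
    next
      case True
      have cov: "ball x (r - D) \<subseteq> (\<Union>z\<in>Z. C z)"
      proof
        fix y assume y: "y \<in> ball x (r - D)"
        define z :: "int ^ 'n" where "z = (\<chi> i. \<lfloor>y $ i / b\<rfloor>)"
        have yz: "y \<in> C z"
          unfolding mem
        proof
          fix i
          have "of_int \<lfloor>y $ i / b\<rfloor> \<le> y $ i / b" "y $ i / b \<le> of_int \<lfloor>y $ i / b\<rfloor> + 1" by linarith+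
          then show "b * z $ i \<le> y $ i \<and> y $ i \<le> b * (z $ i + 1)"
            using b unfolding z_def pos_le_divide_eq[OF b] pos_divide_le_eq[OF b]
            by (simp add: mult.commute[of b])
        qed
        have "C z \<subseteq> ball x r"
        proof
          fix w assume w: "w \<in> C z"
          have "\<bar>(w - y) $ i\<bar> \<le> b" for i
          proof -
            have "b * z $ i \<le> y $ i" "y $ i \<le> b * z $ i + b" "b * z $ i \<le> w $ i" "w $ i \<le> b * z $ i + b"
              using yz w unfolding mem by (auto simp: distrib_left)
            then show ?thesis by simp
          qed
          then have "norm (w - y) \<le> D" unfolding D_def d_def by (rule norm_le_CARD_mult)
          then have "dist y w \<le> D" by (simp add: dist_norm norm_minus_commute)
          then show "w \<in> ball x r" using y dist_triangle[of x w y] by simp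
        qed
        then show "y \<in> (\<Union>z\<in>Z. C z)" using yz by (auto simp: Z_def)
      qed
      show ?thesis
      proof (cases "N = 0")
        case False
        then have fin: "finite Z" using True by simp
        have mC: "emeasure lebesgue (C z) = ennreal (b ^ d)" for z
        proof -
          have "measure lebesgue (C z) = b ^ d"
            unfolding C_def using b
            by (subst measure_completion, simp, subst content_cbox_cart)
              (auto simp: interval_ne_empty_cart d_def distrib_left)
          moreover have "C z \<in> lmeasurable" by (simp add: C_def)
          ultimately show ?thesis by (simp add: emeasure_eq_measure2)
        qed
        have "ennreal (V * (r - D) ^ d) = emeasure lebesgue (ball x (r - D))" using r by (intro ball[symmetric]) simp
        also have "\<dots> \<le> emeasure lebesgue (\<Union>z\<in>Z. C z)"
          by (rule emeasure_mono[OF cov]) (auto simp: C_def intro!: sets.finite_UN fin)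
        also have "\<dots> \<le> (\<Sum>z\<in>Z. emeasure lebesgue (C z))"
          by (rule emeasure_subadditive_finite) (auto simp: C_def fin)
        also have "\<dots> = ennreal (card Z * b ^ d)"
          using b by (simp add: mC ennreal_of_nat_eq_real_of_nat ennreal_mult'')
        finally have "V * (r - D) ^ d \<le> card Z * b ^ d" using b by (simp add: ennreal_le_iff)
        then have "N * (V * (r - D) ^ d) \<le> N * (card Z * b ^ d)" by (rule mult_left_mono) simp
        then have "N / b ^ d * ((r - D) / r) ^ d \<le> N * card Z / (V * r ^ d)"
          using V b r D by (simp add: field_simps power_divide)
        then have "g r \<le> ennreal (N * card Z / (V * r ^ d))" unfolding g_def by (rule ennreal_leI)
        also have "\<dots> = ennreal (real (card (p ` (Z \<times> {..<N})))) / emeasure lebesgue (ball x r)"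
          unfolding ballr using r D V by (simp add: card_image[OF injZ] card_cartesian_product divide_ennreal mult.commute)
        also have "\<dots> \<le> emeasure (count_space UNIV) (S \<inter> ball x r) / emeasure lebesgue (ball x r)"
        proof (rule divide_right_mono_ennreal)
          have "ennreal (real (card (p ` (Z \<times> {..<N})))) = emeasure (count_space UNIV) (p ` (Z \<times> {..<N}))"
            using fin by (subst emeasure_count_space_finite) (auto simp: ennreal_of_nat_eq_real_of_nat)
          also have "\<dots> \<le> emeasure (count_space UNIV) (S \<inter> ball x r)"
            by (rule emeasure_mono[OF sub]) simp
          finally show "ennreal (real (card (p ` (Z \<times> {..<N})))) \<le> emeasure (count_space UNIV) (S \<inter> ball x r)" .
        qed
        finally show ?thesis .
      qed (simp add: g_def)
    qed
  qed
  have "(g \<longlongrightarrow> ennreal (N / b ^ d * (1 - D * 0) ^ d)) at_top"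
  proof (rule Lim_transform_eventually)
    show "((\<lambda>r. ennreal (N / b ^ d * (1 - D * inverse r) ^ d)) \<longlongrightarrow> ennreal (N / b ^ d * (1 - D * 0) ^ d)) at_top"
      by (intro tendsto_ennrealI tendsto_intros tendsto_inverse_0_at_top filterlim_ident)
    show "eventually (\<lambda>r. ennreal (N / b ^ d * (1 - D * inverse r) ^ d) = g r) at_top"
      using eventually_gt_at_top[of 0]
      by eventually_elim (simp add: g_def divide_inverse left_diff_distrib)
  qed
  then have "ennreal (N / b ^ d) = Liminf at_top g"
    by (subst lim_imp_Liminf) auto
  also have "\<dots> \<le> lower_Beurling_density S"
    unfolding lower_Beurling_density_def
  proof (rule Liminf_mono)
    show "eventually (\<lambda>r. g r \<le> (INF x. emeasure (count_space UNIV) (S \<inter> ball x r) / emeasure lebesgue (ball x r))) at_top"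
      using eventually_gt_at_top[of D] by eventually_elim (intro INF_greatest bound)
  qed
  finally show ?thesis by (simp add: d_def S_def)
qed

section \<open>Configurations of frequencies\<close>

definition ibox :: "nat \<Rightarrow> int ^ 'n \<Rightarrow> (int ^ 'n) set" where
  "ibox k v = {q. \<forall>i. v $ i \<le> q $ i \<and> q $ i < v $ i + int k}"

definition scale_int :: "nat \<Rightarrow> int ^ 'n \<Rightarrow> int ^ 'n" where
  "scale_int M v = (\<chi> i. int M * v $ i)"

definition lattice_point :: "real \<Rightarrow> int ^ 'n \<Rightarrow> real ^ 'n" where
  "lattice_point R q = (\<chi> i. of_int (q $ i) / R)"

lemma ibox_bij: "bij_betw (\<lambda>f. \<chi> i. f i) (UNIV \<rightarrow>\<^sub>E {0..<int k}) (ibox k (0 :: int ^ 'n))"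
proof (rule bij_betw_byWitness[where f' = "\<lambda>q. vec_nth q"])
qed (auto simp: ibox_def PiE_def Pi_def)

lemma card_ibox: "finite (ibox k v) \<and> card (ibox k (v :: int ^ 'n)) = k ^ CARD('n)"
proof -
  have "ibox k v = (\<lambda>q. v + q) ` ibox k 0"
  proof (intro Set.set_eqI iffI)
    fix q assume "q \<in> ibox k v"
    then have "q - v \<in> ibox k 0" by (simp add: ibox_def diff_less_eq add.commute)
    then show "q \<in> (\<lambda>q. v + q) ` ibox k 0"
      by (intro image_eqI[of _ _ "q - v"]) auto
  qed (auto simp: ibox_def)
  moreover have "inj_on (\<lambda>q. v + q) (ibox k 0)" by simp
  moreover have "finite (ibox k (0 :: int ^ 'n))"
    by (rule bij_betw_finite[OF ibox_bij, THEN iffD1]) (intro finite_PiE, auto)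
  moreover have "card (ibox k (0 :: int ^ 'n)) = k ^ CARD('n)"
    using bij_betw_same_card[OF ibox_bij[of k], symmetric] by (simp add: card_PiE)
  ultimately show ?thesis by (simp add: card_image)
qed

text \<open>Boxes of side at most M on a grid of spacing M: integer division by M recovers the grid
  point.\<close>

lemma ibox_scale_disjoint:
  assumes "k \<le> M" "k > 0" "q \<in> ibox k (scale_int M z)" "q \<in> ibox k (scale_int M z')"
  shows "z = z'"
proof -
  have "z $ i = q $ i div int M" if "q \<in> ibox k (scale_int M z)" for z i
  proof -
    have "int M * z $ i \<le> q $ i" "q $ i < int M * z $ i + int M"
      using that assms(1) by (auto simp: ibox_def scale_int_def) (smt (verit) of_nat_mono)
    then show ?thesis by (intro int_div_pos_eq[of _ _ _ "q $ i - int M * z $ i", symmetric]) auto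
  qed
  from this[OF assms(3)] this[OF assms(4)] show ?thesis by (simp add: Finite_Cartesian_Product.vec_eq_iff)
qed

lemma disjoint_ibox_scale: "k \<le> M \<Longrightarrow> k > 0 \<Longrightarrow> disjoint ((\<lambda>z. ibox k (scale_int M z)) ` Z)"
  unfolding pairwise_def disjnt_def using ibox_scale_disjoint by blast

lemma inj_lattice_point: "R \<noteq> 0 \<Longrightarrow> inj_on (lattice_point R) F"
  by (auto simp: inj_on_def lattice_point_def Finite_Cartesian_Product.vec_eq_iff)

lemma lattice_point_Ints: "R \<noteq> 0 \<Longrightarrow> lattice_point R q $ a * R \<in> \<int>"
  by (simp add: lattice_point_def)

lemma energy_mono_neutral:
  assumes "finite G" "F \<subseteq> G" "\<And>i. i \<in> G - F \<Longrightarrow> c i = 0"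
  shows "energy S G l c = energy S F l c"
proof -
  have "trig G l c x = trig F l c x" for x
    unfolding trig_def using assms by (intro sum.mono_neutral_right) auto
  then show ?thesis by (simp add: energy_def)
qed

lemma energy_cong:
  "(\<And>i. i \<in> F \<Longrightarrow> l i = l' i) \<Longrightarrow> (\<And>i. i \<in> F \<Longrightarrow> c i = c' i) \<Longrightarrow> energy S F l c = energy S F l' c'"
  unfolding energy_def trig_def by (simp cong: sum.cong)

lemma energy_reindex: "inj_on g F \<Longrightarrow> energy S (g ` F) l c = energy S F (\<lambda>i. l (g i)) (\<lambda>i. c (g i))"
  unfolding energy_def trig_def by (simp add: sum.reindex)

lemma ft_hermitian: "S \<in> lmeasurable \<Longrightarrow> ft S (l j - l i) = cnj (ft S (l i - l j))"
  using ft_minus[of S "l i - l j"] by simp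

text \<open>Spacing and side of the boxes are both k, so they tile the lattice. The matrix W is the
  Gram matrix divided by the volume of the cube, and \<open>coefficient_bound\<close> is the
  hypothesis of the selection. The constant a does not depend on Z.\<close>

lemma lower_lattice_selection:
  fixes Z :: "(int ^ 'n) set" and S :: "(real ^ 'n) set" and R t a K r \<tau> :: real and k m :: nat
  defines "\<tau> \<equiv> measure lebesgue S / R ^ CARD('n)"
  defines "r \<equiv> \<tau> / (1 + t) + (1 - \<tau>) / t"
  assumes Z: "finite Z" and S: "S \<in> lmeasurable" "S \<subseteq> cube R" and R: "R > 0" and t: "t > 0" and r: "r > 0"
    and K: "K > 1" and k: "k > 0"
    and par: "(1 - 1 / K)\<^sup>2 / (k ^ CARD('n) * r) * (m - 2 * K\<^sup>2) \<ge> t + a"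
  shows "\<exists>A. A \<subseteq> (\<Union>z\<in>Z. ibox k (scale_int k z)) \<and> (\<forall>z\<in>Z. card (ibox k (scale_int k z) \<inter> A) \<ge> k ^ CARD('n) - m) \<and>
    (\<forall>c. energy S A (lattice_point R) c \<ge> a * (R ^ CARD('n) * (\<Sum>q\<in>A. (cmod (c q))\<^sup>2)))"
proof -
  define I where "I = (\<Union>z\<in>Z. ibox k (scale_int k z))"
  define Bs where "Bs = (\<lambda>z. ibox k (scale_int k z)) ` Z"
  define W where "W i j = ft S (lattice_point R j - lattice_point R i) / R ^ CARD('n)" for i j :: "int ^ 'n"
  have I: "finite I" using Z by (auto simp: I_def card_ibox)
  have Rd: "R ^ CARD('n) > 0" using R by simp
  have qf: "qfI I W c = energy S I (lattice_point R) c / R ^ CARD('n)" for c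
  proof -
    have "(\<Sum>i\<in>I. cnj (c i) * (\<Sum>j\<in>I. W i j * c j))
        = (\<Sum>i\<in>I. cnj (c i) * (\<Sum>j\<in>I. ft S (lattice_point R j - lattice_point R i) * c j)) / of_real (R ^ CARD('n))"
      by (simp add: W_def flip: sum_divide_distrib)
    also have "\<dots> = of_real (energy S I (lattice_point R) c / R ^ CARD('n))"
      unfolding energy_gram[OF S(1), symmetric] by simp
    finally show ?thesis by (simp add: qfI_def del: of_real_divide)
  qed
  have "\<exists>A\<subseteq>\<Union>Bs. (\<forall>b\<in>Bs. card (b \<inter> A) \<ge> k ^ CARD('n) - m) \<and>
      (\<forall>x. (\<forall>i\<in>I - A. x i = 0) \<longrightarrow> qfI I W x \<ge> a * nsqI I x)"
  proof (rule selection_lowerI[of I W r K "k ^ CARD('n)" t])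
    show "W j i = cnj (W i j)" for i j
      unfolding W_def by (subst ft_hermitian[OF S(1)]) simp
    show "(cmod (x j))\<^sup>2 \<le> r * (t * nsqI I x + qfI I W x)" if "j \<in> I" for x j
      unfolding qf nsqI_def
      by (rule coefficient_bound[OF R I inj_lattice_point lattice_point_Ints S t that \<tau>_def[THEN meta_eq_to_obj_eq] r_def[THEN meta_eq_to_obj_eq] r])
        (use R in auto)
    show "disjoint Bs" unfolding Bs_def using k by (intro disjoint_ibox_scale) auto
    show "(1 - 1 / K)\<^sup>2 / (real (k ^ CARD('n)) * r) * (real m - 2 * K\<^sup>2) \<ge> t + a" using par by simp
    show "b \<subseteq> I \<and> card b = k ^ CARD('n)" if "b \<in> Bs" for b
      using that by (auto simp: Bs_def I_def card_ibox)
  qed (use I r K k Z in \<open>auto simp: Bs_def\<close>)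
  then obtain A where A: "A \<subseteq> \<Union>Bs" "\<forall>b\<in>Bs. card (b \<inter> A) \<ge> k ^ CARD('n) - m"
      "\<And>x. (\<forall>i\<in>I - A. x i = 0) \<Longrightarrow> qfI I W x \<ge> a * nsqI I x" by auto
  have AI: "A \<subseteq> I" using A(1) by (auto simp: Bs_def I_def)
  have "energy S A (lattice_point R) c \<ge> a * (R ^ CARD('n) * (\<Sum>q\<in>A. (cmod (c q))\<^sup>2))" for c
  proof -
    define x where "x i = (if i \<in> A then c i else 0)" for i
    have "energy S I (lattice_point R) x = energy S A (lattice_point R) x"
      by (rule energy_mono_neutral[OF I AI]) (simp add: x_def)
    also have "\<dots> = energy S A (lattice_point R) c" by (rule energy_cong) (auto simp: x_def)
    finally have e: "energy S I (lattice_point R) x = energy S A (lattice_point R) c" .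
    have "nsqI I x = (\<Sum>q\<in>A. (cmod (x q))\<^sup>2)"
      unfolding nsqI_def by (rule sum.mono_neutral_right[OF I AI]) (simp add: x_def)
    also have "\<dots> = (\<Sum>q\<in>A. (cmod (c q))\<^sup>2)" by (rule sum.cong) (auto simp: x_def)
    finally have n: "nsqI I x = (\<Sum>q\<in>A. (cmod (c q))\<^sup>2)" .
    have "qfI I W x \<ge> a * nsqI I x" by (rule A(3)) (simp add: x_def)
    then show ?thesis using Rd unfolding qf e n by (simp add: field_simps)
  qed
  then show ?thesis using A(1,2) by (intro exI[of _ A]) (auto simp: Bs_def)
qed

text \<open>The identity is added to the Gram matrix only to make it positive definite. The bound does not depend on
  the refinement \<open>k\<close>, although the cube grows with it.\<close>

lemma upper_lattice_selection:
  fixes A :: "(int ^ 'n) set" and \<Omega> :: "(real ^ 'n) set" and R :: real and w k :: nat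
  defines "Q \<equiv> \<Omega> \<inter> cube (w * k * R)"
  assumes A: "finite A" and \<Omega>: "\<Omega> \<in> lmeasurable" and R: "R > 0" and w: "w > 0" and k: "k > 0"
  shows "\<exists>\<mu>. (\<forall>q\<in>A. \<forall>i. of_int (q $ i) / R \<le> \<mu> q $ i \<and> \<mu> q $ i \<le> of_int (q $ i) / R + 1 / (w * R)) \<and>
    (\<forall>c. energy Q A \<mu> c \<le> 2 * (measure lebesgue \<Omega> + 2 + (w * R) ^ CARD('n)) * (\<Sum>q\<in>A. (cmod (c q))\<^sup>2))"
proof -
  \<comment> \<open>After division by R1 the cell of q starts at q/R, has side 1/(w R) and holds
    k^CARD('n) points of the fine lattice.\<close>
  define cell where "cell q = ibox k (scale_int (w * k) q)" for q :: "int ^ 'n"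
  define R1 where "R1 = w * k * R"
  define I where "I = (\<Union>q\<in>A. cell q)"
  define Bs where "Bs = cell ` A"
  define l where "l = (lattice_point R1 :: int ^ 'n \<Rightarrow> real ^ 'n)"
  define W where "W i j = ft Q (l j - l i) + (if i = j then 1 else 0)" for i j
  define L where "L = k ^ CARD('n)"
  define C where "C = R1 ^ CARD('n) + 1"
  define \<omega> where "\<omega> = measure lebesgue \<Omega> + 1"
  have R1: "R1 > 0" using R w k by (simp add: R1_def)
  have I: "finite I" using A by (auto simp: I_def cell_def card_ibox)
  have Q: "Q \<in> lmeasurable" "Q \<subseteq> cube R1" using \<Omega> by (auto simp: Q_def R1_def)
  have kw: "k \<le> w * k" using w by simp
  have qf: "qfI I W c = energy Q I l c + nsqI I c" for c
  proof -
    have "(\<Sum>i\<in>I. cnj (c i) * (\<Sum>j\<in>I. W i j * c j))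
       = (\<Sum>i\<in>I. cnj (c i) * (\<Sum>j\<in>I. ft Q (l j - l i) * c j)) + (\<Sum>i\<in>I. cnj (c i) * c i)"
      using I by (simp add: W_def distrib_right sum.distrib distrib_left if_distrib[of "\<lambda>z. z * _"] cong: if_cong)
    also have "(\<Sum>i\<in>I. cnj (c i) * c i) = of_real (nsqI I c)"
      by (simp add: nsqI_def complex_norm_square mult.commute del: of_real_power)
    finally show ?thesis unfolding energy_gram[OF Q(1), symmetric] by (simp add: qfI_def)
  qed
  have "\<exists>S\<subseteq>\<Union>Bs. (\<forall>b\<in>Bs. card (b \<inter> S) = 1) \<and>
      (\<forall>x. (\<forall>i\<in>I - S. x i = 0) \<longrightarrow> qfI I W x \<le> (2 * \<omega> + 2 * (C / L)) * nsqI I x)"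
  proof (rule selection_upperI[OF I])
    show "W j i = cnj (W i j)" for i j
      unfolding W_def by (subst ft_hermitian[OF Q(1)]) simp
    show "qfI I W x > 0" if "\<exists>i\<in>I. x i \<noteq> 0" for x
    proof -
      have "nsqI I x > 0" unfolding nsqI_def using that I by (auto intro: sum_pos2)
      then show ?thesis unfolding qf using energy_nonneg[of Q I l x] by simp
    qed
    show "C > 0" using R1 by (simp add: C_def add_pos_pos)
    show "qfI I W x \<le> C * nsqI I x" for x
    proof -
      have "energy Q I l x \<le> energy (cube R1) I l x" using Q by (intro energy_mono) auto
      also have "\<dots> = R1 ^ CARD('n) * nsqI I x"
        unfolding nsqI_def l_def using R1
        by (intro energy_cube I inj_lattice_point lattice_point_Ints) auto
      finally show ?thesis unfolding qf C_def by (simp add: distrib_right)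
    qed
    show "\<omega> > 0" by (simp add: \<omega>_def add_nonneg_pos)
    show "Re (W j j) \<le> \<omega>" for j
      using measure_mono_fmeasurable[of Q \<Omega> lebesgue] Q(1) \<Omega>
      by (simp add: W_def \<omega>_def ft_0 Q_def fmeasurableD)
    show "disjoint Bs" unfolding Bs_def cell_def using k kw by (intro disjoint_ibox_scale)
    show "b \<subseteq> I \<and> card b = L" if "b \<in> Bs" for b
      using that by (auto simp: Bs_def I_def L_def cell_def card_ibox)
  qed (use I k A in \<open>auto simp: Bs_def L_def\<close>)
  then obtain S where S: "S \<subseteq> \<Union>Bs" "\<forall>b\<in>Bs. card (b \<inter> S) = 1"
      "\<And>x. (\<forall>i\<in>I - S. x i = 0) \<Longrightarrow> qfI I W x \<le> (2 * \<omega> + 2 * (C / L)) * nsqI I x" by auto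
  have "\<exists>s. s \<in> cell q \<inter> S" if "q \<in> A" for q
    using S(2) that by (force simp: Bs_def card_1_singleton_iff)
  then obtain f where f: "\<And>q. q \<in> A \<Longrightarrow> f q \<in> cell q \<inter> S" by metis
  have inj: "inj_on f A"
  proof (rule inj_onI)
    fix x y assume "x \<in> A" "y \<in> A" "f x = f y"
    then have "f x \<in> cell x" "f x \<in> cell y" using f[of x] f[of y] by auto
    then show "x = y" unfolding cell_def by (rule ibox_scale_disjoint[OF kw k])
  qed
  have fI: "f ` A \<subseteq> I" using f by (auto simp: I_def)
  have range: "of_int (q $ i) / R \<le> l (f q) $ i \<and> l (f q) $ i \<le> of_int (q $ i) / R + 1 / (w * R)"
    if q: "q \<in> A" for q i
  proof -
    have "int (w * k) * q $ i \<le> f q $ i" "f q $ i \<le> int (w * k) * q $ i + int k"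
      using f[OF q] by (auto simp: cell_def ibox_def scale_int_def intro: less_imp_le)
    then have "real w * k * q $ i \<le> f q $ i" "f q $ i \<le> real w * k * q $ i + k"
      by (simp_all flip: of_int_le_iff[where 'a = real])
    then show ?thesis
      using R w k by (simp add: l_def lattice_point_def R1_def field_simps)
  qed
  \<comment> \<open>The refinement cancels: the cube volume and the number of points per cell both
    carry the factor k^CARD('n).\<close>
  have CL: "C / L \<le> (w * R) ^ CARD('n) + 1"
  proof -
    have "C / L = (w * R) ^ CARD('n) + 1 / L"
      using k by (simp add: C_def L_def R1_def add_divide_distrib power_mult_distrib)
    moreover have "1 / real L \<le> 1" using k by (simp add: L_def)
    ultimately show ?thesis by simp
  qed
  have "energy Q A (\<lambda>q. l (f q)) c \<le> 2 * (measure lebesgue \<Omega> + 2 + (w * R) ^ CARD('n)) * (\<Sum>q\<in>A. (cmod (c q))\<^sup>2)" for c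
  proof -
    define x where "x i = (if i \<in> f ` A then c (the_inv_into A f i) else 0)" for i
    have xf: "x (f q) = c q" if "q \<in> A" for q using that inj by (simp add: x_def the_inv_into_f_f)
    have "energy Q I l x = energy Q (f ` A) l x"
      by (rule energy_mono_neutral[OF I fI]) (simp add: x_def)
    also have "\<dots> = energy Q A (\<lambda>q. l (f q)) c"
      unfolding energy_reindex[OF inj] by (rule energy_cong) (auto simp: xf)
    finally have e: "energy Q I l x = energy Q A (\<lambda>q. l (f q)) c" .
    have "nsqI I x = (\<Sum>q\<in>f ` A. (cmod (x q))\<^sup>2)"
      unfolding nsqI_def by (rule sum.mono_neutral_right[OF I fI]) (simp add: x_def)
    also have "\<dots> = (\<Sum>q\<in>A. (cmod (c q))\<^sup>2)"
      unfolding sum.reindex[OF inj] by (rule sum.cong) (auto simp: xf)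
    finally have n: "nsqI I x = (\<Sum>q\<in>A. (cmod (c q))\<^sup>2)" .
    have n0: "nsqI I x \<ge> 0" by (simp add: nsqI_def sum_nonneg)
    have "energy Q I l x \<le> qfI I W x" unfolding qf using n0 by simp
    also have "\<dots> \<le> (2 * \<omega> + 2 * (C / L)) * nsqI I x"
      by (rule S(3)) (use f in \<open>auto simp: x_def\<close>)
    also have "\<dots> \<le> 2 * (measure lebesgue \<Omega> + 2 + (w * R) ^ CARD('n)) * nsqI I x"
      using CL by (intro mult_right_mono n0) (simp add: \<omega>_def)
    finally show ?thesis unfolding e n .
  qed
  then show ?thesis using range by (intro exI[of _ "\<lambda>q. l (f q)"]) blast
qed

text \<open>The squared triangle inequality gives a s \<le> 2 E + 2 (a/4) s, where s is the norm
  term, E the perturbed energy, and a/4 the perturbation cost allowed by \<open>small\<close>. This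
  leaves E at least (a/4) s.\<close>

lemma perturbed_lower_bound:
  fixes \<mu> :: "int ^ 'n \<Rightarrow> real ^ 'n" and S :: "(real ^ 'n) set"
  assumes A: "finite A" and R: "R > 0" and S: "S \<in> lmeasurable" "S \<subseteq> cube R" and w: "w > 0"
    and \<mu>: "\<And>q i. q \<in> A \<Longrightarrow> \<bar>\<mu> q $ i - of_int (q $ i) / R\<bar> \<le> 1 / (w * R)"
    and small: "(exp (pi * CARD('n) / w) - 1)\<^sup>2 \<le> a / 4"
    and lower: "a * (R ^ CARD('n) * (\<Sum>q\<in>A. (cmod (c q))\<^sup>2)) \<le> energy S A (lattice_point R) c"
  shows "a / 4 * R ^ CARD('n) * (\<Sum>q\<in>A. (cmod (c q))\<^sup>2) \<le> energy S A \<mu> c"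
proof -
  define s where "s = R ^ CARD('n) * (\<Sum>q\<in>A. (cmod (c q))\<^sup>2)"
  define l where "l = (lattice_point R :: int ^ 'n \<Rightarrow> real ^ 'n)"
  define d where "d x = trig A \<mu> c x - trig A l c x" for x
  have s0: "s \<ge> 0" using R by (simp add: s_def sum_nonneg)
  have i: "integrable (lebesgue_on Q) (\<lambda>x. (cmod (d x))\<^sup>2)" if "Q \<in> lmeasurable" for Q
  proof (rule integrable_lebesgue_on_bounded[OF that])
    show "continuous_on Q (\<lambda>x. (cmod (d x))\<^sup>2)" unfolding d_def by (intro continuous_intros)
    show "norm ((cmod (d x))\<^sup>2) \<le> (2 * (\<Sum>i\<in>A. cmod (c i)))\<^sup>2" for x
    proof -
      have "cmod (d x) \<le> 2 * (\<Sum>i\<in>A. cmod (c i))"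
        using norm_triangle_ineq4[of "trig A \<mu> c x" "trig A l c x"] norm_trig_le[of A \<mu> c x] norm_trig_le[of A l c x]
        by (simp add: d_def)
      from power_mono[OF this norm_ge_zero, of 2] show ?thesis by simp
    qed
  qed
  have \<xi>: "\<bar>(\<mu> q - l q) $ i\<bar> \<le> 1 / (w * R)" if "q \<in> A" for q i
    using \<mu>[OF that] by (simp add: l_def lattice_point_def)
  have "(LINT x|lebesgue_on S. (cmod (d x))\<^sup>2) \<le> (LINT x|lebesgue_on (cube R). (cmod (d x))\<^sup>2)"
    by (subst LINT_split[OF S(1) lmeasurable_cube S(2) i]) auto
  also have "\<dots> \<le> (exp (pi * CARD('n) / w) - 1)\<^sup>2 * s"
    using perturbation_bound[OF R A inj_lattice_point lattice_point_Ints, where \<xi> = "\<lambda>q. \<mu> q - l q" and \<rho> = "1 / (w * R)"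
      and \<theta> = "pi * CARD('n) / w" and c = c] R w \<xi>
    unfolding d_def s_def l_def by simp
  also have "\<dots> \<le> a / 4 * s" using small s0 by (rule mult_right_mono)
  finally have D: "(LINT x|lebesgue_on S. (cmod (d x))\<^sup>2) \<le> a / 4 * s" .
  have "a * s \<le> energy S A l c" using lower by (simp add: s_def l_def)
  also have "\<dots> \<le> (LINT x|lebesgue_on S. 2 * (cmod (trig A \<mu> c x))\<^sup>2 + 2 * (cmod (d x))\<^sup>2)"
    unfolding energy_def
  proof (rule integral_mono)
    fix x
    have "cmod (trig A l c x) \<le> cmod (trig A \<mu> c x) + cmod (d x)"
      using norm_triangle_ineq4[of "trig A \<mu> c x" "d x"] by (simp add: d_def)
    then have "(cmod (trig A l c x))\<^sup>2 \<le> (cmod (trig A \<mu> c x) + cmod (d x))\<^sup>2" by (intro power_mono) auto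
    also have "\<dots> \<le> 2 * (cmod (trig A \<mu> c x))\<^sup>2 + 2 * (cmod (d x))\<^sup>2"
      using sum_squares_bound[of "cmod (trig A \<mu> c x)" "cmod (d x)"] by (simp add: power2_sum)
    finally show "(cmod (trig A l c x))\<^sup>2 \<le> 2 * (cmod (trig A \<mu> c x))\<^sup>2 + 2 * (cmod (d x))\<^sup>2" .
  qed (intro Bochner_Integration.integrable_add integrable_mult_right integrable_trig_square i S(1))+
  also have "\<dots> = 2 * energy S A \<mu> c + 2 * (LINT x|lebesgue_on S. (cmod (d x))\<^sup>2)"
    unfolding energy_def using i[OF S(1)] integrable_trig_square[OF S(1), of A \<mu> c] by simp
  finally show ?thesis using D by (simp add: s_def)
qed

text \<open>Label (z, s) denotes the s-th surviving point of block z after its move inside its fine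
  cell. Exactly N survivors per block are used, so that configurations for different Z share the
  label set and compactness can act on them.\<close>

lemma finite_configuration:
  fixes Z :: "(int ^ 'n) set" and \<Omega> S :: "(real ^ 'n) set" and R a :: real and k w n N :: nat
  defines "B \<equiv> 2 * (measure lebesgue \<Omega> + 2 + (w * R) ^ CARD('n))"
  assumes Z: "finite Z" and R: "R > 0" and S: "S \<in> lmeasurable" "S \<subseteq> cube R" and \<Omega>: "\<Omega> \<in> lmeasurable"
    and A: "A \<subseteq> (\<Union>z\<in>Z. ibox k (scale_int k z))" and N: "\<And>z. z \<in> Z \<Longrightarrow> N \<le> card (ibox k (scale_int k z) \<inter> A)"
    and lower: "\<And>c. a * (R ^ CARD('n) * (\<Sum>q\<in>A. (cmod (c q))\<^sup>2)) \<le> energy S A (lattice_point R) c"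
    and pos: "k > 0" "w > 0" "n > 0" and small: "(exp (pi * CARD('n) / w) - 1)\<^sup>2 \<le> a / 4"
  shows "\<exists>x. (\<forall>z s i. k / R * z $ i \<le> x (z, s) $ i \<and> x (z, s) $ i \<le> k / R * (z $ i + 1)) \<and>
    (\<forall>c. a / 4 * R ^ CARD('n) * (\<Sum>p\<in>Z \<times> {..<N}. (cmod (c p))\<^sup>2) \<le> energy S (Z \<times> {..<N}) x c) \<and>
    (\<forall>c. energy (\<Omega> \<inter> cube (n * (w * R))) (Z \<times> {..<N}) x c \<le> B * (\<Sum>p\<in>Z \<times> {..<N}. (cmod (c p))\<^sup>2))"
proof -
  define F where "F = Z \<times> {..<N}"
  define box where "box z = ibox k (scale_int k z)" for z :: "int ^ 'n"
  have finA: "finite A" using A by (rule finite_subset) (simp add: Z card_ibox)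
  obtain \<mu> where \<mu>: "\<And>q i. q \<in> A \<Longrightarrow> of_int (q $ i) / R \<le> \<mu> q $ i \<and> \<mu> q $ i \<le> of_int (q $ i) / R + 1 / (w * R)"
      "\<And>c. energy (\<Omega> \<inter> cube (w * n * R)) A \<mu> c \<le> B * (\<Sum>q\<in>A. (cmod (c q))\<^sup>2)"
    using upper_lattice_selection[OF finA \<Omega> R pos(2,3)] unfolding B_def by blast
  have low: "a / 4 * R ^ CARD('n) * (\<Sum>q\<in>A. (cmod (c q))\<^sup>2) \<le> energy S A \<mu> c" for c
  proof (rule perturbed_lower_bound[OF finA R S _ _ small lower])
    show "\<bar>\<mu> q $ i - of_int (q $ i) / R\<bar> \<le> 1 / (w * R)" if "q \<in> A" for q i
      using \<mu>(1)[OF that, of i] by (simp add: abs_le_iff)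
  qed (use pos in auto)
  have "\<exists>e. inj_on e {..<N} \<and> e ` {..<N} \<subseteq> box z \<inter> A" if "z \<in> Z" for z
    using N[OF that] finA card_le_inj[of "{..<N}" "box z \<inter> A"] by (auto simp: box_def)
  then obtain e where e: "\<And>z. z \<in> Z \<Longrightarrow> inj_on (e z) {..<N}" "\<And>z. z \<in> Z \<Longrightarrow> e z ` {..<N} \<subseteq> box z \<inter> A"
    by metis
  define g where "g p = e (fst p) (snd p)" for p
  have gbox: "g (z, s) \<in> box z \<inter> A" if "z \<in> Z" "s < N" for z s
    using e(2)[OF that(1)] that(2) by (auto simp: g_def)
  have gA: "g ` F \<subseteq> A" using gbox by (auto simp: F_def)
  have inj: "inj_on g F"
  proof (rule inj_onI)
    fix p p' assume p: "p \<in> F" "p' \<in> F" "g p = g p'"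
    obtain z s z' s' where pz: "p = (z, s)" "p' = (z', s')" by fastforce
    have "g p \<in> box z" "g p \<in> box z'" using gbox[of z s] gbox[of z' s'] p pz by (auto simp: F_def)
    then have zz: "z = z'" unfolding box_def using pos by (intro ibox_scale_disjoint[of k k]) auto
    then have "s = s'" using e(1)[of z] p pz by (auto simp: F_def g_def inj_on_def)
    then show "p = p'" using pz zz by simp
  qed
  \<comment> \<open>Labels outside F get the lower corner of their cell, so the cell constraint
    holds for all labels.\<close>
  define x where "x p = (if p \<in> F then \<mu> (g p) else (\<chi> i. k / R * fst p $ i))" for p
  have cell: "k / R * z $ i \<le> x (z, s) $ i \<and> x (z, s) $ i \<le> k / R * (z $ i + 1)" for z s i
  proof (cases "(z, s) \<in> F")
    case True
    define q where "q = g (z, s)"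
    have q: "q \<in> box z" "q \<in> A" using gbox[of z s] True by (auto simp: F_def q_def)
    \<comment> \<open>The box is half-open, so q + 1 still fits. This leaves room 1/R for the
      displacement, which is at most 1/(w R).\<close>
    have "int k * z $ i \<le> q $ i" "q $ i + 1 \<le> int k * z $ i + int k"
      using q(1) by (auto simp: box_def ibox_def scale_int_def zless_imp_add1_zle)
    then have qr: "real k * z $ i \<le> q $ i" "q $ i + 1 \<le> real k * z $ i + k"
      by (simp_all flip: of_int_le_iff[where 'a = real])
    have "1 / (w * R) \<le> 1 / R" using pos R by (intro divide_left_mono) auto
    then have "of_int (q $ i) / R \<le> x (z, s) $ i" "x (z, s) $ i \<le> (of_int (q $ i) + 1) / R"
      using \<mu>(1)[OF q(2), of i] True by (auto simp: x_def q_def add_divide_distrib)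
    moreover have "real k * z $ i / R \<le> of_int (q $ i) / R" "(of_int (q $ i) + 1) / R \<le> (real k * z $ i + k) / R"
      using qr R by (simp_all add: divide_right_mono)
    ultimately show ?thesis by (simp add: distrib_left add_divide_distrib)
  next
    case False
    then show ?thesis using R by (simp add: x_def distrib_left)
  qed
  have transfer: "energy Q F x c = energy Q A \<mu> (\<lambda>q. if q \<in> g ` F then c (the_inv_into F g q) else 0)"
    "(\<Sum>p\<in>F. (cmod (c p))\<^sup>2) = (\<Sum>q\<in>A. (cmod (if q \<in> g ` F then c (the_inv_into F g q) else 0))\<^sup>2)" for Q c
  proof -
    define y where "y q = (if q \<in> g ` F then c (the_inv_into F g q) else 0)" for q
    have yg: "y (g p) = c p" if "p \<in> F" for p using that inj by (simp add: y_def the_inv_into_f_f)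
    have "energy Q A \<mu> y = energy Q (g ` F) \<mu> y"
      by (rule energy_mono_neutral[OF finA gA]) (simp add: y_def)
    also have "\<dots> = energy Q F x c"
      unfolding energy_reindex[OF inj] by (rule energy_cong) (auto simp: yg x_def)
    finally show "energy Q F x c = energy Q A \<mu> (\<lambda>q. if q \<in> g ` F then c (the_inv_into F g q) else 0)"
      by (simp add: y_def[abs_def])
    have "(\<Sum>q\<in>A. (cmod (y q))\<^sup>2) = (\<Sum>q\<in>g ` F. (cmod (y q))\<^sup>2)"
      by (rule sum.mono_neutral_right[OF finA gA]) (simp add: y_def)
    also have "\<dots> = (\<Sum>p\<in>F. (cmod (c p))\<^sup>2)"
      unfolding sum.reindex[OF inj] by (rule sum.cong) (auto simp: yg)
    finally show "(\<Sum>p\<in>F. (cmod (c p))\<^sup>2) = (\<Sum>q\<in>A. (cmod (if q \<in> g ` F then c (the_inv_into F g q) else 0))\<^sup>2)"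
      by (simp add: y_def)
  qed
  have eq: "n * (w * R) = w * n * R" by (simp add: mult_ac)
  have "a / 4 * R ^ CARD('n) * (\<Sum>p\<in>F. (cmod (c p))\<^sup>2) \<le> energy S F x c"
    "energy (\<Omega> \<inter> cube (n * (w * R))) F x c \<le> B * (\<Sum>p\<in>F. (cmod (c p))\<^sup>2)" for c
    unfolding transfer eq by (rule low, rule \<mu>(2))
  then show ?thesis
    unfolding F_def[symmetric] by (intro exI[of _ x] conjI allI) (use cell in auto)
qed

section \<open>Passing to infinite configurations\<close>

text \<open>By \<open>energy_gram\<close> the frequencies enter only through values of the
  continuous function \<open>ft S\<close> at coordinate differences, so the product topology
  suffices.\<close>

lemma continuous_on_energy:
  assumes S: "S \<in> lmeasurable"
  shows "continuous_on UNIV (\<lambda>x. energy S F x c)"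
proof -
  have "energy S F x c = Re (\<Sum>i\<in>F. cnj (c i) * (\<Sum>j\<in>F. ft S (x j - x i) * c j))" for x
    unfolding energy_gram[OF S, symmetric] by simp
  moreover have "continuous_on UNIV (\<lambda>x. ft S (x j - x i))" for i j
    by (rule continuous_on_compose2[OF isCont_ft[OF S]])
      (intro continuous_intros continuous_on_product_coordinates, simp)
  ultimately show ?thesis by (simp only:) (intro continuous_intros)
qed

lemma measure_Int_cube_tendsto:
  fixes \<Omega> :: "(real ^ 'n) set"
  assumes \<Omega>: "\<Omega> \<in> lmeasurable" and h: "h > 0"
  shows "(\<lambda>n. measure lebesgue (\<Omega> \<inter> cube (real n * h))) \<longlonglongrightarrow> measure lebesgue \<Omega>"
proof -
  have sub: "cube a \<subseteq> (cube b :: (real ^ 'n) set)" if "a \<le> b" for a b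
  proof
    fix x :: "real ^ 'n" assume "x \<in> cube a"
    then have "- (a / 2) \<le> x $ i \<and> x $ i \<le> a / 2" for i by (simp add: cube_def)
    then have "- (b / 2) \<le> x $ i \<and> x $ i \<le> b / 2" for i using that by (smt (verit) divide_right_mono)
    then show "x \<in> cube b" by (simp add: cube_def)
  qed
  have "(\<Union>n. \<Omega> \<inter> cube (real n * h)) = \<Omega>"
  proof (intro equalityI subsetI)
    fix x assume x: "x \<in> \<Omega>"
    obtain n :: nat where n: "2 * norm x / h \<le> n" using real_arch_simple by blast
    have "- (n * h / 2) \<le> x $ i \<and> x $ i \<le> n * h / 2" for i
    proof -
      have "2 * norm x \<le> n * h" using n h by (simp add: pos_divide_le_eq)
      then show ?thesis using component_le_norm_cart[of x i] by linarith
    qed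
    then have "x \<in> cube (n * h)" by (simp add: cube_def)
    then show "x \<in> (\<Union>n. \<Omega> \<inter> cube (real n * h))" using x by blast
  qed auto
  moreover have "(\<lambda>n. measure lebesgue (\<Omega> \<inter> cube (real n * h))) \<longlonglongrightarrow> measure lebesgue (\<Union>n. \<Omega> \<inter> cube (real n * h))"
  proof (rule Lim_measure_incseq)
    show "incseq (\<lambda>n. \<Omega> \<inter> cube (real n * h))"
      using sub h by (intro incseq_SucI Int_mono) auto
    show "range (\<lambda>n. \<Omega> \<inter> cube (real n * h)) \<subseteq> sets lebesgue"
      using \<Omega> by (auto intro!: sets.Int fmeasurableD)
    show "emeasure lebesgue (\<Union>n. \<Omega> \<inter> cube (real n * h)) \<noteq> \<infinity>"
      unfolding \<open>(\<Union>n. \<Omega> \<inter> cube (real n * h)) = \<Omega>\<close> using fmeasurableD2[OF \<Omega>] by simp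
  qed
  ultimately show ?thesis by simp
qed

lemma cube_mono: "a \<le> b \<Longrightarrow> cube a \<subseteq> cube b"
  by (auto simp: cube_def intro: order_trans[OF _ divide_right_mono] order_trans[rotated, OF divide_right_mono])
    (smt (verit) divide_right_mono)+

text \<open>The sets \<open>T Z n\<close> of admissible configurations are closed and decrease in
  both arguments: extend coefficients by 0, and shrink the domain. Hence finitely many of them
  contain a common member of the form \<open>T Z n\<close>, and the finite intersection property in
  the compact product of closed cells gives a configuration good for all Z and n.\<close>

lemma compact_configuration:
  fixes \<Omega> S :: "(real ^ 'n) set" and N :: nat and b h \<alpha> B :: real
  assumes S: "S \<in> lmeasurable" and \<Omega>: "\<Omega> \<in> lmeasurable" and h: "h > 0"
    and ex: "\<And>Z n. finite Z \<Longrightarrow> n > 0 \<Longrightarrow> \<exists>x :: (int ^ 'n) \<times> nat \<Rightarrow> real ^ 'n.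
      (\<forall>z s i. b * z $ i \<le> x (z, s) $ i \<and> x (z, s) $ i \<le> b * (z $ i + 1)) \<and>
      (\<forall>c. \<alpha> * (\<Sum>p\<in>Z \<times> {..<N}. (cmod (c p))\<^sup>2) \<le> energy S (Z \<times> {..<N}) x c) \<and>
      (\<forall>c. energy (\<Omega> \<inter> cube (real n * h)) (Z \<times> {..<N}) x c \<le> B * (\<Sum>p\<in>Z \<times> {..<N}. (cmod (c p))\<^sup>2))"
  shows "\<exists>x :: (int ^ 'n) \<times> nat \<Rightarrow> real ^ 'n.
      (\<forall>z s i. b * z $ i \<le> x (z, s) $ i \<and> x (z, s) $ i \<le> b * (z $ i + 1)) \<and>
      (\<forall>F c. finite F \<longrightarrow> F \<subseteq> UNIV \<times> {..<N} \<longrightarrow>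
        \<alpha> * (\<Sum>p\<in>F. (cmod (c p))\<^sup>2) \<le> energy S F x c \<and> energy \<Omega> F x c \<le> B * (\<Sum>p\<in>F. (cmod (c p))\<^sup>2))"
proof -
  define cell where "cell p = cbox (\<chi> i. b * fst p $ i) (\<chi> i. b * (fst p $ i + 1))" for p :: "(int ^ 'n) \<times> nat"
  define K where "K = {x. \<forall>p. x p \<in> cell p}"
  define T where "T Z n = {x. \<forall>c. \<alpha> * (\<Sum>p\<in>Z \<times> {..<N}. (cmod (c p))\<^sup>2) \<le> energy S (Z \<times> {..<N}) x c \<and>
      energy (\<Omega> \<inter> cube (real n * h)) (Z \<times> {..<N}) x c \<le> B * (\<Sum>p\<in>Z \<times> {..<N}. (cmod (c p))\<^sup>2)}"
    for Z :: "(int ^ 'n) set" and n :: nat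
  have cell: "x p \<in> cell p \<longleftrightarrow> (\<forall>i. b * fst p $ i \<le> x p $ i \<and> x p $ i \<le> b * (fst p $ i + 1))"
    for x :: "(int ^ 'n) \<times> nat \<Rightarrow> real ^ 'n" and p
    by (simp add: cell_def mem_box_cart)
  have \<Omega>n: "\<Omega> \<inter> cube r \<in> lmeasurable" for r using \<Omega> by auto
  have "closed (T Z n)" for Z n
  proof -
    have eq: "T Z n = (\<Inter>c. {x. \<alpha> * (\<Sum>p\<in>Z \<times> {..<N}. (cmod (c p))\<^sup>2) \<le> energy S (Z \<times> {..<N}) x c} \<inter>
        {x. energy (\<Omega> \<inter> cube (real n * h)) (Z \<times> {..<N}) x c \<le> B * (\<Sum>p\<in>Z \<times> {..<N}. (cmod (c p))\<^sup>2)})"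
      by (auto simp: T_def)
    show ?thesis unfolding eq
      by (intro closed_INT ballI closed_Int closed_Collect_le continuous_on_const continuous_on_energy S \<Omega>n)
  qed
  have mono: "T Z n \<subseteq> T Z' n'" if "finite Z" "Z' \<subseteq> Z" "n' \<le> n" for Z Z' n n'
  proof
    fix x assume x: "x \<in> T Z n"
    have fin: "finite (Z \<times> {..<N})" and sub: "Z' \<times> {..<N} \<subseteq> Z \<times> {..<N}" using that by auto
    have "\<alpha> * (\<Sum>p\<in>Z' \<times> {..<N}. (cmod (c p))\<^sup>2) \<le> energy S (Z' \<times> {..<N}) x c \<and>
      energy (\<Omega> \<inter> cube (real n' * h)) (Z' \<times> {..<N}) x c \<le> B * (\<Sum>p\<in>Z' \<times> {..<N}. (cmod (c p))\<^sup>2)" for c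
    proof -
      define y where "y p = (if p \<in> Z' \<times> {..<N} then c p else 0)" for p
      have e: "energy Q (Z \<times> {..<N}) x y = energy Q (Z' \<times> {..<N}) x c" for Q
      proof -
        have "energy Q (Z \<times> {..<N}) x y = energy Q (Z' \<times> {..<N}) x y"
          by (rule energy_mono_neutral[OF fin sub]) (metis DiffD2 y_def)
        also have "\<dots> = energy Q (Z' \<times> {..<N}) x c" by (rule energy_cong) (simp_all only: y_def if_True)
        finally show ?thesis .
      qed
      have "(\<Sum>p\<in>Z \<times> {..<N}. (cmod (y p))\<^sup>2) = (\<Sum>p\<in>Z' \<times> {..<N}. (cmod (y p))\<^sup>2)"
        by (rule sum.mono_neutral_right[OF fin sub]) (auto simp: y_def)
      also have "\<dots> = (\<Sum>p\<in>Z' \<times> {..<N}. (cmod (c p))\<^sup>2)" by (rule sum.cong) (auto simp: y_def)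
      finally have n: "(\<Sum>p\<in>Z \<times> {..<N}. (cmod (y p))\<^sup>2) = (\<Sum>p\<in>Z' \<times> {..<N}. (cmod (c p))\<^sup>2)" .
      have "cube (real n' * h) \<subseteq> (cube (real n * h) :: (real ^ 'n) set)"
        using that(3) h by (intro cube_mono) (simp add: mult_right_mono)
      then have "energy (\<Omega> \<inter> cube (real n' * h)) (Z' \<times> {..<N}) x c \<le> energy (\<Omega> \<inter> cube (real n * h)) (Z' \<times> {..<N}) x c"
        by (intro energy_mono \<Omega>n) auto
      moreover have "\<alpha> * (\<Sum>p\<in>Z' \<times> {..<N}. (cmod (c p))\<^sup>2) \<le> energy S (Z' \<times> {..<N}) x c \<and>
        energy (\<Omega> \<inter> cube (real n * h)) (Z' \<times> {..<N}) x c \<le> B * (\<Sum>p\<in>Z' \<times> {..<N}. (cmod (c p))\<^sup>2)"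
        using x unfolding T_def mem_Collect_eq e[symmetric] n[symmetric] by blast
      ultimately show ?thesis by linarith
    qed
    then show "x \<in> T Z' n'" by (simp add: T_def)
  qed
  define I where "I = {Zn :: (int ^ 'n) set \<times> nat. finite (fst Zn)}"
  have "K \<inter> (\<Inter>(Z, n)\<in>I. T Z n) \<noteq> {}"
  proof (rule compact_imp_fip_image)
    show "compact K" unfolding K_def by (rule compact_Pi_UNIV) (simp add: cell_def)
    show "closed (case i of (Z, n) \<Rightarrow> T Z n)" if "i \<in> I" for i
      using \<open>\<And>Z n. closed (T Z n)\<close> by (simp add: split_def)
    show "K \<inter> (\<Inter>i\<in>J. case i of (Z, n) \<Rightarrow> T Z n) \<noteq> {}" if J: "finite J" "J \<subseteq> I" for J
    proof -
      define Z where "Z = (\<Union>i\<in>J. fst i)"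
      define n where "n = Suc (\<Sum>i\<in>J. snd i)"
      have Z: "finite Z" using J by (auto simp: Z_def I_def)
      obtain x where "x \<in> K" "x \<in> T Z n"
        using ex[OF Z, of n] unfolding K_def T_def mem_Collect_eq cell by (auto simp: n_def)
      moreover have "x \<in> (case i of (Z, n) \<Rightarrow> T Z n)" if "i \<in> J" for i
      proof -
        have fs: "fst i \<subseteq> Z" using that by (auto simp: Z_def)
        have sn: "snd i \<le> n" using member_le_sum[of i J snd] that J by (simp add: n_def)
        show ?thesis using mono[OF Z fs sn] \<open>x \<in> T Z n\<close> by (auto simp: split_def)
      qed
      ultimately show ?thesis by blast
    qed
  qed
  then obtain x where xI: "x \<in> K" "x \<in> (\<Inter>(Z, n)\<in>I. T Z n)" by blast
  have x: "x \<in> K" "\<And>Z n. finite Z \<Longrightarrow> x \<in> T Z n" using xI by (auto simp: I_def)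
  have "\<alpha> * (\<Sum>p\<in>F. (cmod (c p))\<^sup>2) \<le> energy S F x c \<and> energy \<Omega> F x c \<le> B * (\<Sum>p\<in>F. (cmod (c p))\<^sup>2)"
    if F: "finite F" "F \<subseteq> UNIV \<times> {..<N}" for F c
  proof -
    define Z where "Z = fst ` F"
    define y where "y p = (if p \<in> F then c p else 0)" for p
    have Z: "finite Z" "F \<subseteq> Z \<times> {..<N}" using F by (force simp: Z_def)+
    then have fin: "finite (Z \<times> {..<N})" by simp
    have e: "energy Q (Z \<times> {..<N}) x y = energy Q F x c" for Q
    proof -
      have "energy Q (Z \<times> {..<N}) x y = energy Q F x y"
        by (rule energy_mono_neutral[OF fin Z(2)]) (simp add: y_def)
      also have "\<dots> = energy Q F x c" by (rule energy_cong) (auto simp: y_def)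
      finally show ?thesis .
    qed
    have "(\<Sum>p\<in>Z \<times> {..<N}. (cmod (y p))\<^sup>2) = (\<Sum>p\<in>F. (cmod (y p))\<^sup>2)"
      by (rule sum.mono_neutral_right[OF fin Z(2)]) (simp add: y_def)
    also have "\<dots> = (\<Sum>p\<in>F. (cmod (c p))\<^sup>2)" by (rule sum.cong) (auto simp: y_def)
    finally have s: "(\<Sum>p\<in>Z \<times> {..<N}. (cmod (y p))\<^sup>2) = (\<Sum>p\<in>F. (cmod (c p))\<^sup>2)" .
    have xn: "\<alpha> * (\<Sum>p\<in>F. (cmod (c p))\<^sup>2) \<le> energy S F x c"
      "energy (\<Omega> \<inter> cube (real n * h)) F x c \<le> B * (\<Sum>p\<in>F. (cmod (c p))\<^sup>2)" for n
      using x(2)[OF Z(1), of n] unfolding T_def mem_Collect_eq e[symmetric] s[symmetric] by blast+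
    define M where "M = (\<Sum>i\<in>F. cmod (c i))\<^sup>2"
    \<comment> \<open>A fixed exponential sum is bounded, so the energy outside the n-th cube is at
      most M times a measure that tends to 0.\<close>
    have "energy \<Omega> F x c \<le> B * (\<Sum>p\<in>F. (cmod (c p))\<^sup>2) + M * (measure lebesgue \<Omega> - measure lebesgue \<Omega>)"
    proof (rule LIMSEQ_le_const)
      show "(\<lambda>n. B * (\<Sum>p\<in>F. (cmod (c p))\<^sup>2) + M * (measure lebesgue \<Omega> - measure lebesgue (\<Omega> \<inter> cube (real n * h))))
        \<longlonglongrightarrow> B * (\<Sum>p\<in>F. (cmod (c p))\<^sup>2) + M * (measure lebesgue \<Omega> - measure lebesgue \<Omega>)"
        by (intro tendsto_intros measure_Int_cube_tendsto \<Omega> h)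
      have "energy \<Omega> F x c \<le> B * (\<Sum>p\<in>F. (cmod (c p))\<^sup>2) + M * (measure lebesgue \<Omega> - measure lebesgue (\<Omega> \<inter> cube (real n * h)))" for n
      proof -
        let ?Q = "\<Omega> \<inter> cube (real n * h)"
        have D: "\<Omega> - ?Q \<in> lmeasurable" using \<Omega> \<Omega>n by (intro fmeasurable.Diff)
        have "energy (\<Omega> - ?Q) F x c \<le> (LINT t|lebesgue_on (\<Omega> - ?Q). M)"
          unfolding energy_def
        proof (rule integral_mono)
          show "integrable (lebesgue_on (\<Omega> - ?Q)) (\<lambda>t. M)"
            by (rule integrable_lebesgue_on_bounded[OF D, of _ "norm M"]) auto
          show "(cmod (trig F x c t))\<^sup>2 \<le> M" for t
            unfolding M_def by (intro power_mono norm_trig_le) simp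
        qed (intro integrable_trig_square D)
        also have "\<dots> = M * measure lebesgue (\<Omega> - ?Q)"
          using D by (simp add: measure_restrict_space fmeasurableD mult.commute)
        also have "measure lebesgue (\<Omega> - ?Q) = measure lebesgue \<Omega> - measure lebesgue ?Q"
          using \<Omega> \<Omega>n by (intro measurable_measure_Diff) (auto simp: fmeasurableD)
        finally show ?thesis
          using energy_split[OF \<Omega>n[of "real n * h"] \<Omega> Int_lower1, of F x c] xn(2)[of n] by simp
      qed
      then show "\<exists>N0. \<forall>n\<ge>N0. energy \<Omega> F x c \<le> B * (\<Sum>p\<in>F. (cmod (c p))\<^sup>2) + M * (measure lebesgue \<Omega> - measure lebesgue (\<Omega> \<inter> cube (real n * h)))"
        by blast
    qed
    then show ?thesis using xn(1) by simp
  qed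
  then show ?thesis using x(1) unfolding K_def mem_Collect_eq cell by (intro exI[of _ x]) auto
qed

text \<open>Discarding the fraction 1 - \<tau> + \<eta> instead of 1 - \<tau> leaves a slack \<eta>
  = e \<tau>, spent in quarters: on t, on a, on the factor (1 - 1/K)^2, and on the
  \<open>2 * K\<^sup>2\<close> lost rounds together with rounding N.\<close>

lemma selection_parameters:
  fixes \<tau> e :: real and d :: nat
  assumes \<tau>: "0 < \<tau>" "\<tau> \<le> 1" and e: "0 < e" "e < 1" and d: "d > 0"
  shows "\<exists>(t::real) (a::real) (K::real) (k::nat) (N::nat) (m::nat). t > 0 \<and> a > 0 \<and> K > 1 \<and> k > 0 \<and> N + m = k ^ d \<and> real N \<ge> (1 - e) * \<tau> * k ^ d \<and>
    t + a \<le> (1 - 1 / K)\<^sup>2 / (k ^ d * (\<tau> / (1 + t) + (1 - \<tau>) / t)) * (real m - 2 * K\<^sup>2)"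
proof -
  define \<eta> where "\<eta> = e * \<tau>"
  define t where "t = e / 4"
  define r where "r = \<tau> / (1 + t) + (1 - \<tau>) / t"
  define a where "a = \<eta> / (4 * r)"
  \<comment> \<open>Makes (1 - 1/K)^2 at least 1 - \<eta>/4. The size k is then large enough that 1
    + 2 K^2 is below \<eta>/4 of a block.\<close>
  define K where "K = 8 / \<eta>"
  define k where "k = Suc (nat \<lceil>(1 + 2 * K\<^sup>2) * 4 / \<eta>\<rceil>)"
  define L where "L = real (k ^ d)"
  define N where "N = nat \<lceil>(1 - e) * \<tau> * k ^ d\<rceil>"
  define m where "m = k ^ d - N"
  have \<eta>: "0 < \<eta>" "\<eta> < 1" 
  proof -
    show "0 < \<eta>" using \<tau> e by (simp add: \<eta>_def)
    have "\<eta> \<le> e * 1" unfolding \<eta>_def using \<tau> e by (intro mult_left_mono) auto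
    then show "\<eta> < 1" using e by simp
  qed
  have t: "t > 0" using e by (simp add: t_def)
  have r: "r > 0" using \<tau> t by (auto simp: r_def intro!: add_pos_nonneg)
  have a: "a > 0" using \<eta> r by (simp add: a_def)
  have K: "K > 1" using \<eta> by (simp add: K_def)
  have k: "k > 0" by (simp add: k_def)
  have L: "L \<ge> (1 + 2 * K\<^sup>2) * 4 / \<eta>"
  proof -
    have "(1 + 2 * K\<^sup>2) * 4 / \<eta> \<le> k" unfolding k_def by linarith
    also have "real k \<le> L" unfolding L_def using d k by (simp add: self_le_power)
    finally show ?thesis .
  qed
  have L0: "L > 0" using k by (simp add: L_def)
  have N1: "(1 - e) * \<tau> * L \<le> N" unfolding N_def L_def by linarith
  have N2: "N \<le> (1 - e) * \<tau> * L + 1" unfolding N_def L_def using \<tau> e by (simp add: of_nat_nat)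
  have "(1 - e) * \<tau> \<le> 1" using \<tau> e by (simp add: mult_le_one)
  then have "(1 - e) * \<tau> * L \<le> real (k ^ d)" using L0 by (simp add: L_def)
  then have NL: "N \<le> k ^ d" unfolding N_def L_def by (simp add: nat_le_iff ceiling_le_iff)
  have m: "real m \<ge> (1 - \<tau> + \<eta>) * L - 1"
    using N2 NL by (simp add: m_def L_def \<eta>_def of_nat_diff algebra_simps)
  have rt: "r * (t + a) \<le> 1 - \<tau> + \<eta> / 2"
  proof -
    have "r * t = \<tau> * (t / (1 + t)) + (1 - \<tau>)" using t by (simp add: r_def distrib_right)
    also have "\<tau> * (t / (1 + t)) \<le> \<tau> * t" using t \<tau> by (intro mult_left_mono) (auto simp: divide_le_eq)
    also have "\<tau> * t = \<eta> / 4" by (simp add: t_def \<eta>_def)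
    finally have "r * t \<le> \<eta> / 4 + (1 - \<tau>)" by simp
    moreover have "r * a = \<eta> / 4" using r by (simp add: a_def)
    ultimately show ?thesis by (simp add: distrib_left)
  qed
  define y where "y = (real m - 2 * K\<^sup>2) / L"
  have "(1 - \<tau> + \<eta> - \<eta> / 4) * L \<le> real m - 2 * K\<^sup>2"
  proof -
    have "1 + 2 * K\<^sup>2 \<le> \<eta> / 4 * L" using L \<eta> by (simp add: field_simps)
    then show ?thesis using m by (simp add: algebra_simps)
  qed
  then have y: "1 - \<tau> + \<eta> - \<eta> / 4 \<le> y" using L0 by (simp add: y_def pos_le_divide_eq)
  define y0 where "y0 = 1 - \<tau> + \<eta> - \<eta> / 4"
  have y0: "0 \<le> y0" "y0 \<le> 1"
    using \<tau> \<eta> e mult_left_mono[of e 1 \<tau>] by (auto simp: y0_def \<eta>_def mult.commute)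
  have K2: "(1 - 1 / K)\<^sup>2 \<ge> 1 - \<eta> / 4"
    using \<eta> by (simp add: K_def power2_diff power_divide) 
  have "1 - \<tau> + \<eta> / 2 \<le> (1 - \<eta> / 4) * y0"
  proof -
    have "\<eta> / 4 * y0 \<le> \<eta> / 4" using y0 \<eta> by (intro mult_left_le) auto
    moreover have "(1 - \<eta> / 4) * y0 = y0 - \<eta> / 4 * y0" by (simp add: left_diff_distrib)
    ultimately show ?thesis unfolding y0_def by linarith
  qed
  also have "\<dots> \<le> (1 - 1 / K)\<^sup>2 * y" using K2 y y0 \<eta> by (intro mult_mono) (auto simp: y0_def)
  finally have "r * (t + a) \<le> (1 - 1 / K)\<^sup>2 * y" using rt by linarith
  then have "t + a \<le> (1 - 1 / K)\<^sup>2 / (L * r) * (real m - 2 * K\<^sup>2)"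
    using r L0 by (simp add: y_def field_simps)
  moreover have "N + m = k ^ d" using NL by (simp add: m_def)
  ultimately show ?thesis
    using t a K k N1 unfolding L_def r_def 
    by - (rule exI[of _ t], rule exI[of _ a], rule exI[of _ K], rule exI[of _ k], rule exI[of _ N], rule exI[of _ m], simp)
qed

theorem theorem1p4:
  fixes \<Omega> :: "(real ^ 'n) set" and \<epsilon> :: real
  assumes "\<Omega> \<in> sets lebesgue" and "emeasure lebesgue \<Omega> < \<infinity>" and "\<epsilon> > 0"
  shows "\<exists>\<Lambda> :: (real ^ 'n) set. countable \<Lambda> \<and>
           enn2ereal (lower_Beurling_density \<Lambda>) \<ge> ereal ((1 - \<epsilon>) * measure lebesgue \<Omega>) \<and>
           Riesz_sequence_L2 (lebesgue_on \<Omega>)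
             (\<lambda>l x. exp (2 * of_real pi * \<i> * of_real (l \<bullet> x)) * indicator \<Omega> x) \<Lambda>"
proof -
  have \<Omega>: "\<Omega> \<in> lmeasurable" using assms(1,2) by (rule fmeasurableI)
  have \<epsilon>: "\<epsilon> > 0" by (rule assms(3))
  show ?thesis
  proof (cases "\<epsilon> \<ge> 1 \<or> measure lebesgue \<Omega> = 0")
    case True
    \<comment> \<open>The required density is not positive, so the empty set qualifies.\<close>
    have "(1 - \<epsilon>) * measure lebesgue \<Omega> \<le> 0" using True by (auto simp: mult_le_0_iff)
    then have "ereal ((1 - \<epsilon>) * measure lebesgue \<Omega>) \<le> enn2ereal (lower_Beurling_density {})"
      by (intro order_trans[OF _ enn2ereal_nonneg]) simp
    moreover have "Riesz_sequence_L2 (lebesgue_on \<Omega>)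
        (\<lambda>l x. exp (2 * of_real pi * \<i> * of_real (l \<bullet> x)) * indicator \<Omega> x) {}"
      by (rule Riesz_sequence_from_finite[OF \<Omega>, of _ 1 1]) (auto simp: energy_def trig_def)
    ultimately show ?thesis by (intro exI[of _ "{}"]) simp
  next
    case False
    then have \<epsilon>1: "\<epsilon> < 1" and m\<Omega>: "measure lebesgue \<Omega> > 0" by (auto simp: less_le)
    define d where "d = CARD('n)"
    \<comment> \<open>One part of the loss pays for cutting \<Omega> down to a cube, the other for
      the selection of points; the cube is chosen so that together they cost at most
      \<epsilon>.\<close>
    define e where "e = \<epsilon> / 2"
    have e: "0 < e" "e < 1" using \<epsilon> \<epsilon>1 by (auto simp: e_def)
    have "(1 - \<epsilon>) / (1 - e) * measure lebesgue \<Omega> < measure lebesgue \<Omega>"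
      using \<epsilon> \<epsilon>1 m\<Omega> by (simp add: e_def field_simps)
    then have "eventually (\<lambda>n. (1 - \<epsilon>) / (1 - e) * measure lebesgue \<Omega> < measure lebesgue (\<Omega> \<inter> cube (real n * 1)) \<and> n > 0) sequentially"
      using order_tendstoD(1)[OF measure_Int_cube_tendsto[OF \<Omega>, of 1]] by (intro eventually_conj eventually_gt_at_top) auto
    then obtain n0 :: nat where n0: "(1 - \<epsilon>) / (1 - e) * measure lebesgue \<Omega> < measure lebesgue (\<Omega> \<inter> cube n0)" "n0 > 0"
      by (auto dest!: eventually_happens)
    define R where "R = real n0"
    define S where "S = \<Omega> \<inter> cube R"
    have R: "R > 0" using n0 by (simp add: R_def)
    have S: "S \<in> lmeasurable" "S \<subseteq> cube R" using \<Omega> by (auto simp: S_def)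
    have mS: "(1 - \<epsilon>) * measure lebesgue \<Omega> \<le> (1 - e) * measure lebesgue S"
      using n0(1) e unfolding S_def R_def by (simp add: field_simps)
    have mS0: "measure lebesgue S > 0"
    proof (rule ccontr)
      assume "\<not> measure lebesgue S > 0"
      then have "measure lebesgue S = 0" using measure_nonneg[of lebesgue S] by simp
      moreover have "(1 - \<epsilon>) * measure lebesgue \<Omega> > 0" using \<epsilon>1 m\<Omega> by simp
      ultimately show False using mS by simp
    qed
    define \<tau> where "\<tau> = measure lebesgue S / R ^ d"
    have "measure lebesgue S \<le> measure lebesgue (cube R :: (real ^ 'n) set)"
      using S by (intro measure_mono_fmeasurable) (auto simp: fmeasurableD)
    also have "\<dots> = R ^ d" unfolding d_def using R by (intro measure_cube) simp
    finally have \<tau>: "0 < \<tau>" "\<tau> \<le> 1" using mS0 R by (auto simp: \<tau>_def)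
    obtain t a K :: real and k N m :: nat where par: "t > 0" "a > 0" "K > 1" "k > 0" "N + m = k ^ d"
        "real N \<ge> (1 - e) * \<tau> * k ^ d"
        "t + a \<le> (1 - 1 / K)\<^sup>2 / (k ^ d * (\<tau> / (1 + t) + (1 - \<tau>) / t)) * (real m - 2 * K\<^sup>2)"
      using selection_parameters[OF \<tau> e, of d] by (auto simp: d_def)
    \<comment> \<open>The cells shrink only after a is known, so that moving points inside them
      keeps part of the lower bound.\<close>
    have "(\<lambda>w. (exp (pi * real d / real w) - 1)\<^sup>2) \<longlonglongrightarrow> (exp 0 - 1)\<^sup>2"
      by (intro tendsto_intros lim_const_over_n)
    from order_tendstoD(2)[OF this, of "a / 4"] have "eventually (\<lambda>w. (exp (pi * real d / real w) - 1)\<^sup>2 < a / 4 \<and> w > 0) sequentially"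
      using par(2) by (intro eventually_conj eventually_gt_at_top) auto
    then obtain w :: nat where w: "(exp (pi * real d / real w) - 1)\<^sup>2 < a / 4" "w > 0"
      by (auto dest!: eventually_happens)
    define b where "b = k / R"
    define \<alpha> where "\<alpha> = a / 4 * R ^ d"
    define B where "B = 2 * (measure lebesgue \<Omega> + 2 + (w * R) ^ d)"
    have b: "b > 0" and \<alpha>: "\<alpha> > 0" using par R by (auto simp: b_def \<alpha>_def)
    have "(w * R) ^ d \<ge> 0" using R by simp
    then have B: "B > 0" unfolding B_def using m\<Omega> by (intro mult_pos_pos add_pos_nonneg add_pos_pos) simp_all
    \<comment> \<open>The constants \<alpha>, B, b and the number N were fixed before Z and n, which
      is the uniformity that compactness needs.\<close>
    have "\<exists>x :: (int ^ 'n) \<times> nat \<Rightarrow> real ^ 'n.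
      (\<forall>z s i. b * z $ i \<le> x (z, s) $ i \<and> x (z, s) $ i \<le> b * (z $ i + 1)) \<and>
      (\<forall>c. \<alpha> * (\<Sum>p\<in>Z \<times> {..<N}. (cmod (c p))\<^sup>2) \<le> energy S (Z \<times> {..<N}) x c) \<and>
      (\<forall>c. energy (\<Omega> \<inter> cube (real n * (w * R))) (Z \<times> {..<N}) x c \<le> B * (\<Sum>p\<in>Z \<times> {..<N}. (cmod (c p))\<^sup>2))"
      if Z: "finite Z" and n: "n > 0" for Z n
    proof -
      have r: "measure lebesgue S / R ^ CARD('n) / (1 + t) + (1 - measure lebesgue S / R ^ CARD('n)) / t > 0"
        using \<tau> par(1) mS0 R unfolding \<tau>_def d_def by (intro add_pos_nonneg) auto
      obtain A where A: "A \<subseteq> (\<Union>z\<in>Z. ibox k (scale_int k z))"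
          "\<And>z. z \<in> Z \<Longrightarrow> card (ibox k (scale_int k z) \<inter> A) \<ge> k ^ CARD('n) - m"
          "\<And>c. energy S A (lattice_point R) c \<ge> a * (R ^ CARD('n) * (\<Sum>q\<in>A. (cmod (c q))\<^sup>2))"
        using lower_lattice_selection[OF Z S R par(1) r par(3,4) par(7)[unfolded \<tau>_def d_def]] by blast
      have N: "N \<le> card (ibox k (scale_int k z) \<inter> A)" if "z \<in> Z" for z
        using A(2)[OF that] par(5) by (simp add: d_def)
      show ?thesis
        unfolding b_def \<alpha>_def B_def d_def
        by (rule finite_configuration[OF Z R S \<Omega> A(1) N A(3) par(4) w(2) n])
          (use w in \<open>auto simp: d_def\<close>)
    qed
    note configuration = compact_configuration[OF S(1) \<Omega> _ this]
    have "real w * R > 0" using w(2) R by simp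
    from configuration[OF this] obtain x :: "(int ^ 'n) \<times> nat \<Rightarrow> real ^ 'n" where x:
      "(\<forall>z s i. b * z $ i \<le> x (z, s) $ i \<and> x (z, s) $ i \<le> b * (z $ i + 1)) \<and>
      (\<forall>F c. finite F \<longrightarrow> F \<subseteq> UNIV \<times> {..<N} \<longrightarrow>
        \<alpha> * (\<Sum>p\<in>F. (cmod (c p))\<^sup>2) \<le> energy S F x c \<and> energy \<Omega> F x c \<le> B * (\<Sum>p\<in>F. (cmod (c p))\<^sup>2))" ..
    have cell: "b * z $ i \<le> x (z, s) $ i \<and> x (z, s) $ i \<le> b * (z $ i + 1)" for z s i
      using x by blast
    have lower: "\<alpha> * (\<Sum>p\<in>F. (cmod (c p))\<^sup>2) \<le> energy S F x c"
      and upper: "energy \<Omega> F x c \<le> B * (\<Sum>p\<in>F. (cmod (c p))\<^sup>2)"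
      if "finite F" "F \<subseteq> UNIV \<times> {..<N}" for F c
      using x that by blast+
    have inj: "inj_on x (UNIV \<times> {..<N})"
    proof (rule inj_onI, rule ccontr)
      fix p q assume pq: "p \<in> UNIV \<times> {..<N}" "q \<in> UNIV \<times> {..<N}" "x p = x q" "p \<noteq> q"
      \<comment> \<open>Two coinciding frequencies with opposite coefficients cancel, against the
        lower bound; so passing to the limit merges no points.\<close>
      define c where "c r = (if r = p then 1 else - 1 :: complex)" for r
      have "energy S {p, q} x c = 0" using pq by (simp add: energy_def trig_def c_def)
      moreover have "(\<Sum>r\<in>{p, q}. (cmod (c r))\<^sup>2) = 2" using pq by (simp add: c_def)
      ultimately show False using lower[of "{p, q}" c] pq \<alpha> by simp
    qed
    define \<Lambda> where "\<Lambda> = x ` (UNIV \<times> {..<N})"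
    have "ereal ((1 - \<epsilon>) * measure lebesgue \<Omega>) \<le> enn2ereal (ennreal (N / b ^ CARD('n)))"
    proof -
      \<comment> \<open>With b = k/R the quotient is N / k^d times R^d, and N / k^d is at least (1 -
        e) \<tau>.\<close>
      have "(1 - e) * measure lebesgue S \<le> N / b ^ d"
        using par(4,6) R by (simp add: b_def \<tau>_def power_divide field_simps)
      then show ?thesis using mS b by (simp add: enn2ereal_ennreal d_def)
    qed
    also have "\<dots> \<le> enn2ereal (lower_Beurling_density \<Lambda>)"
      using lower_Beurling_density_ge[OF b inj] cell unfolding \<Lambda>_def less_eq_ennreal.rep_eq by blast
    finally have density: "ereal ((1 - \<epsilon>) * measure lebesgue \<Omega>) \<le> enn2ereal (lower_Beurling_density \<Lambda>)" .
    have countable: "countable \<Lambda>" unfolding \<Lambda>_def by simp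
    have fin: "\<alpha> * (\<Sum>l\<in>F. (cmod (c l))\<^sup>2) \<le> energy \<Omega> F (\<lambda>l. l) c \<and>
        energy \<Omega> F (\<lambda>l. l) c \<le> B * (\<Sum>l\<in>F. (cmod (c l))\<^sup>2)" if F: "finite F" "F \<subseteq> \<Lambda>" for F c
    proof -
      obtain G where G: "G \<subseteq> UNIV \<times> {..<N}" "F = x ` G" "inj_on x G"
        using F(2) inj unfolding \<Lambda>_def by (meson inj_on_subset subset_imageE)
      have fG: "finite G" using F(1) G finite_image_iff by blast
      have "\<alpha> * (\<Sum>p\<in>G. (cmod (c (x p)))\<^sup>2) \<le> energy S G x (\<lambda>p. c (x p))" by (rule lower[OF fG G(1)])
      \<comment> \<open>The lower bound is known on S and passes to the larger set \<Omega>.\<close>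
      also have "\<dots> \<le> energy \<Omega> G x (\<lambda>p. c (x p))" using S(1) \<Omega> by (intro energy_mono) (auto simp: S_def)
      finally show ?thesis
        using upper[OF fG G(1), of "\<lambda>p. c (x p)"] unfolding G(2) by (simp add: energy_reindex[OF G(3)] sum.reindex[OF G(3)])
    qed
    have "Riesz_sequence_L2 (lebesgue_on \<Omega>)
        (\<lambda>l x. exp (2 * of_real pi * \<i> * of_real (l \<bullet> x)) * indicator \<Omega> x) \<Lambda>"
      by (rule Riesz_sequence_from_finite[OF \<Omega> countable \<alpha> B]) (use fin in auto)
    then show ?thesis using countable density by blast
  qed
qed

end
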